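(* Let $n\ge 2$, $m=n-1$, $G=SO_0(1,n)$ and $K=1\times SO(n)\cong SO(n)$, and let $(\varphi_s)_{s\in\mathbb C}$ be the spherical functions on the Gelfand pair $(G,K)$, indexed as in the context. Then for every $s\in\mathbb C$ with $|\mathrm{Re}(s)|<\frac m2$ the function $\varphi_s$ is a completely bounded Fourier multiplier of $G$, with norm $$\|\varphi_s\|_{M_0A(G)}=\frac{\Gamma\left(\frac m2+\mathrm{Re}(s)\right)\Gamma\left(\frac m2-\mathrm{Re}(s)\right)\Gamma\left(\frac m2+i\,\mathrm{Im}(s)\right)\Gamma\left(\frac m2-i\,\mathrm{Im}(s)\right)}{\Gamma\left(\frac m2\right)\Gamma\left(\frac m2\right)\left|\Gamma\left(\frac m2+s\right)\Gamma\left(\frac m2-s\right)\right|},$$ where $\Gamma$ is the Gamma function, and $$\|\varphi_s\|_{M_0A(G)}=1\quad\text{for } s=\pm\tfrac m2 .$$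
   Context: $SO_0(1,n)$ is the group of real $(n+1)\times(n+1)$ matrices $g=(g_{ij})_{i,j=0}^n$ with $g^{T}Jg=J$, where $J=\mathrm{diag}(-1,1,\dots,1)$, $\det g=1$ and $g_{00}\ge1$. For $r\in\mathbb R$, $a_r\in SO_0(1,n)$ is the matrix acting on coordinates $0,1$ by $\begin{pmatrix}\cosh r&\sinh r\\ \sinh r&\cosh r\end{pmatrix}$ and as the identity on coordinates $2,\dots,n$. One has $G=K\{a_r: r\ge0\}K$. A function $\varphi$ on $G$ is $K$-bi-invariant if $\varphi(kgk')=\varphi(g)$ for all $k,k'\in K$, $g\in G$. For $s\in\mathbb C$ the spherical function $\varphi_s$ is the continuous $K$-bi-invariant function on $G$ determined by $$\varphi_s(a_r)=F\Big(\frac m4+\frac s2,\frac m4-\frac s2;\frac{m+1}2;-\sinh(r)^2\Big)\qquad(r\in\mathbb R),$$ where $F(a,b;c;z)={}_2F_1(a,b;c;z)$ is the Gauss hypergeometric function (analytically continued to $\mathbb C\setminus[1,\infty)$). Let $\lambda$ be the left regular representation of a locally compact group $G$ on $L^2(G)$. A continuous function $\varphi:G\to\mathbb C$ is a completely bounded Fourier multiplier of $G$ (written $\varphi\in M_0A(G)$) if $\lambda(g)\mapsto\varphi(g)\lambda(g)$ extends to a $\sigma$-weakly continuous, completely bounded linear operator $M_\varphi$ on the group von Neumann algebra of $G$; then $\|\varphi\|_{M_0A(G)}=\|M_\varphi\|_{cb}$. Equivalently, $\|\varphi\|_{M_0A(G)}\le k$ iff there are a Hilbert space $\mathscr H$ and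 bounded continuous maps $P,Q:G\to\mathscr H$ with $\varphi(y^{-1}x)=\langle P(x),Q(y)\rangle$ for all $x,y\in G$ and $\sup_x\|P(x)\|\,\sup_y\|Q(y)\|\le k$. *)

theory Defs
  imports "HOL-Complex_Analysis.Complex_Analysis" "HOL-Algebra.Group"
begin

section \<open>Haar measure, \<open>L\<^sup>2(G)\<close> and its bounded operators\<close>

text \<open>
  The groups carry the subspace topology of the ambient second countable Hausdorff type.
  For a locally compact such group, every Borel measure that is finite on compact sets is
  regular, so no separate regularity condition is needed.
\<close>

definition left_haar_measure ::
  "('a::{second_countable_topology, t2_space}, 'b) monoid_scheme \<Rightarrow> 'a measure \<Rightarrow> bool" where
  "left_haar_measure G \<mu> \<longleftrightarrow>
     sets \<mu> = sets (restrict_space borel (carrier G)) \<and>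
     emeasure \<mu> (carrier G) \<noteq> 0 \<and>
     (\<forall>C. compact C \<and> C \<subseteq> carrier G \<longrightarrow> emeasure \<mu> C < \<infinity>) \<and>
     (\<forall>g\<in>carrier G. \<forall>A\<in>sets \<mu>. emeasure \<mu> ((\<lambda>x. g \<otimes>\<^bsub>G\<^esub> x) ` A) = emeasure \<mu> A)"

text \<open>
  Elements of \<open>L\<^sup>2(\<mu>)\<close> are represented by square integrable functions; they are identified
  when they agree almost everywhere, i.e. when their distance in \<open>L2_norm\<close> is zero.
\<close>

definition L2_space :: "'a measure \<Rightarrow> ('a \<Rightarrow> complex) set" where
  "L2_space \<mu> = {f \<in> borel_measurable \<mu>. integrable \<mu> (\<lambda>x. (cmod (f x))\<^sup>2)}"

definition L2_inner :: "'a measure \<Rightarrow> ('a \<Rightarrow> complex) \<Rightarrow> ('a \<Rightarrow> complex) \<Rightarrow> complex" where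
  "L2_inner \<mu> f g = (LINT x|\<mu>. f x * cnj (g x))"

definition L2_norm :: "'a measure \<Rightarrow> ('a \<Rightarrow> complex) \<Rightarrow> real" where
  "L2_norm \<mu> f = sqrt (LINT x|\<mu>. (cmod (f x))\<^sup>2)"

type_synonym 'a operator = "('a \<Rightarrow> complex) \<Rightarrow> ('a \<Rightarrow> complex)"

text \<open>
  Linearity holds up to null sets. Together with boundedness it implies that the operators
  respect almost everywhere equality, so that they act on the quotient.
\<close>

definition L2_operators :: "'a measure \<Rightarrow> 'a operator set" where
  "L2_operators \<mu> = {T.
     (\<forall>f\<in>L2_space \<mu>. T f \<in> L2_space \<mu>) \<and>
     (\<forall>f\<in>L2_space \<mu>. \<forall>g\<in>L2_space \<mu>. \<forall>a b.
        AE x in \<mu>. T (\<lambda>y. a * f y + b * g y) x = a * T f x + b * T g x) \<and>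
     (\<exists>C. \<forall>f\<in>L2_space \<mu>. L2_norm \<mu> (T f) \<le> C * L2_norm \<mu> f)}"

definition op_eq :: "'a measure \<Rightarrow> 'a operator \<Rightarrow> 'a operator \<Rightarrow> bool" where
  "op_eq \<mu> S T \<longleftrightarrow> (\<forall>f\<in>L2_space \<mu>. AE x in \<mu>. S f x = T f x)"

text \<open>
  The \<open>\<sigma>\<close>-weak topology on the bounded operators is the initial topology of the functionals
  \<open>T \<mapsto> \<Sum>n. \<langle>T f\<^sub>n, g\<^sub>n\<rangle>\<close> with \<open>\<Sum>n. \<parallel>f\<^sub>n\<parallel>\<^sup>2 < \<infinity>\<close> and \<open>\<Sum>n. \<parallel>g\<^sub>n\<parallel>\<^sup>2 < \<infinity>\<close>. Operators that
  agree up to \<open>op_eq\<close> are topologically indistinguishable.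
\<close>

definition square_summable :: "'a measure \<Rightarrow> (nat \<Rightarrow> 'a \<Rightarrow> complex) \<Rightarrow> bool" where
  "square_summable \<mu> f \<longleftrightarrow>
     (\<forall>n. f n \<in> L2_space \<mu>) \<and> summable (\<lambda>n. (L2_norm \<mu> (f n))\<^sup>2)"

definition sigma_weak_topology :: "'a measure \<Rightarrow> 'a operator topology" where
  "sigma_weak_topology \<mu> = topology_generated_by
     {{T \<in> L2_operators \<mu>. (\<Sum>n. L2_inner \<mu> (T (f n)) (g n)) \<in> U} | f g U.
        square_summable \<mu> f \<and> square_summable \<mu> g \<and> open U}"


section \<open>The group von Neumann algebra\<close>

definition left_regular :: "('a, 'b) monoid_scheme \<Rightarrow> 'a \<Rightarrow> 'a operator" where
  "left_regular G g f = (\<lambda>x. f (inv\<^bsub>G\<^esub> g \<otimes>\<^bsub>G\<^esub> x))"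

definition left_regular_span :: "('a, 'b) monoid_scheme \<Rightarrow> 'a operator set" where
  "left_regular_span G =
     {\<lambda>f x. \<Sum>g\<in>F. c g * left_regular G g f x | F c. finite F \<and> F \<subseteq> carrier G}"

text \<open>
  The span of the left regular representation is a unital \<open>*\<close>-algebra; its \<open>\<sigma>\<close>-weak closure
  is the von Neumann algebra that it generates.
\<close>

definition group_vN :: "('a, 'b) monoid_scheme \<Rightarrow> 'a measure \<Rightarrow> 'a operator set" where
  "group_vN G \<mu> = sigma_weak_topology \<mu> closure_of left_regular_span G"


section \<open>Completely bounded maps\<close>

text \<open>
  The operator norm of the matrix \<open>(T i j)\<close>, \<open>i, j < k\<close>, acting on the Hilbert space sum of
  \<open>k\<close> copies of \<open>L\<^sup>2(\<mu>)\<close>.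
\<close>

definition matrix_op_norm :: "'a measure \<Rightarrow> nat \<Rightarrow> (nat \<Rightarrow> nat \<Rightarrow> 'a operator) \<Rightarrow> real" where
  "matrix_op_norm \<mu> k T = Inf {C. 0 \<le> C \<and>
     (\<forall>f. (\<forall>j<k. f j \<in> L2_space \<mu>) \<longrightarrow>
        L2_set (\<lambda>i. L2_norm \<mu> (\<lambda>x. \<Sum>j<k. T i j (f j) x)) {..<k}
          \<le> C * L2_set (\<lambda>j. L2_norm \<mu> (f j)) {..<k})}"

text \<open>
  The values of \<open>\<parallel>(M (T i j))\<parallel>\<close> over all sizes \<open>k\<close> and all matrices over \<open>N\<close> of norm at most
  \<open>1\<close>; their supremum is \<open>sup\<^sub>k \<parallel>M \<otimes> id\<^sub>k\<parallel>\<close>.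
\<close>

definition amplification_values ::
  "'a measure \<Rightarrow> 'a operator set \<Rightarrow> ('a operator \<Rightarrow> 'a operator) \<Rightarrow> real set" where
  "amplification_values \<mu> N M = {matrix_op_norm \<mu> k (\<lambda>i j. M (T i j)) | k T.
     (\<forall>i<k. \<forall>j<k. T i j \<in> N) \<and> matrix_op_norm \<mu> k T \<le> 1}"

definition completely_bounded ::
  "'a measure \<Rightarrow> 'a operator set \<Rightarrow> ('a operator \<Rightarrow> 'a operator) \<Rightarrow> bool" where
  "completely_bounded \<mu> N M \<longleftrightarrow> bdd_above (amplification_values \<mu> N M)"

definition cb_norm ::
  "'a measure \<Rightarrow> 'a operator set \<Rightarrow> ('a operator \<Rightarrow> 'a operator) \<Rightarrow> real" where
  "cb_norm \<mu> N M = Sup (amplification_values \<mu> N M)"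


section \<open>Completely bounded Fourier multipliers\<close>

definition linear_on_operators ::
  "'a measure \<Rightarrow> 'a operator set \<Rightarrow> ('a operator \<Rightarrow> 'a operator) \<Rightarrow> bool" where
  "linear_on_operators \<mu> N M \<longleftrightarrow> (\<forall>S\<in>N. \<forall>T\<in>N. \<forall>a b.
     op_eq \<mu> (M (\<lambda>f x. a * S f x + b * T f x)) (\<lambda>f x. a * M S f x + b * M T f x))"

definition is_cb_multiplier_map ::
  "('a, 'b) monoid_scheme \<Rightarrow> 'a measure \<Rightarrow> ('a \<Rightarrow> complex) \<Rightarrow> ('a operator \<Rightarrow> 'a operator) \<Rightarrow> bool"
where
  "is_cb_multiplier_map G \<mu> \<phi> M \<longleftrightarrow>
     continuous_map (subtopology (sigma_weak_topology \<mu>) (group_vN G \<mu>))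
                    (subtopology (sigma_weak_topology \<mu>) (group_vN G \<mu>)) M \<and>
     linear_on_operators \<mu> (group_vN G \<mu>) M \<and>
     completely_bounded \<mu> (group_vN G \<mu>) M \<and>
     (\<forall>g\<in>carrier G. op_eq \<mu> (M (left_regular G g)) (\<lambda>f x. \<phi> g * left_regular G g f x))"

definition M0A :: "('a::topological_space, 'b) monoid_scheme \<Rightarrow> 'a measure \<Rightarrow> ('a \<Rightarrow> complex) set" where
  "M0A G \<mu> = {\<phi>. continuous_on (carrier G) \<phi> \<and> (\<exists>M. is_cb_multiplier_map G \<mu> \<phi> M)}"

text \<open>
  By \<open>\<sigma>\<close>-weak continuity the extension is unique on \<open>group_vN G \<mu>\<close> up to \<open>op_eq\<close>, so the choice
  below does not matter.
\<close>

definition M0A_norm :: "('a, 'b) monoid_scheme \<Rightarrow> 'a measure \<Rightarrow> ('a \<Rightarrow> complex) \<Rightarrow> real" where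
  "M0A_norm G \<mu> \<phi> = cb_norm \<mu> (group_vN G \<mu>) (SOME M. is_cb_multiplier_map G \<mu> \<phi> M)"


section \<open>The generalized Lorentz groups\<close>

text \<open>
  For a finite type \<open>'m\<close> with \<open>m \<ge> 1\<close> elements, the \<open>n + 1 = m + 2\<close> coordinates are indexed by
  \<open>'m option option\<close>: coordinate \<open>0\<close> is \<open>None\<close>, coordinate \<open>1\<close> is \<open>Some None\<close>, and the
  coordinates \<open>2, \<dots>, n\<close> are \<open>Some (Some i)\<close>. The type \<open>'m option\<close> thus indexes \<open>1, \<dots>, n\<close>, and
  every \<open>n \<ge> 2\<close> arises.
\<close>

type_synonym 'm lorentz_matrix = "real ^ 'm option option ^ 'm option option"

definition minkowski_form :: "'m::finite lorentz_matrix" where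
  "minkowski_form = (\<chi> i j. if i = j then (if i = None then - 1 else 1) else 0)"

definition SO0 :: "'m::finite lorentz_matrix monoid" where
  "SO0 = \<lparr>carrier = {g. transpose g ** minkowski_form ** g = minkowski_form \<and>
                      det g = 1 \<and> g $ None $ None \<ge> 1},
          mult = (**), one = mat 1\<rparr>"

definition block_one :: "real ^ 'm option ^ 'm option \<Rightarrow> 'm::finite lorentz_matrix" where
  "block_one k = (\<chi> i j. case (i, j) of
      (None, None) \<Rightarrow> 1 | (Some a, Some b) \<Rightarrow> k $ a $ b | _ \<Rightarrow> 0)"

definition SO_subgroup :: "'m::finite lorentz_matrix set" where
  "SO_subgroup = block_one ` {k. orthogonal_matrix k \<and> det k = 1}"

definition boost :: "real \<Rightarrow> 'm::finite lorentz_matrix" where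
  "boost r = (\<chi> i j.
      if i \<in> {None, Some None} \<and> j \<in> {None, Some None}
      then (if i = j then cosh r else sinh r)
      else (if i = j then 1 else 0))"


section \<open>Spherical functions\<close>

definition Gauss_F :: "complex \<Rightarrow> complex \<Rightarrow> complex \<Rightarrow> complex \<Rightarrow> complex" where
  "Gauss_F a b c = (SOME F. F holomorphic_on (- (complex_of_real ` {1..})) \<and>
      (\<forall>z\<in>ball 0 1. F z = eval_fps (fps_hypergeo [a, b] [c] 1) z))"

definition is_spherical_function :: "complex \<Rightarrow> ('m::finite lorentz_matrix \<Rightarrow> complex) \<Rightarrow> bool" where
  "is_spherical_function s \<phi> \<longleftrightarrow>
     continuous_on (carrier SO0) \<phi> \<and>
     (\<forall>k\<in>SO_subgroup. \<forall>k'\<in>SO_subgroup. \<forall>g\<in>carrier SO0. \<phi> (k ** g ** k') = \<phi> g) \<and>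
     (\<forall>r. \<phi> (boost r) =
        (let m = of_nat CARD('m)
         in Gauss_F (m / 4 + s / 2) (m / 4 - s / 2) ((m + 1) / 2) (- (of_real (sinh r))\<^sup>2)))"

text \<open>
  By \<open>G = K {a\<^sub>r. r \<ge> 0} K\<close> the values on \<open>G\<close> are determined; the values at matrices outside the
  group are irrelevant.
\<close>

definition spherical_function :: "complex \<Rightarrow> 'm::finite lorentz_matrix \<Rightarrow> complex" where
  "spherical_function s = (SOME \<phi>. is_spherical_function s \<phi>)"

end

theory Submission
  imports Defs "HOL-Probability.Characteristic_Functions" "HOL-Real_Asymp.Real_Asymp"
begin

text \<open>
  In horospherical coordinates the point \<open>gK\<close> of hyperbolic space is a pair \<open>(a, b)\<close> with \<open>a > 0\<close> and
  \<open>b \<in> \<real>\<^sup>m\<close>. Writing \<open>k\<^sub>s\<close> for the Macdonald function, the Fourier transform of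
  \<open>\<xi> \<mapsto> k\<^sub>s (a |\<xi>|) k\<^sub>s (a' |\<xi>|)\<close> depends, up to the factor \<open>(a a')\<close> to the power \<open>- m / 2\<close>, only on the
  hyperbolic distance, and solves the hypergeometric equation. Hence \<open>\<phi>\<^sub>s (y\<inverse> x)\<close> is, up to a
  constant \<open>Z = \<integral> k\<^sub>s\<^sup>2\<close>, the inner product in \<open>L\<^sup>2 (\<real>\<^sup>m)\<close> of waves \<open>\<xi> \<mapsto> k\<^sub>s (a |\<xi>|) exp (i b \<xi>)\<close>
  scaled to the constant norm \<open>(\<integral> |k\<^sub>s|\<^sup>2)\<close> to the power \<open>1 / 2\<close>. This factorization bounds the multiplier
  norm by \<open>\<integral> |k\<^sub>s|\<^sup>2 / |Z|\<close>. Conversely, on the abelian group \<open>a = 1\<close> the function \<open>\<phi>\<^sub>s\<close> is the Fourier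
  transform of \<open>k\<^sub>s\<^sup>2 / Z\<close>, and Toeplitz matrices of the phase of \<open>k\<^sub>s\<^sup>2 / Z\<close>, tested on Fejer kernels, show
  that its Schur multiplier norm is at least the total mass \<open>\<integral> |k\<^sub>s|\<^sup>2 / |Z|\<close>. Both integrals are
  products of Gamma functions.
\<close>

section \<open>Square integrable functions and sequences\<close>

text \<open>The norm can exceed 1 because the waves are paired crosswise, order \<open>s\<close>
  against order \<open>cnj s\<close>: the inner product contains the square of the Macdonald
  function, the norms the square of its modulus. Both integrals are computed by one device: for u =
  v + w / 2 and u' = v - w / 2 one has cosh u + cosh u' = 2 cosh (w / 2) cosh v, so a double
  integral splits into two simple ones, each a beta integral. The constant \<integral> exp (- |x|)
  occurs in both and cancels, so polar coordinates never enter. The bound |Re s| < m / 2 is square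
  integrability of the Macdonald function at the origin; at s = \<plusminus>m / 2 the spherical
  function is constant instead. Operators act on functions rather than on classes, so identities
  between them hold almost everywhere only, and the \<sigma>-weak topology is given by single
  sequences of vectors. This is why the factorization is brought to the form of scalar sequences, by
  a Gram-Schmidt process on countably many waves, and why double series are flattened.\<close>

lemma borel_measurable_cnj [measurable (raw)]:
  "f \<in> borel_measurable M \<Longrightarrow> (\<lambda>x. cnj (f x)) \<in> borel_measurable M"
  by (rule borel_measurable_continuous_on[of cnj]) (auto intro: continuous_intros)

lemma L2_space_measurable: "f \<in> L2_space \<mu> \<Longrightarrow> f \<in> borel_measurable \<mu>"
  by (simp add: L2_space_def)

lemma L2_space_integrable: "f \<in> L2_space \<mu> \<Longrightarrow> integrable \<mu> (\<lambda>x. (cmod (f x))\<^sup>2)"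
  by (simp add: L2_space_def)

lemma L2_norm_nonneg [simp]: "0 \<le> L2_norm \<mu> f"
  by (simp add: L2_norm_def)

lemma L2_norm_sq: "(L2_norm \<mu> f)\<^sup>2 = (LINT x|\<mu>. (cmod (f x))\<^sup>2)"
  by (simp add: L2_norm_def)

lemma nn_integral_L2:
  "f \<in> L2_space \<mu> \<Longrightarrow> (\<integral>\<^sup>+x. ennreal ((cmod (f x))\<^sup>2) \<partial>\<mu>) = ennreal ((L2_norm \<mu> f)\<^sup>2)"
  by (simp add: L2_norm_sq nn_integral_eq_integral L2_space_integrable)

lemma L2_spaceI_nn:
  assumes [measurable]: "f \<in> borel_measurable \<mu>"
    and le: "(\<integral>\<^sup>+x. ennreal ((cmod (f x))\<^sup>2) \<partial>\<mu>) \<le> ennreal C" and "0 \<le> C"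
  shows "f \<in> L2_space \<mu>" "(L2_norm \<mu> f)\<^sup>2 \<le> C"
proof -
  have "integrable \<mu> (\<lambda>x. (cmod (f x))\<^sup>2)"
    using le by (intro integrableI_bounded) (auto intro: le_less_trans)
  then show *: "f \<in> L2_space \<mu>" by (simp add: L2_space_def)
  show "(L2_norm \<mu> f)\<^sup>2 \<le> C" using le \<open>0 \<le> C\<close> by (simp add: nn_integral_L2[OF *])
qed

lemma cmod_add_sq_le: "(cmod (a + b))\<^sup>2 \<le> 2 * (cmod a)\<^sup>2 + 2 * (cmod b)\<^sup>2"
proof -
  have "(cmod (a + b))\<^sup>2 \<le> (cmod a + cmod b)\<^sup>2" by (simp add: norm_triangle_ineq power_mono)
  also have "\<dots> \<le> 2 * (cmod a)\<^sup>2 + 2 * (cmod b)\<^sup>2"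
    using sum_squares_bound[of "cmod a" "cmod b"] by (simp add: power2_sum)
  finally show ?thesis .
qed

lemma L2_space_add:
  assumes "f \<in> L2_space \<mu>" "g \<in> L2_space \<mu>"
  shows "(\<lambda>x. f x + g x) \<in> L2_space \<mu>"
proof -
  note [measurable] = assms[THEN L2_space_measurable]
  have "integrable \<mu> (\<lambda>x. 2 * (cmod (f x))\<^sup>2 + 2 * (cmod (g x))\<^sup>2)"
    using assms by (simp add: L2_space_integrable)
  then have "integrable \<mu> (\<lambda>x. (cmod (f x + g x))\<^sup>2)"
    by (rule Bochner_Integration.integrable_bound) (auto intro!: AE_I2 simp: cmod_add_sq_le)
  then show ?thesis by (simp add: L2_space_def)
qed

lemma L2_space_cmult: "f \<in> L2_space \<mu> \<Longrightarrow> (\<lambda>x. c * f x) \<in> L2_space \<mu>"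
  by (auto simp: L2_space_def norm_mult power_mult_distrib)

lemma L2_norm_cmult: "L2_norm \<mu> (\<lambda>x. c * f x) = cmod c * L2_norm \<mu> f"
  by (simp add: L2_norm_def norm_mult power_mult_distrib real_sqrt_mult)

lemma L2_space_zero [simp]: "(\<lambda>x. 0) \<in> L2_space \<mu>"
  by (simp add: L2_space_def)

lemma L2_space_diff:
  assumes "f \<in> L2_space \<mu>" "g \<in> L2_space \<mu>"
  shows "(\<lambda>x. f x - g x) \<in> L2_space \<mu>"
  using L2_space_add[OF assms(1) L2_space_cmult[OF assms(2), of "-1"]] by simp

lemma L2_space_sum:
  "(\<And>i. i \<in> I \<Longrightarrow> f i \<in> L2_space \<mu>) \<Longrightarrow> (\<lambda>x. \<Sum>i\<in>I. f i x) \<in> L2_space \<mu>"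
  by (induction I rule: infinite_finite_induct) (auto intro: L2_space_add)

lemma L2_norm_cong_AE:
  assumes "AE x in \<mu>. f x = g x" "f \<in> borel_measurable \<mu>" "g \<in> borel_measurable \<mu>"
  shows "L2_norm \<mu> f = L2_norm \<mu> g"
  unfolding L2_norm_def
  using assms by (intro arg_cong[where f=sqrt] integral_cong_AE) auto

lemma integrable_L2_inner:
  assumes "f \<in> L2_space \<mu>" "g \<in> L2_space \<mu>"
  shows "integrable \<mu> (\<lambda>x. f x * cnj (g x))"
proof -
  note [measurable] = assms[THEN L2_space_measurable]
  have "integrable \<mu> (\<lambda>x. (cmod (f x))\<^sup>2 + (cmod (g x))\<^sup>2)"
    using assms by (simp add: L2_space_integrable)
  then show ?thesis
  proof (rule Bochner_Integration.integrable_bound)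
    have "cmod (f x) * cmod (g x) \<le> (cmod (f x))\<^sup>2 + (cmod (g x))\<^sup>2" for x
      using sum_squares_bound[of "cmod (f x)" "cmod (g x)"]
        mult_nonneg_nonneg[of "cmod (f x)" "cmod (g x)", OF norm_ge_zero norm_ge_zero] by linarith
    then show "AE x in \<mu>. norm (f x * cnj (g x)) \<le> norm ((cmod (f x))\<^sup>2 + (cmod (g x))\<^sup>2)"
      by (auto simp: norm_mult)
  qed auto
qed

text \<open>The arithmetic-geometric bound takes the place of the Cauchy-Schwarz inequality: it
  gives summable majorants for series of inner products, and where the unknown norm stands on both
  sides it can be absorbed.\<close>

lemma L2_inner_AMGM:
  assumes "f \<in> L2_space \<mu>" "g \<in> L2_space \<mu>"
  shows "(LINT x|\<mu>. cmod (f x * cnj (g x))) \<le> ((L2_norm \<mu> f)\<^sup>2 + (L2_norm \<mu> g)\<^sup>2) / 2"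
    and "cmod (L2_inner \<mu> f g) \<le> ((L2_norm \<mu> f)\<^sup>2 + (L2_norm \<mu> g)\<^sup>2) / 2"
proof -
  have "(LINT x|\<mu>. cmod (f x * cnj (g x))) \<le> (LINT x|\<mu>. ((cmod (f x))\<^sup>2 + (cmod (g x))\<^sup>2) / 2)"
  proof (rule integral_mono)
    fix x show "cmod (f x * cnj (g x)) \<le> ((cmod (f x))\<^sup>2 + (cmod (g x))\<^sup>2) / 2"
      using sum_squares_bound[of "cmod (f x)" "cmod (g x)"] by (simp add: norm_mult)
  qed (use assms in \<open>auto intro!: integrable_L2_inner integrable_norm L2_space_integrable\<close>)
  also have "\<dots> = ((L2_norm \<mu> f)\<^sup>2 + (L2_norm \<mu> g)\<^sup>2) / 2"
    using assms by (simp add: L2_norm_sq L2_space_integrable)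
  finally show *: "(LINT x|\<mu>. cmod (f x * cnj (g x))) \<le> ((L2_norm \<mu> f)\<^sup>2 + (L2_norm \<mu> g)\<^sup>2) / 2" .
  show "cmod (L2_inner \<mu> f g) \<le> ((L2_norm \<mu> f)\<^sup>2 + (L2_norm \<mu> g)\<^sup>2) / 2"
    unfolding L2_inner_def by (rule order_trans[OF integral_norm_bound *])
qed

text \<open>Cauchy-Schwarz for series: the finite inequality bounds all partial sums by a number
  that does not depend on their length.\<close>

lemma suminf_cmod_mult_sq_le:
  fixes a b :: "nat \<Rightarrow> complex"
  assumes a: "summable (\<lambda>l. (cmod (a l))\<^sup>2)" and b: "summable (\<lambda>l. (cmod (b l))\<^sup>2)"
  shows "summable (\<lambda>l. cmod (a l * b l))"
    and "(cmod (\<Sum>l. a l * b l))\<^sup>2 \<le> (\<Sum>l. (cmod (a l))\<^sup>2) * (\<Sum>l. (cmod (b l))\<^sup>2)"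
proof -
  show s: "summable (\<lambda>l. cmod (a l * b l))"
  proof (rule summable_comparison_test')
    show "summable (\<lambda>l. (cmod (a l))\<^sup>2 + (cmod (b l))\<^sup>2)" by (intro summable_add a b)
    show "norm (cmod (a n * b n)) \<le> (cmod (a n))\<^sup>2 + (cmod (b n))\<^sup>2" for n
      using sum_squares_bound[of "cmod (a n)" "cmod (b n)"]
        mult_nonneg_nonneg[of "cmod (a n)" "cmod (b n)", OF norm_ge_zero norm_ge_zero]
      by (simp only: norm_mult real_norm_def abs_mult abs_norm_cancel)
  qed
  let ?A = "\<Sum>l. (cmod (a l))\<^sup>2" and ?B = "\<Sum>l. (cmod (b l))\<^sup>2"
  have fin: "(cmod (\<Sum>l<n. a l * b l))\<^sup>2 \<le> ?A * ?B" for n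
  proof -
    have "cmod (\<Sum>l<n. a l * b l) \<le> (\<Sum>l<n. cmod (a l) * cmod (b l))"
      by (rule order_trans[OF norm_sum]) (simp add: norm_mult)
    then have "(cmod (\<Sum>l<n. a l * b l))\<^sup>2 \<le> (\<Sum>l<n. cmod (a l) * cmod (b l))\<^sup>2"
      by (intro power_mono) auto
    also have "\<dots> \<le> (\<Sum>l<n. (cmod (a l))\<^sup>2) * (\<Sum>l<n. (cmod (b l))\<^sup>2)"
      by (rule Cauchy_Schwarz_ineq_sum)
    also have "\<dots> \<le> ?A * ?B"
      by (intro mult_mono sum_le_suminf a b sum_nonneg suminf_nonneg) auto
    finally show ?thesis .
  qed
  have "(\<lambda>n. (cmod (\<Sum>l<n. a l * b l))\<^sup>2) \<longlonglongrightarrow> (cmod (\<Sum>l. a l * b l))\<^sup>2"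
    by (intro tendsto_intros summable_LIMSEQ summable_norm_cancel[OF s])
  then show "(cmod (\<Sum>l. a l * b l))\<^sup>2 \<le> ?A * ?B"
    by (rule LIMSEQ_le_const2) (use fin in auto)
qed

text \<open>Tonelli: the integral of the pointwise sum of squares is finite, so the sum itself is
  finite almost everywhere.\<close>

lemma AE_summable_L2:
  assumes h: "\<And>l. h l \<in> L2_space \<mu>" and s: "summable (\<lambda>l. (L2_norm \<mu> (h l))\<^sup>2)"
  shows "AE x in \<mu>. summable (\<lambda>l. (cmod (h l x))\<^sup>2)"
    and "(\<integral>\<^sup>+x. (\<Sum>l. ennreal ((cmod (h l x))\<^sup>2)) \<partial>\<mu>) = ennreal (\<Sum>l. (L2_norm \<mu> (h l))\<^sup>2)"
proof -
  note [measurable] = h[THEN L2_space_measurable]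
  have "(\<integral>\<^sup>+x. (\<Sum>l. ennreal ((cmod (h l x))\<^sup>2)) \<partial>\<mu>)
      = (\<Sum>l. \<integral>\<^sup>+x. ennreal ((cmod (h l x))\<^sup>2) \<partial>\<mu>)"
    by (rule nn_integral_suminf) measurable
  also have "\<dots> = ennreal (\<Sum>l. (L2_norm \<mu> (h l))\<^sup>2)"
    by (simp add: nn_integral_L2[OF h] suminf_ennreal2 s)
  finally show *: "(\<integral>\<^sup>+x. (\<Sum>l. ennreal ((cmod (h l x))\<^sup>2)) \<partial>\<mu>) = ennreal (\<Sum>l. (L2_norm \<mu> (h l))\<^sup>2)" .
  have "AE x in \<mu>. (\<Sum>l. ennreal ((cmod (h l x))\<^sup>2)) \<noteq> \<infinity>"
    by (rule nn_integral_noteq_infinite) (auto simp: *)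
  then show "AE x in \<mu>. summable (\<lambda>l. (cmod (h l x))\<^sup>2)"
    by eventually_elim (auto intro: summable_suminf_not_top)
qed

text \<open>The row \<open>q\<close> of multiplication operators sends a square summable sequence of
  functions to one function. Cauchy-Schwarz at each point gives the factor \<open>B\<close>. The
  series converges almost everywhere only; on the remaining null set \<open>suminf\<close> takes
  some value without consequence.\<close>

lemma L2_row_sum:
  assumes h: "\<And>l. h l \<in> L2_space \<mu>" and s: "summable (\<lambda>l. (L2_norm \<mu> (h l))\<^sup>2)"
    and q[measurable]: "\<And>l. q l \<in> borel_measurable \<mu>"
    and qs: "\<And>x. x \<in> space \<mu> \<Longrightarrow> summable (\<lambda>l. (cmod (q l x))\<^sup>2)"
    and qB: "\<And>x. x \<in> space \<mu> \<Longrightarrow> (\<Sum>l. (cmod (q l x))\<^sup>2) \<le> B" and "0 \<le> B"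
  shows "AE x in \<mu>. summable (\<lambda>l. cmod (cnj (q l x) * h l x))"
    and "(\<lambda>x. \<Sum>l. cnj (q l x) * h l x) \<in> L2_space \<mu>"
    and "(L2_norm \<mu> (\<lambda>x. \<Sum>l. cnj (q l x) * h l x))\<^sup>2 \<le> B * (\<Sum>l. (L2_norm \<mu> (h l))\<^sup>2)"
proof -
  note [measurable] = h[THEN L2_space_measurable]
  note AE = AE_summable_L2(1)[OF h s]
  show "AE x in \<mu>. summable (\<lambda>l. cmod (cnj (q l x) * h l x))"
    using AE AE_space
    by eventually_elim (rule suminf_cmod_mult_sq_le, auto simp: qs)
  have "AE x in \<mu>. ennreal ((cmod (\<Sum>l. cnj (q l x) * h l x))\<^sup>2)
      \<le> ennreal B * (\<Sum>l. ennreal ((cmod (h l x))\<^sup>2))"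
    using AE AE_space
  proof eventually_elim
    case (elim x)
    have "(cmod (\<Sum>l. cnj (q l x) * h l x))\<^sup>2 \<le> (\<Sum>l. (cmod (cnj (q l x)))\<^sup>2) * (\<Sum>l. (cmod (h l x))\<^sup>2)"
      using elim by (intro suminf_cmod_mult_sq_le(2)) (auto simp: qs)
    also have "\<dots> \<le> B * (\<Sum>l. (cmod (h l x))\<^sup>2)"
      using elim by (intro mult_right_mono suminf_nonneg) (auto simp: qB)
    finally have "ennreal ((cmod (\<Sum>l. cnj (q l x) * h l x))\<^sup>2) \<le> ennreal (B * (\<Sum>l. (cmod (h l x))\<^sup>2))"
      by (rule ennreal_leI)
    also have "\<dots> = ennreal B * (\<Sum>l. ennreal ((cmod (h l x))\<^sup>2))"
      using elim \<open>0 \<le> B\<close> by (simp add: ennreal_mult' suminf_ennreal2)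
    finally show ?case .
  qed
  then have "(\<integral>\<^sup>+x. ennreal ((cmod (\<Sum>l. cnj (q l x) * h l x))\<^sup>2) \<partial>\<mu>)
      \<le> (\<integral>\<^sup>+x. ennreal B * (\<Sum>l. ennreal ((cmod (h l x))\<^sup>2)) \<partial>\<mu>)"
    by (rule nn_integral_mono_AE)
  also have "\<dots> = ennreal (B * (\<Sum>l. (L2_norm \<mu> (h l))\<^sup>2))"
    using \<open>0 \<le> B\<close> by (simp add: nn_integral_cmult AE_summable_L2(2)[OF h s] ennreal_mult')
  finally have le: "(\<integral>\<^sup>+x. ennreal ((cmod (\<Sum>l. cnj (q l x) * h l x))\<^sup>2) \<partial>\<mu>)
      \<le> ennreal (B * (\<Sum>l. (L2_norm \<mu> (h l))\<^sup>2))" .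
  have nn: "0 \<le> B * (\<Sum>l. (L2_norm \<mu> (h l))\<^sup>2)"
    using \<open>0 \<le> B\<close> s by (intro mult_nonneg_nonneg suminf_nonneg) auto
  have meas: "(\<lambda>x. \<Sum>l. cnj (q l x) * h l x) \<in> borel_measurable \<mu>"
    by measurable
  show "(\<lambda>x. \<Sum>l. cnj (q l x) * h l x) \<in> L2_space \<mu>"
    and "(L2_norm \<mu> (\<lambda>x. \<Sum>l. cnj (q l x) * h l x))\<^sup>2 \<le> B * (\<Sum>l. (L2_norm \<mu> (h l))\<^sup>2)"
    by (fact L2_spaceI_nn[OF meas le nn])+
qed

text \<open>The column \<open>p\<close> is the companion of the row above: Tonelli moves the sum
  over \<open>l\<close> under the integral, where it is at most \<open>A\<close>.\<close>

lemma L2_column: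
  assumes f: "f \<in> L2_space \<mu>"
    and p[measurable]: "\<And>l. p l \<in> borel_measurable \<mu>"
    and ps: "\<And>x. x \<in> space \<mu> \<Longrightarrow> summable (\<lambda>l. (cmod (p l x))\<^sup>2)"
    and pA: "\<And>x. x \<in> space \<mu> \<Longrightarrow> (\<Sum>l. (cmod (p l x))\<^sup>2) \<le> A" and "0 \<le> A"
  shows "(\<lambda>x. p l x * f x) \<in> L2_space \<mu>"
    and "summable (\<lambda>l. (L2_norm \<mu> (\<lambda>x. p l x * f x))\<^sup>2)"
    and "(\<Sum>l. (L2_norm \<mu> (\<lambda>x. p l x * f x))\<^sup>2) \<le> A * (L2_norm \<mu> f)\<^sup>2"
proof -
  note [measurable] = f[THEN L2_space_measurable]
  have eq: "(\<Sum>l. \<integral>\<^sup>+x. ennreal ((cmod (p l x * f x))\<^sup>2) \<partial>\<mu>) \<le> ennreal (A * (L2_norm \<mu> f)\<^sup>2)"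
  proof -
    have "(\<Sum>l. \<integral>\<^sup>+x. ennreal ((cmod (p l x * f x))\<^sup>2) \<partial>\<mu>)
        = (\<integral>\<^sup>+x. (\<Sum>l. ennreal ((cmod (p l x * f x))\<^sup>2)) \<partial>\<mu>)"
      by (rule nn_integral_suminf[symmetric]) measurable
    also have "\<dots> \<le> (\<integral>\<^sup>+x. ennreal A * ennreal ((cmod (f x))\<^sup>2) \<partial>\<mu>)"
    proof (rule nn_integral_mono)
      fix x assume x: "x \<in> space \<mu>"
      have "(\<Sum>l. ennreal ((cmod (p l x * f x))\<^sup>2)) = ennreal ((\<Sum>l. (cmod (p l x))\<^sup>2) * (cmod (f x))\<^sup>2)"
        using ps[OF x]
        by (simp add: norm_mult power_mult_distrib suminf_ennreal2 summable_mult2 suminf_mult2)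
      also have "\<dots> \<le> ennreal (A * (cmod (f x))\<^sup>2)"
        by (intro ennreal_leI mult_right_mono pA x) auto
      finally show "(\<Sum>l. ennreal ((cmod (p l x * f x))\<^sup>2)) \<le> ennreal A * ennreal ((cmod (f x))\<^sup>2)"
        using \<open>0 \<le> A\<close> by (simp add: ennreal_mult')
    qed
    also have "\<dots> = ennreal (A * (L2_norm \<mu> f)\<^sup>2)"
      using \<open>0 \<le> A\<close> by (simp add: nn_integral_cmult nn_integral_L2[OF f] ennreal_mult')
    finally show ?thesis .
  qed
  have nn: "0 \<le> A * (L2_norm \<mu> f)\<^sup>2" using \<open>0 \<le> A\<close> by simp
  have L2: "(\<lambda>x. p l x * f x) \<in> L2_space \<mu>" for l
  proof (rule L2_spaceI_nn(1)[OF _ _ nn])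
    show "(\<integral>\<^sup>+x. ennreal ((cmod (p l x * f x))\<^sup>2) \<partial>\<mu>) \<le> ennreal (A * (L2_norm \<mu> f)\<^sup>2)"
      using sum_le_suminf[of "\<lambda>l. \<integral>\<^sup>+x. ennreal ((cmod (p l x * f x))\<^sup>2) \<partial>\<mu>" "{l}"] eq
      by (auto intro: order_trans)
  qed measurable
  then show "(\<lambda>x. p l x * f x) \<in> L2_space \<mu>" .
  have le: "(\<Sum>l. ennreal ((L2_norm \<mu> (\<lambda>x. p l x * f x))\<^sup>2)) \<le> ennreal (A * (L2_norm \<mu> f)\<^sup>2)"
    using eq by (simp add: nn_integral_L2[OF L2])
  then show s: "summable (\<lambda>l. (L2_norm \<mu> (\<lambda>x. p l x * f x))\<^sup>2)"
    by (intro summable_suminf_not_top) (auto simp: top_unique)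
  show "(\<Sum>l. (L2_norm \<mu> (\<lambda>x. p l x * f x))\<^sup>2) \<le> A * (L2_norm \<mu> f)\<^sup>2"
    using le nn by (simp add: suminf_ennreal2 s)
qed

text \<open>The row built from \<open>q\<close> is the adjoint of the column built from
  \<open>q\<close>. Sum and integral may be interchanged because \<open>L2_inner_AMGM\<close>
  supplies a summable majorant.\<close>

lemma L2_inner_row_sum:
  assumes h: "\<And>l. h l \<in> L2_space \<mu>" and s: "summable (\<lambda>l. (L2_norm \<mu> (h l))\<^sup>2)"
    and q[measurable]: "\<And>l. q l \<in> borel_measurable \<mu>"
    and qs: "\<And>x. x \<in> space \<mu> \<Longrightarrow> summable (\<lambda>l. (cmod (q l x))\<^sup>2)"
    and qB: "\<And>x. x \<in> space \<mu> \<Longrightarrow> (\<Sum>l. (cmod (q l x))\<^sup>2) \<le> B" and "0 \<le> B"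
    and g: "g \<in> L2_space \<mu>"
  shows "L2_inner \<mu> (\<lambda>x. \<Sum>l. cnj (q l x) * h l x) g = (\<Sum>l. L2_inner \<mu> (h l) (\<lambda>x. q l x * g x))"
proof -
  note [measurable] = h[THEN L2_space_measurable] g[THEN L2_space_measurable]
  have qg: "(\<lambda>x. q l x * g x) \<in> L2_space \<mu>"
    "summable (\<lambda>l. (L2_norm \<mu> (\<lambda>x. q l x * g x))\<^sup>2)" for l
    by (rule L2_column[OF g, of q B]; simp add: qs qB \<open>0 \<le> B\<close>)+
  have AE0: "AE x in \<mu>. summable (\<lambda>l. cmod (cnj (q l x) * h l x))"
    by (rule L2_row_sum(1)[OF h s q]) (use qs qB \<open>0 \<le> B\<close> in auto)
  have "AE x in \<mu>. summable (\<lambda>l. norm (h l x * cnj (q l x * g x))) \<and>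
          (\<Sum>l. cnj (q l x) * h l x) * cnj (g x) = (\<Sum>l. h l x * cnj (q l x * g x))"
    using AE0
  proof eventually_elim
    case (elim x)
    then have "summable (\<lambda>l. cmod (cnj (q l x) * h l x) * cmod (g x))" by (rule summable_mult2)
    moreover have "(\<Sum>l. cnj (q l x) * h l x) * cnj (g x) = (\<Sum>l. cnj (q l x) * h l x * cnj (g x))"
      by (rule suminf_mult2[OF summable_norm_cancel]) (use elim in simp)
    ultimately show ?case by (simp add: norm_mult mult_ac)
  qed
  then have AE: "AE x in \<mu>. summable (\<lambda>l. norm (h l x * cnj (q l x * g x)))"
    "AE x in \<mu>. (\<Sum>l. cnj (q l x) * h l x) * cnj (g x) = (\<Sum>l. h l x * cnj (q l x * g x))"
    by (auto elim: eventually_mono)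
  have "L2_inner \<mu> (\<lambda>x. \<Sum>l. cnj (q l x) * h l x) g
      = (LINT x|\<mu>. (\<Sum>l. h l x * cnj (q l x * g x)))"
    unfolding L2_inner_def by (intro integral_cong_AE AE(2)) measurable
  also have "\<dots> = (\<Sum>l. LINT x|\<mu>. h l x * cnj (q l x * g x))"
  proof (rule integral_suminf)
    show "integrable \<mu> (\<lambda>x. h l x * cnj (q l x * g x))" for l
      by (intro integrable_L2_inner h qg(1))
    show "AE x in \<mu>. summable (\<lambda>l. norm (h l x * cnj (q l x * g x)))" by (fact AE(1))
    show "summable (\<lambda>l. LINT x|\<mu>. norm (h l x * cnj (q l x * g x)))"
    proof (rule summable_comparison_test')
      show "summable (\<lambda>l. ((L2_norm \<mu> (h l))\<^sup>2 + (L2_norm \<mu> (\<lambda>x. q l x * g x))\<^sup>2) / 2)"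
        by (intro summable_divide summable_add s qg(2))
      show "norm (LINT x|\<mu>. norm (h l x * cnj (q l x * g x)))
          \<le> ((L2_norm \<mu> (h l))\<^sup>2 + (L2_norm \<mu> (\<lambda>x. q l x * g x))\<^sup>2) / 2" for l
        using L2_inner_AMGM(1)[OF h[of l] qg(1)[of l]] by (simp add: integral_nonneg_AE)
    qed
  qed
  finally show ?thesis by (simp add: L2_inner_def)
qed

lemma L2_operators_L2: "T \<in> L2_operators \<mu> \<Longrightarrow> f \<in> L2_space \<mu> \<Longrightarrow> T f \<in> L2_space \<mu>"
  by (auto simp: L2_operators_def)

lemma L2_operators_bound:
  assumes "T \<in> L2_operators \<mu>"
  obtains C where "0 \<le> C" "\<And>f. f \<in> L2_space \<mu> \<Longrightarrow> L2_norm \<mu> (T f) \<le> C * L2_norm \<mu> f"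
    "\<And>f. f \<in> L2_space \<mu> \<Longrightarrow> (L2_norm \<mu> (T f))\<^sup>2 \<le> C\<^sup>2 * (L2_norm \<mu> f)\<^sup>2"
proof -
  obtain C where C: "\<forall>f\<in>L2_space \<mu>. L2_norm \<mu> (T f) \<le> C * L2_norm \<mu> f"
    using assms unfolding L2_operators_def by blast
  have le: "L2_norm \<mu> (T f) \<le> \<bar>C\<bar> * L2_norm \<mu> f" if "f \<in> L2_space \<mu>" for f
    by (rule order_trans[OF C[rule_format, OF that]]) (simp add: mult_right_mono)
  moreover have "(L2_norm \<mu> (T f))\<^sup>2 \<le> \<bar>C\<bar>\<^sup>2 * (L2_norm \<mu> f)\<^sup>2" if "f \<in> L2_space \<mu>" for f
    using power_mono[OF le[OF that], of 2] by (simp add: power_mult_distrib)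
  ultimately show ?thesis using that[of "\<bar>C\<bar>"] by simp
qed

lemma L2_operators_linear:
  "T \<in> L2_operators \<mu> \<Longrightarrow> f \<in> L2_space \<mu> \<Longrightarrow> g \<in> L2_space \<mu> \<Longrightarrow>
    AE x in \<mu>. T (\<lambda>y. a * f y + b * g y) x = a * T f x + b * T g x"
  by (simp add: L2_operators_def)

text \<open>Flattens an absolutely convergent double series along the pairing
  \<open>prod_decode\<close>. The functionals that define the \<sigma>-weak topology range over
  single sequences, so a family indexed by pairs has to be brought to that form.\<close>

lemma suminf_prod_decode_complex:
  fixes t :: "nat \<Rightarrow> nat \<Rightarrow> complex"
  assumes s: "\<And>n. summable (\<lambda>l. b n l)" "summable (\<lambda>n. \<Sum>l. b n l)" and b: "\<And>n l. 0 \<le> b n l"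
    and t: "\<And>n l. cmod (t n l) \<le> b n l"
  shows "(\<Sum>k. case prod_decode k of (n, l) \<Rightarrow> t n l) = (\<Sum>n. \<Sum>l. t n l)"
    and "summable (\<lambda>k. case prod_decode k of (n, l) \<Rightarrow> b n l)"
proof -
  have bij: "bij_betw prod_decode UNIV (UNIV :: (nat \<times> nat) set)"
    by (rule bij_prod_decode)
  have sb: "(\<lambda>(n, l). b n l) summable_on (UNIV \<times> UNIV)"
  proof (rule summable_on_SigmaI)
    show "((\<lambda>y. case (x, y) of (n, l) \<Rightarrow> b n l) has_sum (\<Sum>l. b x l)) UNIV" for x
      using s(1)[of x] b by (auto intro!: sums_nonneg_imp_has_sum summable_sums)
    show "(\<lambda>n. \<Sum>l. b n l) summable_on UNIV"
      using s(2) b by (subst summable_on_UNIV_nonneg_real_iff) (auto intro: suminf_nonneg s(1))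
  qed (use b in auto)
  then have sb': "(\<lambda>k. (\<lambda>(n, l). b n l) (prod_decode k)) summable_on UNIV"
    by (subst summable_on_reindex_bij_betw[OF bij]) simp
  then show "summable (\<lambda>k. case prod_decode k of (n, l) \<Rightarrow> b n l)"
    by (rule summable_on_imp_summable)
  have "(\<lambda>x. norm ((\<lambda>(n, l). t n l) x)) summable_on (UNIV \<times> UNIV)"
    by (rule summable_on_comparison_test[OF sb]) (use t b in auto)
  then have st: "(\<lambda>(n, l). t n l) summable_on (UNIV \<times> UNIV)"
    by (rule abs_summable_summable)
  have ts: "summable (\<lambda>l. norm (t n l))" for n
    by (rule summable_comparison_test'[OF s(1)[of n]]) (simp add: t)
  have in_b: "((t n) has_sum (\<Sum>l. t n l)) UNIV" for n
    by (rule norm_summable_imp_has_sum[OF ts summable_sums[OF summable_norm_cancel[OF ts]]])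
  have out: "((\<lambda>n. \<Sum>l. t n l) has_sum (\<Sum>n. \<Sum>l. t n l)) UNIV"
  proof (rule norm_summable_imp_has_sum)
    show sn: "summable (\<lambda>n. norm (\<Sum>l. t n l))"
    proof (rule summable_comparison_test'[OF s(2)])
      fix n
      have "norm (\<Sum>l. t n l) \<le> (\<Sum>l. norm (t n l))" by (rule summable_norm[OF ts])
      also have "\<dots> \<le> (\<Sum>l. b n l)"
        by (rule suminf_le[OF t ts s(1)])
      finally show "norm (norm (\<Sum>l. t n l)) \<le> (\<Sum>l. b n l)" by simp
    qed
    show "(\<lambda>n. \<Sum>l. t n l) sums (\<Sum>n. \<Sum>l. t n l)"
      by (rule summable_sums[OF summable_norm_cancel[OF sn]])
  qed
  have "(\<Sum>n. \<Sum>l. t n l) = infsum (\<lambda>n. infsum (\<lambda>l. t n l) UNIV) UNIV"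
    using out by (simp add: infsumI[OF in_b] infsumI)
  also have "\<dots> = infsum (\<lambda>(n, l). t n l) (UNIV \<times> UNIV)"
    by (rule infsum_Sigma'_banach) (use st in simp)
  also have "\<dots> = infsum (\<lambda>k. (\<lambda>(n, l). t n l) (prod_decode k)) UNIV"
    by (subst infsum_reindex_bij_betw[OF bij]) simp
  also have "\<dots> = (\<Sum>k. case prod_decode k of (n, l) \<Rightarrow> t n l)"
  proof (rule infsumI)
    have "(\<lambda>k. (\<lambda>(n, l). t n l) (prod_decode k)) summable_on UNIV"
      using st by (subst summable_on_reindex_bij_betw[OF bij]) simp
    then obtain S where S: "((\<lambda>k. (\<lambda>(n, l). t n l) (prod_decode k)) has_sum S) UNIV"
      by (auto simp: summable_on_def)
    with has_sum_imp_sums[OF S] show "((\<lambda>k. (\<lambda>(n, l). t n l) (prod_decode k)) has_sum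
      (\<Sum>k. case prod_decode k of (n, l) \<Rightarrow> t n l)) UNIV"
      by (simp add: sums_iff)
  qed
  finally show "(\<Sum>k. case prod_decode k of (n, l) \<Rightarrow> t n l) = (\<Sum>n. \<Sum>l. t n l)" by simp
qed

text \<open>A Gilbert factorization \<open>\<phi> (y\<inverse> x) = \<Sum>l. P l x * cnj (Q l y)\<close> turns the multiplier map into
  \<open>T \<mapsto> \<Sum>l. q\<^sub>l\<^sup>* T p\<^sub>l\<close> with multiplication operators \<open>p\<^sub>l\<close>, \<open>q\<^sub>l\<close>.\<close>

definition schur_op ::
  "(nat \<Rightarrow> 'a \<Rightarrow> complex) \<Rightarrow> (nat \<Rightarrow> 'a \<Rightarrow> complex) \<Rightarrow> 'a operator \<Rightarrow> 'a operator" where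
  "schur_op p q T f = (\<lambda>x. \<Sum>l. cnj (q l x) * T (\<lambda>y. p l y * f y) x)"

section \<open>Norms of operator matrices\<close>

lemma L2_norm_sum_sq_le:
  assumes "\<And>j. j < k \<Longrightarrow> f j \<in> L2_space \<mu>"
  shows "(L2_norm \<mu> (\<lambda>x. \<Sum>j<k. f j x))\<^sup>2 \<le> real k * (\<Sum>j<k. (L2_norm \<mu> (f j))\<^sup>2)"
proof -
  have "(LINT x|\<mu>. (cmod (\<Sum>j<k. f j x))\<^sup>2) \<le> (LINT x|\<mu>. real k * (\<Sum>j<k. (cmod (f j x))\<^sup>2))"
  proof (rule integral_mono)
    show "integrable \<mu> (\<lambda>x. (cmod (\<Sum>j<k. f j x))\<^sup>2)"
      by (intro L2_space_integrable L2_space_sum assms) auto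
    show "integrable \<mu> (\<lambda>x. real k * (\<Sum>j<k. (cmod (f j x))\<^sup>2))"
      by (intro integrable_mult_right Bochner_Integration.integrable_sum L2_space_integrable assms) auto
    fix x
    have "(cmod (\<Sum>j<k. f j x))\<^sup>2 \<le> (\<Sum>j<k. cmod (f j x) * 1)\<^sup>2"
      by (intro power_mono) (auto intro: norm_sum)
    also have "\<dots> \<le> (\<Sum>j<k. (cmod (f j x))\<^sup>2) * (\<Sum>j<k. 1\<^sup>2)"
      by (rule Cauchy_Schwarz_ineq_sum)
    finally show "(cmod (\<Sum>j<k. f j x))\<^sup>2 \<le> real k * (\<Sum>j<k. (cmod (f j x))\<^sup>2)"
      by (simp add: mult.commute)
  qed
  also have "\<dots> = real k * (\<Sum>j<k. (L2_norm \<mu> (f j))\<^sup>2)"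
    using assms by (simp add: L2_norm_sq L2_space_integrable)
  finally show ?thesis by (simp add: L2_norm_sq)
qed

text \<open>The infimum of an empty set of reals carries no information, so an admissible constant
  must exist before \<open>matrix_op_norm\<close> can be used. A crude one, built from bounds of all
  entries, is enough.\<close>

lemma matrix_op_norm_set_nonempty:
  fixes T :: "nat \<Rightarrow> nat \<Rightarrow> 'a operator"
  assumes T: "\<And>i j. i < k \<Longrightarrow> j < k \<Longrightarrow> T i j \<in> L2_operators \<mu>"
  shows "{C. 0 \<le> C \<and>
     (\<forall>f. (\<forall>j<k. f j \<in> L2_space \<mu>) \<longrightarrow>
        L2_set (\<lambda>i. L2_norm \<mu> (\<lambda>x. \<Sum>j<k. T i j (f j) x)) {..<k}
          \<le> C * L2_set (\<lambda>j. L2_norm \<mu> (f j)) {..<k})} \<noteq> {}"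
proof -
  have "\<forall>i j. \<exists>C. i < k \<longrightarrow> j < k \<longrightarrow> (\<forall>f\<in>L2_space \<mu>. (L2_norm \<mu> (T i j f))\<^sup>2 \<le> C\<^sup>2 * (L2_norm \<mu> f)\<^sup>2)"
    using L2_operators_bound[OF T] by metis
  then obtain C where C: "\<And>i j f. i < k \<Longrightarrow> j < k \<Longrightarrow> f \<in> L2_space \<mu> \<Longrightarrow>
      (L2_norm \<mu> (T i j f))\<^sup>2 \<le> (C i j)\<^sup>2 * (L2_norm \<mu> f)\<^sup>2"
    by metis
  let ?D = "real k * (\<Sum>i<k. \<Sum>j<k. (C i j)\<^sup>2)"
  have "L2_set (\<lambda>i. L2_norm \<mu> (\<lambda>x. \<Sum>j<k. T i j (f j) x)) {..<k}
          \<le> sqrt ?D * L2_set (\<lambda>j. L2_norm \<mu> (f j)) {..<k}"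
    if f: "\<forall>j<k. f j \<in> L2_space \<mu>" for f
  proof -
    let ?F = "\<Sum>j<k. (L2_norm \<mu> (f j))\<^sup>2"
    have "(\<Sum>i<k. (L2_norm \<mu> (\<lambda>x. \<Sum>j<k. T i j (f j) x))\<^sup>2)
        \<le> (\<Sum>i<k. real k * (\<Sum>j<k. (C i j)\<^sup>2 * ?F))"
    proof (rule sum_mono)
      fix i assume i: "i \<in> {..<k}"
      have "(L2_norm \<mu> (\<lambda>x. \<Sum>j<k. T i j (f j) x))\<^sup>2 \<le> real k * (\<Sum>j<k. (L2_norm \<mu> (T i j (f j)))\<^sup>2)"
        using i f by (intro L2_norm_sum_sq_le L2_operators_L2[OF T]) auto
      also have "\<dots> \<le> real k * (\<Sum>j<k. (C i j)\<^sup>2 * ?F)"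
      proof (intro mult_left_mono sum_mono)
        fix j assume j: "j \<in> {..<k}"
        have "(L2_norm \<mu> (T i j (f j)))\<^sup>2 \<le> (C i j)\<^sup>2 * (L2_norm \<mu> (f j))\<^sup>2"
          using i j f by (intro C) auto
        also have "\<dots> \<le> (C i j)\<^sup>2 * ?F"
          using j by (intro mult_left_mono member_le_sum) auto
        finally show "(L2_norm \<mu> (T i j (f j)))\<^sup>2 \<le> (C i j)\<^sup>2 * ?F" .
      qed simp
      finally show "(L2_norm \<mu> (\<lambda>x. \<Sum>j<k. T i j (f j) x))\<^sup>2 \<le> real k * (\<Sum>j<k. (C i j)\<^sup>2 * ?F)" .
    qed
    also have "\<dots> = ?D * ?F" by (simp add: sum_distrib_left sum_distrib_right mult_ac)
    finally have "L2_set (\<lambda>i. L2_norm \<mu> (\<lambda>x. \<Sum>j<k. T i j (f j) x)) {..<k} \<le> sqrt (?D * ?F)"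
      unfolding L2_set_def by (rule real_sqrt_le_mono)
    then show ?thesis unfolding L2_set_def by (simp only: real_sqrt_mult)
  qed
  moreover have "0 \<le> sqrt ?D" by (intro real_sqrt_ge_zero mult_nonneg_nonneg sum_nonneg) auto
  ultimately show ?thesis by blast
qed

text \<open>The infimum is itself an admissible constant: divided by the norm of the vector, the
  inequality is a lower bound for all admissible constants. For a vector of norm zero any single one
  of them gives the claim.\<close>

lemma matrix_op_norm_bound:
  assumes T: "\<And>i j. i < k \<Longrightarrow> j < k \<Longrightarrow> T i j \<in> L2_operators \<mu>"
    and f: "\<And>j. j < k \<Longrightarrow> f j \<in> L2_space \<mu>"
  shows "L2_set (\<lambda>i. L2_norm \<mu> (\<lambda>x. \<Sum>j<k. T i j (f j) x)) {..<k}
          \<le> matrix_op_norm \<mu> k T * L2_set (\<lambda>j. L2_norm \<mu> (f j)) {..<k}" (is "?a \<le> _ * ?b")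
proof -
  let ?X = "{C. 0 \<le> C \<and>
     (\<forall>f. (\<forall>j<k. f j \<in> L2_space \<mu>) \<longrightarrow>
        L2_set (\<lambda>i. L2_norm \<mu> (\<lambda>x. \<Sum>j<k. T i j (f j) x)) {..<k}
          \<le> C * L2_set (\<lambda>j. L2_norm \<mu> (f j)) {..<k})}"
  have le: "?a \<le> C * ?b" if "C \<in> ?X" for C
    using that f by blast
  have ne: "?X \<noteq> {}" by (rule matrix_op_norm_set_nonempty[OF T])
  then obtain C0 where C0: "C0 \<in> ?X" by blast
  show ?thesis
  proof (cases "?b = 0")
    case True
    then show ?thesis using le[OF C0] by simp
  next
    case False
    then have b: "0 < ?b" using L2_set_nonneg[of "\<lambda>j. L2_norm \<mu> (f j)" "{..<k}"] by linarith
    have "?a / ?b \<le> Inf ?X"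
      by (rule cInf_greatest[OF ne]) (use le b in \<open>simp add: divide_le_eq\<close>)
    then show ?thesis using b by (simp add: matrix_op_norm_def divide_le_eq)
  qed
qed

lemma matrix_op_norm_le:
  assumes "0 \<le> C"
    and "\<And>f. (\<And>j. j < k \<Longrightarrow> f j \<in> L2_space \<mu>) \<Longrightarrow>
        L2_set (\<lambda>i. L2_norm \<mu> (\<lambda>x. \<Sum>j<k. T i j (f j) x)) {..<k}
          \<le> C * L2_set (\<lambda>j. L2_norm \<mu> (f j)) {..<k}"
  shows "matrix_op_norm \<mu> k T \<le> C"
  unfolding matrix_op_norm_def by (rule cInf_lower) (use assms in \<open>auto intro: bdd_belowI[of _ 0]\<close>)

lemma matrix_op_norm_cong:
  assumes eq: "\<And>i j. i < k \<Longrightarrow> j < k \<Longrightarrow> op_eq \<mu> (S i j) (T i j)"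
    and S: "\<And>i j. i < k \<Longrightarrow> j < k \<Longrightarrow> S i j \<in> L2_operators \<mu>"
    and T: "\<And>i j. i < k \<Longrightarrow> j < k \<Longrightarrow> T i j \<in> L2_operators \<mu>"
  shows "matrix_op_norm \<mu> k S = matrix_op_norm \<mu> k T"
proof -
  have "L2_set (\<lambda>i. L2_norm \<mu> (\<lambda>x. \<Sum>j<k. S i j (f j) x)) {..<k}
      = L2_set (\<lambda>i. L2_norm \<mu> (\<lambda>x. \<Sum>j<k. T i j (f j) x)) {..<k}"
    if f: "\<forall>j<k. f j \<in> L2_space \<mu>" for f
  proof (rule L2_set_cong[OF refl])
    fix i assume i: "i \<in> {..<k}"
    show "L2_norm \<mu> (\<lambda>x. \<Sum>j<k. S i j (f j) x) = L2_norm \<mu> (\<lambda>x. \<Sum>j<k. T i j (f j) x)"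
    proof (rule L2_norm_cong_AE)
      have "AE x in \<mu>. \<forall>j\<in>{..<k}. S i j (f j) x = T i j (f j) x"
        using eq i f by (intro AE_finite_allI) (auto simp: op_eq_def)
      then show "AE x in \<mu>. (\<Sum>j<k. S i j (f j) x) = (\<Sum>j<k. T i j (f j) x)"
        by eventually_elim (auto intro: sum.cong)
    qed (use i f in \<open>auto intro!: L2_space_measurable L2_space_sum L2_operators_L2[OF S] L2_operators_L2[OF T]\<close>)
  qed
  then show ?thesis
    unfolding matrix_op_norm_def by (intro arg_cong[where f=Inf] Collect_cong conj_cong refl) auto
qed

section \<open>The \<sigma>-weak topology and equality almost everywhere\<close>

definition sigma_weak_subbasis :: "'a measure \<Rightarrow> 'a operator set set" where
  "sigma_weak_subbasis \<mu> = {{T \<in> L2_operators \<mu>. (\<Sum>n. L2_inner \<mu> (T (f n)) (g n)) \<in> U} | f g U.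
        square_summable \<mu> f \<and> square_summable \<mu> g \<and> open U}"

lemma sigma_weak_topology_alt: "sigma_weak_topology \<mu> = topology_generated_by (sigma_weak_subbasis \<mu>)"
  by (simp add: sigma_weak_topology_def sigma_weak_subbasis_def)

lemma square_summable_zero: "square_summable \<mu> (\<lambda>n x. 0)"
  by (simp add: square_summable_def L2_norm_def)

lemma square_summable_single:
  "f \<in> L2_space \<mu> \<Longrightarrow> square_summable \<mu> (\<lambda>n. if n = 0 then f else (\<lambda>x. 0))"
  unfolding square_summable_def
  by (auto intro!: summable_finite[of "{0}"] simp: L2_norm_def split: if_splits)

lemma Union_sigma_weak_subbasis: "\<Union>(sigma_weak_subbasis \<mu>) = L2_operators \<mu>"
proof -
  have "L2_operators \<mu> \<in> sigma_weak_subbasis \<mu>"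
    unfolding sigma_weak_subbasis_def
    by (auto intro!: exI[of _ "\<lambda>n x. 0"] exI[of _ UNIV] square_summable_zero)
  then show ?thesis by (auto simp: sigma_weak_subbasis_def)
qed

lemma topspace_sigma_weak: "topspace (sigma_weak_topology \<mu>) = L2_operators \<mu>"
  by (simp add: sigma_weak_topology_alt Union_sigma_weak_subbasis)

lemma continuous_map_L2_inner:
  assumes f: "f \<in> L2_space \<mu>" and g: "g \<in> L2_space \<mu>"
  shows "continuous_map (sigma_weak_topology \<mu>) euclidean (\<lambda>T. L2_inner \<mu> (T f) g)"
proof -
  \<comment> \<open>A single inner product is the functional of two sequences that vanish after
    their first term.\<close>
  define F where "F = (\<lambda>n::nat. if n = 0 then f else (\<lambda>x. 0))"
  define H where "H = (\<lambda>n::nat. if n = 0 then g else (\<lambda>x. 0))"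
  have "(\<Sum>n. L2_inner \<mu> (T (F n)) (H n)) = L2_inner \<mu> (T f) g" for T
  proof -
    have "(\<Sum>n. L2_inner \<mu> (T (F n)) (H n)) = (\<Sum>n\<in>{0}. L2_inner \<mu> (T (F n)) (H n))"
      by (rule suminf_finite) (auto simp: H_def L2_inner_def)
    then show ?thesis by (simp add: F_def H_def)
  qed
  moreover have "square_summable \<mu> F" "square_summable \<mu> H"
    unfolding F_def H_def using f g by (auto intro: square_summable_single)
  ultimately have sub: "{T \<in> L2_operators \<mu>. L2_inner \<mu> (T f) g \<in> U} \<in> sigma_weak_subbasis \<mu>" if "open U" for U
    unfolding sigma_weak_subbasis_def using that
    by (intro CollectI exI[of _ F] exI[of _ H] exI[of _ U]) auto
  show ?thesis
    unfolding continuous_map_def topspace_sigma_weak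
    using sub by (auto simp: sigma_weak_topology_alt intro: topology_generated_by_Basis)
qed

lemma op_eq_sum_inner:
  assumes eq: "op_eq \<mu> S T" and S: "S \<in> L2_operators \<mu>" and T: "T \<in> L2_operators \<mu>"
    and f: "f \<in> L2_space \<mu>" and g: "g \<in> L2_space \<mu>"
  shows "L2_inner \<mu> (S f) g = L2_inner \<mu> (T f) g"
proof -
  note [measurable] = L2_operators_L2[OF S f, THEN L2_space_measurable]
    L2_operators_L2[OF T f, THEN L2_space_measurable] g[THEN L2_space_measurable]
  show ?thesis
    unfolding L2_inner_def
    using eq f by (intro integral_cong_AE) (auto simp: op_eq_def elim!: eventually_mono)
qed

text \<open>A subbasic set sees an operator only through inner products, which \<open>op_eq\<close>
  preserves; intersections and unions inherit this. The topology cannot separate operators that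
  agree almost everywhere, so closures absorb such differences.\<close>

lemma op_eq_openin:
  assumes "openin (sigma_weak_topology \<mu>) U"
    and eq: "op_eq \<mu> S T" and S: "S \<in> L2_operators \<mu>" and T: "T \<in> L2_operators \<mu>"
  shows "S \<in> U \<longleftrightarrow> T \<in> U"
proof -
  have "generate_topology_on (sigma_weak_subbasis \<mu>) U"
    using assms(1) by (simp add: sigma_weak_topology_alt openin_topology_generated_by_iff)
  then show ?thesis
  proof induction
    case (Basis s)
    then obtain f g V where s: "s = {T \<in> L2_operators \<mu>. (\<Sum>n. L2_inner \<mu> (T (f n)) (g n)) \<in> V}"
      and fg: "square_summable \<mu> f" "square_summable \<mu> g"
      by (auto simp: sigma_weak_subbasis_def)
    have "(\<Sum>n. L2_inner \<mu> (S (f n)) (g n)) = (\<Sum>n. L2_inner \<mu> (T (f n)) (g n))"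
      using fg by (intro suminf_cong op_eq_sum_inner[OF eq S T]) (auto simp: square_summable_def)
    then show ?case using S T by (simp add: s)
  qed auto
qed

lemma op_eq_closure_of:
  assumes eq: "op_eq \<mu> S T" and S: "S \<in> L2_operators \<mu>" and T: "T \<in> L2_operators \<mu>"
    and "T \<in> sigma_weak_topology \<mu> closure_of X"
  shows "S \<in> sigma_weak_topology \<mu> closure_of X"
  using assms(4) op_eq_openin[OF _ eq S T] S unfolding in_closure_of topspace_sigma_weak by blast

text \<open>Testing against the difference \<open>d = S f - T f\<close> itself makes its norm
  vanish.\<close>

lemma op_eqI_inner:
  assumes S: "S \<in> L2_operators \<mu>" and T: "T \<in> L2_operators \<mu>"
    and eq: "\<And>f g. f \<in> L2_space \<mu> \<Longrightarrow> g \<in> L2_space \<mu> \<Longrightarrow> L2_inner \<mu> (S f) g = L2_inner \<mu> (T f) g"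
  shows "op_eq \<mu> S T"
  unfolding op_eq_def
proof
  fix f assume f: "f \<in> L2_space \<mu>"
  define d where "d = (\<lambda>x. S f x - T f x)"
  have Sf: "S f \<in> L2_space \<mu>" and Tf: "T f \<in> L2_space \<mu>"
    using f by (auto intro: L2_operators_L2[OF S] L2_operators_L2[OF T])
  have d: "d \<in> L2_space \<mu>" unfolding d_def by (intro L2_space_diff Sf Tf)
  have "L2_inner \<mu> d d = L2_inner \<mu> (S f) d - L2_inner \<mu> (T f) d"
    unfolding L2_inner_def d_def[of] left_diff_distrib
    by (intro Bochner_Integration.integral_diff)
       (use integrable_L2_inner[OF Sf d] integrable_L2_inner[OF Tf d] in \<open>simp_all add: d_def\<close>)
  then have "L2_inner \<mu> d d = 0" by (simp add: eq f d)
  moreover have "L2_inner \<mu> d d = complex_of_real (LINT x|\<mu>. (cmod (d x))\<^sup>2)"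
    unfolding L2_inner_def by (simp add: complex_norm_square[symmetric] del: of_real_power)
  ultimately have "(LINT x|\<mu>. (cmod (d x))\<^sup>2) = 0" by (simp del: of_real_power)
  then have "AE x in \<mu>. (cmod (d x))\<^sup>2 = 0"
    using integral_nonneg_eq_0_iff_AE[OF L2_space_integrable[OF d]] by simp
  then show "AE x in \<mu>. S f x = T f x" by eventually_elim (simp add: d_def)
qed

lemma square_summable_columns:
  assumes p: "\<And>f. f \<in> L2_space \<mu> \<Longrightarrow> (\<forall>l. (\<lambda>x. p l x * f x) \<in> L2_space \<mu>) \<and>
      summable (\<lambda>l. (L2_norm \<mu> (\<lambda>x. p l x * f x))\<^sup>2) \<and>
      (\<Sum>l. (L2_norm \<mu> (\<lambda>x. p l x * f x))\<^sup>2) \<le> A * (L2_norm \<mu> f)\<^sup>2"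
    and f: "square_summable \<mu> f"
  shows "square_summable \<mu> (\<lambda>i. case prod_decode i of (n, l) \<Rightarrow> (\<lambda>x. p l x * f n x))"
    and "summable (\<lambda>n. \<Sum>l. (L2_norm \<mu> (\<lambda>x. p l x * f n x))\<^sup>2)"
proof -
  have fL2: "f n \<in> L2_space \<mu>" and fs: "summable (\<lambda>n. (L2_norm \<mu> (f n))\<^sup>2)" for n
    using f by (auto simp: square_summable_def)
  show s: "summable (\<lambda>n. \<Sum>l. (L2_norm \<mu> (\<lambda>x. p l x * f n x))\<^sup>2)"
    by (rule summable_comparison_test'[OF summable_mult[OF fs, of A]])
       (use p[OF fL2] in \<open>simp add: suminf_nonneg\<close>)
  have "summable (\<lambda>i. case prod_decode i of (n, l) \<Rightarrow> (L2_norm \<mu> (\<lambda>x. p l x * f n x))\<^sup>2)"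
    by (rule suminf_prod_decode_complex(2)[where t = "\<lambda>_ _. 0"])
       (use p[OF fL2] s in \<open>auto\<close>)
  then show "square_summable \<mu> (\<lambda>i. case prod_decode i of (n, l) \<Rightarrow> (\<lambda>x. p l x * f n x))"
    unfolding square_summable_def using p[OF fL2] by (auto split: prod.splits simp: case_prod_unfold)
qed

section \<open>The map defined by a row and a column of multiplication operators\<close>

locale schur_rows =
  fixes \<mu> :: "'a measure" and p q :: "nat \<Rightarrow> 'a \<Rightarrow> complex" and A B :: real
  assumes p_meas: "\<And>l. p l \<in> borel_measurable \<mu>"
    and q_meas: "\<And>l. q l \<in> borel_measurable \<mu>"
    and p_summable: "\<And>x. x \<in> space \<mu> \<Longrightarrow> summable (\<lambda>l. (cmod (p l x))\<^sup>2)"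
    and q_summable: "\<And>x. x \<in> space \<mu> \<Longrightarrow> summable (\<lambda>l. (cmod (q l x))\<^sup>2)"
    and p_le: "\<And>x. x \<in> space \<mu> \<Longrightarrow> (\<Sum>l. (cmod (p l x))\<^sup>2) \<le> A"
    and q_le: "\<And>x. x \<in> space \<mu> \<Longrightarrow> (\<Sum>l. (cmod (q l x))\<^sup>2) \<le> B"
    and A_nonneg: "0 \<le> A" and B_nonneg: "0 \<le> B"
begin

abbreviation "M \<equiv> schur_op p q"

lemma p_column:
  assumes "f \<in> L2_space \<mu>"
  shows "(\<lambda>x. p l x * f x) \<in> L2_space \<mu>"
    and "summable (\<lambda>l. (L2_norm \<mu> (\<lambda>x. p l x * f x))\<^sup>2)"
    and "(\<Sum>l. (L2_norm \<mu> (\<lambda>x. p l x * f x))\<^sup>2) \<le> A * (L2_norm \<mu> f)\<^sup>2"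
  by (rule L2_column[OF assms, of p A]; simp add: p_meas p_summable p_le A_nonneg)+

lemma q_column:
  assumes "f \<in> L2_space \<mu>"
  shows "(\<lambda>x. q l x * f x) \<in> L2_space \<mu>"
    and "summable (\<lambda>l. (L2_norm \<mu> (\<lambda>x. q l x * f x))\<^sup>2)"
    and "(\<Sum>l. (L2_norm \<mu> (\<lambda>x. q l x * f x))\<^sup>2) \<le> B * (L2_norm \<mu> f)\<^sup>2"
  by (rule L2_column[OF assms, of q B]; simp add: q_meas q_summable q_le B_nonneg)+

lemma T_rows:
  assumes T: "T \<in> L2_operators \<mu>" and f: "f \<in> L2_space \<mu>"
  shows "T (\<lambda>y. p l y * f y) \<in> L2_space \<mu>"
    and "summable (\<lambda>l. (L2_norm \<mu> (T (\<lambda>y. p l y * f y)))\<^sup>2)"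
proof -
  show "T (\<lambda>y. p l y * f y) \<in> L2_space \<mu>" by (intro L2_operators_L2[OF T] p_column f)
  obtain C where C: "\<And>f. f \<in> L2_space \<mu> \<Longrightarrow> (L2_norm \<mu> (T f))\<^sup>2 \<le> C\<^sup>2 * (L2_norm \<mu> f)\<^sup>2"
    by (rule L2_operators_bound[OF T]) blast
  show "summable (\<lambda>l. (L2_norm \<mu> (T (\<lambda>y. p l y * f y)))\<^sup>2)"
    by (rule summable_comparison_test'[OF summable_mult[OF p_column(2)[OF f], of "C\<^sup>2"]])
       (simp add: C p_column(1)[OF f])
qed

lemma M_facts:
  assumes T: "T \<in> L2_operators \<mu>" and f: "f \<in> L2_space \<mu>"
  shows M_AE: "AE x in \<mu>. summable (\<lambda>l. cmod (cnj (q l x) * T (\<lambda>y. p l y * f y) x))"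
    and M_L2: "M T f \<in> L2_space \<mu>"
    and M_inner: "g \<in> L2_space \<mu> \<Longrightarrow>
      L2_inner \<mu> (M T f) g = (\<Sum>l. L2_inner \<mu> (T (\<lambda>y. p l y * f y)) (\<lambda>x. q l x * g x))"
proof -
  show "AE x in \<mu>. summable (\<lambda>l. cmod (cnj (q l x) * T (\<lambda>y. p l y * f y) x))"
    by (rule L2_row_sum(1)[where B = B])
       (use T_rows[OF T f] in \<open>simp_all add: q_meas q_summable q_le B_nonneg\<close>)
  show "M T f \<in> L2_space \<mu>"
    unfolding schur_op_def by (rule L2_row_sum(2)[where B = B])
       (use T_rows[OF T f] in \<open>simp_all add: q_meas q_summable q_le B_nonneg\<close>)
  show "L2_inner \<mu> (M T f) g = (\<Sum>l. L2_inner \<mu> (T (\<lambda>y. p l y * f y)) (\<lambda>x. q l x * g x))"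
    if "g \<in> L2_space \<mu>"
    unfolding schur_op_def by (rule L2_inner_row_sum[where B = B])
       (use T_rows[OF T f] that in \<open>simp_all add: q_meas q_summable q_le B_nonneg\<close>)
qed

text \<open>The amplified map is a product of three factors: the column of \<open>p\<close>, the
  matrix \<open>T\<close> acting in every layer \<open>l\<close>, and the row of \<open>q\<close>.
  Row and column act on each of the \<open>k\<close> components separately, so their norms do not
  grow with \<open>k\<close>. This is complete boundedness with constant
  \<open>sqrt (A * B)\<close>.\<close>

lemma M_matrix_bound:
  fixes T :: "nat \<Rightarrow> nat \<Rightarrow> 'a operator"
  assumes T: "\<And>i j. i < k \<Longrightarrow> j < k \<Longrightarrow> T i j \<in> L2_operators \<mu>"
    and f: "\<And>j. j < k \<Longrightarrow> f j \<in> L2_space \<mu>"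
  shows "L2_set (\<lambda>i. L2_norm \<mu> (\<lambda>x. \<Sum>j<k. M (T i j) (f j) x)) {..<k}
    \<le> sqrt (A * B) * \<bar>matrix_op_norm \<mu> k T\<bar> * L2_set (\<lambda>j. L2_norm \<mu> (f j)) {..<k}"
proof -
  define N where "N = \<bar>matrix_op_norm \<mu> k T\<bar>"
  define h where "h = (\<lambda>i l x. \<Sum>j<k. T i j (\<lambda>y. p l y * f j y) x)"
  have h_L2: "h i l \<in> L2_space \<mu>" if "i < k" for i l
    unfolding h_def using that by (intro L2_space_sum T_rows(1) T f) auto
  \<comment> \<open>In a fixed layer \<open>l\<close> the matrix \<open>T\<close> acts on one
    vector, so its operator norm applies layer by layer.\<close>
  have col: "(\<Sum>i<k. (L2_norm \<mu> (h i l))\<^sup>2) \<le> N\<^sup>2 * (\<Sum>j<k. (L2_norm \<mu> (\<lambda>y. p l y * f j y))\<^sup>2)" for l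
  proof -
    let ?F = "L2_set (\<lambda>j. L2_norm \<mu> (\<lambda>y. p l y * f j y)) {..<k}"
    have "L2_set (\<lambda>i. L2_norm \<mu> (h i l)) {..<k} \<le> matrix_op_norm \<mu> k T * ?F"
      unfolding h_def by (intro matrix_op_norm_bound T p_column f)
    also have "\<dots> \<le> N * ?F" by (intro mult_right_mono L2_set_nonneg) (simp add: N_def)
    finally have "(L2_set (\<lambda>i. L2_norm \<mu> (h i l)) {..<k})\<^sup>2 \<le> (N * ?F)\<^sup>2"
      by (rule power_mono) (simp add: L2_set_nonneg)
    then show ?thesis by (simp add: L2_set_def power_mult_distrib sum_nonneg)
  qed
  have s: "summable (\<lambda>l. \<Sum>j<k. (L2_norm \<mu> (\<lambda>y. p l y * f j y))\<^sup>2)"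
    by (intro summable_sum p_column f) auto
  have hs: "summable (\<lambda>l. (L2_norm \<mu> (h i l))\<^sup>2)" if i: "i < k" for i
  proof (rule summable_comparison_test'[OF summable_mult[OF s, of "N\<^sup>2"]])
    fix l
    have "(L2_norm \<mu> (h i l))\<^sup>2 \<le> (\<Sum>i<k. (L2_norm \<mu> (h i l))\<^sup>2)"
      using i by (intro member_le_sum) auto
    with col[of l]
    show "norm ((L2_norm \<mu> (h i l))\<^sup>2) \<le> N\<^sup>2 * (\<Sum>j<k. (L2_norm \<mu> (\<lambda>y. p l y * f j y))\<^sup>2)" by simp
  qed
  have row: "(L2_norm \<mu> (\<lambda>x. \<Sum>j<k. M (T i j) (f j) x))\<^sup>2 \<le> B * (\<Sum>l. (L2_norm \<mu> (h i l))\<^sup>2)"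
    if i: "i < k" for i
  proof -
    \<comment> \<open>The series for the finitely many \<open>j\<close> converge off one common null
      set, which permits interchanging them with the sum over \<open>j\<close>.\<close>
    have "AE x in \<mu>. \<forall>j\<in>{..<k}. summable (\<lambda>l. cmod (cnj (q l x) * T i j (\<lambda>y. p l y * f j y) x))"
      using i by (intro AE_finite_allI M_AE T f) auto
    then have "AE x in \<mu>. (\<Sum>j<k. M (T i j) (f j) x) = (\<Sum>l. cnj (q l x) * h i l x)"
    proof eventually_elim
      case (elim x)
      have "(\<Sum>j<k. M (T i j) (f j) x) = (\<Sum>l. \<Sum>j<k. cnj (q l x) * T i j (\<lambda>y. p l y * f j y) x)"
        unfolding schur_op_def using elim
        by (intro suminf_sum[symmetric]) (auto intro: summable_norm_cancel)
      then show ?case by (simp add: h_def sum_distrib_left)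
    qed
    moreover have "(\<lambda>x. \<Sum>j<k. M (T i j) (f j) x) \<in> L2_space \<mu>"
      using i by (intro L2_space_sum M_L2 T f) auto
    moreover have rs: "(\<lambda>x. \<Sum>l. cnj (q l x) * h i l x) \<in> L2_space \<mu>"
      "(L2_norm \<mu> (\<lambda>x. \<Sum>l. cnj (q l x) * h i l x))\<^sup>2 \<le> B * (\<Sum>l. (L2_norm \<mu> (h i l))\<^sup>2)"
      by (rule L2_row_sum[where B = B and h = "h i"];
          use h_L2[OF i] hs[OF i] in \<open>simp add: q_meas q_summable q_le B_nonneg\<close>)+
    ultimately have "L2_norm \<mu> (\<lambda>x. \<Sum>j<k. M (T i j) (f j) x) = L2_norm \<mu> (\<lambda>x. \<Sum>l. cnj (q l x) * h i l x)"
      by (intro L2_norm_cong_AE L2_space_measurable)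
    with rs(2) show ?thesis by simp
  qed
  have "(\<Sum>i<k. (L2_norm \<mu> (\<lambda>x. \<Sum>j<k. M (T i j) (f j) x))\<^sup>2) \<le> (\<Sum>i<k. B * (\<Sum>l. (L2_norm \<mu> (h i l))\<^sup>2))"
    by (intro sum_mono row) auto
  also have "\<dots> = B * (\<Sum>l. \<Sum>i<k. (L2_norm \<mu> (h i l))\<^sup>2)"
    by (subst suminf_sum) (auto simp: hs sum_distrib_left)
  also have "\<dots> \<le> B * (\<Sum>l. N\<^sup>2 * (\<Sum>j<k. (L2_norm \<mu> (\<lambda>y. p l y * f j y))\<^sup>2))"
    by (intro mult_left_mono suminf_le col summable_sum hs summable_mult s B_nonneg) auto
  also have "\<dots> = B * (N\<^sup>2 * (\<Sum>j<k. \<Sum>l. (L2_norm \<mu> (\<lambda>y. p l y * f j y))\<^sup>2))"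
    by (subst suminf_mult[OF s], subst suminf_sum) (auto intro: p_column f)
  also have "\<dots> \<le> B * (N\<^sup>2 * (\<Sum>j<k. A * (L2_norm \<mu> (f j))\<^sup>2))"
    by (intro mult_left_mono sum_mono p_column(3) f B_nonneg) auto
  also have "\<dots> = A * B * N\<^sup>2 * (\<Sum>j<k. (L2_norm \<mu> (f j))\<^sup>2)"
    by (simp add: sum_distrib_left mult_ac)
  finally have "L2_set (\<lambda>i. L2_norm \<mu> (\<lambda>x. \<Sum>j<k. M (T i j) (f j) x)) {..<k}
      \<le> sqrt (A * B * N\<^sup>2 * (\<Sum>j<k. (L2_norm \<mu> (f j))\<^sup>2))"
    unfolding L2_set_def by (rule real_sqrt_le_mono)
  also have "\<dots> = sqrt (A * B) * N * L2_set (\<lambda>j. L2_norm \<mu> (f j)) {..<k}"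
    unfolding L2_set_def by (simp add: real_sqrt_mult N_def)
  finally show ?thesis by (simp add: N_def)
qed

lemma M_operator:
  assumes T: "T \<in> L2_operators \<mu>"
  shows "M T \<in> L2_operators \<mu>"
  unfolding L2_operators_def
proof (intro CollectI conjI ballI allI)
  show "M T f \<in> L2_space \<mu>" if "f \<in> L2_space \<mu>" for f by (rule M_L2[OF T that])
  show "AE x in \<mu>. M T (\<lambda>y. a * f y + b * g y) x = a * M T f x + b * M T g x"
    if f: "f \<in> L2_space \<mu>" and g: "g \<in> L2_space \<mu>" for f g a b
  proof -
    have "AE x in \<mu>. T (\<lambda>y. p l y * (a * f y + b * g y)) x
        = a * T (\<lambda>y. p l y * f y) x + b * T (\<lambda>y. p l y * g y) x" for l
      using L2_operators_linear[OF T p_column(1)[OF f, of l] p_column(1)[OF g, of l], of a b]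
      by (simp add: algebra_simps)
    \<comment> \<open>The exceptional null set depends on \<open>l\<close>; countably many of them
      still form a null set.\<close>
    then have "AE x in \<mu>. \<forall>l. T (\<lambda>y. p l y * (a * f y + b * g y)) x
        = a * T (\<lambda>y. p l y * f y) x + b * T (\<lambda>y. p l y * g y) x"
      by (simp add: AE_all_countable)
    then show ?thesis using M_AE[OF T f] M_AE[OF T g]
    proof eventually_elim
      case (elim x)
      have "(\<lambda>l. a * (cnj (q l x) * T (\<lambda>y. p l y * f y) x) + b * (cnj (q l x) * T (\<lambda>y. p l y * g y) x))
          sums (a * M T f x + b * M T g x)"
        unfolding schur_op_def using elim(2,3)
        by (intro sums_add sums_mult summable_sums) (auto intro: summable_norm_cancel)
      moreover have "(\<lambda>l. cnj (q l x) * T (\<lambda>y. p l y * (a * f y + b * g y)) x) =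
          (\<lambda>l. a * (cnj (q l x) * T (\<lambda>y. p l y * f y) x) + b * (cnj (q l x) * T (\<lambda>y. p l y * g y) x))"
        by (rule ext, subst elim(1)[rule_format]) (simp add: distrib_left)
      ultimately show ?case unfolding schur_op_def
        by (intro sums_unique[symmetric]) simp
    qed
  qed
  have "L2_norm \<mu> (M T f) \<le> sqrt (A * B) * \<bar>matrix_op_norm \<mu> 1 (\<lambda>_ _. T)\<bar> * L2_norm \<mu> f"
    if f: "f \<in> L2_space \<mu>" for f
    using M_matrix_bound[of 1 "\<lambda>_ _. T" "\<lambda>_. f"] T f by (simp add: L2_set_def)
  then show "\<exists>C. \<forall>f\<in>L2_space \<mu>. L2_norm \<mu> (M T f) \<le> C * L2_norm \<mu> f" by blast
qed

lemma M_linear: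
  assumes S: "S \<in> L2_operators \<mu>" and T: "T \<in> L2_operators \<mu>"
  shows "op_eq \<mu> (M (\<lambda>f x. a * S f x + b * T f x)) (\<lambda>f x. a * M S f x + b * M T f x)"
  unfolding op_eq_def
proof
  fix f assume f: "f \<in> L2_space \<mu>"
  show "AE x in \<mu>. M (\<lambda>f x. a * S f x + b * T f x) f x = a * M S f x + b * M T f x"
    using M_AE[OF S f] M_AE[OF T f]
  proof eventually_elim
    case (elim x)
    have "(\<lambda>l. a * (cnj (q l x) * S (\<lambda>y. p l y * f y) x) + b * (cnj (q l x) * T (\<lambda>y. p l y * f y) x))
        sums (a * M S f x + b * M T f x)"
      unfolding schur_op_def using elim
      by (intro sums_add sums_mult summable_sums) (auto intro: summable_norm_cancel)
    then show ?case unfolding schur_op_def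
      by (intro sums_unique[symmetric]) (simp add: algebra_simps)
  qed
qed

lemma M_amplification_le:
  fixes T :: "nat \<Rightarrow> nat \<Rightarrow> 'a operator"
  assumes T: "\<And>i j. i < k \<Longrightarrow> j < k \<Longrightarrow> T i j \<in> L2_operators \<mu>"
    and T1: "matrix_op_norm \<mu> k T \<le> 1"
  shows "matrix_op_norm \<mu> k (\<lambda>i j. M (T i j)) \<le> sqrt (A * B)"
proof (rule matrix_op_norm_le)
  have nn: "0 \<le> matrix_op_norm \<mu> k T"
    unfolding matrix_op_norm_def
    by (rule cInf_greatest[OF matrix_op_norm_set_nonempty[OF T]]) auto
  fix f :: "nat \<Rightarrow> 'a \<Rightarrow> complex" assume f: "\<And>j. j < k \<Longrightarrow> f j \<in> L2_space \<mu>"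
  show "L2_set (\<lambda>i. L2_norm \<mu> (\<lambda>x. \<Sum>j<k. M (T i j) (f j) x)) {..<k}
      \<le> sqrt (A * B) * L2_set (\<lambda>j. L2_norm \<mu> (f j)) {..<k}"
    using T1 nn A_nonneg B_nonneg
    by (intro order_trans[OF M_matrix_bound[OF T f]] mult_right_mono L2_set_nonneg)
       (auto intro: mult_left_le)
qed (simp add: A_nonneg B_nonneg)

text \<open>Moving \<open>p\<close> and \<open>q\<close> to the test vectors turns a functional of
  \<open>M T\<close> into a functional of \<open>T\<close>, given by the sequences
  \<open>p l * f n\<close> and \<open>q l * g n\<close>. Hence preimages of subbasic sets are
  subbasic.\<close>

lemma M_sigma_weak:
  assumes T: "T \<in> L2_operators \<mu>" and f: "square_summable \<mu> f" and g: "square_summable \<mu> g"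
  shows "(\<Sum>n. L2_inner \<mu> (M T (f n)) (g n)) =
    (\<Sum>i. L2_inner \<mu> (T ((case prod_decode i of (n, l) \<Rightarrow> (\<lambda>x. p l x * f n x))))
                    (case prod_decode i of (n, l) \<Rightarrow> (\<lambda>x. q l x * g n x)))"
proof -
  have fL2: "f n \<in> L2_space \<mu>" and gL2: "g n \<in> L2_space \<mu>" for n
    using f g by (auto simp: square_summable_def)
  note sp = square_summable_columns[where p = p and A = A, OF _ f] and sq = square_summable_columns[where p = q and A = B, OF _ g]
  obtain C where C: "\<And>f. f \<in> L2_space \<mu> \<Longrightarrow> (L2_norm \<mu> (T f))\<^sup>2 \<le> C\<^sup>2 * (L2_norm \<mu> f)\<^sup>2"
    by (rule L2_operators_bound[OF T]) blast
  \<comment> \<open>The majorant comes from the arithmetic-geometric inequality: unlike a product of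
    norms it is a sum of two families already known to be summable.\<close>
  define b where "b = (\<lambda>n l. (C\<^sup>2 * (L2_norm \<mu> (\<lambda>x. p l x * f n x))\<^sup>2 + (L2_norm \<mu> (\<lambda>x. q l x * g n x))\<^sup>2) / 2)"
  define t where "t = (\<lambda>n l. L2_inner \<mu> (T (\<lambda>x. p l x * f n x)) (\<lambda>x. q l x * g n x))"
  have "(\<Sum>i. case prod_decode i of (n, l) \<Rightarrow> t n l) = (\<Sum>n. \<Sum>l. t n l)"
  proof (rule suminf_prod_decode_complex(1))
    show bs: "summable (\<lambda>l. b n l)" for n
      unfolding b_def by (intro summable_divide summable_add summable_mult p_column q_column fL2 gL2)
    have "(\<Sum>l. b n l) = (C\<^sup>2 * (\<Sum>l. (L2_norm \<mu> (\<lambda>x. p l x * f n x))\<^sup>2) + (\<Sum>l. (L2_norm \<mu> (\<lambda>x. q l x * g n x))\<^sup>2)) / 2" for n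
      unfolding b_def
      by (intro sums_unique[symmetric] sums_divide sums_add sums_mult summable_sums p_column q_column fL2 gL2)
    moreover have "summable (\<lambda>n. (C\<^sup>2 * (\<Sum>l. (L2_norm \<mu> (\<lambda>x. p l x * f n x))\<^sup>2) + (\<Sum>l. (L2_norm \<mu> (\<lambda>x. q l x * g n x))\<^sup>2)) / 2)"
      by (intro summable_divide summable_add summable_mult sp sq conjI allI p_column q_column)
    ultimately show "summable (\<lambda>n. \<Sum>l. b n l)" by (simp only:)
    show "0 \<le> b n l" for n l by (simp add: b_def)
    show "cmod (t n l) \<le> b n l" for n l
    proof -
      have "cmod (t n l) \<le> ((L2_norm \<mu> (T (\<lambda>x. p l x * f n x)))\<^sup>2 + (L2_norm \<mu> (\<lambda>x. q l x * g n x))\<^sup>2) / 2"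
        unfolding t_def by (intro L2_inner_AMGM T_rows[OF T] q_column fL2 gL2)
      also have "\<dots> \<le> b n l" unfolding b_def using C[OF p_column(1)[OF fL2, of l n]] by simp
      finally show ?thesis .
    qed
  qed
  also have "\<dots> = (\<Sum>n. L2_inner \<mu> (M T (f n)) (g n))"
    by (simp add: M_inner[OF T fL2 gL2] t_def)
  finally show ?thesis by (simp add: t_def case_prod_unfold)
qed

lemma continuous_map_M: "continuous_map (sigma_weak_topology \<mu>) (sigma_weak_topology \<mu>) M"
proof -
  have op: "openin (sigma_weak_topology \<mu>) (M -` U \<inter> topspace (sigma_weak_topology \<mu>))"
    if U: "U \<in> sigma_weak_subbasis \<mu>" for U
  proof -
    obtain f g V where U': "U = {T \<in> L2_operators \<mu>. (\<Sum>n. L2_inner \<mu> (T (f n)) (g n)) \<in> V}"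
      and f: "square_summable \<mu> f" and g: "square_summable \<mu> g" and V: "open V"
      using U by (auto simp: sigma_weak_subbasis_def)
    define F where "F = (\<lambda>i. case prod_decode i of (n, l) \<Rightarrow> (\<lambda>x. p l x * f n x))"
    define H where "H = (\<lambda>i. case prod_decode i of (n, l) \<Rightarrow> (\<lambda>x. q l x * g n x))"
    have "square_summable \<mu> F" unfolding F_def
      by (rule square_summable_columns(1)[where p = p and A = A, OF _ f]) (intro conjI allI p_column)
    moreover have "square_summable \<mu> H" unfolding H_def
      by (rule square_summable_columns(1)[where p = q and A = B, OF _ g]) (intro conjI allI q_column)
    ultimately have "{T \<in> L2_operators \<mu>. (\<Sum>n. L2_inner \<mu> (T (F n)) (H n)) \<in> V} \<in> sigma_weak_subbasis \<mu>"
      unfolding sigma_weak_subbasis_def using V by blast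
    moreover have "M -` U \<inter> topspace (sigma_weak_topology \<mu>)
        = {T \<in> L2_operators \<mu>. (\<Sum>n. L2_inner \<mu> (T (F n)) (H n)) \<in> V}"
      using M_sigma_weak[OF _ f g] M_operator
      by (auto simp: U' topspace_sigma_weak F_def H_def)
    ultimately show ?thesis by (simp add: sigma_weak_topology_alt topology_generated_by_Basis)
  qed
  have "continuous_map (sigma_weak_topology \<mu>) (topology_generated_by (sigma_weak_subbasis \<mu>)) M"
    by (rule continuous_on_generated_topo)
       (use op M_operator in \<open>auto simp: topspace_sigma_weak Union_sigma_weak_subbasis\<close>)
  then show ?thesis by (simp add: sigma_weak_topology_alt)
qed
end

lemma op_eq_trans_sym:
  assumes "op_eq \<mu> S U" "op_eq \<mu> T U"
  shows "op_eq \<mu> S T"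
  unfolding op_eq_def
proof
  fix f assume "f \<in> L2_space \<mu>"
  then have "AE x in \<mu>. S f x = U f x" "AE x in \<mu>. T f x = U f x"
    using assms by (auto simp: op_eq_def)
  then show "AE x in \<mu>. S f x = T f x" by eventually_elim simp
qed

section \<open>Multipliers of a group with a Haar measure\<close>

text \<open>Translations and the inverse are continuous on the carrier, where the Haar measure
  lives, which makes them measurable maps. Exhaustion by compact sets supplies a set of positive
  finite measure, and with it a unit vector.\<close>

locale haar_group = group G for G :: "('a::{second_countable_topology, t2_space}, 'b) monoid_scheme" (structure) +
  fixes \<mu> :: "'a measure"
  assumes haar: "left_haar_measure G \<mu>"
    and continuous_mult: "\<And>g. g \<in> carrier G \<Longrightarrow> continuous_on (carrier G) (\<lambda>x. g \<otimes> x)"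
    and continuous_inv: "continuous_on (carrier G) (\<lambda>x. inv x)"
    and sigma_compact: "\<exists>C::nat \<Rightarrow> 'a set. (\<forall>n. compact (C n)) \<and> (\<Union>n. C n) = carrier G"
begin

lemma sets_haar: "sets \<mu> = sets (restrict_space borel (carrier G))"
  using haar by (simp add: left_haar_measure_def)

lemma space_haar: "space \<mu> = carrier G"
  using sets_eq_imp_space_eq[OF sets_haar] by (simp add: space_restrict_space)

lemma measurable_haar:
  assumes "continuous_on (carrier G) f" "\<And>x. x \<in> carrier G \<Longrightarrow> f x \<in> carrier G"
  shows "f \<in> measurable \<mu> \<mu>"
proof -
  have "f \<in> measurable (restrict_space borel (carrier G)) (restrict_space borel (carrier G))"
    using assms by (intro measurable_restrict_space2 borel_measurable_continuous_on_restrict)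
      (auto simp: space_restrict_space)
  then show ?thesis by (simp cong: measurable_cong_sets add: measurable_cong_sets[OF sets_haar sets_haar])
qed

lemma borel_measurable_haar:
  fixes f :: "'a \<Rightarrow> 'd::topological_space"
  assumes "continuous_on (carrier G) f"
  shows "f \<in> borel_measurable \<mu>"
  using borel_measurable_continuous_on_restrict[OF assms]
  by (simp add: measurable_cong_sets[OF sets_haar refl])

lemma measurable_translation: "g \<in> carrier G \<Longrightarrow> (\<lambda>x. g \<otimes> x) \<in> measurable \<mu> \<mu>"
  by (intro measurable_haar continuous_mult) auto

text \<open>The preimage under translation by \<open>g\<close> is the image under translation by
  \<open>inv g\<close>, to which left invariance applies.\<close>

lemma distr_translation:
  assumes g: "g \<in> carrier G"
  shows "distr \<mu> \<mu> (\<lambda>x. g \<otimes> x) = \<mu>"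
proof (rule measure_eqI)
  fix A assume "A \<in> sets (distr \<mu> \<mu> (\<lambda>x. g \<otimes> x))"
  then have A: "A \<in> sets \<mu>" by simp
  then have sub: "A \<subseteq> carrier G" using sets.sets_into_space space_haar by blast
  have "(\<lambda>x. g \<otimes> x) -` A \<inter> carrier G = (\<lambda>x. inv g \<otimes> x) ` A"
  proof safe
    fix x assume "x \<in> carrier G" "g \<otimes> x \<in> A"
    then show "x \<in> (\<lambda>x. inv g \<otimes> x) ` A"
      using g by (intro image_eqI[of _ _ "g \<otimes> x"]) (auto simp: m_assoc[symmetric])
  qed (use g sub in \<open>auto simp: m_assoc[symmetric] subset_iff\<close>)
  then have "emeasure (distr \<mu> \<mu> (\<lambda>x. g \<otimes> x)) A = emeasure \<mu> ((\<lambda>x. inv g \<otimes> x) ` A)"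
    using A g by (simp add: emeasure_distr measurable_translation space_haar)
  also have "\<dots> = emeasure \<mu> A"
    using haar A g by (simp add: left_haar_measure_def)
  finally show "emeasure (distr \<mu> \<mu> (\<lambda>x. g \<otimes> x)) A = emeasure \<mu> A" .
qed simp

lemma translation_L2:
  assumes g: "g \<in> carrier G" and f: "f \<in> L2_space \<mu>"
  shows "(\<lambda>x. f (g \<otimes> x)) \<in> L2_space \<mu>" "L2_norm \<mu> (\<lambda>x. f (g \<otimes> x)) = L2_norm \<mu> f"
proof -
  note [measurable] = measurable_translation[OF g] f[THEN L2_space_measurable]
  have i: "integrable \<mu> (\<lambda>x. (cmod (f (g \<otimes> x)))\<^sup>2)"
    using L2_space_integrable[OF f]
    by (subst (asm) distr_translation[OF g, symmetric]) (simp add: integrable_distr_eq)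
  then show "(\<lambda>x. f (g \<otimes> x)) \<in> L2_space \<mu>" by (simp add: L2_space_def)
  have "(LINT x|\<mu>. (cmod (f x))\<^sup>2) = (LINT x|\<mu>. (cmod (f (g \<otimes> x)))\<^sup>2)"
    by (subst distr_translation[OF g, symmetric]) (simp add: integral_distr)
  then show "L2_norm \<mu> (\<lambda>x. f (g \<otimes> x)) = L2_norm \<mu> f" by (simp add: L2_norm_def)
qed

section \<open>The left regular representation and its von Neumann algebra\<close>

lemma left_regular_L2:
  assumes g: "g \<in> carrier G" and f: "f \<in> L2_space \<mu>"
  shows "left_regular G g f \<in> L2_space \<mu>" "L2_norm \<mu> (left_regular G g f) = L2_norm \<mu> f"
  using translation_L2[of "inv g" f] g f by (simp_all add: left_regular_def)

lemma span_operators: "left_regular_span G \<subseteq> L2_operators \<mu>"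
proof
  fix T assume "T \<in> left_regular_span G"
  then obtain F c where T: "T = (\<lambda>f x. \<Sum>g\<in>F. c g * left_regular G g f x)" and F: "finite F" "F \<subseteq> carrier G"
    by (auto simp: left_regular_span_def)
  let ?k = "card F"
  obtain e where e: "bij_betw e {..<?k} F" using ex_bij_betw_nat_finite[OF F(1)] by (auto simp: atLeast0LessThan)
  have eF: "e j \<in> carrier G" if "j < ?k" for j using e F that by (auto simp: bij_betw_def)
  have T': "T f = (\<lambda>x. \<Sum>j<?k. c (e j) * left_regular G (e j) f x)" for f
    unfolding T by (rule ext) (rule sum.reindex_bij_betw[OF e, symmetric])
  show "T \<in> L2_operators \<mu>"
    unfolding L2_operators_def
  proof (intro CollectI conjI ballI allI)
    fix f assume f: "f \<in> L2_space \<mu>"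
    show "T f \<in> L2_space \<mu>" unfolding T
      using F f by (auto intro!: L2_space_sum L2_space_cmult left_regular_L2)
  next
    show "AE x in \<mu>. T (\<lambda>y. a * f y + b * g y) x = a * T f x + b * T g x" for f g a b
      by (simp add: T left_regular_def distrib_left sum.distrib sum_distrib_left mult_ac)
  next
    have "L2_norm \<mu> (T f) \<le> sqrt (real ?k * (\<Sum>j<?k. (cmod (c (e j)))\<^sup>2)) * L2_norm \<mu> f"
      if f: "f \<in> L2_space \<mu>" for f
    proof -
      have "(L2_norm \<mu> (T f))\<^sup>2 \<le> real ?k * (\<Sum>j<?k. (L2_norm \<mu> (\<lambda>x. c (e j) * left_regular G (e j) f x))\<^sup>2)"
        unfolding T' by (intro L2_norm_sum_sq_le L2_space_cmult left_regular_L2 eF f)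
      also have "\<dots> = (real ?k * (\<Sum>j<?k. (cmod (c (e j)))\<^sup>2)) * (L2_norm \<mu> f)\<^sup>2"
        by (simp add: L2_norm_cmult left_regular_L2 eF f power_mult_distrib sum_distrib_left sum_distrib_right mult_ac)
      finally have "sqrt ((L2_norm \<mu> (T f))\<^sup>2) \<le> sqrt ((real ?k * (\<Sum>j<?k. (cmod (c (e j)))\<^sup>2)) * (L2_norm \<mu> f)\<^sup>2)"
        by (rule real_sqrt_le_mono)
      then show ?thesis by (simp add: real_sqrt_mult)
    qed
    then show "\<exists>C. \<forall>f\<in>L2_space \<mu>. L2_norm \<mu> (T f) \<le> C * L2_norm \<mu> f" by blast
  qed
qed

lemma vN_operators: "T \<in> group_vN G \<mu> \<Longrightarrow> T \<in> L2_operators \<mu>"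
  using closure_of_subset_topspace[of "sigma_weak_topology \<mu>"]
  by (auto simp: group_vN_def topspace_sigma_weak)

lemma span_vN: "T \<in> left_regular_span G \<Longrightarrow> T \<in> group_vN G \<mu>"
  unfolding group_vN_def using span_operators
  by (metis (no_types, lifting) closure_of_subset subsetD topspace_sigma_weak)

lemma topspace_vN: "topspace (subtopology (sigma_weak_topology \<mu>) (group_vN G \<mu>)) = group_vN G \<mu>"
  using vN_operators by (auto simp: topspace_subtopology topspace_sigma_weak)

lemma cmult_left_regular_span:
  assumes "g \<in> carrier G"
  shows "(\<lambda>f x. c * left_regular G g f x) \<in> left_regular_span G"
  unfolding left_regular_span_def using assms
  by (intro CollectI exI[of _ "{g}"] exI[of _ "\<lambda>_. c"]) auto

lemma left_regular_span1: "g \<in> carrier G \<Longrightarrow> left_regular G g \<in> left_regular_span G"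
  using cmult_left_regular_span[of g 1] by simp

lemma multiplier_vN:
  assumes "is_cb_multiplier_map G \<mu> \<phi> M" "T \<in> group_vN G \<mu>"
  shows "M T \<in> group_vN G \<mu>"
  using assms unfolding is_cb_multiplier_map_def
  by (metis continuous_map_funspace funcset_mem topspace_vN)

lemma multiplier_span:
  assumes M: "is_cb_multiplier_map G \<mu> \<phi> M" and F: "finite F" "F \<subseteq> carrier G"
  shows "op_eq \<mu> (M (\<lambda>f x. \<Sum>g\<in>F. c g * left_regular G g f x))
           (\<lambda>f x. \<Sum>g\<in>F. c g * (\<phi> g * left_regular G g f x))"
  using F
proof (induction F rule: finite_induct)
  case empty
  have lin: "linear_on_operators \<mu> (group_vN G \<mu>) M" using M by (simp add: is_cb_multiplier_map_def)
  have "left_regular G \<one> \<in> group_vN G \<mu>" by (intro span_vN left_regular_span1) auto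
  \<comment> \<open>Linearity speaks of combinations of two operators, so the zero operator is
    written as such a combination with both coefficients zero.\<close>
  then have "op_eq \<mu> (M (\<lambda>f x. 0 * left_regular G \<one> f x + 0 * left_regular G \<one> f x))
     (\<lambda>f x. 0 * M (left_regular G \<one>) f x + 0 * M (left_regular G \<one>) f x)"
    using lin unfolding linear_on_operators_def by blast
  then show ?case by simp
next
  case (insert h F)
  have lin: "linear_on_operators \<mu> (group_vN G \<mu>) M" using M by (simp add: is_cb_multiplier_map_def)
  let ?S = "\<lambda>f x. \<Sum>g\<in>F. c g * left_regular G g f x"
  have "left_regular G h \<in> group_vN G \<mu>" "?S \<in> group_vN G \<mu>"
    using insert by (auto intro!: span_vN left_regular_span1) (auto simp: left_regular_span_def)
  then have 1: "op_eq \<mu> (M (\<lambda>f x. c h * left_regular G h f x + 1 * ?S f x))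
     (\<lambda>f x. c h * M (left_regular G h) f x + 1 * M ?S f x)"
    by (rule lin[unfolded linear_on_operators_def, rule_format])
  have 2: "op_eq \<mu> (M (left_regular G h)) (\<lambda>f x. \<phi> h * left_regular G h f x)"
    using M insert by (simp add: is_cb_multiplier_map_def)
  have 3: "op_eq \<mu> (M ?S) (\<lambda>f x. \<Sum>g\<in>F. c g * (\<phi> g * left_regular G g f x))"
    using insert by auto
  show ?case unfolding op_eq_def
  proof
    fix f assume f: "f \<in> L2_space \<mu>"
    from 1 2 3 f have "AE x in \<mu>. M (\<lambda>f x. c h * left_regular G h f x + 1 * ?S f x) f x = c h * M (left_regular G h) f x + 1 * M ?S f x"
      "AE x in \<mu>. M (left_regular G h) f x = \<phi> h * left_regular G h f x"
      "AE x in \<mu>. M ?S f x = (\<Sum>g\<in>F. c g * (\<phi> g * left_regular G g f x))"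
      by (simp_all add: op_eq_def)
    then show "AE x in \<mu>. M (\<lambda>f x. \<Sum>g\<in>insert h F. c g * left_regular G g f x) f x
       = (\<Sum>g\<in>insert h F. c g * (\<phi> g * left_regular G g f x))"
      by eventually_elim (use insert in simp)
  qed
qed

text \<open>Continuous maps that agree on a dense set agree if the target is Hausdorff. As the
  operators are separated only up to \<open>op_eq\<close>, the comparison is made in the complex
  numbers, one matrix coefficient at a time.\<close>

lemma multiplier_unique:
  assumes M: "is_cb_multiplier_map G \<mu> \<phi> M" and M': "is_cb_multiplier_map G \<mu> \<phi> M'"
    and T: "T \<in> group_vN G \<mu>"
  shows "op_eq \<mu> (M T) (M' T)"
proof (rule op_eqI_inner)
  show "M T \<in> L2_operators \<mu>" "M' T \<in> L2_operators \<mu>"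
    by (intro vN_operators multiplier_vN[OF M] multiplier_vN[OF M'] T)+
  fix f g assume f: "f \<in> L2_space \<mu>" and g: "g \<in> L2_space \<mu>"
  let ?X = "subtopology (sigma_weak_topology \<mu>) (group_vN G \<mu>)"
  have cont: "continuous_map ?X euclidean (\<lambda>T. L2_inner \<mu> (N T f) g)" if N: "is_cb_multiplier_map G \<mu> \<phi> N" for N
  proof -
    have "continuous_map ?X (sigma_weak_topology \<mu>) N"
      using N by (auto simp: is_cb_multiplier_map_def continuous_map_in_subtopology)
    from continuous_map_compose[OF this continuous_map_L2_inner[OF f g]]
    show ?thesis by (simp add: o_def)
  qed
  show "L2_inner \<mu> (M T f) g = L2_inner \<mu> (M' T f) g"
  proof (rule forall_in_closure_of_eq[where X = ?X and Y = euclidean and S = "left_regular_span G"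
        and f = "\<lambda>T. L2_inner \<mu> (M T f) g" and g = "\<lambda>T. L2_inner \<mu> (M' T f) g" and x = T])
    have "group_vN G \<mu> \<inter> left_regular_span G = left_regular_span G" using span_vN by auto
    then show "T \<in> (subtopology (sigma_weak_topology \<mu>) (group_vN G \<mu>)) closure_of left_regular_span G"
      using T by (simp add: closure_of_subtopology) (simp add: group_vN_def)
    show "Hausdorff_space (euclidean :: complex topology)" by simp
    fix S assume S: "S \<in> left_regular_span G"
    then obtain F c where S': "S = (\<lambda>f x. \<Sum>g\<in>F. c g * left_regular G g f x)" and F: "finite F" "F \<subseteq> carrier G"
      by (auto simp: left_regular_span_def)
    have "op_eq \<mu> (M S) (M' S)"
      using multiplier_span[OF M F, of c] multiplier_span[OF M' F, of c]
      unfolding S' by (rule op_eq_trans_sym)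
    then show "L2_inner \<mu> (M S f) g = L2_inner \<mu> (M' S f) g"
      by (rule op_eq_sum_inner[OF _ _ _ f g])
         (intro vN_operators multiplier_vN[OF M] multiplier_vN[OF M'] span_vN S)+
  qed (rule cont[OF M], rule cont[OF M'])
qed

text \<open>Amplified norms depend on a map only up to \<open>op_eq\<close>. This makes the choice
  of an extension in \<open>M0A_norm\<close> harmless.\<close>

lemma amplification_values_unique:
  assumes M: "is_cb_multiplier_map G \<mu> \<phi> M" and M': "is_cb_multiplier_map G \<mu> \<phi> M'"
  shows "amplification_values \<mu> (group_vN G \<mu>) M = amplification_values \<mu> (group_vN G \<mu>) M'"
proof -
  have "matrix_op_norm \<mu> k (\<lambda>i j. M (T i j)) = matrix_op_norm \<mu> k (\<lambda>i j. M' (T i j))"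
    if "\<forall>i<k. \<forall>j<k. T i j \<in> group_vN G \<mu>" for k T
    using that
    by (intro matrix_op_norm_cong multiplier_unique[OF M M'] vN_operators multiplier_vN[OF M] multiplier_vN[OF M']) auto
  then show ?thesis unfolding amplification_values_def by (intro Collect_cong) metis
qed

lemma M0A_norm_eq:
  assumes M: "is_cb_multiplier_map G \<mu> \<phi> M"
  shows "M0A_norm G \<mu> \<phi> = cb_norm \<mu> (group_vN G \<mu>) M"
proof -
  have "is_cb_multiplier_map G \<mu> \<phi> (SOME M. is_cb_multiplier_map G \<mu> \<phi> M)"
    using someI[where P = "is_cb_multiplier_map G \<mu> \<phi>", OF M] .
  from amplification_values_unique[OF this M] show ?thesis
    by (simp add: M0A_norm_def cb_norm_def)
qed

text \<open>Countably many compact sets exhaust the group, so one of them has positive measure, and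
  its measure is finite. Its normalized indicator serves.\<close>

lemma exists_unit_vector:
  obtains f where "f \<in> L2_space \<mu>" "L2_norm \<mu> f = 1"
proof -
  obtain C :: "nat \<Rightarrow> 'a set" where C: "\<And>n. compact (C n)" "(\<Union>n. C n) = carrier G"
    using sigma_compact by blast
  have C_sub: "C n \<subseteq> carrier G" for n using C by auto
  have C_sets: "C n \<in> sets \<mu>" for n
    unfolding sets_haar sets_restrict_space using C C_sub[of n]
    by (auto intro!: image_eqI[of _ _ "C n"] borel_closed compact_imp_closed)
  have "\<exists>n. emeasure \<mu> (C n) \<noteq> 0"
  proof (rule ccontr)
    assume "\<not> ?thesis"
    then have "emeasure \<mu> (\<Union>n. C n) = 0"
      by (intro emeasure_UN_eq_0) (auto simp: C_sets)
    then show False using haar C by (simp add: left_haar_measure_def)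
  qed
  then obtain n where n: "emeasure \<mu> (C n) \<noteq> 0" by blast
  have fin: "emeasure \<mu> (C n) < \<infinity>" using haar C C_sub by (auto simp: left_haar_measure_def)
  define f where "f = (\<lambda>x. complex_of_real (indicator (C n) x / sqrt (measure \<mu> (C n))))"
  have pos: "measure \<mu> (C n) > 0" using n fin by (simp add: measure_def enn2real_positive_iff less_top zero_less_iff_neq_zero)
  have "(cmod (f x))\<^sup>2 = indicator (C n) x / measure \<mu> (C n)" for x
    using pos by (simp add: f_def norm_divide power_divide indicator_def)
  then have sq: "(\<lambda>x. (cmod (f x))\<^sup>2) = (\<lambda>x. indicator (C n) x / measure \<mu> (C n))" by blast
  have "f \<in> L2_space \<mu>"
    unfolding L2_space_def mem_Collect_eq sq using C_sets fin by (auto simp: f_def)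
  moreover have "L2_norm \<mu> f = 1"
    unfolding L2_norm_def sq using C_sets fin pos by (simp add: Int_absorb2 C_sub space_haar)
  ultimately show ?thesis using that by blast
qed

text \<open>The matrix with entries \<open>c i j * left_regular G (inv (g i) \<otimes> g j)\<close>
  is the scalar matrix \<open>c\<close> conjugated by the unitary diagonal matrix of the
  translations by \<open>g i\<close>, hence a contraction. The multiplier map inserts the factors
  \<open>\<phi> (inv (g i) \<otimes> g j)\<close>, and testing on translates of one unit vector
  leaves a scalar matrix. So the multiplier norm dominates the norm of \<phi> as a Schur multiplier
  on every finite family of group elements.\<close>

lemma M0A_norm_ge:
  fixes c :: "nat \<Rightarrow> nat \<Rightarrow> complex"
  assumes M: "is_cb_multiplier_map G \<mu> \<phi> M"
    and g: "\<And>i. i < k \<Longrightarrow> g i \<in> carrier G"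
    and c: "\<And>v. L2_set (\<lambda>i. cmod (\<Sum>j<k. c i j * v j)) {..<k} \<le> L2_set (\<lambda>j. cmod (v j)) {..<k}"
  shows "L2_set (\<lambda>i. cmod (\<Sum>j<k. c i j * \<phi> (inv (g i) \<otimes> g j) * v j)) {..<k}
    \<le> M0A_norm G \<mu> \<phi> * L2_set (\<lambda>j. cmod (v j)) {..<k}"
proof -
  define T where "T = (\<lambda>i j f x. c i j * left_regular G (inv (g i) \<otimes> g j) f x)"
  define S where "S = (\<lambda>i j f x. c i j * (\<phi> (inv (g i) \<otimes> g j) * left_regular G (inv (g i) \<otimes> g j) f x))"
  have gg: "inv (g i) \<otimes> g j \<in> carrier G" if "i < k" "j < k" for i j using g that by auto
  have T_vN: "T i j \<in> group_vN G \<mu>" if "i < k" "j < k" for i j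
    unfolding T_def using that by (intro span_vN cmult_left_regular_span gg)
  have S_op: "S i j \<in> L2_operators \<mu>" if "i < k" "j < k" for i j
    unfolding S_def mult.assoc[symmetric] using that by (intro subsetD[OF span_operators] cmult_left_regular_span gg)
  have MS: "op_eq \<mu> (M (T i j)) (S i j)" if "i < k" "j < k" for i j
    using multiplier_span[OF M, of "{inv (g i) \<otimes> g j}" "\<lambda>_. c i j"] gg[OF that]
    by (simp add: T_def S_def)
  have translate: "left_regular G (inv (g i) \<otimes> g j) (\<lambda>y. f (g j \<otimes> y)) x = f (g i \<otimes> x)"
    if "i < k" "j < k" "x \<in> carrier G" for i j x and f :: "'a \<Rightarrow> complex"
    using g that by (simp add: left_regular_def inv_mult_group m_assoc) (simp add: m_assoc[symmetric])
  have untranslate: "left_regular G (inv (g i) \<otimes> g j) f x = f (inv (g j) \<otimes> (g i \<otimes> x))"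
    if "i < k" "j < k" "x \<in> carrier G" for i j x and f :: "'a \<Rightarrow> complex"
    using g that by (simp add: left_regular_def inv_mult_group m_assoc)
  have "matrix_op_norm \<mu> k T \<le> 1"
  proof (rule matrix_op_norm_le)
    fix f :: "nat \<Rightarrow> 'a \<Rightarrow> complex" assume f: "\<And>j. j < k \<Longrightarrow> f j \<in> L2_space \<mu>"
    \<comment> \<open>Translating the component \<open>j\<close> by \<open>g j\<close> removes the
      group elements from the matrix and preserves the norms.\<close>
    define F where "F = (\<lambda>j x. f j (inv (g j) \<otimes> x))"
    have F: "F j \<in> L2_space \<mu>" "L2_norm \<mu> (F j) = L2_norm \<mu> (f j)" if "j < k" for j
      unfolding F_def using translation_L2[of "inv (g j)" "f j"] g f that by auto
    define H where "H = (\<lambda>i x. \<Sum>j<k. c i j * F j x)"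
    have H: "H i \<in> L2_space \<mu>" for i
      unfolding H_def by (intro L2_space_sum L2_space_cmult F) auto
    have TH: "L2_norm \<mu> (\<lambda>x. \<Sum>j<k. T i j (f j) x) = L2_norm \<mu> (H i)" if i: "i < k" for i
    proof -
      have "L2_norm \<mu> (\<lambda>x. \<Sum>j<k. T i j (f j) x) = L2_norm \<mu> (\<lambda>x. H i (g i \<otimes> x))"
        unfolding L2_norm_def
        by (intro arg_cong[where f = sqrt] Bochner_Integration.integral_cong refl)
           (use i in \<open>simp add: T_def H_def F_def space_haar untranslate\<close>)
      then show ?thesis using translation_L2(2)[OF g[OF i] H] by simp
    qed
    have "(\<Sum>i<k. (L2_norm \<mu> (H i))\<^sup>2) = (LINT x|\<mu>. (\<Sum>i<k. (cmod (H i x))\<^sup>2))"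
      by (simp add: L2_norm_sq L2_space_integrable[OF H])
    also have "\<dots> \<le> (LINT x|\<mu>. (\<Sum>j<k. (cmod (F j x))\<^sup>2))"
    proof (rule integral_mono)
      \<comment> \<open>At a single point only the scalar contraction \<open>c\<close> is
        left.\<close>
      fix x
      have "(L2_set (\<lambda>i. cmod (H i x)) {..<k})\<^sup>2 \<le> (L2_set (\<lambda>j. cmod (F j x)) {..<k})\<^sup>2"
        unfolding H_def by (intro power_mono c L2_set_nonneg)
      then show "(\<Sum>i<k. (cmod (H i x))\<^sup>2) \<le> (\<Sum>j<k. (cmod (F j x))\<^sup>2)"
        by (simp add: L2_set_def sum_nonneg)
    qed (auto intro!: Bochner_Integration.integrable_sum L2_space_integrable H F)
    also have "\<dots> = (\<Sum>j<k. (L2_norm \<mu> (f j))\<^sup>2)"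
      using F by (simp add: L2_norm_sq[symmetric] L2_space_integrable)
    finally show "L2_set (\<lambda>i. L2_norm \<mu> (\<lambda>x. \<Sum>j<k. T i j (f j) x)) {..<k}
          \<le> 1 * L2_set (\<lambda>j. L2_norm \<mu> (f j)) {..<k}"
      by (simp add: L2_set_def TH)
  qed simp
  then have "matrix_op_norm \<mu> k (\<lambda>i j. M (T i j)) \<in> amplification_values \<mu> (group_vN G \<mu>) M"
    unfolding amplification_values_def using T_vN by blast
  moreover have "bdd_above (amplification_values \<mu> (group_vN G \<mu>) M)"
    using M by (simp add: is_cb_multiplier_map_def completely_bounded_def)
  ultimately have le: "matrix_op_norm \<mu> k (\<lambda>i j. M (T i j)) \<le> M0A_norm G \<mu> \<phi>"
    unfolding M0A_norm_eq[OF M] cb_norm_def by (rule cSup_upper)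
  have "matrix_op_norm \<mu> k (\<lambda>i j. M (T i j)) = matrix_op_norm \<mu> k S"
    by (intro matrix_op_norm_cong MS S_op vN_operators multiplier_vN[OF M] T_vN)
  with le have le: "matrix_op_norm \<mu> k S \<le> M0A_norm G \<mu> \<phi>" by simp
  obtain f where f: "f \<in> L2_space \<mu>" "L2_norm \<mu> f = 1" by (rule exists_unit_vector)
  \<comment> \<open>The entry in position \<open>i\<close>, \<open>j\<close> sends this vector to a
    multiple of \<open>f (g i \<otimes> x)\<close>, the same function for all \<open>j\<close>, so
    the sum over \<open>j\<close> takes place in the scalars.\<close>
  define h where "h = (\<lambda>j x. v j * f (g j \<otimes> x))"
  have h: "h j \<in> L2_space \<mu>" "L2_norm \<mu> (h j) = cmod (v j)" if "j < k" for j
    unfolding h_def using translation_L2[of "g j" f] g f that by (auto intro: L2_space_cmult simp: L2_norm_cmult)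
  have lrh: "left_regular G a (h j) x = v j * left_regular G a (\<lambda>y. f (g j \<otimes> y)) x" for a j x
    by (simp add: left_regular_def h_def)
  have "L2_norm \<mu> (\<lambda>x. \<Sum>j<k. S i j (h j) x) = cmod (\<Sum>j<k. c i j * \<phi> (inv (g i) \<otimes> g j) * v j)" if i: "i < k" for i
  proof -
    have "L2_norm \<mu> (\<lambda>x. \<Sum>j<k. S i j (h j) x)
        = L2_norm \<mu> (\<lambda>x. (\<Sum>j<k. c i j * \<phi> (inv (g i) \<otimes> g j) * v j) * f (g i \<otimes> x))"
      unfolding L2_norm_def
      by (intro arg_cong[where f = sqrt] Bochner_Integration.integral_cong refl)
         (use i in \<open>simp add: S_def lrh space_haar translate sum_distrib_left sum_distrib_right mult_ac\<close>)
    then show ?thesis using translation_L2[OF g[OF i] f(1)] f(2) by (simp add: L2_norm_cmult)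
  qed
  then have "L2_set (\<lambda>i. cmod (\<Sum>j<k. c i j * \<phi> (inv (g i) \<otimes> g j) * v j)) {..<k}
      = L2_set (\<lambda>i. L2_norm \<mu> (\<lambda>x. \<Sum>j<k. S i j (h j) x)) {..<k}"
    by (intro L2_set_cong) auto
  also have "\<dots> \<le> matrix_op_norm \<mu> k S * L2_set (\<lambda>j. L2_norm \<mu> (h j)) {..<k}"
    by (intro matrix_op_norm_bound S_op h)
  also have "\<dots> \<le> M0A_norm G \<mu> \<phi> * L2_set (\<lambda>j. L2_norm \<mu> (h j)) {..<k}"
    by (intro mult_right_mono le L2_set_nonneg)
  also have "L2_set (\<lambda>j. L2_norm \<mu> (h j)) {..<k} = L2_set (\<lambda>j. cmod (v j)) {..<k}"
    by (intro L2_set_cong) (auto simp: h)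
  finally show ?thesis .
qed

text \<open>The easy half of the Gilbert characterization, with sequences as Hilbert space vectors.
  On the translation by \<open>g\<close> the map produces the factor
  \<open>\<Sum>l. p l (inv g \<otimes> x) * cnj (q l x)\<close>. With \<open>p\<close> and
  \<open>q\<close> taken as \<open>P\<close> and \<open>Q\<close> after the inverse, this is the
  factorization at \<open>inv x \<otimes> g\<close> and \<open>inv x\<close>, so it equals
  \<open>\<phi> g\<close> for every \<open>x\<close>.\<close>

lemma schur_multiplier:
  fixes P Q :: "nat \<Rightarrow> 'a \<Rightarrow> complex"
  assumes P: "\<And>l. P l \<in> borel_measurable \<mu>" and Q: "\<And>l. Q l \<in> borel_measurable \<mu>"
    and Ps: "\<And>x. x \<in> carrier G \<Longrightarrow> summable (\<lambda>l. (cmod (P l x))\<^sup>2)"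
    and Qs: "\<And>x. x \<in> carrier G \<Longrightarrow> summable (\<lambda>l. (cmod (Q l x))\<^sup>2)"
    and PA: "\<And>x. x \<in> carrier G \<Longrightarrow> (\<Sum>l. (cmod (P l x))\<^sup>2) \<le> A"
    and QB: "\<And>x. x \<in> carrier G \<Longrightarrow> (\<Sum>l. (cmod (Q l x))\<^sup>2) \<le> B"
    and "0 \<le> A" "0 \<le> B"
    and PQ: "\<And>x y. x \<in> carrier G \<Longrightarrow> y \<in> carrier G \<Longrightarrow>
      (\<lambda>l. P l x * cnj (Q l y)) sums \<phi> (inv y \<otimes> x)"
  shows "\<exists>M. is_cb_multiplier_map G \<mu> \<phi> M" and "M0A_norm G \<mu> \<phi> \<le> sqrt (A * B)"
proof -
  define p where "p = (\<lambda>l x. P l (inv x))"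
  define q where "q = (\<lambda>l x. Q l (inv x))"
  have inv_meas: "(\<lambda>x. inv x) \<in> measurable \<mu> \<mu>" by (intro measurable_haar continuous_inv) auto
  interpret schur_rows \<mu> p q A B
    by unfold_locales
       (use Ps Qs PA QB \<open>0 \<le> A\<close> \<open>0 \<le> B\<close> measurable_compose[OF inv_meas P] measurable_compose[OF inv_meas Q]
         in \<open>auto simp: p_def q_def space_haar\<close>)
  have span: "op_eq \<mu> (M (\<lambda>f x. \<Sum>g\<in>F. c g * left_regular G g f x)) (\<lambda>f x. \<Sum>g\<in>F. c g * \<phi> g * left_regular G g f x)"
    if F: "finite F" "F \<subseteq> carrier G" for F c
    unfolding op_eq_def
  proof (intro ballI AE_I2)
    fix f x assume "f \<in> L2_space \<mu>" "x \<in> space \<mu>"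
    then have x: "x \<in> carrier G" by (simp add: space_haar)
    have "(\<lambda>l. \<Sum>g\<in>F. (c g * left_regular G g f x) * (p l (inv g \<otimes> x) * cnj (q l x)))
        sums (\<Sum>g\<in>F. (c g * left_regular G g f x) * \<phi> g)"
    proof (intro sums_sum sums_mult)
      fix g assume "g \<in> F"
      then have g: "g \<in> carrier G" using F by auto
      have "inv (inv x) \<otimes> (inv x \<otimes> g) = g" using x g by (simp add: m_assoc[symmetric])
      with PQ[of "inv x \<otimes> g" "inv x"] x g
      show "(\<lambda>l. p l (inv g \<otimes> x) * cnj (q l x)) sums \<phi> g"
        by (simp add: p_def q_def inv_mult_group)
    qed
    then show "M (\<lambda>f x. \<Sum>g\<in>F. c g * left_regular G g f x) f x = (\<Sum>g\<in>F. c g * \<phi> g * left_regular G g f x)"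
      unfolding schur_op_def
      by (intro sums_unique[symmetric])
         (simp add: left_regular_def sum_distrib_left sum_distrib_right mult_ac)
  qed
  \<comment> \<open>The image of the span lies in the span up to \<open>op_eq\<close> only; the
    closure absorbs the difference.\<close>
  have M_span: "M T \<in> group_vN G \<mu>" if "T \<in> left_regular_span G" for T
  proof -
    obtain F c where T: "T = (\<lambda>f x. \<Sum>g\<in>F. c g * left_regular G g f x)" and F: "finite F" "F \<subseteq> carrier G"
      using \<open>T \<in> left_regular_span G\<close> by (auto simp: left_regular_span_def)
    have S: "(\<lambda>f x. \<Sum>g\<in>F. c g * \<phi> g * left_regular G g f x) \<in> left_regular_span G"
      unfolding left_regular_span_def using F
      by (intro CollectI exI[of _ F] exI[of _ "\<lambda>g. c g * \<phi> g"]) simp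
    show ?thesis unfolding group_vN_def
      by (rule op_eq_closure_of[OF span[OF F, of c, folded T]])
         (use S span_vN[OF S] span_operators that in \<open>auto intro: M_operator simp: group_vN_def\<close>)
  qed
  have M_vN: "M T \<in> group_vN G \<mu>" if T: "T \<in> group_vN G \<mu>" for T
  proof -
    have "M ` group_vN G \<mu> \<subseteq> sigma_weak_topology \<mu> closure_of (M ` left_regular_span G)"
      unfolding group_vN_def by (rule continuous_map_image_closure_subset[OF continuous_map_M])
    also have "\<dots> \<subseteq> sigma_weak_topology \<mu> closure_of (group_vN G \<mu>)"
      by (intro closure_of_mono) (auto intro: M_span)
    also have "\<dots> = group_vN G \<mu>" unfolding group_vN_def by simp
    finally show ?thesis using T by blast
  qed
  have amp: "x \<le> sqrt (A * B)" if "x \<in> amplification_values \<mu> (group_vN G \<mu>) M" for x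
    using that vN_operators unfolding amplification_values_def by (auto intro!: M_amplification_le)
  have is_M: "is_cb_multiplier_map G \<mu> \<phi> M"
    unfolding is_cb_multiplier_map_def
  proof (intro conjI ballI)
    show "continuous_map (subtopology (sigma_weak_topology \<mu>) (group_vN G \<mu>))
       (subtopology (sigma_weak_topology \<mu>) (group_vN G \<mu>)) M"
      using M_vN by (auto simp: continuous_map_in_subtopology topspace_vN
          intro: continuous_map_from_subtopology[OF continuous_map_M])
    show "linear_on_operators \<mu> (group_vN G \<mu>) M"
      unfolding linear_on_operators_def by (intro ballI allI M_linear vN_operators)
    show "completely_bounded \<mu> (group_vN G \<mu>) M"
      unfolding completely_bounded_def using amp by (rule bdd_aboveI)
    show "op_eq \<mu> (M (left_regular G g)) (\<lambda>f x. \<phi> g * left_regular G g f x)" if "g \<in> carrier G" for g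
      using span[of "{g}" "\<lambda>_. 1"] that by simp
  qed
  then show "\<exists>M. is_cb_multiplier_map G \<mu> \<phi> M" by blast
  \<comment> \<open>The empty matrix shows that the set of amplified norms is nonempty, which a
    bound for its supremum requires.\<close>
  have "matrix_op_norm \<mu> 0 (\<lambda>i j. M (left_regular G \<one>)) \<in> amplification_values \<mu> (group_vN G \<mu>) M"
    unfolding amplification_values_def
    by (intro CollectI exI[of _ 0] exI[of _ "\<lambda>_ _. left_regular G \<one>"])
       (auto intro!: matrix_op_norm_le)
  then show "M0A_norm G \<mu> \<phi> \<le> sqrt (A * B)"
    unfolding M0A_norm_eq[OF is_M] cb_norm_def using amp by (intro cSup_least) auto
qed
end

section \<open>Gram--Schmidt expansions\<close>

lemma L2_inner_diff_left:
  assumes "f \<in> L2_space M" "g \<in> L2_space M" "h \<in> L2_space M"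
  shows "L2_inner M (\<lambda>x. f x - g x) h = L2_inner M f h - L2_inner M g h"
  unfolding L2_inner_def left_diff_distrib
  by (intro Bochner_Integration.integral_diff integrable_L2_inner assms)

lemma L2_inner_cmult_left: "L2_inner M (\<lambda>x. c * f x) h = c * L2_inner M f h"
  unfolding L2_inner_def by (simp add: mult.assoc)

lemma L2_inner_sum_left:
  assumes "\<And>i. i \<in> I \<Longrightarrow> f i \<in> L2_space M" "h \<in> L2_space M"
  shows "L2_inner M (\<lambda>x. \<Sum>i\<in>I. f i x) h = (\<Sum>i\<in>I. L2_inner M (f i) h)"
  unfolding L2_inner_def sum_distrib_right
  by (intro Bochner_Integration.integral_sum integrable_L2_inner assms)

lemma L2_inner_cnj: "L2_inner M f g = cnj (L2_inner M g f)"
  unfolding L2_inner_def by (subst Bochner_Integration.integral_cnj[symmetric]) (simp add: mult.commute)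

lemma L2_inner_self: "L2_inner M f f = complex_of_real ((L2_norm M f)\<^sup>2)"
  unfolding L2_inner_def L2_norm_sq
  by (simp add: complex_norm_square[symmetric] del: of_real_power)

lemma L2_inner_norm_zero:
  assumes f: "f \<in> L2_space M" and g: "g \<in> L2_space M" and "L2_norm M g = 0"
  shows "L2_inner M f g = 0"
proof -
  have "(LINT x|M. (cmod (g x))\<^sup>2) = 0" using assms(3) by (simp add: L2_norm_sq[symmetric])
  then have "AE x in M. (cmod (g x))\<^sup>2 = 0"
    using integral_nonneg_eq_0_iff_AE[OF L2_space_integrable[OF g]] by simp
  then have "AE x in M. f x * cnj (g x) = 0" by eventually_elim simp
  then show ?thesis unfolding L2_inner_def by (rule integral_eq_zero_AE)
qed

text \<open>Normalization divides by the norm of the residual, and \<open>1 / 0 = 0\<close>: a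
  vector that depends on its predecessors up to a null function yields the zero function. The index
  set stays the natural numbers and no vector has to be discarded.\<close>

function gram_schmidt :: "'a measure \<Rightarrow> (nat \<Rightarrow> 'a \<Rightarrow> complex) \<Rightarrow> nat \<Rightarrow> 'a \<Rightarrow> complex" where
  "gram_schmidt M v n =
    (let w = (\<lambda>x. v n x - (\<Sum>i<n. L2_inner M (v n) (gram_schmidt M v i) * gram_schmidt M v i x))
     in (\<lambda>x. complex_of_real (1 / L2_norm M w) * w x))"
  by pat_completeness auto
termination by (relation "Wellfounded.measure (\<lambda>(M, v, n). n)") auto

declare gram_schmidt.simps [simp del]

definition L2_residual ::
  "'a measure \<Rightarrow> (nat \<Rightarrow> 'a \<Rightarrow> complex) \<Rightarrow> nat \<Rightarrow> ('a \<Rightarrow> complex) \<Rightarrow> 'a \<Rightarrow> complex" where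
  "L2_residual M e n f = (\<lambda>x. f x - (\<Sum>i<n. L2_inner M f (e i) * e i x))"

lemma gram_schmidt_residual:
  "gram_schmidt M v n = (\<lambda>x. complex_of_real (1 / L2_norm M (L2_residual M (gram_schmidt M v) n (v n)))
      * L2_residual M (gram_schmidt M v) n (v n) x)"
  by (subst gram_schmidt.simps) (simp add: Let_def L2_residual_def)

lemma L2_residual_L2:
  assumes "\<And>i. i < n \<Longrightarrow> e i \<in> L2_space M" "f \<in> L2_space M"
  shows "L2_residual M e n f \<in> L2_space M"
  unfolding L2_residual_def using assms by (intro L2_space_diff L2_space_sum L2_space_cmult) auto

lemma L2_residual_inner:
  assumes e: "\<And>i. i < n \<Longrightarrow> e i \<in> L2_space M" and f: "f \<in> L2_space M" and g: "g \<in> L2_space M"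
  shows "L2_inner M (L2_residual M e n f) g = L2_inner M f g - (\<Sum>i<n. L2_inner M f (e i) * L2_inner M (e i) g)"
proof -
  have "L2_inner M (L2_residual M e n f) g
      = L2_inner M f g - L2_inner M (\<lambda>x. \<Sum>i<n. L2_inner M f (e i) * e i x) g"
    unfolding L2_residual_def using e f g by (intro L2_inner_diff_left L2_space_sum L2_space_cmult) auto
  also have "L2_inner M (\<lambda>x. \<Sum>i<n. L2_inner M f (e i) * e i x) g = (\<Sum>i<n. L2_inner M f (e i) * L2_inner M (e i) g)"
    using e g by (subst L2_inner_sum_left) (auto intro: L2_space_cmult simp: L2_inner_cmult_left)
  finally show ?thesis .
qed

context
  fixes M :: "'a measure" and v :: "nat \<Rightarrow> 'a \<Rightarrow> complex"
  assumes v: "\<And>n. v n \<in> L2_space M"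
begin

private abbreviation "e \<equiv> gram_schmidt M v"

lemma gram_schmidt_L2: "e n \<in> L2_space M"
proof (induction n rule: less_induct)
  case (less n)
  show ?case by (subst gram_schmidt_residual) (intro L2_space_cmult L2_residual_L2 less v)
qed

lemma gram_schmidt_norm: "L2_norm M (e n) = 0 \<or> L2_norm M (e n) = 1"
  by (subst (1 2) gram_schmidt_residual) (simp only: L2_norm_cmult, simp add: norm_divide)

text \<open>Norm one makes the second factor 1, norm zero makes the first factor 0; in this form the
  degenerate vectors need no separate treatment.\<close>

lemma gram_schmidt_inner_self: "f \<in> L2_space M \<Longrightarrow> L2_inner M f (e i) * L2_inner M (e i) (e i) = L2_inner M f (e i)"
  using gram_schmidt_norm[of i] L2_inner_norm_zero[OF _ gram_schmidt_L2[of i]] by (auto simp: L2_inner_self)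

lemma L2_residual_orthogonal:
  assumes orth: "\<And>i j. i < n \<Longrightarrow> j < n \<Longrightarrow> i \<noteq> j \<Longrightarrow> L2_inner M (e i) (e j) = 0"
    and f: "f \<in> L2_space M" and i: "i < n"
  shows "L2_inner M (L2_residual M e n f) (e i) = 0"
proof -
  have "(\<Sum>j<n. L2_inner M f (e j) * L2_inner M (e j) (e i)) = (\<Sum>j\<in>{i}. L2_inner M f (e j) * L2_inner M (e j) (e i))"
    using i by (intro sum.mono_neutral_right) (auto simp: orth)
  then show ?thesis using i f by (simp add: L2_residual_inner gram_schmidt_L2 gram_schmidt_inner_self)
qed

lemma gram_schmidt_orthogonal_less: "i < n \<Longrightarrow> L2_inner M (e n) (e i) = 0"
proof (induction n arbitrary: i rule: less_induct)
  case (less n)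
  have "L2_inner M (e k) (e l) = 0" if "k < n" "l < n" "k \<noteq> l" for k l
    using that less.IH[of k l] less.IH[of l k] L2_inner_cnj[of M "e k" "e l"]
    by (metis complex_cnj_zero linorder_neqE_nat)
  then have "L2_inner M (L2_residual M e n (v n)) (e i) = 0"
    using less.prems v by (intro L2_residual_orthogonal)
  then show ?case by (subst gram_schmidt_residual) (simp only: L2_inner_cmult_left, simp)
qed

lemma gram_schmidt_orthogonal: "i \<noteq> j \<Longrightarrow> L2_inner M (e i) (e j) = 0"
  using gram_schmidt_orthogonal_less[of i j] gram_schmidt_orthogonal_less[of j i] L2_inner_cnj[of M "e i" "e j"]
  by (metis complex_cnj_zero linorder_neqE_nat)

text \<open>Parseval with remainder: a residual is orthogonal to all \<open>e i\<close> with
  \<open>i < n\<close>, so the mixed terms vanish.\<close>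

lemma L2_residual_inner_residual:
  assumes f: "f \<in> L2_space M" and g: "g \<in> L2_space M"
  shows "L2_inner M (L2_residual M e n f) (L2_residual M e n g)
    = L2_inner M f g - (\<Sum>i<n. L2_inner M f (e i) * cnj (L2_inner M g (e i)))"
proof -
  have "L2_inner M (L2_residual M e n g) (L2_residual M e n f)
      = L2_inner M g (L2_residual M e n f) - (\<Sum>i<n. L2_inner M g (e i) * L2_inner M (e i) (L2_residual M e n f))"
    by (intro L2_residual_inner gram_schmidt_L2 g L2_residual_L2 f)
  also have "(\<Sum>i<n. L2_inner M g (e i) * L2_inner M (e i) (L2_residual M e n f)) = 0"
    using f by (intro sum.neutral ballI)
      (subst L2_inner_cnj[of M "e _"], simp add: L2_residual_orthogonal gram_schmidt_orthogonal)
  finally have "L2_inner M (L2_residual M e n g) (L2_residual M e n f) = L2_inner M g (L2_residual M e n f)" by simp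
  then have "L2_inner M (L2_residual M e n f) (L2_residual M e n g) = L2_inner M (L2_residual M e n f) g"
    by (metis L2_inner_cnj)
  also have "\<dots> = L2_inner M f g - (\<Sum>i<n. L2_inner M f (e i) * L2_inner M (e i) g)"
    by (intro L2_residual_inner gram_schmidt_L2 f g)
  also have "(\<lambda>i. L2_inner M (e i) g) = (\<lambda>i. cnj (L2_inner M g (e i)))"
    using L2_inner_cnj by blast
  finally show ?thesis by simp
qed

lemma L2_residual_norm:
  assumes f: "f \<in> L2_space M"
  shows "(L2_norm M (L2_residual M e n f))\<^sup>2 = (L2_norm M f)\<^sup>2 - (\<Sum>i<n. (cmod (L2_inner M f (e i)))\<^sup>2)"
proof -
  have "complex_of_real ((L2_norm M (L2_residual M e n f))\<^sup>2)
      = complex_of_real ((L2_norm M f)\<^sup>2 - (\<Sum>i<n. (cmod (L2_inner M f (e i)))\<^sup>2))"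
    using L2_residual_inner_residual[OF f f, of n]
    by (simp add: L2_inner_self complex_norm_square[symmetric] del: of_real_power)
  then show ?thesis by (simp only: of_real_eq_iff)
qed

text \<open>The coefficient of \<open>v k\<close> along \<open>e k\<close> is the norm of its
  residual at stage \<open>k\<close>. Stage \<open>k\<close> therefore removes all that was left of
  \<open>v k\<close>, and later stages cannot add to it.\<close>

lemma L2_residual_generator:
  assumes "k < n"
  shows "L2_norm M (L2_residual M e n (v k)) = 0"
proof -
  define w where "w = L2_residual M e k (v k)"
  have w: "w \<in> L2_space M" unfolding w_def by (intro L2_residual_L2 gram_schmidt_L2 v)
  have e: "e k = (\<lambda>x. complex_of_real (1 / L2_norm M w) * w x)"
    unfolding w_def by (rule gram_schmidt_residual)
  have "L2_inner M (v k) (e k) = L2_inner M w (e k)"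
    unfolding w_def using v by (simp add: L2_residual_inner gram_schmidt_L2 gram_schmidt_orthogonal)
  also have "\<dots> = cnj (complex_of_real (1 / L2_norm M w) * L2_inner M w w)"
    unfolding e by (subst L2_inner_cnj) (simp only: L2_inner_cmult_left)
  also have "\<dots> = complex_of_real (L2_norm M w)"
    by (simp add: L2_inner_self power2_eq_square)
  finally have "(cmod (L2_inner M (v k) (e k)))\<^sup>2 = (L2_norm M w)\<^sup>2" by simp
  also have "\<dots> = (L2_norm M (v k))\<^sup>2 - (\<Sum>i<k. (cmod (L2_inner M (v k) (e i)))\<^sup>2)"
    unfolding w_def by (rule L2_residual_norm[OF v])
  finally have "(L2_norm M (v k))\<^sup>2 = (\<Sum>i<Suc k. (cmod (L2_inner M (v k) (e i)))\<^sup>2)" by simp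
  also have "\<dots> \<le> (\<Sum>i<n. (cmod (L2_inner M (v k) (e i)))\<^sup>2)"
    using assms by (intro sum_mono2) auto
  finally have "(L2_norm M (L2_residual M e n (v k)))\<^sup>2 \<le> 0" by (simp add: L2_residual_norm v)
  then show ?thesis by simp
qed

text \<open>Taking residuals is contractive and annihilates \<open>v k\<close> from stage
  \<open>k + 1\<close> on, so the residual of \<open>f\<close> is controlled by the distance from
  \<open>f\<close> to a suitable \<open>v k\<close>.\<close>

lemma L2_residual_tendsto_0:
  assumes f: "f \<in> L2_space M"
    and dense: "\<And>\<epsilon>. 0 < \<epsilon> \<Longrightarrow> \<exists>k. (L2_norm M (\<lambda>x. f x - v k x))\<^sup>2 < \<epsilon>"
  shows "(\<lambda>n. (L2_norm M (L2_residual M e n f))\<^sup>2) \<longlonglongrightarrow> 0"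
proof (rule LIMSEQ_I)
  fix r :: real assume "0 < r"
  then obtain k where k: "(L2_norm M (\<lambda>x. f x - v k x))\<^sup>2 < r / 2" using dense[of "r / 2"] by auto
  have "(L2_norm M (L2_residual M e n f))\<^sup>2 < r" if n: "n \<ge> Suc k" for n
  proof -
    let ?d = "\<lambda>x. f x - v k x"
    have d: "?d \<in> L2_space M" by (intro L2_space_diff f v)
    have "L2_residual M e n f = (\<lambda>x. L2_residual M e n ?d x + L2_residual M e n (v k) x)"
      unfolding L2_residual_def
      by (simp add: L2_inner_diff_left f v gram_schmidt_L2 fun_eq_iff sum_subtractf left_diff_distrib)
    moreover have "(L2_norm M (\<lambda>x. \<Sum>j<(2::nat). (if j = 0 then L2_residual M e n ?d else L2_residual M e n (v k)) x))\<^sup>2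
       \<le> real 2 * (\<Sum>j<(2::nat). (L2_norm M (if j = 0 then L2_residual M e n ?d else L2_residual M e n (v k)))\<^sup>2)"
      by (rule L2_norm_sum_sq_le) (auto intro: L2_residual_L2 gram_schmidt_L2 v d)
    ultimately have "(L2_norm M (L2_residual M e n f))\<^sup>2 \<le> 2 * (L2_norm M (L2_residual M e n ?d))\<^sup>2"
      using L2_residual_generator[of k n] n by (simp add: numeral_2_eq_2)
    also have "\<dots> \<le> 2 * (L2_norm M ?d)\<^sup>2"
      by (simp add: L2_residual_norm[OF d] sum_nonneg)
    finally show ?thesis using k by simp
  qed
  then show "\<exists>no. \<forall>n\<ge>no. norm ((L2_norm M (L2_residual M e n f))\<^sup>2 - 0) < r"
    by (intro exI[of _ "Suc k"]) auto
qed

text \<open>Parseval for two functions in the closure of the family \<open>v\<close>: the finite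
  identity has the inner product of two residuals as its error term, and both residuals tend to
  zero.\<close>

lemma gram_schmidt_sums:
  assumes f: "f \<in> L2_space M" and g: "g \<in> L2_space M"
    and df: "\<And>\<epsilon>. 0 < \<epsilon> \<Longrightarrow> \<exists>k. (L2_norm M (\<lambda>x. f x - v k x))\<^sup>2 < \<epsilon>"
    and dg: "\<And>\<epsilon>. 0 < \<epsilon> \<Longrightarrow> \<exists>k. (L2_norm M (\<lambda>x. g x - v k x))\<^sup>2 < \<epsilon>"
  shows "(\<lambda>i. L2_inner M f (e i) * cnj (L2_inner M g (e i))) sums L2_inner M f g"
proof -
  have "(\<lambda>n. L2_inner M (L2_residual M e n f) (L2_residual M e n g)) \<longlonglongrightarrow> 0"
  proof (rule Lim_null_comparison)
    show "eventually (\<lambda>n. norm (L2_inner M (L2_residual M e n f) (L2_residual M e n g))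
        \<le> ((L2_norm M (L2_residual M e n f))\<^sup>2 + (L2_norm M (L2_residual M e n g))\<^sup>2) / 2) sequentially"
      by (intro always_eventually allI L2_inner_AMGM L2_residual_L2 gram_schmidt_L2 f g)
    show "(\<lambda>n. ((L2_norm M (L2_residual M e n f))\<^sup>2 + (L2_norm M (L2_residual M e n g))\<^sup>2) / 2) \<longlonglongrightarrow> 0"
      using tendsto_divide[OF tendsto_add[OF L2_residual_tendsto_0[OF f df] L2_residual_tendsto_0[OF g dg]] tendsto_const[of 2]]
      by simp
  qed
  from tendsto_diff[OF tendsto_const[of "L2_inner M f g"] this] show ?thesis
    by (simp add: sums_def L2_residual_inner_residual[OF f g])
qed

end

section \<open>Lorentz geometry\<close>

lemma sum_UNIV_option:
  "(\<Sum>i\<in>(UNIV :: 'a::finite option set). f i) = f None + (\<Sum>j\<in>UNIV. f (Some j))"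
  by (simp add: UNIV_option_conv sum.reindex)

lemma prod_UNIV_option:
  "(\<Prod>i\<in>(UNIV :: 'a::finite option set). f i) = f None * (\<Prod>j\<in>UNIV. f (Some j))"
  by (simp add: UNIV_option_conv prod.reindex)

lemma vec_option_eq_iff:
  "(A :: 'b ^ 'a::finite option) = B \<longleftrightarrow> A $ None = B $ None \<and> (\<forall>j. A $ Some j = B $ Some j)"
  by (auto simp: vec_eq_iff split_option_all)

lemma minkowski_mult_left: "(minkowski_form ** g) $ i $ j = (if i = None then - g $ i $ j else g $ i $ j)"
  by (simp add: matrix_matrix_mult_def minkowski_form_def if_distrib[where f = "\<lambda>x. x * _"] cong: if_cong)

lemma minkowski_mult_right: "(g ** minkowski_form) $ i $ j = (if j = None then - g $ i $ j else g $ i $ j)"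
  by (simp add: matrix_matrix_mult_def minkowski_form_def if_distrib[where f = "\<lambda>x. _ * x"] cong: if_cong)

lemma minkowski_form_square: "minkowski_form ** minkowski_form = mat 1"
  by (simp add: vec_eq_iff minkowski_mult_left) (simp add: minkowski_form_def mat_def)

lemma transpose_minkowski_form: "transpose minkowski_form = minkowski_form"
  by (simp add: transpose_def minkowski_form_def vec_eq_iff)

lemma minkowski_entry:
  "(transpose x ** minkowski_form ** y) $ i $ j
    = - x $ None $ i * y $ None $ j + (\<Sum>k\<in>UNIV. x $ Some k $ i * y $ Some k $ j)"
proof -
  have "(transpose x ** (minkowski_form ** y)) $ i $ j = - x $ None $ i * y $ None $ j + (\<Sum>k\<in>UNIV. x $ Some k $ i * y $ Some k $ j)"
    by (subst matrix_matrix_mult_def) (simp add: sum_UNIV_option minkowski_mult_left transpose_def)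
  then show ?thesis by (simp add: matrix_mul_assoc)
qed

text \<open>The inverse, read off from the relation
  \<open>transpose g ** minkowski_form ** g = minkowski_form\<close>. Its entries are those of
  \<open>g\<close> up to position and sign, so inversion is visibly continuous.\<close>

definition minkowski_inv :: "'m::finite lorentz_matrix \<Rightarrow> 'm lorentz_matrix" where
  "minkowski_inv g = minkowski_form ** transpose g ** minkowski_form"

lemma minkowski_inv_entry: "minkowski_inv g $ i $ j = (if (i = None) = (j = None) then g $ j $ i else - g $ j $ i)"
  by (auto simp: minkowski_inv_def minkowski_mult_left minkowski_mult_right transpose_def)

lemma SO0_simps [simp]:
  "mult SO0 = (**)" "one SO0 = mat 1"
  by (simp_all add: SO0_def)

lemma carrier_SO0: "g \<in> carrier SO0 \<longleftrightarrow>
    transpose g ** minkowski_form ** g = minkowski_form \<and> det g = 1 \<and> 1 \<le> g $ None $ None"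
  by (simp add: SO0_def)

lemma det_minkowski_form_sq: "det (minkowski_form :: 'm::finite lorentz_matrix) * det (minkowski_form :: 'm lorentz_matrix) = 1"
  by (metis det_I det_mul minkowski_form_square)

lemma det_minkowski_orthogonal:
  fixes g :: "'m::finite lorentz_matrix"
  assumes "transpose g ** minkowski_form ** g = minkowski_form"
  shows "det g * det g = 1"
proof -
  have "det g * det (minkowski_form :: 'm lorentz_matrix) * det g = det (minkowski_form :: 'm lorentz_matrix)"
    using assms by (metis det_mul det_transpose)
  then show ?thesis
    by (metis det_minkowski_form_sq mult.assoc mult.commute mult.left_neutral)
qed

lemma minkowski_inv_left:
  fixes g :: "'m::finite lorentz_matrix"
  assumes "transpose g ** minkowski_form ** g = minkowski_form"
  shows "minkowski_inv g ** g = mat 1"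
  using assms minkowski_form_square by (metis matrix_mul_assoc minkowski_inv_def)

lemma minkowski_inv_right:
  fixes g :: "'m::finite lorentz_matrix"
  assumes "transpose g ** minkowski_form ** g = minkowski_form"
  shows "g ** minkowski_inv g = mat 1"
  using minkowski_inv_left[OF assms] matrix_left_right_inverse by blast

text \<open>A left inverse of a square matrix is a right inverse, so the rows satisfy the same
  relations as the columns.\<close>

lemma minkowski_rows:
  fixes g :: "'m::finite lorentz_matrix"
  assumes "transpose g ** minkowski_form ** g = minkowski_form"
  shows "g ** minkowski_form ** transpose g = minkowski_form"
proof -
  have "g ** minkowski_form ** transpose g ** minkowski_form = mat 1"
    using minkowski_inv_right[OF assms] by (simp add: minkowski_inv_def matrix_mul_assoc)
  then show ?thesis by (metis matrix_mul_assoc matrix_mul_lid matrix_mul_rid minkowski_form_square)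
qed

lemma minkowski_column0:
  fixes g :: "'m::finite lorentz_matrix"
  assumes "transpose g ** minkowski_form ** g = minkowski_form"
  shows "(g $ None $ None)\<^sup>2 = 1 + (\<Sum>k\<in>UNIV. (g $ Some k $ None)\<^sup>2)"
  using minkowski_entry[of g g None None] assms by (simp add: minkowski_form_def power2_eq_square)

lemma minkowski_row0:
  fixes g :: "'m::finite lorentz_matrix"
  assumes "transpose g ** minkowski_form ** g = minkowski_form"
  shows "(g $ None $ None)\<^sup>2 = 1 + (\<Sum>k\<in>UNIV. (g $ None $ Some k)\<^sup>2)"
  using minkowski_entry[of "transpose g" "transpose g" None None] minkowski_rows[OF assms]
  by (simp add: minkowski_form_def power2_eq_square transpose_def)

text \<open>Reversed Cauchy-Schwarz for timelike vectors: \<open>(a * b - 1)\<^sup>2\<close> exceeds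
  \<open>(a\<^sup>2 - 1) * (b\<^sup>2 - 1)\<close> by the square \<open>(a - b)\<^sup>2\<close>. It
  keeps the condition \<open>1 \<le> g $ None $ None\<close> under products.\<close>

lemma one_le_lorentz_product:
  fixes a b S :: real
  assumes "1 \<le> a" "1 \<le> b" "S\<^sup>2 \<le> (a\<^sup>2 - 1) * (b\<^sup>2 - 1)"
  shows "1 \<le> a * b + S"
proof -
  have "(a * b - 1)\<^sup>2 - (a\<^sup>2 - 1) * (b\<^sup>2 - 1) = (a - b)\<^sup>2" by (simp add: power2_eq_square algebra_simps)
  then have "S\<^sup>2 \<le> (a * b - 1)\<^sup>2" using assms(3) zero_le_power2[of "a - b"] by linarith
  moreover have "1 \<le> a * b" using mult_mono[OF assms(1,2)] assms by simp
  ultimately have "\<bar>S\<bar> \<le> a * b - 1" by (simp add: abs_le_square_iff[symmetric])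
  then show ?thesis by linarith
qed

lemma mult_SO0_closed:
  fixes g h :: "'m::finite lorentz_matrix"
  assumes g: "g \<in> carrier SO0" and h: "h \<in> carrier SO0"
  shows "g ** h \<in> carrier SO0"
proof -
  have "transpose (g ** h) ** minkowski_form ** (g ** h) = transpose h ** (transpose g ** minkowski_form ** g) ** h"
    by (simp add: matrix_transpose_mul matrix_mul_assoc)
  also have "\<dots> = minkowski_form" using g h by (simp add: carrier_SO0)
  finally have 1: "transpose (g ** h) ** minkowski_form ** (g ** h) = minkowski_form" .
  let ?S = "\<Sum>k\<in>UNIV. g $ None $ Some k * h $ Some k $ None"
  have "?S\<^sup>2 \<le> (\<Sum>k\<in>UNIV. (g $ None $ Some k)\<^sup>2) * (\<Sum>k\<in>UNIV. (h $ Some k $ None)\<^sup>2)"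
    by (rule Cauchy_Schwarz_ineq_sum)
  also have "\<dots> = ((g $ None $ None)\<^sup>2 - 1) * ((h $ None $ None)\<^sup>2 - 1)"
    using minkowski_row0[of g] minkowski_column0[of h] g h by (simp add: carrier_SO0)
  finally have "1 \<le> g $ None $ None * h $ None $ None + ?S"
    using g h by (intro one_le_lorentz_product) (auto simp: carrier_SO0)
  also have "\<dots> = (g ** h) $ None $ None" by (simp add: matrix_matrix_mult_def sum_UNIV_option)
  finally show ?thesis using g h 1 by (simp add: carrier_SO0 det_mul)
qed

lemma minkowski_inv_SO0:
  fixes g :: "'m::finite lorentz_matrix"
  assumes g: "g \<in> carrier SO0"
  shows "minkowski_inv g \<in> carrier SO0"
proof -
  have "transpose (minkowski_inv g) ** minkowski_form ** minkowski_inv g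
      = minkowski_form ** (g ** (minkowski_form ** minkowski_form) ** minkowski_form ** transpose g) ** minkowski_form"
    by (simp add: minkowski_inv_def matrix_transpose_mul transpose_minkowski_form matrix_mul_assoc)
  also have "\<dots> = minkowski_form"
    using minkowski_rows[of g] g by (simp add: carrier_SO0 minkowski_form_square)
  finally have 1: "transpose (minkowski_inv g) ** minkowski_form ** minkowski_inv g = minkowski_form" .
  have "det (minkowski_inv g) = 1"
    using g det_minkowski_form_sq[where 'm = 'm] by (simp add: minkowski_inv_def det_mul carrier_SO0)
  then show ?thesis using g 1 by (simp add: carrier_SO0 minkowski_inv_entry)
qed

lemma group_SO0: "group (SO0 :: 'm::finite lorentz_matrix monoid)"
proof (rule groupI)
  show "\<one>\<^bsub>SO0\<^esub> \<in> carrier (SO0 :: 'm lorentz_matrix monoid)"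
    by (simp add: carrier_SO0) (simp add: mat_def)
  show "\<exists>y\<in>carrier SO0. y \<otimes>\<^bsub>SO0\<^esub> x = \<one>\<^bsub>SO0\<^esub>" if "x \<in> carrier SO0" for x :: "'m lorentz_matrix"
    using that minkowski_inv_SO0[OF that] minkowski_inv_left[of x]
    by (intro bexI[of _ "minkowski_inv x"]) (auto simp: carrier_SO0)
qed (auto simp: mult_SO0_closed matrix_mul_assoc)

lemma inv_SO0:
  fixes g :: "'m::finite lorentz_matrix"
  assumes g: "g \<in> carrier SO0"
  shows "inv\<^bsub>SO0\<^esub> g = minkowski_inv g"
  using group.inv_equality[OF group_SO0, of "minkowski_inv g" g] g minkowski_inv_SO0[OF g] minkowski_inv_left[of g]
  by (simp add: carrier_SO0)

lemma closed_SO0: "closed (carrier (SO0 :: 'm::finite lorentz_matrix monoid))"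
proof -
  have 1: "closed {g :: 'm lorentz_matrix. transpose g ** minkowski_form ** g = minkowski_form}"
    unfolding vec_eq_iff[where 'b = "'m option option"] minkowski_entry
    by (intro closed_Collect_all closed_Collect_eq continuous_intros)
  have 2: "closed {g :: 'm lorentz_matrix. det g = 1}"
    unfolding det_def by (intro closed_Collect_eq continuous_intros)
  have 3: "closed {g :: 'm lorentz_matrix. 1 \<le> g $ None $ None}"
    by (intro closed_Collect_le continuous_intros)
  have "carrier (SO0 :: 'm lorentz_matrix monoid) =
      {g. transpose g ** minkowski_form ** g = minkowski_form} \<inter> {g. det g = 1} \<inter> {g. 1 \<le> g $ None $ None}"
    by (auto simp: carrier_SO0)
  then show ?thesis using 1 2 3 by (simp add: closed_Int)
qed

text \<open>As a closed subset of a Euclidean space the group is the union of its compact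
  intersections with balls.\<close>

lemma haar_group_SO0:
  fixes \<mu> :: "'m::finite lorentz_matrix measure"
  assumes "left_haar_measure SO0 \<mu>"
  shows "haar_group SO0 \<mu>"
proof -
  interpret group "SO0 :: 'm lorentz_matrix monoid" by (rule group_SO0)
  show ?thesis
  proof
    show "left_haar_measure SO0 \<mu>" by fact
    show "continuous_on (carrier SO0) (\<lambda>x. g \<otimes>\<^bsub>SO0\<^esub> x)" for g :: "'m lorentz_matrix"
      unfolding SO0_simps matrix_matrix_mult_def by (intro continuous_intros)
    have "continuous_on (carrier SO0) (\<lambda>x :: 'm lorentz_matrix. \<chi> i j. if (i = None) = (j = None) then x $ j $ i else - x $ j $ i)"
    proof (intro continuous_on_vec_lambda)
      show "continuous_on (carrier SO0) (\<lambda>x :: 'm lorentz_matrix. if (i = None) = (j = None) then x $ j $ i else - x $ j $ i)" for i j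
        by (cases "(i = None) = (j = None)") (auto intro!: continuous_intros)
    qed
    then show "continuous_on (carrier SO0) (\<lambda>x :: 'm lorentz_matrix. inv\<^bsub>SO0\<^esub> x)"
      by (rule continuous_on_eq) (simp add: inv_SO0 minkowski_inv_entry vec_eq_iff)
    show "\<exists>C::nat \<Rightarrow> 'm lorentz_matrix set. (\<forall>n. compact (C n)) \<and> (\<Union>n. C n) = carrier SO0"
    proof (intro exI conjI allI)
      show "compact (carrier (SO0 :: 'm lorentz_matrix monoid) \<inter> cball 0 (real n))" for n
        by (intro closed_Int_compact closed_SO0 compact_cball)
      show "(\<Union>n. carrier (SO0 :: 'm lorentz_matrix monoid) \<inter> cball 0 (real n)) = carrier SO0"
        using real_arch_simple by (auto simp: mem_cball)
    qed
  qed
qed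

text \<open>\<open>horo_height g\<close> and \<open>horo_point g\<close> are the coordinates of \<open>g K\<close> in the upper half space model of
  hyperbolic space; \<open>unip\<close> below parametrizes the horospherical group of the point at infinity.\<close>

definition horo_height :: "'m::finite lorentz_matrix \<Rightarrow> real" where
  "horo_height g = 1 / (g $ None $ None - g $ Some None $ None)"

definition horo_point :: "'m::finite lorentz_matrix \<Rightarrow> real ^ 'm" where
  "horo_point g = (\<chi> i. horo_height g * g $ Some (Some i) $ None)"

lemma norm_vec_sq: "(norm (v :: real ^ 'm))\<^sup>2 = (\<Sum>i\<in>UNIV. (v $ i)\<^sup>2)"
  unfolding power2_norm_eq_inner inner_vec_def by (simp add: power2_eq_square)

lemma horo_denominator_pos:
  fixes g :: "'m::finite lorentz_matrix"
  assumes "g \<in> carrier SO0"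
  shows "0 < g $ None $ None - g $ Some None $ None"
proof -
  have "(g $ None $ None)\<^sup>2 = 1 + ((g $ Some None $ None)\<^sup>2 + (\<Sum>k\<in>UNIV. (g $ Some (Some k) $ None)\<^sup>2))"
    using minkowski_column0[of g] assms by (simp add: carrier_SO0 sum_UNIV_option)
  moreover have "0 \<le> (\<Sum>k\<in>UNIV. (g $ Some (Some k) $ None)\<^sup>2)" by (intro sum_nonneg) simp
  ultimately have "(g $ Some None $ None)\<^sup>2 < (g $ None $ None)\<^sup>2" by linarith
  then have "\<bar>g $ Some None $ None\<bar> < \<bar>g $ None $ None\<bar>" by (metis abs_le_square_iff not_le)
  then show ?thesis using assms by (auto simp: carrier_SO0)
qed

lemma horo_height_pos: "g \<in> carrier SO0 \<Longrightarrow> 0 < horo_height g"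
  using horo_denominator_pos by (simp add: horo_height_def)

text \<open>The left side is the hyperbolic cosine of the distance between the cosets of
  \<open>x\<close> and \<open>y\<close>, the right side its formula in the upper half space model.
  In light cone coordinates \<open>p - q = 1 / a\<close> and
  \<open>p + q = a * (1 + (norm X)\<^sup>2)\<close>, so everything is expressed by height and
  point.\<close>

lemma minkowski_distance:
  fixes x y :: "'m::finite lorentz_matrix"
  assumes x: "x \<in> carrier SO0" and y: "y \<in> carrier SO0"
  shows "(inv\<^bsub>SO0\<^esub> y ** x) $ None $ None =
    ((horo_height x)\<^sup>2 + (horo_height y)\<^sup>2 + (norm (horo_point x - horo_point y))\<^sup>2)
      / (2 * horo_height x * horo_height y)"
proof -
  define p q where "p = x $ None $ None" and "q = x $ Some None $ None"
  define p' q' where "p' = y $ None $ None" and "q' = y $ Some None $ None"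
  define X Y where "X = (\<chi> i. x $ Some (Some i) $ None)" and "Y = (\<chi> i. y $ Some (Some i) $ None)"
  define a b where "a = horo_height x" and "b = horo_height y"
  have pos: "0 < a" "0 < b" unfolding a_def b_def by (intro horo_height_pos x y)+
  have a: "p - q = 1 / a" and b: "p' - q' = 1 / b"
    by (simp_all add: a_def b_def horo_height_def p_def q_def p'_def q'_def)
  have "p\<^sup>2 = 1 + (q\<^sup>2 + (norm X)\<^sup>2)" "p'\<^sup>2 = 1 + (q'\<^sup>2 + (norm Y)\<^sup>2)"
    using minkowski_column0[of x] minkowski_column0[of y] x y
    by (simp_all add: carrier_SO0 sum_UNIV_option p_def q_def p'_def q'_def X_def Y_def norm_vec_sq)
  then have "(p - q) * (p + q) = 1 + (norm X)\<^sup>2" "(p' - q') * (p' + q') = 1 + (norm Y)\<^sup>2"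
    by (simp_all add: power2_eq_square algebra_simps)
  then have pq: "p + q = a * (1 + (norm X)\<^sup>2)" "p' + q' = b * (1 + (norm Y)\<^sup>2)"
    using pos by (simp_all add: a b field_simps)
  have half: "u = ((u - w) + (u + w)) / 2" "w = ((u + w) - (u - w)) / 2" for u w :: real by simp_all
  have "p = (1 / a + a * (1 + (norm X)\<^sup>2)) / 2" using half(1)[of p q] by (simp only: a pq)
  moreover have "q = (a * (1 + (norm X)\<^sup>2) - 1 / a) / 2" using half(2)[of q p] by (simp only: a pq)
  moreover have "p' = (1 / b + b * (1 + (norm Y)\<^sup>2)) / 2" using half(1)[of p' q'] by (simp only: b pq)
  moreover have "q' = (b * (1 + (norm Y)\<^sup>2) - 1 / b) / 2" using half(2)[of q' p'] by (simp only: b pq)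
  moreover have "(inv\<^bsub>SO0\<^esub> y ** x) $ None $ None = p' * p - q' * q - X \<bullet> Y"
    by (simp add: inv_SO0[OF y] matrix_matrix_mult_def sum_UNIV_option minkowski_inv_entry
        p_def q_def p'_def q'_def X_def Y_def inner_vec_def sum_negf mult.commute)
  ultimately have "(inv\<^bsub>SO0\<^esub> y ** x) $ None $ None
      = (1 / a + a * (1 + (norm X)\<^sup>2)) / 2 * ((1 / b + b * (1 + (norm Y)\<^sup>2)) / 2)
        - (a * (1 + (norm X)\<^sup>2) - 1 / a) / 2 * ((b * (1 + (norm Y)\<^sup>2) - 1 / b) / 2) - X \<bullet> Y"
    by (simp only: mult.commute)
  also have "\<dots> = (a\<^sup>2 + b\<^sup>2 + (a\<^sup>2 * (norm X)\<^sup>2 + b\<^sup>2 * (norm Y)\<^sup>2 - 2 * a * b * (X \<bullet> Y))) / (2 * a * b)"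
    using pos by (simp add: field_simps power2_eq_square)
  also have "a\<^sup>2 * (norm X)\<^sup>2 + b\<^sup>2 * (norm Y)\<^sup>2 - 2 * a * b * (X \<bullet> Y) = (norm (a *\<^sub>R X - b *\<^sub>R Y))\<^sup>2"
    unfolding power2_norm_eq_inner
    by (simp add: inner_diff_left inner_diff_right inner_commute power2_eq_square algebra_simps)
  also have "a *\<^sub>R X - b *\<^sub>R Y = horo_point x - horo_point y"
    by (simp add: horo_point_def X_def Y_def a_def b_def vec_eq_iff)
  finally show ?thesis by (simp add: a_def b_def)
qed

section \<open>Horospherical translations, boosts and rotations\<close>

definition unip :: "real ^ 'm \<Rightarrow> 'm::finite lorentz_matrix" where
  "unip b = (\<chi> i j. let h = (norm b)\<^sup>2 / 2 in
     case (i, j) of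
       (None, None) \<Rightarrow> 1 + h | (None, Some None) \<Rightarrow> - h | (None, Some (Some k)) \<Rightarrow> b $ k
     | (Some None, None) \<Rightarrow> h | (Some None, Some None) \<Rightarrow> 1 - h | (Some None, Some (Some k)) \<Rightarrow> b $ k
     | (Some (Some l), None) \<Rightarrow> b $ l | (Some (Some l), Some None) \<Rightarrow> - b $ l
     | (Some (Some l), Some (Some k)) \<Rightarrow> (if l = k then 1 else 0))"

lemma unip_entries [simp]:
  "unip b $ None $ None = 1 + (norm b)\<^sup>2 / 2" "unip b $ None $ Some None = - ((norm b)\<^sup>2 / 2)"
  "unip b $ None $ Some (Some k) = b $ k" "unip b $ Some None $ None = (norm b)\<^sup>2 / 2"
  "unip b $ Some None $ Some None = 1 - (norm b)\<^sup>2 / 2" "unip b $ Some None $ Some (Some k) = b $ k"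
  "unip b $ Some (Some l) $ None = b $ l" "unip b $ Some (Some l) $ Some None = - b $ l"
  "unip b $ Some (Some l) $ Some (Some k) = (if l = k then 1 else 0)"
  by (simp_all add: unip_def Let_def)

text \<open>Each matrix is the exponential of a nilpotent one that is linear in \<open>b\<close> and
  has vanishing third power; the entries with half the squared norm of \<open>b\<close> are the
  quadratic terms. The nilpotent matrices commute, so exponents add.\<close>

lemma unip_add: "unip b ** unip c = unip (b + c)"
proof -
  have n: "(norm (b + c))\<^sup>2 = (norm b)\<^sup>2 + (norm c)\<^sup>2 + 2 * (\<Sum>k\<in>UNIV. b $ k * c $ k)"
    by (simp add: power2_norm_eq_inner inner_add_left inner_add_right inner_commute)
       (simp add: inner_vec_def)
  show ?thesis
    unfolding vec_eq_iff
    by (simp add: split_option_all matrix_matrix_mult_def sum_UNIV_option n field_simps sum_negf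
        if_distrib[where f = "\<lambda>x. x * _"] if_distrib[where f = "\<lambda>x. _ * x"] cong: if_cong)
qed

lemma unip_minkowski: "transpose (unip b) ** minkowski_form ** unip b = minkowski_form"
proof -
  have n: "(\<Sum>k\<in>UNIV. b $ k * b $ k) = (norm b)\<^sup>2" by (simp add: norm_vec_sq flip: power2_eq_square)
  show ?thesis
    unfolding vec_eq_iff minkowski_entry
    by (simp add: split_option_all sum_UNIV_option n minkowski_form_def field_simps sum_negf
        if_distrib[where f = "\<lambda>x. x * _"] if_distrib[where f = "\<lambda>x. _ * x"] cong: if_cong)
qed

text \<open>The determinant is \<plusminus>1, and \<open>unip b\<close> is the square of the matrix
  for half of \<open>b\<close>, which fixes the sign.\<close>

lemma unip_SO0: "unip b \<in> carrier SO0"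
proof -
  have "unip b = unip ((1/2) *\<^sub>R b) ** unip ((1/2) *\<^sub>R b)"
    by (simp add: unip_add scaleR_add_left[symmetric])
  then have "det (unip b) = det (unip ((1/2) *\<^sub>R b)) * det (unip ((1/2) *\<^sub>R b))" by (metis det_mul)
  then have "det (unip b) = 1" using det_minkowski_orthogonal[OF unip_minkowski] by metis
  then show ?thesis by (simp add: carrier_SO0 unip_minkowski)
qed

lemma boost_add: "boost r ** boost s = boost (r + s)"
  unfolding vec_eq_iff
  by (simp add: split_option_all matrix_matrix_mult_def sum_UNIV_option boost_def cosh_add sinh_add
      if_distrib[where f = "\<lambda>x. x * _"] if_distrib[where f = "\<lambda>x. _ * x"] mult.commute add.commute cong: if_cong)

lemma boost_minkowski: "transpose (boost r) ** minkowski_form ** boost r = minkowski_form"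
proof -
  have "cosh r * cosh r = 1 + sinh r * sinh r"
    using cosh_square_eq[of r] by (simp add: power2_eq_square)
  then show ?thesis
    unfolding vec_eq_iff minkowski_entry
    by (simp add: split_option_all sum_UNIV_option boost_def minkowski_form_def
      if_distrib[where f = "\<lambda>x. x * _"] if_distrib[where f = "\<lambda>x. _ * x"] mult.commute cong: if_cong)
qed

lemma boost_SO0: "(boost r :: 'm::finite lorentz_matrix) \<in> carrier SO0"
proof -
  have "(boost r :: 'm lorentz_matrix) = boost (r / 2) ** boost (r / 2)" by (simp add: boost_add)
  then have "det (boost r :: 'm lorentz_matrix) = det (boost (r / 2) ** boost (r / 2) :: 'm lorentz_matrix)"
    by (rule arg_cong)
  also have "\<dots> = 1" using det_minkowski_orthogonal[OF boost_minkowski] by (simp only: det_mul)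
  finally show ?thesis by (simp add: carrier_SO0 boost_minkowski) (simp add: boost_def cosh_real_ge_1)
qed

lemma boost_00: "boost r $ None $ None = cosh r"
  by (simp add: boost_def)

lemma block_one_entries [simp]:
  "block_one k $ None $ None = 1" "block_one k $ None $ Some b = 0"
  "block_one k $ Some a $ None = 0" "block_one k $ Some a $ Some b = k $ a $ b"
  by (simp_all add: block_one_def)

text \<open>Bordering with a unit entry is compatible with the elementary operations that reduce a
  matrix to diagonal form, and it multiplies a diagonal determinant by 1.\<close>

lemma det_block_one: "det (block_one A) = det A"
proof (induction A rule: induct_matrix_row_operations)
  case (1 A i)
  then have "\<forall>j. A $ i $ j = 0" by (simp add: row_def vec_eq_iff)
  then have "row (Some i) (block_one A) = 0"
    by (simp add: row_def vec_option_eq_iff)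
  with 1 show ?case by (simp add: det_zero_row)
next
  case (2 A)
  have "block_one A $ i $ j = 0" if "i \<noteq> j" for i j
    using that 2 by (cases i; cases j) auto
  with 2 show ?case by (simp add: det_diagonal prod_UNIV_option)
next
  case (3 A m n)
  have "block_one (\<chi> i j. A $ i $ Transposition.transpose m n j)
      = (\<chi> i j. block_one A $ i $ Transposition.transpose (Some m) (Some n) j)"
    by (auto simp: vec_option_eq_iff Transposition.transpose_def)
  moreover have "det (\<chi> i j. block_one A $ i $ Transposition.transpose (Some m) (Some n) j) = - det (block_one A)"
    using 3 by (subst det_permute_columns) (auto simp: permutes_swap_id sign_swap_id)
  moreover have "det (\<chi> i j. A $ i $ Transposition.transpose m n j) = - det A"
    using 3 by (subst det_permute_columns) (auto simp: permutes_swap_id sign_swap_id)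
  ultimately show ?case using 3 by simp
next
  case (4 A m n c)
  have "block_one (\<chi> i. if i = m then row m A + c *\<^sub>R row n A else row i A)
      = (\<chi> i. if i = Some m then row (Some m) (block_one A) + c *s row (Some n) (block_one A) else row i (block_one A))"
    by (auto simp: vec_option_eq_iff row_def)
  moreover have "det (\<chi> i. if i = Some m then row (Some m) (block_one A) + c *s row (Some n) (block_one A) else row i (block_one A))
      = det (block_one A)"
    using 4 by (intro det_row_operation) auto
  moreover have "det (\<chi> i. if i = m then row m A + c *\<^sub>R row n A else row i A) = det A"
    using det_row_operation[OF 4(2), where c = c and A = A] by (simp only: scalar_mult_eq_scaleR)
  ultimately show ?case using 4 by simp
qed

lemma orthogonal_matrix_entries:
  "orthogonal_matrix (k :: real ^ 'n ^ 'n) \<longleftrightarrow> (\<forall>i j. (\<Sum>l\<in>UNIV. k $ l $ i * k $ l $ j) = (if i = j then 1 else 0))"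
  by (simp add: orthogonal_matrix vec_eq_iff matrix_matrix_mult_def transpose_def mat_def)

lemma block_one_minkowski:
  "transpose (block_one k) ** minkowski_form ** block_one k = minkowski_form \<longleftrightarrow> orthogonal_matrix k"
  unfolding orthogonal_matrix_entries vec_eq_iff minkowski_entry
  by (simp add: split_option_all minkowski_form_def)

lemma block_one_SO0: "block_one k \<in> carrier SO0 \<longleftrightarrow> orthogonal_matrix k \<and> det k = 1"
  by (auto simp: carrier_SO0 block_one_minkowski det_block_one)

lemma SO_subgroup_mult_00:
  assumes "k \<in> SO_subgroup" "k' \<in> SO_subgroup"
  shows "(k ** g ** k') $ None $ None = g $ None $ None"
  using assms by (auto simp: SO_subgroup_def matrix_matrix_mult_def sum_UNIV_option)

text \<open>Cartan decomposition. A rotation carries the first axis to the direction of the spatial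
  part of column \<open>None\<close> of \<open>g\<close>, so \<open>k ** boost r\<close> and
  \<open>g\<close> agree in that column. Their quotient fixes the time axis and is a
  rotation.\<close>

lemma SO0_decomposition:
  fixes g :: "'m::finite lorentz_matrix"
  assumes g: "g \<in> carrier SO0"
  obtains k r k' where "k \<in> SO_subgroup" "k' \<in> SO_subgroup" "g = k ** boost r ** k'"
proof -
  define p :: "real ^ 'm option" where "p = (\<chi> a. g $ Some a $ None)"
  define r where "r = arcosh (g $ None $ None)"
  have g00: "1 \<le> g $ None $ None" using g by (simp add: carrier_SO0)
  have r: "cosh r = g $ None $ None" "0 \<le> r" unfolding r_def using g00 by (auto simp: cosh_arcosh_real)
  have p: "(norm p)\<^sup>2 = (g $ None $ None)\<^sup>2 - 1"
    using minkowski_column0[of g] g by (simp add: carrier_SO0 norm_vec_sq p_def)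
  also have "\<dots> = (sinh r)\<^sup>2" using r cosh_square_eq[of r] by simp
  finally have np: "norm p = sinh r"
    using r(2) by (metis abs_of_nonneg norm_ge_zero power2_eq_iff_nonneg sinh_real_nonneg_iff)
  \<comment> \<open>Vectors of equal norm are related by a rotation of determinant one only from
    dimension two on, which is where at least one further coordinate enters.\<close>
  have "2 \<le> CARD('m option)" by (simp add: Suc_leI)
  moreover have "norm (sinh r *\<^sub>R axis None 1 :: real ^ 'm option) = norm p"
    by (simp add: np norm_axis_1 r(2))
  ultimately obtain f where f: "orthogonal_transformation f" "det (matrix f) = 1"
    "f (sinh r *\<^sub>R axis None 1) = p" by (rule rotation_exists)
  define k :: "'m lorentz_matrix" where "k = block_one (matrix f)"
  have om: "orthogonal_matrix (matrix f)" using f(1) by (simp add: orthogonal_transformation_matrix)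
  have k: "k \<in> SO_subgroup" "k \<in> carrier SO0"
    using om f(2) by (auto simp: k_def SO_subgroup_def block_one_SO0)
  have "matrix f *v (sinh r *\<^sub>R axis None 1) = p"
    using f(1,3) by (simp add: matrix_works orthogonal_transformation_def)
  then have col: "(\<Sum>j\<in>UNIV. matrix f $ a $ j * (sinh r *\<^sub>R axis None 1 :: real ^ 'm option) $ j) = g $ Some a $ None" for a
    by (simp add: matrix_vector_mult_def p_def vec_eq_iff)
  have col': "matrix f $ a $ None * sinh r = g $ Some a $ None" for a
    using col[of a] by (simp add: sum_UNIV_option axis_def)
  define x where "x = k ** boost r"
  have x: "x \<in> carrier SO0" unfolding x_def by (intro mult_SO0_closed k boost_SO0)
  have x0: "x $ None $ None = g $ None $ None" "x $ Some a $ None = g $ Some a $ None" for a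
    using col'[of a] r by (simp_all add: x_def k_def matrix_matrix_mult_def sum_UNIV_option boost_def)
  define h where "h = minkowski_inv x ** g"
  have h: "h \<in> carrier SO0" unfolding h_def by (intro mult_SO0_closed minkowski_inv_SO0 x g)
  \<comment> \<open>As \<open>x\<close> and \<open>g\<close> share column \<open>None\<close>, this
    entry is minus the Minkowski square of that column.\<close>
  have "h $ None $ None = (g $ None $ None)\<^sup>2 - (\<Sum>a\<in>UNIV. (g $ Some a $ None)\<^sup>2)"
    unfolding h_def matrix_matrix_mult_def
    by (simp add: sum_UNIV_option[where 'a = "'m option"] minkowski_inv_entry x0 power2_eq_square sum_negf)
  then have h00: "h $ None $ None = 1"
    using minkowski_column0[of g] g by (simp add: carrier_SO0)
  have "(\<Sum>a\<in>UNIV. (h $ Some a $ None)\<^sup>2) = 0" "(\<Sum>a\<in>UNIV. (h $ None $ Some a)\<^sup>2) = 0"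
    using minkowski_column0[of h] minkowski_row0[of h] h h00 by (simp_all add: carrier_SO0)
  then have h0: "h $ Some a $ None = 0" "h $ None $ Some a = 0" for a
    by (simp_all add: sum_nonneg_eq_0_iff)
  have hb: "h = block_one (\<chi> a b. h $ Some a $ Some b)"
    unfolding vec_option_eq_iff[where 'a = "'m option"] by (simp add: h00 h0)
  then have "h \<in> SO_subgroup"
    using h block_one_SO0[of "\<chi> a b. h $ Some a $ Some b"] unfolding SO_subgroup_def by (intro image_eqI[where f = block_one, OF hb]) simp
  moreover have "g = k ** boost r ** h"
    using minkowski_inv_right[of x] x
    by (simp only: h_def x_def[symmetric] matrix_mul_assoc carrier_SO0 matrix_mul_lid)
  ultimately show ?thesis using that k(1) by blast
qed

text \<open>Bi-invariance and the Cartan decomposition reduce the comparison to the prescribed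
  values on the boosts.\<close>

lemma is_spherical_function_unique:
  fixes \<phi> \<psi> :: "'m::finite lorentz_matrix \<Rightarrow> complex"
  assumes "is_spherical_function s \<phi>" "is_spherical_function s \<psi>" and g: "g \<in> carrier SO0"
  shows "\<phi> g = \<psi> g"
  using SO0_decomposition[OF g] assms(1,2) boost_SO0 unfolding is_spherical_function_def by metis

section \<open>Integrals over Euclidean space\<close>

lemma borel_measurable_cosh [measurable (raw)]:
  fixes f :: "'a \<Rightarrow> real"
  shows "f \<in> borel_measurable M \<Longrightarrow> (\<lambda>x. cosh (f x)) \<in> borel_measurable M"
  by (rule borel_measurable_continuous_on[of cosh]) (auto intro: continuous_intros)

lemma integrable_exp_neg_abs:
  fixes c :: real
  assumes c: "0 < c"
  shows "integrable lborel (\<lambda>x. exp (- c * \<bar>x\<bar>))"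
proof -
  interpret E: prob_space "density lborel (exponential_density c)"
    by (rule prob_space_exponential_density[OF c])
  have "integrable (density lborel (exponential_density c)) (\<lambda>x. 1 :: real)"
    by simp
  then have 1: "integrable lborel (exponential_density c)"
    using c by (subst (asm) integrable_density) (auto simp: exponential_density_nonneg)
  from lborel_integrable_real_affine[OF 1, of "-1" 0]
  have 2: "integrable lborel (\<lambda>x. exponential_density c (- x))" by simp
  have "integrable lborel (\<lambda>x. (exponential_density c x + exponential_density c (- x)) / c)"
    using 1 2 by simp
  then show ?thesis
    by (rule Bochner_Integration.integrable_bound)
       (use c in \<open>auto simp: exponential_density_def abs_if mult.commute\<close>)
qed

lemma cosh_ge_exp_abs: "exp \<bar>x\<bar> / 2 \<le> cosh (x :: real)"
  by (cases "x \<ge> 0") (auto simp: cosh_field_def add_increasing add_increasing2)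

lemma abs_sinh_le_cosh: "\<bar>sinh x\<bar> \<le> cosh (x :: real)"
proof -
  have "(sinh x)\<^sup>2 \<le> (cosh x)\<^sup>2" using cosh_square_eq[of x] by simp
  then have "\<bar>sinh x\<bar> \<le> \<bar>cosh x\<bar>" by (simp only: abs_le_square_iff)
  then show ?thesis by simp
qed

lemma exp_cosh_powr_le:
  fixes p \<sigma> v :: real
  assumes "0 \<le> p"
  shows "exp (\<sigma> * v) * cosh v powr - p \<le> 2 powr p * exp (- (p - \<bar>\<sigma>\<bar>) * \<bar>v\<bar>)"
proof -
  have "cosh v powr - p \<le> (exp \<bar>v\<bar> / 2) powr - p"
    using assms by (intro powr_mono2' cosh_ge_exp_abs) auto
  also have "\<dots> = 2 powr p * exp (- p * \<bar>v\<bar>)"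
    by (simp add: powr_def ln_div exp_add[symmetric] algebra_simps)
  finally have "exp (\<sigma> * v) * cosh v powr - p \<le> exp (\<bar>\<sigma>\<bar> * \<bar>v\<bar>) * (2 powr p * exp (- p * \<bar>v\<bar>))"
    by (intro mult_mono) (auto simp: abs_mult[symmetric])
  also have "\<dots> = 2 powr p * exp (- (p - \<bar>\<sigma>\<bar>) * \<bar>v\<bar>)"
    by (simp add: exp_add[symmetric] algebra_simps)
  finally show ?thesis .
qed

lemma integrable_exp_cosh_powr:
  fixes p \<sigma> :: real
  assumes "\<bar>\<sigma>\<bar> < p"
  shows "integrable lborel (\<lambda>v. exp (\<sigma> * v) * cosh v powr - p)"
proof (rule Bochner_Integration.integrable_bound)
  show "integrable lborel (\<lambda>v. 2 powr p * exp (- (p - \<bar>\<sigma>\<bar>) * \<bar>v\<bar>))"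
    using assms by (intro integrable_mult_right integrable_exp_neg_abs) simp
  show "AE v in lborel. norm (exp (\<sigma> * v) * cosh v powr - p) \<le> norm (2 powr p * exp (- (p - \<bar>\<sigma>\<bar>) * \<bar>v\<bar>))"
    using exp_cosh_powr_le[of p \<sigma>] assms by (auto simp: abs_mult)
qed auto

lemma power_div_fact_le_exp:
  fixes x :: real
  assumes "0 \<le> x"
  shows "x ^ n / fact n \<le> exp x"
  using assms sum_le_suminf[OF summable_exp, of "{n}" x]
  by (simp add: exp_def divide_inverse mult.commute)

text \<open>One term of the exponential series gives decay of every polynomial order in
  \<open>cosh\<close>, enough to beat any factor \<open>exp (\<sigma> * v)\<close>.\<close>

lemma exp_neg_cosh_le:
  fixes r v :: real
  assumes "0 < r"
  shows "exp (- r * cosh v) \<le> fact n / r ^ n * cosh v powr - real n"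
proof -
  have c: "0 < cosh v" by simp
  have "(r * cosh v) ^ n / fact n \<le> exp (r * cosh v)"
    using assms c by (intro power_div_fact_le_exp) simp
  then have "exp (- (r * cosh v)) \<le> fact n / (r * cosh v) ^ n"
    using assms c by (simp add: exp_minus field_simps)
  also have "\<dots> = fact n / r ^ n * cosh v powr - real n"
    using assms c by (simp add: powr_minus powr_realpow power_mult_distrib field_simps)
  finally show ?thesis by simp
qed

lemma integrable_exp_neg_cosh:
  fixes r \<sigma> :: real
  assumes "0 < r"
  shows "integrable lborel (\<lambda>v. exp (- r * cosh v + \<sigma> * v))"
proof -
  obtain n :: nat where n: "\<bar>\<sigma>\<bar> < real n" using reals_Archimedean2 by blast
  show ?thesis
  proof (rule Bochner_Integration.integrable_bound)
    show "integrable lborel (\<lambda>v. fact n / r ^ n * (exp (\<sigma> * v) * cosh v powr - real n))"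
      by (intro integrable_mult_right integrable_exp_cosh_powr n)
    have "exp (- r * cosh v + \<sigma> * v) \<le> fact n / r ^ n * (exp (\<sigma> * v) * cosh v powr - real n)" for v
      using mult_right_mono[OF exp_neg_cosh_le[OF assms, of v n], of "exp (\<sigma> * v)"]
      unfolding exp_add by (simp add: mult_ac)
    then show "AE v in lborel. norm (exp (- r * cosh v + \<sigma> * v))
        \<le> norm (fact n / r ^ n * (exp (\<sigma> * v) * cosh v powr - real n))"
      using assms by (auto simp: abs_mult)
  qed auto
qed

lemma nn_integral_shift:
  fixes f :: "real \<Rightarrow> ennreal"
  assumes [measurable]: "f \<in> borel_measurable borel"
  shows "(\<integral>\<^sup>+x. f (x + t) \<partial>lborel) = (\<integral>\<^sup>+x. f x \<partial>lborel)"
  using nn_integral_real_affine[of f 1 t] by (simp add: add.commute)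

lemma integral_shift:
  fixes f :: "real \<Rightarrow> 'a :: {banach, second_countable_topology}"
  shows "(LBINT x. f (x + t)) = (LBINT x. f x)"
  using lborel_integral_real_affine[of 1 f t] by (simp add: add.commute)

lemma integrable_shift_iff:
  fixes f :: "real \<Rightarrow> 'a :: {banach, second_countable_topology}"
  shows "integrable lborel (\<lambda>x. f (x + t)) \<longleftrightarrow> integrable lborel f"
  using lborel_integrable_real_affine_iff[of 1 f t] by (simp add: add.commute)

text \<open>The substitution of determinant one behind all factorizations of sums of
  \<open>cosh\<close> and \<open>exp\<close>. It is a translation in one variable followed by a
  translation in the other, so Tonelli and translation invariance prove it.\<close>

lemma distr_shear_half:
  "distr (lborel \<Otimes>\<^sub>M lborel) (lborel \<Otimes>\<^sub>M lborel) (\<lambda>(w :: real, v :: real). (v + w / 2, v - w / 2))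
    = lborel \<Otimes>\<^sub>M lborel" (is "distr ?M ?M ?T = ?M")
proof (rule measure_eqI)
  fix A assume "A \<in> sets (distr ?M ?M ?T)"
  then have A[measurable]: "A \<in> sets ?M" by simp
  have T[measurable]: "?T \<in> measurable ?M ?M" by measurable
  have "emeasure (distr ?M ?M ?T) A = (\<integral>\<^sup>+x. indicator A x \<partial>distr ?M ?M ?T)"
    by (rule nn_integral_indicator[symmetric]) (use A in simp)
  also have "\<dots> = (\<integral>\<^sup>+z. indicator A (?T z) \<partial>?M)" by (rule nn_integral_distr) measurable
  also have "\<dots> = (\<integral>\<^sup>+w. \<integral>\<^sup>+v. indicator A (v + w / 2, v - w / 2) \<partial>lborel \<partial>lborel)"
    by (subst lborel.nn_integral_fst[symmetric]) (auto simp: split_beta')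
  also have "\<dots> = (\<integral>\<^sup>+w. \<integral>\<^sup>+v. indicator A (v + w, v) \<partial>lborel \<partial>lborel)"
  proof (rule nn_integral_cong)
    fix w :: real
    have "(\<integral>\<^sup>+v. indicator A (v + w / 2, v - w / 2) \<partial>lborel)
        = (\<integral>\<^sup>+v. (\<lambda>v. indicator A (v + w, v)) (v + - w / 2) \<partial>lborel)"
      by (simp add: algebra_simps)
    also have "\<dots> = (\<integral>\<^sup>+v. indicator A (v + w, v) \<partial>lborel)" by (rule nn_integral_shift) measurable
    finally show "(\<integral>\<^sup>+v. indicator A (v + w / 2, v - w / 2) \<partial>lborel) = (\<integral>\<^sup>+v. indicator A (v + w, v) \<partial>lborel)" .
  qed
  also have "\<dots> = (\<integral>\<^sup>+v. \<integral>\<^sup>+w. indicator A (w + v, v) \<partial>lborel \<partial>lborel)"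
    by (subst lborel_pair.Fubini') (auto simp: add.commute)
  also have "\<dots> = (\<integral>\<^sup>+v. \<integral>\<^sup>+w. indicator A (w, v) \<partial>lborel \<partial>lborel)"
  proof (rule nn_integral_cong)
    show "(\<integral>\<^sup>+w. indicator A (w + v, v) \<partial>lborel) = (\<integral>\<^sup>+w. indicator A (w, v) \<partial>lborel)" for v :: real
      by (rule nn_integral_shift[where f = "\<lambda>w. indicator A (w, v)"]) measurable
  qed
  also have "\<dots> = (\<integral>\<^sup>+w. \<integral>\<^sup>+v. indicator A (w, v) \<partial>lborel \<partial>lborel)"
    by (rule lborel_pair.Fubini') measurable
  also have "\<dots> = (\<integral>\<^sup>+z. indicator A z \<partial>?M)"
    by (rule lborel.nn_integral_fst) measurable
  also have "\<dots> = emeasure ?M A"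
    by (rule nn_integral_indicator) (use A in simp)
  finally show "emeasure (distr ?M ?M ?T) A = emeasure ?M A" .
qed simp

lemma distr_shear:
  "distr (lborel \<Otimes>\<^sub>M lborel) (lborel \<Otimes>\<^sub>M lborel) (\<lambda>(u :: real, y :: real). (u, y + u))
    = lborel \<Otimes>\<^sub>M lborel" (is "distr ?M ?M ?T = ?M")
proof (rule measure_eqI)
  fix A assume "A \<in> sets (distr ?M ?M ?T)"
  then have A[measurable]: "A \<in> sets ?M" by simp
  have T: "?T \<in> measurable ?M ?M" by measurable
  have "emeasure (distr ?M ?M ?T) A = (\<integral>\<^sup>+x. indicator A x \<partial>distr ?M ?M ?T)"
    by (rule nn_integral_indicator[symmetric]) (use A in simp)
  also have "\<dots> = (\<integral>\<^sup>+z. indicator A (?T z) \<partial>?M)" by (rule nn_integral_distr[OF T]) measurable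
  also have "\<dots> = (\<integral>\<^sup>+u. \<integral>\<^sup>+y. indicator A (u, y + u) \<partial>lborel \<partial>lborel)"
    by (subst lborel.nn_integral_fst[symmetric]) (auto simp: split_beta')
  also have "\<dots> = (\<integral>\<^sup>+u. \<integral>\<^sup>+y. indicator A (u, y) \<partial>lborel \<partial>lborel)"
  proof (rule nn_integral_cong)
    show "(\<integral>\<^sup>+y. indicator A (u, y + u) \<partial>lborel) = (\<integral>\<^sup>+y. indicator A (u, y) \<partial>lborel)" for u :: real
    proof (rule nn_integral_shift[where f = "\<lambda>y. indicator A (u, y)" and t = u])
      show "(\<lambda>y. indicator A (u, y)) \<in> borel_measurable borel" by measurable
    qed
  qed
  also have "\<dots> = (\<integral>\<^sup>+z. indicator A z \<partial>?M)"
    by (rule lborel.nn_integral_fst) measurable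
  also have "\<dots> = emeasure ?M A"
    by (rule nn_integral_indicator) (use A in simp)
  finally show "emeasure (distr ?M ?M ?T) A = emeasure ?M A" .
qed simp

lemma integrable_product_lborel:
  fixes f g :: "real \<Rightarrow> complex"
  assumes f: "integrable lborel f" and g: "integrable lborel g"
  shows "integrable (lborel \<Otimes>\<^sub>M lborel) (\<lambda>(x, y). f x * g y)"
    and "(LINT z|(lborel \<Otimes>\<^sub>M lborel). (case z of (x, y) \<Rightarrow> f x * g y)) = (LBINT x. f x) * (LBINT y. g y)"
proof -
  have [measurable]: "f \<in> borel_measurable borel" "g \<in> borel_measurable borel"
    using f g by auto
  show i: "integrable (lborel \<Otimes>\<^sub>M lborel) (\<lambda>(x, y). f x * g y)"
    by (rule lborel_pair.Fubini_integrable) (use f g in \<open>auto simp: norm_mult\<close>)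
  show "(LINT z|(lborel \<Otimes>\<^sub>M lborel). (case z of (x, y) \<Rightarrow> f x * g y)) = (LBINT x. f x) * (LBINT y. g y)"
    by (subst lborel_pair.integral_fst'[OF i, symmetric]) simp
qed

section \<open>Integrals over \<open>real ^ 'm\<close>: products, scaling, Gaussians\<close>

lemma Basis_real_vec: "(Basis :: (real ^ 'm::finite) set) = range (\<lambda>i. axis i 1)"
  by (auto simp: Basis_vec_def)

lemma prod_Basis_real_vec:
  "(\<Prod>b\<in>(Basis :: (real ^ 'm::finite) set). F b) = (\<Prod>i\<in>UNIV. F (axis i 1))"
  unfolding Basis_real_vec by (subst prod.reindex) (auto simp: inj_on_def axis_eq_axis)

text \<open>Lebesgue measure is the image of a product measure whose factors are indexed by basis
  vectors rather than by coordinates; \<open>F\<close> renames the functions accordingly.\<close>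

lemma integral_prod_lborel:
  fixes f :: "'m::finite \<Rightarrow> real \<Rightarrow> complex"
  assumes f: "\<And>i. integrable lborel (f i)"
  shows "integrable lborel (\<lambda>x :: real ^ 'm. \<Prod>i\<in>UNIV. f i (x $ i))"
    and "(LBINT x :: real ^ 'm. \<Prod>i\<in>UNIV. f i (x $ i)) = (\<Prod>i\<in>UNIV. LBINT t. f i t)"
proof -
  define F where "F = (\<lambda>b :: real ^ 'm. f (THE i. b = axis i 1))"
  have F: "F (axis i 1) = f i" for i
    unfolding F_def by (rule arg_cong[where f = f]) (auto simp: axis_eq_axis)
  interpret product_sigma_finite "\<lambda>_ :: real ^ 'm. lborel :: real measure" by standard
  have iF: "integrable lborel (F b)" if "b \<in> Basis" for b
    using that f F by (auto simp: Basis_real_vec)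
  let ?P = "\<Pi>\<^sub>M b\<in>(Basis :: (real ^ 'm) set). (lborel :: real measure)"
  have T[measurable]: "(\<lambda>f. \<Sum>b\<in>(Basis :: (real ^ 'm) set). f b *\<^sub>R b) \<in> measurable ?P borel"
    by measurable
  have comp: "(\<Prod>i\<in>UNIV. f i ((\<Sum>b\<in>Basis. x b *\<^sub>R b) $ i)) = (\<Prod>b\<in>(Basis :: (real ^ 'm) set). F b (x b))" for x
  proof -
    have "(\<Sum>b\<in>Basis. x b *\<^sub>R b) $ i = x (axis i 1)" for i
    proof -
      have "(\<Sum>b\<in>Basis. x b *\<^sub>R b) $ i = (\<Sum>b\<in>Basis. x b *\<^sub>R b) \<bullet> axis i 1"
        by (simp add: inner_axis)
      also have "\<dots> = x (axis i 1)" by (rule inner_sum_left_Basis) (auto simp: Basis_real_vec)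
      finally show ?thesis .
    qed
    then show ?thesis by (simp add: prod_Basis_real_vec F)
  qed
  have meas[measurable]: "f i \<in> borel_measurable borel" for i using f[of i] by auto
  have m: "(\<lambda>x :: real ^ 'm. \<Prod>i\<in>UNIV. f i (x $ i)) \<in> borel_measurable borel"
  proof (rule borel_measurable_prod)
    fix i
    have "(\<lambda>x :: real ^ 'm. x $ i) \<in> borel_measurable borel"
      by (intro borel_measurable_continuous_onI continuous_intros)
    then show "(\<lambda>x :: real ^ 'm. f i (x $ i)) \<in> borel_measurable borel"
      by (rule measurable_compose[OF _ meas])
  qed
  have i: "integrable ?P (\<lambda>x. \<Prod>b\<in>Basis. F b (x b))"
    by (rule product_integrable_prod) (auto intro: iF)
  show "integrable lborel (\<lambda>x :: real ^ 'm. \<Prod>i\<in>UNIV. f i (x $ i))"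
    by (subst lborel_eq, subst integrable_distr_eq[OF T m]) (unfold comp, rule i)
  have "(LBINT x :: real ^ 'm. \<Prod>i\<in>UNIV. f i (x $ i)) = integral\<^sup>L ?P (\<lambda>x. \<Prod>b\<in>Basis. F b (x b))"
    by (subst lborel_eq, subst integral_distr[OF T m]) (simp only: comp)
  also have "\<dots> = (\<Prod>b\<in>Basis. LBINT t. F b t)"
    by (rule product_integral_prod) (auto intro: iF)
  also have "\<dots> = (\<Prod>i\<in>UNIV. LBINT t. f i t)" by (simp add: prod_Basis_real_vec F)
  finally show "(LBINT x :: real ^ 'm. \<Prod>i\<in>UNIV. f i (x $ i)) = (\<Prod>i\<in>UNIV. LBINT t. f i t)" .
qed

text \<open>The norm is at least the mean of the absolute values of the coordinates, so a product of
  one-dimensional exponentials of rate \<open>1 / m\<close> dominates.\<close>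

lemma integrable_exp_neg_norm:
  "integrable lborel (\<lambda>x :: real ^ 'm::finite. exp (- norm x))"
proof (rule Bochner_Integration.integrable_bound)
  let ?m = "real CARD('m)"
  have "integrable lborel (\<lambda>t. complex_of_real (exp (- (1 / ?m) * \<bar>t\<bar>)))"
    by (intro integrable_of_real integrable_exp_neg_abs) simp
  then show "integrable lborel (\<lambda>x :: real ^ 'm. \<Prod>i\<in>UNIV. complex_of_real (exp (- (1 / ?m) * \<bar>x $ i\<bar>)))"
    by (rule integral_prod_lborel(1))
  have "exp (- norm x) \<le> (\<Prod>i\<in>UNIV. exp (- (1 / ?m) * \<bar>x $ i\<bar>))" for x :: "real ^ 'm"
  proof -
    have "(\<Sum>i\<in>UNIV. \<bar>x $ i\<bar>) \<le> ?m * norm x"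
      using sum_bounded_above[of UNIV "\<lambda>i. \<bar>x $ i\<bar>" "norm x"] component_le_norm_cart[of x] by simp
    then have "- norm x \<le> (\<Sum>i\<in>UNIV. - (1 / ?m) * \<bar>x $ i\<bar>)"
      by (simp add: sum_negf sum_divide_distrib[symmetric] field_simps)
    then show ?thesis by (simp add: exp_sum[symmetric])
  qed
  then show "AE x in lborel. norm (exp (- norm x)) \<le> norm (\<Prod>i\<in>UNIV. complex_of_real (exp (- (1 / ?m) * \<bar>(x :: real ^ 'm) $ i\<bar>)))"
    by (auto simp: prod_norm[symmetric])
qed (auto intro!: borel_measurable_continuous_onI continuous_intros)

lemma lborel_scale:
  fixes f :: "'a::euclidean_space \<Rightarrow> 'b::{banach, second_countable_topology}"
  assumes c: "0 < (c :: real)" and f[measurable]: "f \<in> borel_measurable borel"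
  shows "integrable lborel (\<lambda>x. f (c *\<^sub>R x)) \<longleftrightarrow> integrable lborel f"
    and "(LBINT x. f (c *\<^sub>R x)) = (1 / c ^ DIM('a)) *\<^sub>R (LBINT x. f x)"
proof -
  have eq: "(lborel :: 'a measure) = density (distr lborel borel (\<lambda>x. c *\<^sub>R x)) (\<lambda>_. ennreal (c ^ DIM('a)))"
    using lborel_affine[of c "0 :: 'a"] c by simp
  have m[measurable]: "(\<lambda>x :: 'a. c *\<^sub>R x) \<in> measurable lborel borel" by measurable
  show "integrable lborel (\<lambda>x. f (c *\<^sub>R x)) \<longleftrightarrow> integrable lborel f"
  proof -
    have "integrable lborel f \<longleftrightarrow> integrable lborel (\<lambda>x. c ^ DIM('a) *\<^sub>R f (c *\<^sub>R x))"
      using c by (subst eq) (simp add: integrable_density integrable_distr_eq)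
    moreover have "integrable lborel (\<lambda>x. f (c *\<^sub>R x))"
      if "integrable lborel (\<lambda>x. c ^ DIM('a) *\<^sub>R f (c *\<^sub>R x))"
      using integrable_scaleR_right[of "1 / c ^ DIM('a)", OF that] c by simp
    ultimately show ?thesis by auto
  qed
  have "(LBINT x. f x) = c ^ DIM('a) *\<^sub>R (LBINT x. f (c *\<^sub>R x))"
    using c by (subst eq) (simp add: integral_density integral_distr)
  then show "(LBINT x. f (c *\<^sub>R x)) = (1 / c ^ DIM('a)) *\<^sub>R (LBINT x. f x)" using c by simp
qed

text \<open>Homogeneity alone produces the power of \<open>X\<close>; the integral at
  \<open>X = 1\<close> is left unevaluated.\<close>

lemma integral_exp_neg_norm:
  fixes X :: real
  assumes "0 < X"
  shows "integrable lborel (\<lambda>x :: real ^ 'm::finite. exp (- X * norm x))"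
    and "(LBINT x :: real ^ 'm. exp (- X * norm x)) = X powr - real CARD('m) * (LBINT x :: real ^ 'm. exp (- norm x))"
proof -
  have m: "(\<lambda>x :: real ^ 'm. exp (- norm x)) \<in> borel_measurable borel" by measurable
  show "integrable lborel (\<lambda>x :: real ^ 'm. exp (- X * norm x))"
    using lborel_scale(1)[OF assms m] integrable_exp_neg_norm assms by simp
  show "(LBINT x :: real ^ 'm. exp (- X * norm x)) = X powr - real CARD('m) * (LBINT x :: real ^ 'm. exp (- norm x))"
    using lborel_scale(2)[OF assms m] assms by (simp add: powr_minus powr_realpow field_simps)
qed

lemma integral_exp_neg_norm_pos: "0 < (LBINT x :: real ^ 'm::finite. exp (- norm x))"
proof -
  have "(LBINT x :: real ^ 'm. exp (- norm x)) \<noteq> 0"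
  proof
    assume "(LBINT x :: real ^ 'm. exp (- norm x)) = 0"
    then have "AE x :: real ^ 'm in lborel. exp (- norm x) = 0"
      by (subst (asm) integral_nonneg_eq_0_iff_AE[OF integrable_exp_neg_norm]) auto
    then have "AE x :: real ^ 'm in lborel. False" by simp
    then have "emeasure lborel (UNIV :: (real ^ 'm) set) = 0" by (simp add: AE_iff_measurable[OF _ refl])
    then show False by simp
  qed
  moreover have "0 \<le> (LBINT x :: real ^ 'm. exp (- norm x))" by (intro integral_nonneg_AE) auto
  ultimately show ?thesis by linarith
qed

text \<open>The characteristic function of the standard normal distribution, rescaled by
  \<open>sqrt A\<close>.\<close>

lemma gaussian_fourier_1d:
  fixes A b :: real
  assumes A: "0 < A"
  shows "integrable lborel (\<lambda>x. complex_of_real (exp (- A * x\<^sup>2 / 2)) * exp (\<i> * of_real (b * x)))"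
    and "(LBINT x. complex_of_real (exp (- A * x\<^sup>2 / 2)) * exp (\<i> * of_real (b * x)))
      = complex_of_real (sqrt (2 * pi / A) * exp (- b\<^sup>2 / (2 * A)))"
proof -
  let ?f = "\<lambda>x. complex_of_real (std_normal_density x) * exp (\<i> * of_real ((b / sqrt A) * x))"
  have i: "integrable lborel ?f"
    by (rule Bochner_Integration.integrable_bound[OF integrable_normal_density[of 1 0]])
       (auto simp: norm_mult)
  have "(LBINT x. ?f x) = char std_normal_distribution (b / sqrt A)"
    unfolding char_def by (subst integral_density) (auto simp: scaleR_conv_of_real)
  also have "\<dots> = complex_of_real (exp (- (b / sqrt A)\<^sup>2 / 2))"
    by (simp only: char_std_normal_distribution)
  also have "- (b / sqrt A)\<^sup>2 / 2 = - b\<^sup>2 / (2 * A)" using A by (simp add: power_divide)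
  finally have val: "(LBINT x. ?f x) = complex_of_real (exp (- b\<^sup>2 / (2 * A)))" .
  have eq: "complex_of_real (exp (- A * x\<^sup>2 / 2)) * exp (\<i> * of_real (b * x)) = complex_of_real (sqrt (2 * pi)) * ?f (0 + sqrt A * x)" for x
    using A by (simp add: std_normal_density_def power_mult_distrib field_simps)
  show "integrable lborel (\<lambda>x. complex_of_real (exp (- A * x\<^sup>2 / 2)) * exp (\<i> * of_real (b * x)))"
    unfolding eq using A by (intro integrable_mult_right lborel_integrable_real_affine i) auto
  have "(LBINT x. ?f (0 + sqrt A * x)) = complex_of_real (exp (- b\<^sup>2 / (2 * A))) / complex_of_real (sqrt A)"
    using lborel_integral_real_affine[of "sqrt A" ?f 0] A unfolding val
    by (simp add: scaleR_conv_of_real field_simps)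
  then have "(LBINT x. complex_of_real (sqrt (2 * pi)) * ?f (0 + sqrt A * x))
     = complex_of_real (sqrt (2 * pi)) * (complex_of_real (exp (- b\<^sup>2 / (2 * A))) / complex_of_real (sqrt A))"
    by (subst integral_mult_right_zero) simp
  then show "(LBINT x. complex_of_real (exp (- A * x\<^sup>2 / 2)) * exp (\<i> * of_real (b * x)))
      = complex_of_real (sqrt (2 * pi / A) * exp (- b\<^sup>2 / (2 * A)))"
    unfolding eq by (simp add: real_sqrt_divide)
qed

lemma gaussian_fourier:
  fixes A :: real and b :: "real ^ 'm::finite"
  assumes A: "0 < A"
  shows "integrable lborel (\<lambda>x :: real ^ 'm. complex_of_real (exp (- A * (norm x)\<^sup>2 / 2)) * exp (\<i> * of_real (b \<bullet> x)))"
    and "(LBINT x :: real ^ 'm. complex_of_real (exp (- A * (norm x)\<^sup>2 / 2)) * exp (\<i> * of_real (b \<bullet> x)))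
      = complex_of_real ((2 * pi / A) powr (real CARD('m) / 2) * exp (- (norm b)\<^sup>2 / (2 * A)))"
proof -
  have n: "(norm v)\<^sup>2 = (\<Sum>i\<in>UNIV. (v $ i)\<^sup>2)" for v :: "real ^ 'm"
    unfolding power2_norm_eq_inner inner_vec_def by (simp add: power2_eq_square)
  have eq: "complex_of_real (exp (- A * (norm x)\<^sup>2 / 2)) * exp (\<i> * of_real (b \<bullet> x))
      = (\<Prod>i\<in>UNIV. complex_of_real (exp (- A * (x $ i)\<^sup>2 / 2)) * exp (\<i> * of_real (b $ i * x $ i)))" for x :: "real ^ 'm"
  proof -
    have "exp (- A * (norm x)\<^sup>2 / 2) = (\<Prod>i\<in>UNIV. exp (- A * (x $ i)\<^sup>2 / 2))"
      by (simp add: n exp_sum[symmetric] sum_distrib_left sum_divide_distrib sum_negf)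
    moreover have "exp (\<i> * of_real (b \<bullet> x)) = (\<Prod>i\<in>UNIV. exp (\<i> * of_real (b $ i * x $ i)))"
      by (simp add: inner_vec_def exp_sum[symmetric] sum_distrib_left)
    ultimately show ?thesis by (simp add: prod.distrib)
  qed
  show "integrable lborel (\<lambda>x :: real ^ 'm. complex_of_real (exp (- A * (norm x)\<^sup>2 / 2)) * exp (\<i> * of_real (b \<bullet> x)))"
    unfolding eq by (rule integral_prod_lborel(1)) (rule gaussian_fourier_1d(1)[OF A])
  have "(LBINT x :: real ^ 'm. complex_of_real (exp (- A * (norm x)\<^sup>2 / 2)) * exp (\<i> * of_real (b \<bullet> x)))
      = (\<Prod>i\<in>UNIV. complex_of_real (sqrt (2 * pi / A) * exp (- (b $ i)\<^sup>2 / (2 * A))))"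
    unfolding eq
    by (subst integral_prod_lborel(2)[OF gaussian_fourier_1d(1)[OF A]]) (simp only: gaussian_fourier_1d(2)[OF A])
  also have "\<dots> = complex_of_real (sqrt (2 * pi / A) ^ CARD('m) * (\<Prod>i\<in>UNIV. exp (- (b $ i)\<^sup>2 / (2 * A))))"
    by (simp add: prod.distrib)
  also have "(\<Prod>i\<in>UNIV. exp (- (b $ i)\<^sup>2 / (2 * A))) = exp (- (norm b)\<^sup>2 / (2 * A))"
    by (simp add: n exp_sum[symmetric] sum_divide_distrib sum_negf)
  also have "sqrt (2 * pi / A) ^ CARD('m) = (2 * pi / A) powr (real CARD('m) / 2)"
    using A by (simp add: powr_half_sqrt[symmetric] powr_realpow[symmetric] powr_powr)
  finally show "(LBINT x :: real ^ 'm. complex_of_real (exp (- A * (norm x)\<^sup>2 / 2)) * exp (\<i> * of_real (b \<bullet> x)))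
      = complex_of_real ((2 * pi / A) powr (real CARD('m) / 2) * exp (- (norm b)\<^sup>2 / (2 * A)))" .
qed

section \<open>Macdonald functions\<close>

lemma borel_measurable_lborel_prod:
  fixes f :: "'a::euclidean_space \<times> 'b::euclidean_space \<Rightarrow> 'c::{second_countable_topology, real_normed_vector}"
  assumes "continuous_on UNIV f"
  shows "f \<in> borel_measurable (lborel \<Otimes>\<^sub>M lborel)"
  using borel_measurable_continuous_onI[OF assms] by (simp add: lborel_prod)

lemma integrable_cmod_bound:
  fixes f :: "'a \<Rightarrow> complex"
  assumes "integrable M g" "f \<in> borel_measurable M" "\<And>x. cmod (f x) = g x"
  shows "integrable M f"
  by (rule Bochner_Integration.integrable_bound[OF assms(1,2)]) (use assms(3) in \<open>auto simp: eq_commute\<close>)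

text \<open>\<open>macdonald s\<close> is twice the modified Bessel function \<open>K\<^sub>s\<close>.\<close>

definition macdonald :: "complex \<Rightarrow> real \<Rightarrow> complex" where
  "macdonald s r = (LBINT u. exp (of_real (- r * cosh u) + s * of_real u))"

text \<open>The Macdonald function of real order as a real function; it majorizes the modulus of
  \<open>macdonald s\<close> for \<open>Re s = \<sigma>\<close> and is used for all integrability
  claims.\<close>

definition macdonald_real :: "real \<Rightarrow> real \<Rightarrow> real" where
  "macdonald_real \<sigma> r = (LBINT u. exp (- r * cosh u + \<sigma> * u))"

text \<open>A beta integral in exponential coordinates; \<open>Gamma_mult_sech_transform\<close>
  expresses it by three values of the Gamma function.\<close>

definition sech_transform :: "real \<Rightarrow> complex \<Rightarrow> complex" where
  "sech_transform p \<alpha> = (LBINT v. exp (\<alpha> * of_real v) * of_real (cosh v powr - p))"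

lemma integrable_macdonald:
  fixes s :: complex
  assumes "0 < r"
  shows "integrable lborel (\<lambda>u. exp (of_real (- r * cosh u) + s * of_real u))"
  by (rule integrable_cmod_bound[OF integrable_exp_neg_cosh[OF assms, of "Re s"]])
     (auto intro!: borel_measurable_continuous_onI continuous_intros)

lemma integrable_sech:
  assumes "\<bar>Re \<alpha>\<bar> < p"
  shows "integrable lborel (\<lambda>v. exp (\<alpha> * of_real v) * of_real (cosh v powr - p))"
  by (rule integrable_cmod_bound[OF integrable_exp_cosh_powr[OF assms]])
     (auto intro!: borel_measurable_continuous_onI continuous_intros simp: norm_mult)

lemma macdonald_real_nonneg: "0 \<le> macdonald_real \<sigma> r"
  unfolding macdonald_real_def by (intro integral_nonneg_AE) auto

lemma macdonald_of_real: "macdonald (of_real \<sigma>) r = of_real (macdonald_real \<sigma> r)"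
  unfolding macdonald_def macdonald_real_def
  by (subst integral_complex_of_real[symmetric]) (simp flip: exp_of_real)

lemma cmod_macdonald_le: "cmod (macdonald s r) \<le> macdonald_real (Re s) r"
  unfolding macdonald_def macdonald_real_def
  by (rule order_trans[OF integral_norm_bound]) simp

lemma macdonald_uminus: "macdonald (- s) r = macdonald s r"
  unfolding macdonald_def
  using lborel_integral_real_affine[of "-1" "\<lambda>u. exp (of_real (- r * cosh u) + s * of_real u)" 0]
  by simp

lemma macdonald_cnj: "macdonald (cnj s) r = cnj (macdonald s r)"
  unfolding macdonald_def
  by (subst Bochner_Integration.integral_cnj[symmetric], rule Bochner_Integration.integral_cong)
     (simp_all add: exp_cnj)

lemma borel_measurable_macdonald [measurable (raw)]:
  assumes [measurable]: "f \<in> borel_measurable M"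
  shows "(\<lambda>x. macdonald s (f x)) \<in> borel_measurable M"
proof -
  have "(\<lambda>z :: real \<times> real. exp (complex_of_real (- fst z * cosh (snd z)) + s * of_real (snd z)))
      \<in> borel_measurable (borel \<Otimes>\<^sub>M borel)"
    unfolding borel_prod by (intro borel_measurable_continuous_onI continuous_intros)
  then have "(\<lambda>(r, u). exp (complex_of_real (- r * cosh u) + s * of_real u)) \<in> borel_measurable (borel \<Otimes>\<^sub>M lborel)"
    by (simp add: split_beta')
  from lborel.borel_measurable_lebesgue_integral[OF this]
  have "macdonald s \<in> borel_measurable borel" by (simp add: macdonald_def[abs_def])
  then show ?thesis using measurable_compose[OF assms] by blast
qed

lemma AE_lborel_nonzero: "AE x in lborel. (x :: 'a::euclidean_space) \<noteq> 0"
  by (rule AE_lborel_singleton)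

definition norm_exp_integral :: "'m::finite itself \<Rightarrow> real" where
  "norm_exp_integral _ = (LBINT x :: real ^ 'm. exp (- norm x))"

text \<open>Integrating over \<open>x\<close> before the parameters \<open>u\<close> and
  \<open>v\<close> of the two Macdonald integrals gives a constant times
  \<open>(cosh u + cosh v) powr - m\<close>. The shear turns this power into a product, and the
  exponential into one with exponents \<open>\<mu> - \<kappa>\<close> and
  \<open>\<mu> + \<kappa>\<close> in the new variables.\<close>

lemma macdonald_moment:
  fixes \<mu> \<kappa> :: complex
  defines "m \<equiv> real CARD('m::finite)"
  assumes 1: "\<bar>Re (\<mu> + \<kappa>)\<bar> < m" and 2: "\<bar>Re (\<mu> - \<kappa>)\<bar> < m"
  shows "integrable lborel (\<lambda>x :: real ^ 'm. macdonald \<mu> (norm x) * macdonald \<kappa> (norm x))"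
    and "(LBINT x :: real ^ 'm. macdonald \<mu> (norm x) * macdonald \<kappa> (norm x))
      = of_real (2 powr (1 - m) * norm_exp_integral TYPE('m)) * sech_transform m (\<mu> + \<kappa>) * sech_transform m (\<mu> - \<kappa>)"
proof -
  define h :: "real \<times> real \<Rightarrow> complex" where
    "h = (\<lambda>(u, v). exp (\<mu> * of_real u + \<kappa> * of_real v) * of_real ((cosh u + cosh v) powr - m))"
  define F where "F = (\<lambda>w :: real. 2 powr - m *\<^sub>R (exp ((\<mu> - \<kappa>) * of_real (0 + 1 / 2 * w)) * of_real (cosh (0 + 1 / 2 * w) powr - m)))"
  define G where "G = (\<lambda>v. exp ((\<mu> + \<kappa>) * of_real v) * of_real (cosh v powr - m))"
  have F: "integrable lborel F" unfolding F_def
    by (intro integrable_scaleR_right lborel_integrable_real_affine[OF integrable_sech[OF 2]]) simp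
  have G: "integrable lborel G" unfolding G_def by (rule integrable_sech[OF 1])
  have hcont: "continuous_on UNIV h"
    unfolding h_def split_beta'
    by (intro continuous_intros) (auto simp: add_pos_pos less_imp_neq[symmetric])
  have hm: "h \<in> borel_measurable (lborel \<Otimes>\<^sub>M lborel)"
    by (rule borel_measurable_lborel_prod[OF hcont])
  have T: "(\<lambda>(w :: real, v :: real). (v + w / 2, v - w / 2)) \<in> measurable (lborel \<Otimes>\<^sub>M lborel) (lborel \<Otimes>\<^sub>M lborel)"
    by measurable
  have hT: "h (case z of (w, v) \<Rightarrow> (v + w / 2, v - w / 2)) = (case z of (w, v) \<Rightarrow> F w * G v)" for z
  proof -
    obtain w v where z: "z = (w, v)" by (cases z)
    have "cosh (v + w / 2) + cosh (v - w / 2) = 2 * (cosh (w / 2) * cosh v)" by (simp add: cosh_add cosh_diff)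
    then have c: "(cosh (v + w / 2) + cosh (v - w / 2)) powr - m = 2 powr - m * (cosh (w / 2) powr - m * cosh v powr - m)"
      by (simp only: powr_mult cosh_real_nonneg)
    have "exp (\<mu> * of_real (v + w / 2) + \<kappa> * of_real (v - w / 2)) = exp ((\<mu> - \<kappa>) * of_real (w / 2)) * exp ((\<mu> + \<kappa>) * of_real v)"
    proof -
      have "\<mu> * of_real (v + w / 2) + \<kappa> * of_real (v - w / 2) = (\<mu> - \<kappa>) * of_real (w / 2) + (\<mu> + \<kappa>) * of_real v"
        by (simp add: field_simps)
      then show ?thesis by (simp only: exp_add)
    qed
    with c show ?thesis by (simp add: z h_def F_def G_def scaleR_conv_of_real)
  qed
  have h_int: "integrable (lborel \<Otimes>\<^sub>M lborel) h"
  proof -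
    have "integrable (distr (lborel \<Otimes>\<^sub>M lborel) (lborel \<Otimes>\<^sub>M lborel) (\<lambda>(w :: real, v :: real). (v + w / 2, v - w / 2))) h"
      by (subst integrable_distr_eq[OF T hm], unfold hT) (rule integrable_product_lborel(1)[OF F G])
    then show ?thesis unfolding distr_shear_half .
  qed
  have F_val: "(LBINT w. F w) = 2 powr (1 - m) *\<^sub>R sech_transform m (\<mu> - \<kappa>)"
    unfolding F_def sech_transform_def integral_scaleR_right
    using lborel_integral_real_affine[of "1/2" "\<lambda>v. exp ((\<mu> - \<kappa>) * of_real v) * of_real (cosh v powr - m)" 0]
    by (simp add: powr_diff powr_minus scaleR_conv_of_real field_simps)
  have h_val: "integral\<^sup>L (lborel \<Otimes>\<^sub>M lborel) h = 2 powr (1 - m) *\<^sub>R sech_transform m (\<mu> - \<kappa>) * sech_transform m (\<mu> + \<kappa>)"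
  proof -
    have "integral\<^sup>L (lborel \<Otimes>\<^sub>M lborel) h
       = integral\<^sup>L (distr (lborel \<Otimes>\<^sub>M lborel) (lborel \<Otimes>\<^sub>M lborel) (\<lambda>(w :: real, v :: real). (v + w / 2, v - w / 2))) h"
      unfolding distr_shear_half ..
    also have "\<dots> = (LINT z|(lborel \<Otimes>\<^sub>M lborel). (case z of (w, v) \<Rightarrow> F w * G v))"
      by (subst integral_distr[OF T hm]) (simp only: hT)
    also have "\<dots> = (LBINT w. F w) * (LBINT v. G v)" by (rule integrable_product_lborel(2)[OF F G])
    finally show ?thesis by (simp add: F_val) (simp add: G_def sech_transform_def)
  qed
  let ?C = "norm_exp_integral TYPE('m)"
  define g :: "(real \<times> real) \<times> (real ^ 'm) \<Rightarrow> complex" where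
    "g = (\<lambda>((u, v), x). exp (of_real (- (cosh u + cosh v) * norm x) + \<mu> * of_real u + \<kappa> * of_real v))"
  have gm: "g \<in> borel_measurable (lborel \<Otimes>\<^sub>M lborel)"
    unfolding g_def split_beta' by (intro borel_measurable_lborel_prod continuous_intros)
  have g_eq: "g (z, x) = exp (\<mu> * of_real (fst z) + \<kappa> * of_real (snd z)) * of_real (exp (- (cosh (fst z) + cosh (snd z)) * norm x))" for z x
    by (simp add: g_def split_beta' exp_add[symmetric] exp_of_real[symmetric] algebra_simps)
  have X: "0 < cosh (fst z) + cosh (snd z)" for z :: "real \<times> real" by (simp add: add_pos_pos)
  have g_in: "integrable lborel (\<lambda>x. g (z, x))" for z
    unfolding g_eq by (intro integrable_mult_right integrable_of_real integral_exp_neg_norm(1) X)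
  have g_val: "(LBINT x. g (z, x)) = of_real ?C * h z" for z
  proof -
    have "(LBINT x. g (z, x)) = exp (\<mu> * of_real (fst z) + \<kappa> * of_real (snd z))
        * of_real ((cosh (fst z) + cosh (snd z)) powr - m * ?C)"
      unfolding g_eq integral_mult_right_zero m_def norm_exp_integral_def
      by (subst integral_exp_neg_norm(2)[OF X, symmetric]) (simp only: integral_complex_of_real)
    then show ?thesis by (simp add: h_def split_beta')
  qed
  have g_norm: "(LBINT x. norm (g (z, x))) = ?C * cmod (h z)" for z
  proof -
    have "norm (g (z, x)) = cmod (exp (\<mu> * of_real (fst z) + \<kappa> * of_real (snd z))) * exp (- (cosh (fst z) + cosh (snd z)) * norm x)" for x
      unfolding g_eq norm_mult by simp
    then have "(LBINT x. norm (g (z, x))) = cmod (exp (\<mu> * of_real (fst z) + \<kappa> * of_real (snd z))) * ((cosh (fst z) + cosh (snd z)) powr - m * ?C)"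
      unfolding m_def norm_exp_integral_def by (simp only: integral_mult_right_zero integral_exp_neg_norm(2)[OF X])
    then show ?thesis by (simp add: h_def split_beta' norm_mult)
  qed
  \<comment> \<open>Absolute integrability reduces to that of \<open>h\<close>, because integrating
    the modulus over \<open>x\<close> gives a multiple of the modulus of \<open>h\<close>.\<close>
  have g_int: "integrable (lborel \<Otimes>\<^sub>M lborel) g"
    by (rule lborel_pair.Fubini_integrable[OF gm])
       (use h_int in \<open>simp_all add: g_norm g_in lborel_prod\<close>)
  \<comment> \<open>The origin is excluded, where the Macdonald integral diverges.\<close>
  have inner: "AE x in lborel. (LBINT z. g (z, x)) = macdonald \<mu> (norm x) * macdonald \<kappa> (norm x)"
    using AE_lborel_nonzero
  proof eventually_elim
    case (elim x)
    then have n: "0 < norm x" by simp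
    have "(\<lambda>z. g (z, x)) = (\<lambda>(u, v). exp (of_real (- norm x * cosh u) + \<mu> * of_real u) * exp (of_real (- norm x * cosh v) + \<kappa> * of_real v))"
      by (simp add: g_def fun_eq_iff split_beta' exp_add[symmetric] algebra_simps)
    then show ?case
      using integrable_product_lborel(2)[OF integrable_macdonald[OF n, of \<mu>] integrable_macdonald[OF n, of \<kappa>]]
      by (simp add: macdonald_def lborel_prod)
  qed
  have "integrable lborel (\<lambda>x. LBINT z. g (z, x))"
    by (rule lborel_pair.integrable_snd) (use g_int in simp)
  then show "integrable lborel (\<lambda>x :: real ^ 'm. macdonald \<mu> (norm x) * macdonald \<kappa> (norm x))"
    by (rule integrable_cong_AE_imp) (use inner in \<open>auto simp: eq_commute\<close>)
  have "(LBINT x :: real ^ 'm. macdonald \<mu> (norm x) * macdonald \<kappa> (norm x)) = (LBINT x. LBINT z. g (z, x))"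
    by (rule integral_cong_AE) (use inner \<open>integrable lborel (\<lambda>x. LBINT z. g (z, x))\<close> in \<open>auto simp: eq_commute\<close>)
  also have "\<dots> = (LBINT z. LBINT x. g (z, x))"
    by (rule lborel_pair.Fubini_integral) (use g_int in simp)
  also have "\<dots> = of_real ?C * (LBINT z. h z)" by (simp add: g_val)
  also have "(LBINT z. h z) = 2 powr (1 - m) *\<^sub>R sech_transform m (\<mu> - \<kappa>) * sech_transform m (\<mu> + \<kappa>)"
    using h_val by (simp add: lborel_prod)
  finally show "(LBINT x :: real ^ 'm. macdonald \<mu> (norm x) * macdonald \<kappa> (norm x))
      = of_real (2 powr (1 - m) * ?C) * sech_transform m (\<mu> + \<kappa>) * sech_transform m (\<mu> - \<kappa>)"
    by (simp add: scaleR_conv_of_real)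
qed

section \<open>Gamma and beta integrals on the whole line\<close>

lemma Gamma_log_integral:
  assumes z: "0 < Re z"
  shows "integrable lborel (\<lambda>x. exp (- of_real (exp x) + z * of_real x))"
    and "(LBINT x. exp (- of_real (exp x) + z * of_real x)) = Gamma z"
proof -
  let ?f = "\<lambda>x :: real. exp (- of_real (exp x) + z * of_real x) :: complex"
  define \<sigma> where "\<sigma> = Re z"
  have \<sigma>: "0 < \<sigma>" using z by (simp add: \<sigma>_def)
  \<comment> \<open>With \<open>n > 2 * \<sigma>\<close> the decay for positive \<open>x\<close> is
    at least that of \<open>exp (- \<sigma> * x)\<close>.\<close>
  obtain n :: nat where n: "2 * \<sigma> < real n" using reals_Archimedean2 by blast
  show int: "integrable lborel ?f"
  proof (rule Bochner_Integration.integrable_bound)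
    show "integrable lborel (\<lambda>x. (1 + fact n) * exp (- \<sigma> * \<bar>x\<bar>) :: real)"
      by (intro integrable_mult_right integrable_exp_neg_abs \<sigma>)
    have "exp (- exp x + \<sigma> * x) \<le> (1 + fact n) * exp (- \<sigma> * \<bar>x\<bar>)" for x
    proof (cases "x \<le> 0")
      case True
      then have "exp (- exp x + \<sigma> * x) \<le> 1 * exp (- \<sigma> * \<bar>x\<bar>)" by simp
      also have "\<dots> \<le> (1 + fact n) * exp (- \<sigma> * \<bar>x\<bar>)" by (intro mult_right_mono) auto
      finally show ?thesis .
    next
      case False
      have "(exp x) ^ n / fact n \<le> exp (exp x)"
        by (rule power_div_fact_le_exp) simp
      then have "exp (- exp x) \<le> fact n * exp (- real n * x)"
        by (simp add: exp_minus field_simps exp_of_nat2_mult)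
      then have "exp (- exp x) * exp (\<sigma> * x) \<le> fact n * exp (- real n * x) * exp (\<sigma> * x)"
        by (rule mult_right_mono) simp
      also have "\<dots> = fact n * exp (- (real n - \<sigma>) * x)"
        by (simp add: mult.assoc exp_add[symmetric] algebra_simps)
      also have "\<dots> \<le> (1 + fact n) * exp (- \<sigma> * \<bar>x\<bar>)"
        using False n mult_right_mono[of "\<sigma> - real n" "- \<sigma>" x] by (intro mult_mono) auto
      finally show ?thesis unfolding exp_add by simp
    qed
    then show "AE x in lborel. norm (?f x) \<le> norm ((1 + fact n) * exp (- \<sigma> * \<bar>x\<bar>))"
      by (auto simp: \<sigma>_def)
  qed (auto intro!: borel_measurable_continuous_onI continuous_intros)
  let ?G = "\<lambda>t. complex_of_real t powr (z - 1) / complex_of_real (exp t)"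
  \<comment> \<open>Euler's integrand under \<open>t = exp x\<close>, which moves the integral to
    the line, where translations and shears act.\<close>
  have f_eq: "exp x *\<^sub>R ?G (exp x) = ?f x" for x
    by (simp add: powr_def Ln_of_real scaleR_conv_of_real exp_diff exp_add exp_minus exp_of_real[symmetric] field_simps)
  have G_meas: "set_borel_measurable lborel {0<..} ?G"
  proof -
    have "continuous_on {0<..} ?G"
      by (intro continuous_intros) (auto simp: complex_nonpos_Reals_iff)
    then show ?thesis
      unfolding set_borel_measurable_def
      using borel_measurable_continuous_on_indicator[of "{0<..}" ?G] by simp
  qed
  have G_int: "set_integrable lborel {0<..} ?G"
    using absolutely_integrable_Gamma_integral'[OF z] G_meas
    unfolding set_integrable_def set_borel_measurable_def by (subst (asm) integrable_completion) auto
  have eU: "einterval (-\<infinity>) \<infinity> = UNIV" "einterval 0 \<infinity> = {0<..}"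
    by (auto simp: einterval_def zero_ereal_def)
  have "(LBINT x=0..\<infinity>. ?G x) = (LBINT x=-\<infinity>..\<infinity>. exp x *\<^sub>R ?G (exp x))"
  proof (rule interval_integral_substitution_integrable)
    show "((ereal \<circ> exp \<circ> real_of_ereal) \<longlongrightarrow> 0) (at_right (- \<infinity>))"
      unfolding o_def zero_ereal_def by (simp add: at_right_MInf filterlim_filtermap exp_at_bot)
    show "((ereal \<circ> exp \<circ> real_of_ereal) \<longlongrightarrow> \<infinity>) (at_left \<infinity>)"
      unfolding o_def by (simp add: at_left_PInf filterlim_filtermap tendsto_PInfty_eq_at_top exp_at_top)
    show "set_integrable lborel (einterval (- \<infinity>) \<infinity>) (\<lambda>x. exp x *\<^sub>R ?G (exp x))"
      unfolding eU f_eq using int by (simp add: set_integrable_def)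
    show "set_integrable lborel (einterval 0 \<infinity>) ?G" unfolding eU by (rule G_int)
    show "isCont ?G (exp x)" for x :: real
      by (intro continuous_intros) (auto simp: complex_nonpos_Reals_iff)
  qed (auto intro!: derivative_eq_intros)
  also have "\<dots> = (LBINT x. ?f x)"
    unfolding f_eq by (simp add: interval_lebesgue_integral_def eU set_lebesgue_integral_def)
  finally have "(LBINT x. ?f x) = (LBINT x:{0<..}. ?G x)"
    by (simp add: interval_lebesgue_integral_def eU)
  also have "\<dots> = integral {0<..} ?G" by (rule set_borel_integral_eq_integral(2)[OF G_int])
  also have "\<dots> = Gamma z" by (rule integral_unique[OF Gamma_integral_complex'[OF z]])
  finally show "(LBINT x. ?f x) = Gamma z" .
qed

lemma Gamma_log_integral_scaled:
  fixes c p :: real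
  assumes "0 < c" "0 < p"
  shows "(LBINT x. exp (- of_real (c * exp x) + of_real p * complex_of_real x)) = of_real (c powr - p) * Gamma (of_real p)"
proof -
  let ?g = "\<lambda>x. exp (- of_real (c * exp x) + of_real p * complex_of_real x)"
  have "(LBINT x. ?g x) = (LBINT x. ?g (x + - ln c))" by (rule integral_shift[symmetric])
  also have "\<dots> = (LBINT x. of_real (c powr - p) * exp (- of_real (exp x) + of_real p * complex_of_real x))"
  proof (rule Bochner_Integration.integral_cong[OF refl])
    fix x
    have "c * exp (x + - ln c) = exp x" using assms by (simp add: exp_diff)
    moreover have "exp (of_real p * complex_of_real (x + - ln c)) = of_real (c powr - p) * exp (of_real p * complex_of_real x)"
      using assms by (simp add: powr_def exp_of_real[symmetric] exp_add[symmetric] algebra_simps)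
    ultimately show "?g (x + - ln c) = of_real (c powr - p) * exp (- of_real (exp x) + of_real p * complex_of_real x)"
      by (simp only: exp_add mult_ac)
  qed
  also have "\<dots> = of_real (c powr - p) * Gamma (of_real p)"
    using Gamma_log_integral(2)[of "of_real p"] assms by (simp only: integral_mult_right_zero Re_complex_of_real)
  finally show ?thesis .
qed

text \<open>Euler's beta integral. In the product of two Gamma integrals the shear gives
  \<open>exp (y + d / 2) + exp (y - d / 2) = 2 * cosh (d / 2) * exp y\<close>; integrating over
  \<open>y\<close> leaves a Gamma value and a power of \<open>cosh\<close>, whose transform in
  \<open>d\<close> is \<open>sech_transform\<close>.\<close>

lemma Gamma_mult_sech_transform:
  fixes p :: real and \<alpha> :: complex
  assumes "\<bar>Re \<alpha>\<bar> < p"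
  shows "Gamma ((of_real p + \<alpha>) / 2) * Gamma ((of_real p - \<alpha>) / 2)
    = of_real (2 powr (1 - p)) * Gamma (of_real p) * sech_transform p \<alpha>"
proof -
  have p: "0 < p" using assms by linarith
  define z where "z = (of_real p + \<alpha>) / 2"
  define w where "w = (of_real p - \<alpha>) / 2"
  have zw: "0 < Re z" "0 < Re w" using assms by (auto simp: z_def w_def)
  let ?F = "\<lambda>z x. exp (- of_real (exp x) + z * complex_of_real x)"
  note iz = Gamma_log_integral[OF zw(1)] and iw = Gamma_log_integral[OF zw(2)]
  define h where "h = (\<lambda>(x :: real, y :: real). ?F z x * ?F w y)"
  have T: "(\<lambda>(w :: real, v :: real). (v + w / 2, v - w / 2)) \<in> measurable (lborel \<Otimes>\<^sub>M lborel) (lborel \<Otimes>\<^sub>M lborel)"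
    by measurable
  have h_int: "integrable (lborel \<Otimes>\<^sub>M lborel) h"
    unfolding h_def by (rule integrable_product_lborel(1)[OF iz(1) iw(1)])
  then have hm: "h \<in> borel_measurable (lborel \<Otimes>\<^sub>M lborel)" by auto
  define g where "g = (\<lambda>d y. exp (- of_real (2 * cosh (d / 2) * exp y) + of_real p * complex_of_real y) * exp (\<alpha> * of_real (d / 2)))"
  have hT: "h (case c of (d, y) \<Rightarrow> (y + d / 2, y - d / 2)) = (case c of (d, y) \<Rightarrow> g d y)" for c
  proof -
    obtain d y where c: "c = (d, y)" by (cases c)
    have "exp (y + d / 2) + exp (y - d / 2) = 2 * cosh (d / 2) * exp y"
    proof -
      have "exp (y + d / 2) = exp y * exp (d / 2)" "exp (y - d / 2) = exp y * exp (- (d / 2))"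
        by (simp_all flip: exp_add)
      then show ?thesis by (simp add: cosh_field_def algebra_simps)
    qed
    then have "complex_of_real (exp (y + d / 2)) + of_real (exp (y - d / 2)) = of_real (2 * cosh (d / 2) * exp y)"
      by (simp only: of_real_add[symmetric])
    moreover have "z * of_real (y + d / 2) + w * of_real (y - d / 2) = of_real p * of_real y + \<alpha> * of_real (d / 2)"
      by (simp add: z_def w_def field_simps)
    ultimately have "- of_real (exp (y + d / 2)) + z * of_real (y + d / 2) + (- of_real (exp (y - d / 2)) + w * of_real (y - d / 2))
      = - of_real (2 * cosh (d / 2) * exp y) + of_real p * complex_of_real y + \<alpha> * of_real (d / 2)"
      by (simp add: algebra_simps)
    then show ?thesis by (simp only: c h_def g_def prod.case exp_add[symmetric])
  qed
  have g_int: "integrable (lborel \<Otimes>\<^sub>M lborel) (\<lambda>(d, y). g d y)"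
  proof -
    have "integrable (distr (lborel \<Otimes>\<^sub>M lborel) (lborel \<Otimes>\<^sub>M lborel) (\<lambda>(w :: real, v :: real). (v + w / 2, v - w / 2))) h"
      unfolding distr_shear_half by (rule h_int)
    then show ?thesis by (subst (asm) integrable_distr_eq[OF T hm]) (simp only: hT)
  qed
  have "Gamma z * Gamma w = integral\<^sup>L (lborel \<Otimes>\<^sub>M lborel) h"
    unfolding h_def integrable_product_lborel(2)[OF iz(1) iw(1)] iz(2) iw(2) ..
  also have "\<dots> = integral\<^sup>L (distr (lborel \<Otimes>\<^sub>M lborel) (lborel \<Otimes>\<^sub>M lborel) (\<lambda>(w :: real, v :: real). (v + w / 2, v - w / 2))) h"
    unfolding distr_shear_half ..
  also have "\<dots> = integral\<^sup>L (lborel \<Otimes>\<^sub>M lborel) (\<lambda>(d, y). g d y)"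
    by (subst integral_distr[OF T hm]) (simp only: hT)
  also have "\<dots> = (LBINT d. LBINT y. g d y)"
    using lborel_pair.integral_fst'[OF g_int] by simp
  also have "\<dots> = (LBINT d. of_real (2 powr - p) * Gamma (of_real p) * (exp (\<alpha> * of_real (0 + 1 / 2 * d)) * of_real (cosh (0 + 1 / 2 * d) powr - p)))"
  proof (rule Bochner_Integration.integral_cong[OF refl])
    fix d :: real
    have "(LBINT y. g d y) = of_real ((2 * cosh (d / 2)) powr - p) * Gamma (of_real p) * exp (\<alpha> * of_real (d / 2))"
      unfolding g_def integral_mult_left_zero using p by (subst Gamma_log_integral_scaled) auto
    then show "(LBINT y. g d y) = of_real (2 powr - p) * Gamma (of_real p) * (exp (\<alpha> * of_real (0 + 1 / 2 * d)) * of_real (cosh (0 + 1 / 2 * d) powr - p))"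
      by (simp add: powr_mult)
  qed
  also have "\<dots> = of_real (2 powr - p) * Gamma (of_real p) * (2 * sech_transform p \<alpha>)"
    unfolding integral_mult_right_zero sech_transform_def
    using lborel_integral_real_affine[of "1/2" "\<lambda>v. exp (\<alpha> * of_real v) * of_real (cosh v powr - p)" 0]
    by (simp add: scaleR_conv_of_real mult.commute[of 2])
  finally show ?thesis
    by (simp add: z_def w_def powr_diff powr_minus field_simps)
qed

definition legendre_integral :: "real \<Rightarrow> complex \<Rightarrow> complex \<Rightarrow> complex" where
  "legendre_integral \<nu> s t = (LBINT y. exp (s * of_real y) * (t + of_real (cosh y)) powr - of_real \<nu>)"

section \<open>Fourier transform of a product of Macdonald functions\<close>

lemma borel_measurable_macdonald_real [measurable (raw)]:
  assumes "f \<in> borel_measurable M"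
  shows "(\<lambda>x. macdonald_real \<sigma> (f x)) \<in> borel_measurable M"
proof -
  have "(\<lambda>x. macdonald_real \<sigma> (f x)) = (\<lambda>x. Re (macdonald (of_real \<sigma>) (f x)))"
    by (simp add: macdonald_of_real)
  then show ?thesis using measurable_compose[OF borel_measurable_macdonald[OF assms] borel_measurable_Re] by simp
qed

lemma integrable_macdonald_real_sq:
  fixes \<sigma> a :: real
  assumes \<sigma>: "\<bar>\<sigma>\<bar> < real CARD('m::finite) / 2" and a: "0 < a"
  shows "integrable lborel (\<lambda>x :: real ^ 'm. (macdonald_real \<sigma> (a * norm x))\<^sup>2)"
proof -
  have "integrable lborel (\<lambda>x :: real ^ 'm. macdonald (of_real \<sigma>) (norm x) * macdonald (of_real \<sigma>) (norm x))"
    using \<sigma> by (intro macdonald_moment(1)) auto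
  then have "integrable lborel (\<lambda>x :: real ^ 'm. complex_of_real ((macdonald_real \<sigma> (norm x))\<^sup>2))"
    by (simp add: macdonald_of_real power2_eq_square)
  then have 1: "integrable lborel (\<lambda>x :: real ^ 'm. (macdonald_real \<sigma> (norm x))\<^sup>2)"
    by (simp only: complex_of_real_integrable_eq)
  have "integrable lborel (\<lambda>x :: real ^ 'm. (macdonald_real \<sigma> (norm (a *\<^sub>R x)))\<^sup>2)"
    by (subst lborel_scale(1)[OF a]) (use 1 in measurable)
  then show ?thesis using a by simp
qed

lemma integrable_macdonald_real_mult:
  fixes \<sigma> a a' :: real
  assumes \<sigma>: "\<bar>\<sigma>\<bar> < real CARD('m::finite) / 2" and a: "0 < a" "0 < a'"
  shows "integrable lborel (\<lambda>x :: real ^ 'm. macdonald_real \<sigma> (a * norm x) * macdonald_real \<sigma> (a' * norm x))"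
proof (rule Bochner_Integration.integrable_bound)
  show "integrable lborel (\<lambda>x :: real ^ 'm. (macdonald_real \<sigma> (a * norm x))\<^sup>2 + (macdonald_real \<sigma> (a' * norm x))\<^sup>2)"
    by (intro Bochner_Integration.integrable_add integrable_macdonald_real_sq \<sigma> a)
  have le: "p * q \<le> p\<^sup>2 + q\<^sup>2" if "0 \<le> p" "0 \<le> q" for p q :: real
    using sum_squares_bound[of p q] mult_nonneg_nonneg[OF that] by linarith
  show "AE x :: real ^ 'm in lborel. norm (macdonald_real \<sigma> (a * norm x) * macdonald_real \<sigma> (a' * norm x))
      \<le> norm ((macdonald_real \<sigma> (a * norm x))\<^sup>2 + (macdonald_real \<sigma> (a' * norm x))\<^sup>2)"
    by (auto simp: macdonald_real_nonneg le abs_mult)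
qed measurable

text \<open>Translating \<open>u\<close> by \<open>ln r\<close> trades \<open>cosh\<close> for an
  exponent in which \<open>r\<close> occurs only squared. With \<open>r = norm x\<close> the
  integrand becomes a Gaussian in \<open>x\<close>.\<close>

lemma macdonald_horocyclic:
  fixes a r :: real and s :: complex
  assumes a: "0 < a" and r: "0 < r"
  shows "integrable lborel (\<lambda>u. exp (of_real (- (a * (r\<^sup>2 * exp u + exp (- u)) / 2)) + s * of_real u))"
    and "(LBINT u. exp (of_real (- (a * (r\<^sup>2 * exp u + exp (- u)) / 2)) + s * of_real u))
      = exp (- s * of_real (ln r)) * macdonald s (a * r)"
proof -
  let ?f = "\<lambda>u. exp (of_real (- (a * r) * cosh u) + s * of_real u)"
  have eq: "exp (of_real (- (a * (r\<^sup>2 * exp u + exp (- u)) / 2)) + s * of_real u)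
      = exp (- s * of_real (ln r)) * ?f (u + ln r)" for u
  proof -
    have "cosh (u + ln r) = (r * exp u + exp (- u) / r) / 2"
      using r by (simp add: cosh_field_def exp_add exp_diff exp_minus divide_simps)
    then have "a * (r\<^sup>2 * exp u + exp (- u)) / 2 = (a * r) * cosh (u + ln r)"
      using r by (simp add: field_simps power2_eq_square)
    then have "of_real (- (a * (r\<^sup>2 * exp u + exp (- u)) / 2)) + s * of_real u
      = - s * of_real (ln r) + (of_real (- (a * r) * cosh (u + ln r)) + s * of_real (u + ln r))"
      by (simp add: algebra_simps)
    then show ?thesis by (simp only: exp_add)
  qed
  have i: "integrable lborel (\<lambda>u. ?f (u + ln r))"
    by (subst integrable_shift_iff[of ?f], rule integrable_macdonald) (use a r in simp)
  show "integrable lborel (\<lambda>u. exp (of_real (- (a * (r\<^sup>2 * exp u + exp (- u)) / 2)) + s * of_real u))"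
    unfolding eq by (intro integrable_mult_right i)
  show "(LBINT u. exp (of_real (- (a * (r\<^sup>2 * exp u + exp (- u)) / 2)) + s * of_real u))
      = exp (- s * of_real (ln r)) * macdonald s (a * r)"
    unfolding eq integral_mult_right_zero integral_shift[of ?f] macdonald_def ..
qed

lemma macdonald_real_horocyclic:
  fixes a r \<sigma> :: real
  assumes a: "0 < a" and r: "0 < r"
  shows "(LBINT u. exp (- (a * (r\<^sup>2 * exp u + exp (- u)) / 2) + \<sigma> * u))
      = exp (- \<sigma> * ln r) * macdonald_real \<sigma> (a * r)"
proof -
  have "complex_of_real (LBINT u. exp (- (a * (r\<^sup>2 * exp u + exp (- u)) / 2) + \<sigma> * u))
    = (LBINT u. exp (of_real (- (a * (r\<^sup>2 * exp u + exp (- u)) / 2)) + of_real \<sigma> * of_real u))"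
    by (subst integral_complex_of_real[symmetric]) (simp flip: exp_of_real)
  also have "\<dots> = exp (- of_real \<sigma> * of_real (ln r)) * macdonald (of_real \<sigma>) (a * r)"
    by (rule macdonald_horocyclic(2)[OF a r])
  also have "\<dots> = complex_of_real (exp (- \<sigma> * ln r) * macdonald_real \<sigma> (a * r))"
    by (simp add: macdonald_of_real exp_of_real[symmetric])
  finally show ?thesis by (simp only: of_real_eq_iff)
qed

text \<open>In the form of \<open>macdonald_horocyclic\<close> both factors are Gaussian in
  \<open>x\<close>, so the integral over \<open>x\<close> is a Gaussian Fourier transform. After the
  shear \<open>v = y + u\<close> the integral over \<open>u\<close> is a Gamma integral, and
  \<open>y\<close> survives as the variable of the Legendre integral.\<close>

lemma macdonald_fourier:
  fixes s :: complex and a a' :: real and b :: "real ^ 'm::finite"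
  defines "\<nu> \<equiv> real CARD('m) / 2"
  assumes s: "\<bar>Re s\<bar> < \<nu>" and a: "0 < a" "0 < a'"
  shows "(LBINT x :: real ^ 'm. macdonald s (a * norm x) * macdonald s (a' * norm x) * exp (\<i> * of_real (b \<bullet> x)))
    = of_real ((2 * pi) powr \<nu> * (a * a') powr - \<nu>) * Gamma (of_real \<nu>)
      * legendre_integral \<nu> s (of_real ((a\<^sup>2 + a'\<^sup>2 + (norm b)\<^sup>2) / (2 * a * a')))"
proof -
  define \<sigma> where "\<sigma> = Re s"
  define p where "p = (\<lambda>r u. exp (of_real (- (a * (r\<^sup>2 * exp u + exp (- u)) / 2)) + s * complex_of_real u))"
  \<comment> \<open>The second factor is taken with order \<open>- s\<close>, as
    \<open>macdonald_uminus\<close> permits; the powers of \<open>r\<close> in front of the two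
    factors then cancel.\<close>
  define q where "q = (\<lambda>r v. exp (of_real (- (a' * (r\<^sup>2 * exp v + exp (- v)) / 2)) + (- s) * complex_of_real v))"
  define g :: "(real ^ 'm) \<times> (real \<times> real) \<Rightarrow> complex" where
    "g = (\<lambda>(x, z). p (norm x) (fst z) * q (norm x) (snd z) * exp (\<i> * of_real (b \<bullet> x)))"
  have gm: "g \<in> borel_measurable (lborel \<Otimes>\<^sub>M lborel)"
    unfolding g_def p_def q_def split_beta' by (intro borel_measurable_lborel_prod continuous_intros) auto
  have np: "cmod (p r u) = exp (- (a * (r\<^sup>2 * exp u + exp (- u)) / 2) + \<sigma> * u)" for r u
    by (simp add: p_def \<sigma>_def)
  have nq: "cmod (q r v) = exp (- (a' * (r\<^sup>2 * exp v + exp (- v)) / 2) + (- \<sigma>) * v)" for r v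
    by (simp add: q_def \<sigma>_def)
  have pq: "integrable lborel (p r)" "integrable lborel (q r)"
    "(LBINT u. p r u) = exp (- s * of_real (ln r)) * macdonald s (a * r)"
    "(LBINT u. q r u) = exp (s * of_real (ln r)) * macdonald s (a' * r)"
    "(LBINT u. cmod (p r u)) = exp (- \<sigma> * ln r) * macdonald_real \<sigma> (a * r)"
    "(LBINT u. cmod (q r u)) = exp (\<sigma> * ln r) * macdonald_real \<sigma> (a' * r)" if r: "0 < r" for r
  proof -
    have mu: "macdonald_real (- \<sigma>) (a' * r) = macdonald_real \<sigma> (a' * r)"
      using macdonald_uminus[of "of_real \<sigma>" "a' * r"] macdonald_of_real[of \<sigma>] macdonald_of_real[of "- \<sigma>"]
      by (metis of_real_eq_iff of_real_minus)
    show "integrable lborel (p r)" unfolding p_def by (rule macdonald_horocyclic(1)[OF a(1) r])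
    show "integrable lborel (q r)" unfolding q_def by (rule macdonald_horocyclic(1)[OF a(2) r])
    show "(LBINT u. p r u) = exp (- s * of_real (ln r)) * macdonald s (a * r)"
      unfolding p_def by (rule macdonald_horocyclic(2)[OF a(1) r])
    show "(LBINT u. q r u) = exp (s * of_real (ln r)) * macdonald s (a' * r)"
      unfolding q_def macdonald_horocyclic(2)[OF a(2) r] by (simp add: macdonald_uminus)
    show "(LBINT u. cmod (p r u)) = exp (- \<sigma> * ln r) * macdonald_real \<sigma> (a * r)"
      unfolding np by (rule macdonald_real_horocyclic[OF a(1) r])
    show "(LBINT u. cmod (q r u)) = exp (\<sigma> * ln r) * macdonald_real \<sigma> (a' * r)"
      unfolding nq macdonald_real_horocyclic[OF a(2) r] mu by simp
  qed
  have inner: "integrable lborel (\<lambda>z. g (x, z))"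
      "(LBINT z. g (x, z)) = macdonald s (a * norm x) * macdonald s (a' * norm x) * exp (\<i> * of_real (b \<bullet> x))"
      "(LBINT z. norm (g (x, z))) = macdonald_real \<sigma> (a * norm x) * macdonald_real \<sigma> (a' * norm x)"
    if x: "x \<noteq> 0" for x
  proof -
    have r: "0 < norm x" using x by simp
    note i = integrable_product_lborel[OF pq(1,2)[OF r]]
    have eq: "(\<lambda>z. g (x, z)) = (\<lambda>z. (case z of (u, v) \<Rightarrow> p (norm x) u * q (norm x) v) * exp (\<i> * of_real (b \<bullet> x)))"
      by (simp add: g_def fun_eq_iff split_beta')
    show "integrable lborel (\<lambda>z. g (x, z))"
      unfolding eq using i(1) by (intro integrable_mult_left) (simp add: lborel_prod)
    have "(LBINT z. g (x, z)) = (LBINT u. p (norm x) u) * (LBINT u. q (norm x) u) * exp (\<i> * of_real (b \<bullet> x))"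
      unfolding eq integral_mult_left_zero using i(2) by (simp add: lborel_prod)
    then show "(LBINT z. g (x, z)) = macdonald s (a * norm x) * macdonald s (a' * norm x) * exp (\<i> * of_real (b \<bullet> x))"
      by (simp add: pq[OF r] exp_minus field_simps)
    have j: "integrable lborel (\<lambda>u. complex_of_real (cmod (p (norm x) u)))" "integrable lborel (\<lambda>u. complex_of_real (cmod (q (norm x) u)))"
      using pq(1,2)[OF r] by (auto intro!: integrable_of_real integrable_norm)
    have "complex_of_real (LBINT z. norm (g (x, z)))
        = (LBINT z. (case z of (u, v) \<Rightarrow> complex_of_real (cmod (p (norm x) u)) * complex_of_real (cmod (q (norm x) v))))"
      by (subst integral_complex_of_real[symmetric]) (simp add: g_def norm_mult split_beta')
    also have "\<dots> = complex_of_real ((LBINT u. cmod (p (norm x) u)) * (LBINT u. cmod (q (norm x) u)))"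
      using integrable_product_lborel(2)[OF j] by (simp add: lborel_prod)
    finally have "(LBINT z. norm (g (x, z))) = (LBINT u. cmod (p (norm x) u)) * (LBINT u. cmod (q (norm x) u))"
      by (simp only: of_real_eq_iff)
    then show "(LBINT z. norm (g (x, z))) = macdonald_real \<sigma> (a * norm x) * macdonald_real \<sigma> (a' * norm x)"
      by (simp add: pq[OF r] exp_minus field_simps)
  qed
  have AEn: "AE x in lborel. (x :: real ^ 'm) \<noteq> 0" by (rule AE_lborel_nonzero)
  \<comment> \<open>Integrating the modulus gives a product of two Macdonald functions of real
    order, both square integrable.\<close>
  have gi: "integrable (lborel \<Otimes>\<^sub>M lborel) g"
  proof (rule lborel_pair.Fubini_integrable[OF gm])
    have "integrable lborel (\<lambda>x :: real ^ 'm. macdonald_real \<sigma> (a * norm x) * macdonald_real \<sigma> (a' * norm x))"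
      using s by (intro integrable_macdonald_real_mult a) (simp add: \<sigma>_def \<nu>_def)
    then show "integrable lborel (\<lambda>x. LBINT z. norm (g (x, z)))"
    proof (rule integrable_cong_AE_imp)
      show "(\<lambda>x. LBINT z. norm (g (x, z))) \<in> borel_measurable lborel"
        by (rule lborel.borel_measurable_lebesgue_integral) (use gm in \<open>simp add: borel_measurable_norm\<close>)
      show "AE x in lborel. macdonald_real \<sigma> (a * norm x) * macdonald_real \<sigma> (a' * norm x) = (LBINT z. norm (g (x, z)))"
        using AEn by eventually_elim (simp add: inner)
    qed
    show "AE x in lborel. integrable lborel (\<lambda>z. g (x, z))"
      using AEn by eventually_elim (rule inner)
  qed
  define W :: "real \<times> real \<Rightarrow> complex" where "W = (\<lambda>z. LBINT x. g (x, z))"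
  have Wi: "integrable (lborel \<Otimes>\<^sub>M lborel) W"
    unfolding W_def lborel_prod by (rule lborel_pair.integrable_snd) (use gi in simp)
  have "(LBINT x :: real ^ 'm. macdonald s (a * norm x) * macdonald s (a' * norm x) * exp (\<i> * of_real (b \<bullet> x)))
      = (LBINT x. LBINT z. g (x, z))"
  proof (rule integral_cong_AE)
    show "(\<lambda>x. LBINT z. g (x, z)) \<in> borel_measurable lborel"
      by (rule lborel.borel_measurable_lebesgue_integral) (use gm in simp)
    show "AE x in lborel. macdonald s (a * norm x) * macdonald s (a' * norm x) * exp (\<i> * of_real (b \<bullet> x)) = (LBINT z. g (x, z))"
      using AEn by eventually_elim (simp add: inner)
  qed measurable
  also have "\<dots> = (LBINT z. W z)"
    unfolding W_def by (rule lborel_pair.Fubini_integral[symmetric]) (use gi in simp)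
  also have "\<dots> = integral\<^sup>L (distr (lborel \<Otimes>\<^sub>M lborel) (lborel \<Otimes>\<^sub>M lborel) (\<lambda>(u :: real, y :: real). (u, y + u))) W"
    unfolding distr_shear by (simp add: lborel_prod)
  also have "\<dots> = integral\<^sup>L (lborel \<Otimes>\<^sub>M lborel) (\<lambda>(u, y). W (u, y + u))"
    using Wi by (subst integral_distr) (auto simp: split_beta')
  also have "\<dots> = (LBINT y. LBINT u. W (u, y + u))"
  proof -
    have "integrable (distr (lborel \<Otimes>\<^sub>M lborel) (lborel \<Otimes>\<^sub>M lborel) (\<lambda>(u :: real, y :: real). (u, y + u))) W"
      unfolding distr_shear by (rule Wi)
    then have i: "integrable (lborel \<Otimes>\<^sub>M lborel) (\<lambda>(u, y). W (u, y + u))"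
      using Wi by (subst (asm) integrable_distr_eq) (auto simp: split_beta')
    show ?thesis
      using lborel_pair.integral_fst'[OF i] lborel_pair.Fubini_integral[OF i] by simp
  qed
  also have "\<dots> = (LBINT y. of_real ((2 * pi) powr \<nu> * (a * a') powr - \<nu>) * Gamma (of_real \<nu>)
      * (exp (- s * of_real y) * (of_real ((a\<^sup>2 + a'\<^sup>2 + (norm b)\<^sup>2) / (2 * a * a')) + of_real (cosh y)) powr - of_real \<nu>))"
  proof (rule Bochner_Integration.integral_cong[OF refl])
    fix y :: real
    define D where "D = a + a' * exp y"
    define B where "B = (norm b)\<^sup>2 / (2 * D) + (a + a' * exp (- y)) / 2"
    have D: "0 < D" unfolding D_def using a by (simp add: add_pos_pos)
    have B: "0 < B" unfolding B_def using a D by (intro add_nonneg_pos divide_pos_pos add_pos_pos) auto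
    \<comment> \<open>The Gaussian integral contributes a power of \<open>D\<close>, the Gamma
      integral the same power of \<open>B\<close>; together they form the kernel of the Legendre
      integral.\<close>
    have DB: "D * B = (a * a') * ((a\<^sup>2 + a'\<^sup>2 + (norm b)\<^sup>2) / (2 * a * a') + cosh y)"
    proof -
      have "exp y * exp (- y) = 1" by (simp flip: exp_add)
      then have "(a + a' * exp y) * (a + a' * exp (- y)) = a\<^sup>2 + a'\<^sup>2 + a * a' * (exp y + exp (- y))"
        by (simp add: algebra_simps power2_eq_square)
      moreover have "D * B = (norm b)\<^sup>2 / 2 + D * (a + a' * exp (- y)) / 2"
        using D by (simp add: B_def distrib_left)
      ultimately have "D * B = (norm b)\<^sup>2 / 2 + (a\<^sup>2 + a'\<^sup>2 + a * a' * (exp y + exp (- y))) / 2"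
        by (simp add: D_def)
      moreover have "(a * a') * ((a\<^sup>2 + a'\<^sup>2 + (norm b)\<^sup>2) / (2 * a * a') + cosh y)
          = (norm b)\<^sup>2 / 2 + (a\<^sup>2 + a'\<^sup>2 + a * a' * (exp y + exp (- y))) / 2"
        using a by (simp add: cosh_field_def field_simps)
      ultimately show ?thesis by simp
    qed
    have Wval: "W (u, y + u) = of_real ((2 * pi / D) powr \<nu>) * exp (- s * of_real y)
        * exp (- of_real (B * exp (- u)) + of_real \<nu> * complex_of_real (- u))" for u
    proof -
      define A where "A = a * exp u + a' * exp (y + u)"
      have A: "0 < A" "A = exp u * D" using a by (auto simp: A_def D_def exp_add algebra_simps intro: add_pos_pos)
      define E where "E = exp (of_real (- ((a * exp (- u) + a' * exp (- (y + u))) / 2)) - s * complex_of_real y)"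
      have "g (x, (u, y + u)) = E * (complex_of_real (exp (- A * (norm x)\<^sup>2 / 2)) * exp (\<i> * of_real (b \<bullet> x)))" for x
        by (simp add: g_def p_def q_def E_def A_def exp_add[symmetric] exp_of_real[symmetric] algebra_simps add_divide_distrib diff_divide_distrib)
      then have "W (u, y + u) = E * of_real ((2 * pi / A) powr \<nu> * exp (- (norm b)\<^sup>2 / (2 * A)))"
        unfolding W_def by (simp only: integral_mult_right_zero gaussian_fourier(2)[OF A(1)] \<nu>_def)
      also have "(2 * pi / A) powr \<nu> = (2 * pi / D) powr \<nu> * exp (- \<nu> * u)"
        using D by (simp add: A powr_def ln_mult ln_div exp_add[symmetric] algebra_simps)
      also have "exp (- (norm b)\<^sup>2 / (2 * A)) = exp (- exp (- u) * ((norm b)\<^sup>2 / (2 * D)))"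
        using D by (simp add: A exp_minus field_simps)
      finally have "W (u, y + u) = of_real ((2 * pi / D) powr \<nu>) * (E * exp (of_real (- \<nu> * u)) * exp (of_real (- exp (- u) * ((norm b)\<^sup>2 / (2 * D)))))"
        unfolding exp_of_real by (simp only: of_real_mult mult_ac)
      also have "E * exp (of_real (- \<nu> * u)) * exp (of_real (- exp (- u) * ((norm b)\<^sup>2 / (2 * D))))
          = exp (- s * of_real y) * exp (- of_real (B * exp (- u)) + of_real \<nu> * complex_of_real (- u))"
      proof -
        have "exp (- (y + u)) = exp (- u) * exp (- y)" by (simp flip: exp_add)
        then have "(a * exp (- u) + a' * exp (- (y + u))) / 2 + exp (- u) * ((norm b)\<^sup>2 / (2 * D)) = B * exp (- u)"
          by (simp add: B_def algebra_simps add_divide_distrib)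
        then have K: "complex_of_real (- ((a * exp (- u) + a' * exp (- (y + u))) / 2)) + of_real (- exp (- u) * ((norm b)\<^sup>2 / (2 * D))) = of_real (- (B * exp (- u)))"
          by (simp only: of_real_add[symmetric] of_real_eq_iff)
        have shuffle: "X - s * complex_of_real y + N + Y = (X + Y) + N + - s * of_real y" for X Y N
          by simp
        have "of_real (- ((a * exp (- u) + a' * exp (- (y + u))) / 2)) - s * complex_of_real y
           + of_real (- \<nu> * u) + of_real (- exp (- u) * ((norm b)\<^sup>2 / (2 * D)))
           = - s * of_real y + (- of_real (B * exp (- u)) + of_real \<nu> * complex_of_real (- u))"
          unfolding shuffle K by simp
        then show ?thesis unfolding E_def by (simp only: exp_add[symmetric])
      qed
      finally show ?thesis by (simp only: mult.assoc)
    qed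
    have "(LBINT u. exp (- of_real (B * exp (- u)) + of_real \<nu> * complex_of_real (- u)))
        = (LBINT u. exp (- of_real (B * exp u) + of_real \<nu> * complex_of_real u))"
      using lborel_integral_real_affine[of "-1" "\<lambda>u. exp (- of_real (B * exp u) + of_real \<nu> * complex_of_real u)" 0] by simp
    also have "\<dots> = of_real (B powr - \<nu>) * Gamma (of_real \<nu>)"
      by (rule Gamma_log_integral_scaled[OF B]) (simp add: \<nu>_def)
    finally have "(LBINT u. W (u, y + u)) = of_real ((2 * pi / D) powr \<nu>) * exp (- s * of_real y) * (of_real (B powr - \<nu>) * Gamma (of_real \<nu>))"
      by (simp only: Wval integral_mult_right_zero)
    also have "\<dots> = of_real ((2 * pi / D) powr \<nu> * B powr - \<nu>) * Gamma (of_real \<nu>) * exp (- s * of_real y)" by simp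
    also have "(2 * pi / D) powr \<nu> * B powr - \<nu> = (2 * pi) powr \<nu> * (D * B) powr - \<nu>"
      using D B by (simp add: powr_divide powr_mult powr_minus field_simps)
    also have "\<dots> = (2 * pi) powr \<nu> * (a * a') powr - \<nu> * ((a\<^sup>2 + a'\<^sup>2 + (norm b)\<^sup>2) / (2 * a * a') + cosh y) powr - \<nu>"
      using a by (simp add: DB powr_mult add_nonneg_nonneg)
    finally have "(LBINT u. W (u, y + u)) = of_real ((2 * pi) powr \<nu> * (a * a') powr - \<nu> * ((a\<^sup>2 + a'\<^sup>2 + (norm b)\<^sup>2) / (2 * a * a') + cosh y) powr - \<nu>) * Gamma (of_real \<nu>) * exp (- s * of_real y)" .
    moreover have "complex_of_real (((a\<^sup>2 + a'\<^sup>2 + (norm b)\<^sup>2) / (2 * a * a') + cosh y) powr - \<nu>)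
        = (of_real ((a\<^sup>2 + a'\<^sup>2 + (norm b)\<^sup>2) / (2 * a * a')) + of_real (cosh y)) powr - of_real \<nu>"
    proof -
      have "0 \<le> (a\<^sup>2 + a'\<^sup>2 + (norm b)\<^sup>2) / (2 * a * a') + cosh y" using a by (intro add_nonneg_nonneg divide_nonneg_nonneg) auto
      from powr_of_real[OF this, of "- \<nu>"] show ?thesis by (simp only: of_real_add of_real_minus)
    qed
    ultimately show "(LBINT u. W (u, y + u)) = of_real ((2 * pi) powr \<nu> * (a * a') powr - \<nu>) * Gamma (of_real \<nu>)
      * (exp (- s * of_real y) * (of_real ((a\<^sup>2 + a'\<^sup>2 + (norm b)\<^sup>2) / (2 * a * a')) + of_real (cosh y)) powr - of_real \<nu>)"
      by (simp only: of_real_mult mult_ac)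
  qed
  also have "\<dots> = of_real ((2 * pi) powr \<nu> * (a * a') powr - \<nu>) * Gamma (of_real \<nu>)
      * legendre_integral \<nu> s (of_real ((a\<^sup>2 + a'\<^sup>2 + (norm b)\<^sup>2) / (2 * a * a')))"
    unfolding integral_mult_right_zero legendre_integral_def
    using lborel_integral_real_affine[of "-1" "\<lambda>y. exp (s * of_real y) * (of_real ((a\<^sup>2 + a'\<^sup>2 + (norm b)\<^sup>2) / (2 * a * a')) + of_real (cosh y)) powr - of_real \<nu>" 0]
    by simp
  finally show ?thesis .
qed

section \<open>Integral representation of the hypergeometric function\<close>

text \<open>On the convex set \<open>S\<close> the mean value inequality bounds all difference
  quotients by \<open>g\<close>, so dominated convergence applies along every sequence tending to
  \<open>t\<close>.\<close>

lemma has_field_derivative_integral: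
  fixes f f' :: "complex \<Rightarrow> 'a \<Rightarrow> complex"
  assumes S: "open S" "convex S" and t: "t \<in> S"
    and f: "\<And>z. z \<in> S \<Longrightarrow> integrable M (f z)"
    and f': "\<And>z x. z \<in> S \<Longrightarrow> ((\<lambda>z. f z x) has_field_derivative f' z x) (at z)"
    and le: "\<And>z x. z \<in> S \<Longrightarrow> cmod (f' z x) \<le> g x" and g: "integrable M g"
    and meas: "f' t \<in> borel_measurable M"
  shows "((\<lambda>z. integral\<^sup>L M (f z)) has_field_derivative integral\<^sup>L M (f' t)) (at t)"
  unfolding has_field_derivative_iff tendsto_at_iff_sequentially
proof (intro allI impI)
  fix X :: "nat \<Rightarrow> complex"
  assume X: "\<forall>i. X i \<in> UNIV - {t}" and lim: "X \<longlonglongrightarrow> t"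
  \<comment> \<open>Finitely many terms of the sequence may lie outside \<open>S\<close>; a shift of
    the index discards them.\<close>
  obtain N where N: "\<And>n. n \<ge> N \<Longrightarrow> X n \<in> S"
    using topological_tendstoD[OF lim S(1) t] by (auto simp: eventually_sequentially)
  define Y where "Y = (\<lambda>n. X (n + N))"
  have Y: "Y n \<in> S" "Y n \<noteq> t" for n using N X by (auto simp: Y_def)
  have Ylim: "Y \<longlonglongrightarrow> t" unfolding Y_def by (rule LIMSEQ_ignore_initial_segment[OF lim])
  define d where "d = (\<lambda>n x. (f (Y n) x - f t x) / (Y n - t))"
  have "(\<lambda>n. integral\<^sup>L M (d n)) \<longlonglongrightarrow> integral\<^sup>L M (f' t)"
  proof (rule integral_dominated_convergence[OF meas _ g])
    show "d n \<in> borel_measurable M" for n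
      using f[OF Y(1)[of n]] f[OF t] unfolding d_def by (auto intro!: borel_measurable_divide borel_measurable_diff)
    have "(\<lambda>n. d n x) \<longlonglongrightarrow> f' t x" for x
    proof -
      have "((\<lambda>z. (f z x - f t x) / (z - t)) \<longlongrightarrow> f' t x) (at t)"
        using f'[OF t] by (simp add: has_field_derivative_iff)
      then show ?thesis unfolding d_def tendsto_at_iff_sequentially using Y Ylim by (auto simp: o_def)
    qed
    then show "AE x in M. (\<lambda>n. d n x) \<longlonglongrightarrow> f' t x" by simp
    have "cmod (d n x) \<le> g x" for n x
    proof -
      have "cmod (f (Y n) x - f t x) \<le> g x * cmod (Y n - t)"
        by (rule field_differentiable_bound[OF S(2), of "\<lambda>z. f z x" "\<lambda>z. f' z x"])
           (use f' le Y t in \<open>auto intro: has_field_derivative_at_within\<close>)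
      then show ?thesis using Y(2)[of n] by (simp add: d_def norm_divide divide_le_eq)
    qed
    then show "AE x in M. norm (d n x) \<le> g x" for n by simp
  qed
  moreover have "integral\<^sup>L M (d n) = (integral\<^sup>L M (f (Y n)) - integral\<^sup>L M (f t)) / (Y n - t)" for n
    unfolding d_def using f[OF Y(1)] f[OF t] by simp
  ultimately have "(\<lambda>n. (integral\<^sup>L M (f (X (n + N))) - integral\<^sup>L M (f t)) / (X (n + N) - t)) \<longlonglongrightarrow> integral\<^sup>L M (f' t)"
    by (simp add: Y_def)
  then show "((\<lambda>y. (integral\<^sup>L M (f y) - integral\<^sup>L M (f t)) / (y - t)) \<circ> X) \<longlonglongrightarrow> integral\<^sup>L M (f' t)"
    unfolding o_def by (rule LIMSEQ_offset)
qed

text \<open>Integration by parts without boundary terms, since \<open>F\<close> vanishes at both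
  ends of the line.\<close>

lemma integral_derivative_eq_0:
  fixes F f :: "real \<Rightarrow> complex"
  assumes F: "\<And>x. (F has_vector_derivative f x) (at x)" and cont: "continuous_on UNIV f"
    and int: "integrable lborel f" and c: "0 < c" and bound: "\<And>x. cmod (F x) \<le> C * exp (- c * \<bar>x\<bar>)"
  shows "(LBINT x. f x) = 0"
proof -
  have eU: "einterval (-\<infinity>) \<infinity> = UNIV" by (auto simp: einterval_def)
  have 1: "(F \<longlongrightarrow> 0) at_top"
  proof (rule Lim_null_comparison)
    show "eventually (\<lambda>x. norm (F x) \<le> C * exp (- c * \<bar>x\<bar>)) at_top"
      by (intro always_eventually allI bound)
    show "((\<lambda>x. C * exp (- c * \<bar>x\<bar>)) \<longlongrightarrow> 0) at_top" using c by real_asymp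
  qed
  have 2: "(F \<longlongrightarrow> 0) at_bot"
  proof (rule Lim_null_comparison)
    show "eventually (\<lambda>x. norm (F x) \<le> C * exp (- c * \<bar>x\<bar>)) at_bot"
      by (intro always_eventually allI bound)
    show "((\<lambda>x. C * exp (- c * \<bar>x\<bar>)) \<longlongrightarrow> 0) at_bot" using c by real_asymp
  qed
  have "(LBINT x=-\<infinity>..\<infinity>. f x) = 0 - 0"
  proof (rule interval_integral_FTC_integrable)
    show "((F \<circ> real_of_ereal) \<longlongrightarrow> 0) (at_right (- \<infinity>))"
      using 2 by (simp add: at_right_MInf filterlim_filtermap o_def)
    show "((F \<circ> real_of_ereal) \<longlongrightarrow> 0) (at_left \<infinity>)"
      using 1 by (simp add: at_left_PInf filterlim_filtermap o_def)
    show "isCont f x" for x using cont by (simp add: continuous_on_eq_continuous_at)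
    show "set_integrable lborel (einterval (- \<infinity>) \<infinity>) f" unfolding eU using int by (simp add: set_integrable_def)
  qed (auto simp: F)
  then show ?thesis by (simp add: interval_lebesgue_integral_def eU set_lebesgue_integral_def)
qed

section \<open>The Legendre integral and its differential equation\<close>

lemma cmod_powr_of_real: "z \<noteq> 0 \<Longrightarrow> cmod (z powr of_real x) = cmod z powr x"
  by (simp add: powr_def)

lemma Re_add_cosh_pos: "0 < Re t \<Longrightarrow> 0 < Re (t + of_real (cosh y))"
  by (simp add: add_pos_pos)

lemma add_cosh_nonzero: "0 < Re t \<Longrightarrow> t + of_real (cosh y) \<noteq> 0"
  using Re_add_cosh_pos[of t y] by (metis less_irrefl zero_complex.sel(1))

lemma add_cosh_not_nonpos: "0 < Re t \<Longrightarrow> t + of_real (cosh y) \<notin> \<real>\<^sub>\<le>\<^sub>0"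
  using Re_add_cosh_pos[of t y] by (auto simp: complex_nonpos_Reals_iff)

text \<open>The modulus of \<open>t + cosh y\<close> is at least its real part, which exceeds
  \<open>cosh y\<close>. The bound is uniform in \<open>t\<close> over the half plane, as
  differentiation under the integral requires.\<close>

lemma legendre_kernel_bound:
  assumes t: "0 < Re t" and \<nu>: "0 \<le> \<nu>"
  shows "cmod ((t + of_real (cosh y)) powr - of_real \<nu>) \<le> cosh y powr - \<nu>"
proof -
  have "cosh y \<le> Re (t + of_real (cosh y))" using t by simp
  also have "\<dots> \<le> cmod (t + of_real (cosh y))" by (rule complex_Re_le_cmod)
  finally have "cmod (t + of_real (cosh y)) powr - \<nu> \<le> cosh y powr - \<nu>"
    using \<nu> by (intro powr_mono2') auto
  then show ?thesis using cmod_powr_of_real[OF add_cosh_nonzero[OF t], of y "- \<nu>"] by simp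
qed

lemma continuous_on_legendre_kernel:
  assumes t: "0 < Re t"
  shows "continuous_on UNIV (\<lambda>y. exp (s * of_real y) * (t + of_real (cosh y)) powr - of_real \<nu>)"
  by (intro continuous_intros) (use less_imp_le[OF Re_add_cosh_pos[OF t]] add_cosh_nonzero[OF t] in auto)

lemma legendre_kernel_norm:
  assumes t: "0 < Re t" and \<nu>: "0 \<le> \<nu>"
  shows "cmod (exp (s * of_real y) * (t + of_real (cosh y)) powr - of_real \<nu>) \<le> exp (Re s * y) * cosh y powr - \<nu>"
  using legendre_kernel_bound[OF t \<nu>, of y] by (simp add: norm_mult mult_left_mono)

lemma integrable_legendre_kernel:
  assumes t: "0 < Re t" and s: "\<bar>Re s\<bar> < \<nu>"
  shows "integrable lborel (\<lambda>y. exp (s * of_real y) * (t + of_real (cosh y)) powr - of_real \<nu>)"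
proof (rule Bochner_Integration.integrable_bound[OF integrable_exp_cosh_powr[OF s]])
  show "(\<lambda>y. exp (s * of_real y) * (t + of_real (cosh y)) powr - of_real \<nu>) \<in> borel_measurable lborel"
    using borel_measurable_continuous_onI[OF continuous_on_legendre_kernel[OF t]] by simp
  show "AE y in lborel. norm (exp (s * of_real y) * (t + of_real (cosh y)) powr - of_real \<nu>) \<le> norm (exp (Re s * y) * cosh y powr - \<nu>)"
    using legendre_kernel_norm[OF t, of \<nu> s] s by auto
qed

lemma legendre_kernel_derivative:
  assumes t: "0 < Re t"
  shows "((\<lambda>z. (z + of_real (cosh y)) powr - of_real \<nu>) has_field_derivative
    - of_real \<nu> * (t + of_real (cosh y)) powr - of_real (\<nu> + 1)) (at t)"
proof -
  have "((\<lambda>z. (z + of_real (cosh y)) powr - of_real \<nu>) has_field_derivative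
     - of_real \<nu> * (t + of_real (cosh y)) powr (- of_real \<nu> - 1) * (1 + 0)) (at t)"
    by (intro DERIV_chain2[where f = "\<lambda>w. w powr _"] has_field_derivative_powr DERIV_add DERIV_ident DERIV_const add_cosh_not_nonpos[OF t])
  then show ?thesis by simp
qed

lemma legendre_integral_derivative:
  assumes t: "0 < Re t" and s: "\<bar>Re s\<bar> < \<nu>"
  shows "(legendre_integral \<nu> s has_field_derivative - of_real \<nu> * legendre_integral (\<nu> + 1) s t) (at t)"
proof -
  let ?f = "\<lambda>t y. exp (s * of_real y) * (t + of_real (cosh y)) powr - of_real \<nu>"
  let ?f' = "\<lambda>t y. - of_real \<nu> * (exp (s * of_real y) * (t + of_real (cosh y)) powr - of_real (\<nu> + 1))"
  let ?S = "{z. 0 < Re z}"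
  have "((\<lambda>t. LBINT y. ?f t y) has_field_derivative (LBINT y. ?f' t y)) (at t)"
  proof (rule has_field_derivative_integral[of ?S])
    show "open ?S" by (simp add: open_halfspace_Re_gt)
    show "convex ?S" by (simp add: convex_halfspace_Re_gt)
    show "integrable lborel (\<lambda>y. \<nu> * (exp (Re s * y) * cosh y powr - (\<nu> + 1)))"
      using s by (intro integrable_mult_right integrable_exp_cosh_powr) simp
    show "?f' t \<in> borel_measurable lborel"
      using borel_measurable_continuous_onI[OF continuous_on_legendre_kernel[OF t, of s "\<nu> + 1"]] by simp
    fix z assume "z \<in> ?S"
    then have z: "0 < Re z" by simp
    show "integrable lborel (?f z)" by (rule integrable_legendre_kernel[OF z s])
    show "((\<lambda>z. ?f z y) has_field_derivative ?f' z y) (at z)" for y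
      using DERIV_cmult[OF legendre_kernel_derivative[OF z, of y \<nu>], of "exp (s * of_real y)"]
      by (simp only: mult_ac)
    show "cmod (?f' z y) \<le> \<nu> * (exp (Re s * y) * cosh y powr - (\<nu> + 1))" for y
      using mult_left_mono[OF legendre_kernel_norm[OF z, of "\<nu> + 1" s y], of \<nu>] s
      unfolding norm_mult[of "- of_real \<nu>"] by simp
  qed (use t in simp)
  then show ?thesis unfolding legendre_integral_def[abs_def] by (simp only: integral_mult_right_zero)
qed

text \<open>The Gegenbauer equation in \<open>t\<close>, written with the integrals for
  \<open>\<nu> + 1\<close> and \<open>\<nu> + 2\<close>, which are the first two derivatives up to
  factors. Two integrations by parts in \<open>y\<close> produce it, \<open>exp (s * y)\<close>
  being an eigenfunction of the second derivative with eigenvalue \<open>s\<^sup>2\<close>.\<close>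

lemma legendre_ode:
  assumes t: "0 < Re t" and s: "\<bar>Re s\<bar> < \<nu>"
  shows "of_real (\<nu> * (\<nu> + 1)) * (1 - t\<^sup>2) * legendre_integral (\<nu> + 2) s t
    + of_real (\<nu> * (2 * \<nu> + 1)) * t * legendre_integral (\<nu> + 1) s t
    - (of_real (\<nu>\<^sup>2) - s\<^sup>2) * legendre_integral \<nu> s t = 0"
proof -
  have \<nu>: "0 < \<nu>" using s by linarith
  define D where "D = (\<lambda>y :: real. t + of_real (cosh y))"
  define k where "k = (\<lambda>p y. exp (s * of_real y) * D y powr - of_real p)"
  have kder: "((\<lambda>y. k p y) has_vector_derivative s * k p y - of_real p * of_real (sinh y) * k (p + 1) y) (at y)" for p y
  proof -
    have D': "(D has_vector_derivative of_real (sinh y)) (at y)"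
      unfolding D_def by (auto intro!: derivative_eq_intros has_vector_derivative_of_real)
    have 1: "((\<lambda>y. D y powr - of_real p) has_vector_derivative of_real (sinh y) * (- of_real p * D y powr - of_real (p + 1))) (at y)"
    proof -
      have "((\<lambda>w. w powr - of_real p) has_field_derivative - of_real p * D y powr (- of_real p - 1)) (at (D y))"
        by (rule has_field_derivative_powr) (unfold D_def, rule add_cosh_not_nonpos[OF t])
      then have "((\<lambda>w. w powr - of_real p) has_field_derivative - of_real p * D y powr - of_real (p + 1)) (at (D y))"
        by simp
      from field_vector_diff_chain_at[OF D' this] show ?thesis by (simp add: o_def)
    qed
    have 2: "((\<lambda>y. exp (s * complex_of_real y)) has_vector_derivative s * exp (s * of_real y)) (at y)"
    proof -
      have "((\<lambda>y. s * complex_of_real y) has_vector_derivative s * 1) (at y)"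
        by (auto intro!: derivative_eq_intros has_vector_derivative_of_real)
      from field_vector_diff_chain_at[OF this DERIV_exp] show ?thesis by (simp add: o_def)
    qed
    from has_vector_derivative_mult[OF 2 1] show ?thesis
      by (simp add: k_def algebra_simps)
  qed
  \<comment> \<open>With \<open>E = D powr - \<nu>\<close> this is
    \<open>exp (s * y) * (E' - s * E)\<close>, whose derivative is
    \<open>exp (s * y) * (E'' - s\<^sup>2 * E)\<close>.\<close>
  define F where "F = (\<lambda>y. - of_real \<nu> * (of_real (sinh y) * k (\<nu> + 1) y) - s * k \<nu> y)"
  define f where "f = (\<lambda>y. of_real (\<nu> * (\<nu> + 1)) * (of_real (sinh y))\<^sup>2 * k (\<nu> + 2) y
      - of_real \<nu> * of_real (cosh y) * k (\<nu> + 1) y - s\<^sup>2 * k \<nu> y)"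
  have Fder: "(F has_vector_derivative f y) (at y)" for y
  proof -
    have sh: "((\<lambda>y. complex_of_real (sinh y)) has_vector_derivative of_real (cosh y)) (at y)"
      by (auto intro!: derivative_eq_intros has_vector_derivative_of_real)
    have "(F has_vector_derivative - of_real \<nu> * (of_real (sinh y) * (s * k (\<nu> + 1) y - of_real (\<nu> + 1) * of_real (sinh y) * k (\<nu> + 1 + 1) y)
        + of_real (cosh y) * k (\<nu> + 1) y) - s * (s * k \<nu> y - of_real \<nu> * of_real (sinh y) * k (\<nu> + 1) y)) (at y)"
      unfolding F_def
      by (intro has_vector_derivative_diff has_vector_derivative_mult_right has_vector_derivative_mult kder sh)
    moreover have "\<nu> + 1 + 1 = \<nu> + 2" by simp
    ultimately show ?thesis by (simp add: f_def algebra_simps power2_eq_square)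
  qed
  have D0: "D y \<noteq> 0" for y unfolding D_def by (rule add_cosh_nonzero[OF t])
  have k_low: "k (p - 1) y = D y * k p y" for p y
  proof -
    have "D y powr (1 + - of_real p) = D y powr 1 * D y powr - of_real p" by (rule powr_add)
    moreover have "- complex_of_real (p - 1) = 1 + - of_real p" by simp
    ultimately have "D y powr - of_real (p - 1) = D y * D y powr - of_real p"
      using D0[of y] by (simp only: powr_one_gt_zero_iff) (simp add: powr_def)
    then show ?thesis unfolding k_def by simp
  qed
  have k_eqs: "k (\<nu> + 1) y = D y * k (\<nu> + 2) y" "k \<nu> y = (D y)\<^sup>2 * k (\<nu> + 2) y" for y
  proof -
    have e: "\<nu> + 2 - 1 = \<nu> + 1" "\<nu> + 1 - 1 = \<nu>" by simp_all
    show 1: "k (\<nu> + 1) y = D y * k (\<nu> + 2) y" using k_low[of "\<nu> + 2" y] unfolding e .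
    show "k \<nu> y = (D y)\<^sup>2 * k (\<nu> + 2) y"
      using k_low[of "\<nu> + 1" y] unfolding e 1 by (simp add: power2_eq_square)
  qed
  have ki: "integrable lborel (k \<nu>)" "integrable lborel (k (\<nu> + 1))" "integrable lborel (k (\<nu> + 2))"
    unfolding k_def D_def by (rule integrable_legendre_kernel[OF t]; use s in simp)+
  define G where "G = (\<lambda>y. of_real (\<nu> * (\<nu> + 1)) * (1 - t\<^sup>2) * k (\<nu> + 2) y
    + of_real (\<nu> * (2 * \<nu> + 1)) * t * k (\<nu> + 1) y - (of_real (\<nu>\<^sup>2) - s\<^sup>2) * k \<nu> y)"
  have G: "integrable lborel G" unfolding G_def
    by (intro Bochner_Integration.integrable_diff Bochner_Integration.integrable_add integrable_mult_right ki)
  \<comment> \<open>Substituting \<open>D - t\<close> for \<open>cosh y\<close> and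
    \<open>(D - t)\<^sup>2 - 1\<close> for the square of \<open>sinh y\<close> leaves powers of
    \<open>D\<close> alone, with coefficients in \<open>t\<close>.\<close>
  have fG: "f = (\<lambda>y. - G y)"
  proof
    fix y
    have sh2: "(complex_of_real (sinh y))\<^sup>2 = (D y - t)\<^sup>2 - 1"
      using cosh_square_eq[of y] by (simp add: D_def flip: of_real_power)
    have ch: "complex_of_real (cosh y) = D y - t" by (simp add: D_def)
    show "f y = - G y"
      unfolding f_def G_def k_eqs sh2 ch by (simp add: algebra_simps power2_eq_square)
  qed
  have "(LBINT y. f y) = 0"
  proof (rule integral_derivative_eq_0[OF Fder])
    show "integrable lborel f" using G by (simp add: fG)
    have "continuous_on UNIV (k p)" for p unfolding k_def D_def by (rule continuous_on_legendre_kernel[OF t])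
    then show "continuous_on UNIV f" unfolding f_def by (intro continuous_intros)
    show "0 < \<nu> - \<bar>Re s\<bar>" using s by simp
    show "cmod (F y) \<le> (\<nu> + cmod s) * 2 powr \<nu> * exp (- (\<nu> - \<bar>Re s\<bar>) * \<bar>y\<bar>)" for y
    proof -
      have e: "exp (Re s * y) * cosh y powr - \<nu> \<le> 2 powr \<nu> * exp (- (\<nu> - \<bar>Re s\<bar>) * \<bar>y\<bar>)"
        by (rule exp_cosh_powr_le) (use \<nu> in simp)
      have k0: "cmod (k \<nu> y) \<le> exp (Re s * y) * cosh y powr - \<nu>"
        unfolding k_def D_def using \<nu> by (intro legendre_kernel_norm[OF t]) simp
      have "cmod (k (\<nu> + 1) y) \<le> exp (Re s * y) * cosh y powr - (\<nu> + 1)"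
        unfolding k_def D_def using \<nu> by (intro legendre_kernel_norm[OF t]) simp
      then have "\<bar>sinh y\<bar> * cmod (k (\<nu> + 1) y) \<le> cosh y * (exp (Re s * y) * cosh y powr - (\<nu> + 1))"
        by (intro mult_mono abs_sinh_le_cosh) auto
      also have "\<dots> = exp (Re s * y) * cosh y powr - \<nu>"
        by (simp add: powr_diff powr_minus field_simps)
      finally have k1: "\<bar>sinh y\<bar> * cmod (k (\<nu> + 1) y) \<le> exp (Re s * y) * cosh y powr - \<nu>" .
      have "cmod (F y) \<le> \<nu> * (\<bar>sinh y\<bar> * cmod (k (\<nu> + 1) y)) + cmod s * cmod (k \<nu> y)"
        unfolding F_def using \<nu> by (intro order_trans[OF norm_triangle_ineq4]) (simp add: norm_mult)
      also have "\<dots> \<le> \<nu> * (exp (Re s * y) * cosh y powr - \<nu>) + cmod s * (exp (Re s * y) * cosh y powr - \<nu>)"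
        using \<nu> k0 k1 by (intro add_mono mult_left_mono) auto
      also have "\<dots> = (\<nu> + cmod s) * (exp (Re s * y) * cosh y powr - \<nu>)" by (simp add: algebra_simps)
      also have "\<dots> \<le> (\<nu> + cmod s) * (2 powr \<nu> * exp (- (\<nu> - \<bar>Re s\<bar>) * \<bar>y\<bar>))"
        using \<nu> e by (intro mult_left_mono) auto
      finally show ?thesis by (simp only: mult.assoc)
    qed
  qed
  then have "(LBINT y. G y) = 0" by (simp add: fG)
  moreover have "(LBINT y. G y) = of_real (\<nu> * (\<nu> + 1)) * (1 - t\<^sup>2) * (LBINT y. k (\<nu> + 2) y)
    + of_real (\<nu> * (2 * \<nu> + 1)) * t * (LBINT y. k (\<nu> + 1) y) - (of_real (\<nu>\<^sup>2) - s\<^sup>2) * (LBINT y. k \<nu> y)"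
    unfolding G_def using ki by simp
  ultimately show ?thesis by (simp add: legendre_integral_def k_def D_def)
qed

section \<open>Continuation of the Gauss series to the slit plane\<close>

abbreviation slit_domain :: "complex set" where
  "slit_domain \<equiv> - (complex_of_real ` {1..})"

lemma slit_domain_iff: "z \<in> slit_domain \<longleftrightarrow> 1 - z \<notin> \<real>\<^sub>\<le>\<^sub>0"
proof -
  have "z \<in> complex_of_real ` {1..} \<longleftrightarrow> 1 - z \<in> \<real>\<^sub>\<le>\<^sub>0"
  proof
    assume "1 - z \<in> \<real>\<^sub>\<le>\<^sub>0"
    then have "Im z = 0" "1 \<le> Re z" by (auto simp: complex_nonpos_Reals_iff)
    then show "z \<in> complex_of_real ` {1..}"
      by (intro image_eqI[of _ _ "Re z"]) (auto simp: complex_eq_iff)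
  qed (auto simp: complex_nonpos_Reals_iff)
  then show ?thesis by blast
qed

lemma one_minus_square_slit_domain:
  assumes "1 \<le> t"
  shows "1 - (complex_of_real t)\<^sup>2 \<in> slit_domain"
proof -
  have "0 < t * t" using assms by simp
  then show ?thesis
    unfolding slit_domain_iff by (simp add: complex_nonpos_Reals_iff power2_eq_square not_le)
qed

lemma open_slit_domain: "open slit_domain"
proof -
  have "closed (complex_of_real ` {1..})"
    by (rule closed_injective_linear_image) (auto intro!: linearI simp: inj_def scaleR_conv_of_real)
  then show ?thesis by (rule open_Compl)
qed

lemma starlike_slit_domain: "starlike slit_domain"
  unfolding starlike_def
proof (intro bexI ballI subsetI)
  show "0 \<in> slit_domain" by auto
  fix x y assume x: "x \<in> slit_domain" and "y \<in> closed_segment 0 x"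
  then obtain u where u: "0 \<le> u" "u \<le> 1" "y = u *\<^sub>R x" by (auto simp: in_segment)
  show "y \<in> slit_domain"
  proof
    assume "y \<in> complex_of_real ` {1..}"
    then obtain r where r: "1 \<le> r" "y = of_real r" by auto
    then have "u \<noteq> 0" using u by auto
    then have "x = of_real (r / u)" using r u by (auto simp: scaleR_conv_of_real field_simps)
    moreover have "1 \<le> r / u" using r u \<open>u \<noteq> 0\<close> by (simp add: field_simps)
    ultimately have "x \<in> complex_of_real ` {1..}" by (intro image_eqI[where x = "r / u"]) auto
    then show False using x by auto
  qed
qed

lemma ball_slit_domain: "ball 0 1 \<subseteq> slit_domain"
  by (auto simp: dist_norm)

text \<open>The existence of one holomorphic extension of the series justifies the choice in
  \<open>Gauss_F\<close>; the identity theorem on the connected slit domain shows that it is the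
  only one.\<close>

lemma Gauss_F_eqI:
  assumes H: "H holomorphic_on slit_domain"
    and ball: "\<And>z. z \<in> ball 0 1 \<Longrightarrow> H z = eval_fps (fps_hypergeo [a, b] [c] 1) z"
    and z: "z \<in> slit_domain"
  shows "Gauss_F a b c z = H z"
proof -
  let ?P = "\<lambda>F. F holomorphic_on slit_domain \<and> (\<forall>z\<in>ball 0 1. F z = eval_fps (fps_hypergeo [a, b] [c] 1) z)"
  have "?P (Gauss_F a b c)"
    unfolding Gauss_F_def by (rule someI[of ?P H]) (use H ball in auto)
  then have F: "Gauss_F a b c holomorphic_on slit_domain" "\<And>z. z \<in> ball 0 1 \<Longrightarrow> Gauss_F a b c z = H z"
    using ball by auto
  show ?thesis
    by (rule analytic_continuation_open[of "ball 0 1" slit_domain "Gauss_F a b c" H])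
       (use F H z open_slit_domain ball_slit_domain starlike_imp_connected[OF starlike_slit_domain] in auto)
qed

lemma Gauss_F_holomorphic:
  assumes "H holomorphic_on slit_domain"
    and "\<And>z. z \<in> ball 0 1 \<Longrightarrow> H z = eval_fps (fps_hypergeo [a, b] [c] 1) z"
  shows "Gauss_F a b c holomorphic_on slit_domain"
  using Gauss_F_eqI[OF assms] assms(1) by (metis holomorphic_cong)

lemma eball_1: "eball 0 1 = (ball 0 1 :: complex set)"
  by (auto simp: eball_def one_ereal_def)

text \<open>A solution of the hypergeometric equation that is regular at the origin is a multiple of
  the Gauss series, since the equation determines the ratio of consecutive coefficients.\<close>

lemma hypergeometric_ode_series:
  fixes a b c :: complex
  assumes h: "h holomorphic_on ball 0 1"
    and h': "\<And>z. z \<in> ball 0 1 \<Longrightarrow> (h has_field_derivative h1 z) (at z)"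
    and h'': "\<And>z. z \<in> ball 0 1 \<Longrightarrow> (h1 has_field_derivative h2 z) (at z)"
    and ode: "\<And>z. z \<in> ball 0 1 \<Longrightarrow> z * (1 - z) * h2 z + (c - (a + b + 1) * z) * h1 z - a * b * h z = 0"
    and c: "\<And>n :: nat. c \<noteq> - of_nat n"
    and z: "z \<in> ball 0 1"
  shows "h z = h 0 * eval_fps (fps_hypergeo [a, b] [c] 1) z"
proof -
  define H where "H = fps_expansion h 0"
  have e: "h has_fps_expansion H" unfolding H_def
    by (rule has_fps_expansion_fps_expansion[OF _ _ h]) auto
  have d1: "deriv h z = h1 z" if "z \<in> ball 0 1" for z using h'[OF that] by (rule DERIV_imp_deriv)
  have d2: "deriv (deriv h) z = h2 z" if "z \<in> ball 0 1" for z
  proof -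
    have "deriv (deriv h) z = deriv h1 z"
      using that by (intro deriv_cong_ev eventually_mono[OF eventually_nhds_in_open[of "ball 0 1" z]] d1) auto
    then show ?thesis using DERIV_imp_deriv[OF h''[OF that]] by simp
  qed
  let ?op = "fps_X * (1 - fps_X) * fps_deriv (fps_deriv H) + (fps_const c - fps_const (a + b + 1) * fps_X) * fps_deriv H - fps_const (a * b) * H"
  have "(\<lambda>z. z * (1 - z) * deriv (deriv h) z + (c - (a + b + 1) * z) * deriv h z - a * b * h z) has_fps_expansion ?op"
    by (intro fps_expansion_intros e)
  moreover have "(\<lambda>z. z * (1 - z) * deriv (deriv h) z + (c - (a + b + 1) * z) * deriv h z - a * b * h z) has_fps_expansion 0"
    unfolding has_fps_expansion_0_iff
    by (rule eventually_mono[OF eventually_nhds_in_open[of "ball 0 1" 0]]) (use d1 d2 ode in auto)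
  ultimately have op0: "?op = 0" by (rule fps_expansion_unique_complex)
  have rec: "of_nat (Suc n) * (c + of_nat n) * H $ Suc n = (a + of_nat n) * (b + of_nat n) * H $ n" for n
  proof -
    have "?op $ n = 0" by (simp only: op0 fps_zero_nth)
    moreover have "(fps_X * (1 - fps_X) * fps_deriv (fps_deriv H)) $ n
        = of_nat n * of_nat (Suc n) * H $ Suc n - of_nat n * (of_nat n - 1) * H $ n"
    proof -
      have "fps_X * (1 - fps_X) * fps_deriv (fps_deriv H) = fps_X * fps_deriv (fps_deriv H) - fps_X * (fps_X * fps_deriv (fps_deriv H))"
        by (simp add: algebra_simps)
      then show ?thesis by (cases n) (auto simp: fps_X_mult_nth algebra_simps nat.split split: nat.splits elim: nat.exhaust)
    qed
    moreover have "((fps_const c - fps_const (a + b + 1) * fps_X) * fps_deriv H) $ n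
        = c * of_nat (Suc n) * H $ Suc n - (a + b + 1) * of_nat n * H $ n"
    proof -
      have "(fps_const c - fps_const (a + b + 1) * fps_X) * fps_deriv H = fps_const c * fps_deriv H - fps_const (a + b + 1) * (fps_X * fps_deriv H)"
        by (simp add: left_diff_distrib mult.assoc)
      then show ?thesis by (cases n) (simp_all add: fps_X_mult_nth del: fps_const_add fps_const_sub)
    qed
    ultimately have "of_nat n * of_nat (Suc n) * H $ Suc n - of_nat n * (of_nat n - 1) * H $ n
        + (c * of_nat (Suc n) * H $ Suc n - (a + b + 1) * of_nat n * H $ n) - a * b * H $ n = 0"
      by (simp only: fps_sub_nth fps_add_nth fps_mult_left_const_nth)
    then show ?thesis by (simp add: algebra_simps)
  qed
  have c0: "c + of_nat n \<noteq> 0" for n using c[of n] by (metis add_eq_0_iff2)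
  have H_eq: "H = fps_const (h 0) * fps_hypergeo [a, b] [c] 1"
  proof (rule fps_ext)
    fix n show "H $ n = (fps_const (h 0) * fps_hypergeo [a, b] [c] 1) $ n"
    proof (induction n)
      case 0
      show ?case by (simp add: H_def fps_expansion_def)
    next
      case (Suc n)
      have "of_nat (Suc n) * (c + of_nat n) \<noteq> 0" using c0 by (simp del: of_nat_Suc)
      then have "H $ Suc n = (a + of_nat n) * (b + of_nat n) / (of_nat (Suc n) * (c + of_nat n)) * H $ n"
        using rec[of n] by (simp add: field_simps del: of_nat_Suc)
      then show ?case
        unfolding fps_mult_left_const_nth fps_hypergeo_rec Suc by (simp del: of_nat_Suc fps_hypergeo_nth)
    qed
  qed
  from H_eq have "eval_fps H z = eval_fps (fps_const (h 0) * fps_hypergeo [a, b] [c] 1) z" by simp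
  moreover have "eval_fps H z = h z"
  proof -
    have "h holomorphic_on eball 0 1" using h unfolding eball_1 .
    then show ?thesis using eval_fps_expansion'[of h 0 1 z] z by (simp add: H_def one_ereal_def)
  qed
  moreover have "eval_fps (fps_const (h 0) * fps_hypergeo [a, b] [c] 1) z = h 0 * eval_fps (fps_hypergeo [a, b] [c] 1) z"
  \<comment> \<open>Convergence of the Gauss series on the disc is read off from the expansion of
    \<open>h\<close>, of which it is a multiple unless \<open>h 0 = 0\<close>; in that case both
    sides vanish.\<close>
  proof (cases "h 0 = 0")
    case False
    have "fps_conv_radius H \<ge> 1"
      unfolding H_def using h by (intro conv_radius_fps_expansion) (simp only: eball_1)
    moreover have "fps_hypergeo [a, b] [c] 1 = fps_const (1 / h 0) * H"
      using False by (simp add: H_eq mult.assoc[symmetric])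
    ultimately have "fps_conv_radius (fps_hypergeo [a, b] [c] 1) \<ge> 1"
      using fps_conv_radius_cmult_left[of "1 / h 0" H] False by simp
    moreover have "ereal (norm z) < 1" using z by (simp add: one_ereal_def)
    ultimately have "ereal (norm z) < fps_conv_radius (fps_hypergeo [a, b] [c] 1)"
      by (rule less_le_trans[rotated])
    then show ?thesis by (simp add: eval_fps_mult)
  qed simp
  ultimately show ?thesis by simp
qed

text \<open>The principal root has non-negative real part, and real part zero would put
  \<open>1 - z\<close> on the cut. So the root stays in the half plane on which the Legendre
  integral is holomorphic.\<close>

lemma Re_csqrt_pos:
  assumes "z \<in> slit_domain"
  shows "0 < Re (csqrt (1 - z))"
proof -
  have "1 - z \<notin> \<real>\<^sub>\<le>\<^sub>0" using assms unfolding slit_domain_iff .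
  moreover have "Re (csqrt (1 - z)) = 0 \<Longrightarrow> (csqrt (1 - z))\<^sup>2 \<in> \<real>\<^sub>\<le>\<^sub>0"
    by (simp add: complex_nonpos_Reals_iff power2_eq_square del: power2_csqrt)
  moreover have "0 \<le> Re (csqrt (1 - z))" using csqrt_principal[of "1 - z"] by auto
  ultimately show ?thesis by (metis order_le_less power2_csqrt)
qed

text \<open>The substitution \<open>z = 1 - t\<^sup>2\<close> takes the Gegenbauer equation to the
  hypergeometric one and the point \<open>t = 1\<close> to the regular solution at 0. Dividing by
  the value there normalizes it to the Gauss series. For \<open>t = cosh r\<close> the variable
  \<open>z\<close> is minus the square of \<open>sinh r\<close>.\<close>

lemma Gauss_F_legendre:
  fixes \<nu> :: real and s :: complex
  assumes s: "\<bar>Re s\<bar> < \<nu>" and nz: "legendre_integral \<nu> s 1 \<noteq> 0"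
  defines "a \<equiv> of_real (\<nu> / 2) + s / 2" and "b \<equiv> of_real (\<nu> / 2) - s / 2" and "c \<equiv> of_real (\<nu> + 1 / 2)"
  shows "Gauss_F a b c holomorphic_on slit_domain"
    and "z \<in> slit_domain \<Longrightarrow> Gauss_F a b c z = legendre_integral \<nu> s (csqrt (1 - z)) / legendre_integral \<nu> s 1"
proof -
  have \<nu>: "0 < \<nu>" using s by linarith
  define w where "w = (\<lambda>z :: complex. csqrt (1 - z))"
  define J0 J1 J2 where "J0 = (\<lambda>z. legendre_integral \<nu> s (w z))" and "J1 = (\<lambda>z. legendre_integral (\<nu> + 1) s (w z))"
    and "J2 = (\<lambda>z. legendre_integral (\<nu> + 2) s (w z))"
  have w0: "w z \<noteq> 0" if "z \<in> slit_domain" for z using Re_csqrt_pos[OF that] by (auto simp: w_def)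
  have w2: "(w z)\<^sup>2 = 1 - z" for z by (simp add: w_def)
  have wd: "(w has_field_derivative - 1 / (2 * w z)) (at z)" if "z \<in> slit_domain" for z
    unfolding w_def using that[unfolded slit_domain_iff] by (auto intro!: derivative_eq_intros)
  have J0d: "(J0 has_field_derivative of_real \<nu> / 2 * (J1 z / w z)) (at z)" if z: "z \<in> slit_domain" for z
  proof -
    have "(legendre_integral \<nu> s has_field_derivative - of_real \<nu> * J1 z) (at (w z))"
      unfolding J1_def using Re_csqrt_pos[OF z] s by (intro legendre_integral_derivative) (auto simp: w_def)
    from DERIV_chain2[OF this wd[OF z]] show ?thesis unfolding J0_def by (simp add: field_simps)
  qed
  have J1d: "(J1 has_field_derivative of_real (\<nu> + 1) / 2 * (J2 z / w z)) (at z)" if z: "z \<in> slit_domain" for z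
  proof -
    have "(legendre_integral (\<nu> + 1) s has_field_derivative - of_real (\<nu> + 1) * legendre_integral (\<nu> + 1 + 1) s (w z)) (at (w z))"
      using Re_csqrt_pos[OF z] s by (intro legendre_integral_derivative) (auto simp: w_def)
    then have "(legendre_integral (\<nu> + 1) s has_field_derivative - of_real (\<nu> + 1) * J2 z) (at (w z))"
      by (simp add: J2_def add.assoc)
    note chain = DERIV_chain2[OF this wd[OF z]]
    have eq: "(- d * J2 z) * (- 1 / (2 * w z)) = d / 2 * (J2 z / w z)" for d
      by simp
    show ?thesis unfolding J1_def using chain by (simp only: eq)
  qed
  define h1 where "h1 = (\<lambda>z. of_real \<nu> / 2 * (J1 z / w z))"
  define h2 where "h2 = (\<lambda>z. of_real \<nu> / 2 * ((of_real (\<nu> + 1) / 2 * (J2 z / w z) * w z - J1 z * (- 1 / (2 * w z))) / (w z * w z)))"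
  have h1d: "(h1 has_field_derivative h2 z) (at z)" if z: "z \<in> slit_domain" for z
    unfolding h1_def h2_def by (intro DERIV_cmult DERIV_divide J1d wd w0 z)
  have hol: "J0 holomorphic_on slit_domain"
    using J0d open_slit_domain by (auto simp: holomorphic_on_open)
  have ode: "z * (1 - z) * h2 z + (c - (a + b + 1) * z) * h1 z - a * b * J0 z = 0" if z: "z \<in> slit_domain" for z
  proof -
    have L: "of_real (\<nu> * (\<nu> + 1)) * (1 - (w z)\<^sup>2) * J2 z + of_real (\<nu> * (2 * \<nu> + 1)) * w z * J1 z
        = (of_real (\<nu>\<^sup>2) - s\<^sup>2) * J0 z"
      using legendre_ode[of "w z" s \<nu>] Re_csqrt_pos[OF z] s by (simp add: J0_def J1_def J2_def w_def)
    have zw: "z = 1 - (w z)\<^sup>2" using w2[of z] by simp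
    have ab: "a + b = of_real \<nu>" "a * b = (of_real (\<nu>\<^sup>2) - s\<^sup>2) / 4"
      by (simp_all add: a_def b_def power2_eq_square field_simps)
    have h2': "(w z)\<^sup>2 * h2 z = of_real \<nu> / 4 * (of_real (\<nu> + 1) * J2 z + J1 z / w z)"
      using w0[OF z] by (simp add: h2_def field_simps power2_eq_square)
    have "z * (1 - z) * h2 z = (1 - (w z)\<^sup>2) * ((w z)\<^sup>2 * h2 z)"
      using zw w2[of z] by (metis mult.assoc)
    also have "\<dots> = (1 - (w z)\<^sup>2) * (of_real \<nu> / 4 * (of_real (\<nu> + 1) * J2 z + J1 z / w z))" by (simp only: h2')
    finally have t1: "z * (1 - z) * h2 z = (1 - (w z)\<^sup>2) * (of_real \<nu> / 4 * (of_real (\<nu> + 1) * J2 z + J1 z / w z))" .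
    have t2: "(c - (a + b + 1) * z) * h1 z = (of_real (\<nu> + 1 / 2) - (of_real \<nu> + 1) * (1 - (w z)\<^sup>2)) * (of_real \<nu> / 2 * (J1 z / w z))"
      by (simp only: h1_def c_def ab(1)) (simp add: w2)
    have t3: "a * b * J0 z = (of_real (\<nu> * (\<nu> + 1)) * (1 - (w z)\<^sup>2) * J2 z + of_real (\<nu> * (2 * \<nu> + 1)) * w z * J1 z) / 4"
      by (simp only: ab(2) L) simp
    show ?thesis unfolding t1 t2 t3 using w0[OF z] by (simp add: field_simps power2_eq_square)
  qed
  have cn: "c \<noteq> - of_nat n" for n :: nat
  proof
    assume "c = - of_nat n"
    then have "Re c = - real n" by simp
    then show False using \<nu> by (simp add: c_def)
  qed
  have J00: "J0 0 = legendre_integral \<nu> s 1" by (simp add: J0_def w_def)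
  have series: "J0 z = J0 0 * eval_fps (fps_hypergeo [a, b] [c] 1) z" if "z \<in> ball 0 1" for z
  proof (rule hypergeometric_ode_series[OF _ _ _ _ cn that])
    show "J0 holomorphic_on ball 0 1" by (rule holomorphic_on_subset[OF hol ball_slit_domain])
    fix z :: complex assume "z \<in> ball 0 1"
    then have z: "z \<in> slit_domain" using ball_slit_domain by blast
    show "(J0 has_field_derivative h1 z) (at z)" unfolding h1_def by (rule J0d[OF z])
    show "(h1 has_field_derivative h2 z) (at z)" by (rule h1d[OF z])
    show "z * (1 - z) * h2 z + (c - (a + b + 1) * z) * h1 z - a * b * J0 z = 0" by (rule ode[OF z])
  qed
  define H where "H = (\<lambda>z. J0 z / legendre_integral \<nu> s 1)"
  have H: "H holomorphic_on slit_domain" unfolding H_def by (intro holomorphic_intros hol) (use nz in auto)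
  have Hb: "H z = eval_fps (fps_hypergeo [a, b] [c] 1) z" if "z \<in> ball 0 1" for z
    unfolding H_def using series[OF that] nz J00 by simp
  show "Gauss_F a b c holomorphic_on slit_domain" by (rule Gauss_F_holomorphic[OF H Hb])
  show "Gauss_F a b c z = legendre_integral \<nu> s (csqrt (1 - z)) / legendre_integral \<nu> s 1" if "z \<in> slit_domain"
    using Gauss_F_eqI[OF H Hb that] by (simp add: H_def J0_def w_def)
qed

text \<open>A vanishing upper parameter cuts the series after its constant term.\<close>

lemma Gauss_F_degenerate:
  assumes "a = 0 \<or> b = 0" and "z \<in> slit_domain"
  shows "Gauss_F a b c z = 1"
proof (rule Gauss_F_eqI[OF _ _ assms(2), where H = "\<lambda>_. 1"])
  have "fps_hypergeo [a, b] [c] 1 = 1"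
  proof (rule fps_ext)
    show "fps_hypergeo [a, b] [c] 1 $ n = 1 $ n" for n
      using assms(1) by (cases n) (auto simp: pochhammer_0_left)
  qed
  then show "1 = eval_fps (fps_hypergeo [a, b] [c] 1) z" for z by simp
qed auto

section \<open>Fejer kernels and Fourier transforms of measures\<close>

lemma character_orthogonality_1d:
  fixes h :: real and k :: int
  assumes h: "0 < h"
  defines "f \<equiv> \<lambda>t. complex_of_real (h / (2 * pi) * indicator {- pi / h..pi / h} t) * exp (\<i> * of_real (h * of_int k * t))"
  shows "integrable lborel f" and "(LBINT t. f t) = (if k = 0 then 1 else 0)"
proof -
  let ?e = "\<lambda>t. exp (\<i> * of_real (h * of_int k * t))"
  have eq: "f t = complex_of_real (h / (2 * pi)) * (indicator {- pi / h..pi / h} t *\<^sub>R ?e t)" for t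
    by (simp add: f_def scaleR_conv_of_real)
  have cont: "continuous_on {- pi / h..pi / h} ?e" by (intro continuous_intros)
  have i: "integrable lborel (\<lambda>t. indicator {- pi / h..pi / h} t *\<^sub>R ?e t)"
    using borel_integrable_compact[OF compact_Icc cont] by (simp add: indicator_scaleR_eq_if)
  show "integrable lborel f" unfolding eq[abs_def] by (intro integrable_mult_right i)
  have le: "- pi / h \<le> pi / h" using h by (simp add: field_simps)
  show "(LBINT t. f t) = (if k = 0 then 1 else 0)"
  proof (cases "k = 0")
    case True
    have "(LBINT t. indicator {- pi / h..pi / h} t *\<^sub>R ?e t) = of_real (pi / h) - of_real (- pi / h)"
      using True le by (intro integral_FTC_atLeastAtMost) (auto intro!: derivative_eq_intros has_vector_derivative_of_real)
    then show ?thesis unfolding eq integral_mult_right_zero using True h by (simp add: field_simps)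
  next
    case False
    define d where "d = \<i> * complex_of_real (h * of_int k)"
    have d: "d \<noteq> 0" using False h by (simp add: d_def)
    have "(LBINT t. indicator {- pi / h..pi / h} t *\<^sub>R ?e t) = exp (d * of_real (pi / h)) / d - exp (d * of_real (- pi / h)) / d"
    proof (rule integral_FTC_atLeastAtMost[OF le])
      fix t :: real
      have "((\<lambda>t. exp (d * of_real t) / d) has_vector_derivative (d * 1) * exp (d * of_real t) / d) (at t within {- pi / h..pi / h})"
      proof -
        have "((\<lambda>t. d * complex_of_real t) has_vector_derivative d * 1) (at t within {- pi / h..pi / h})"
          by (auto intro!: derivative_eq_intros has_vector_derivative_of_real)
        from field_vector_diff_chain_within[OF this has_field_derivative_at_within[OF DERIV_exp]]
        have "((\<lambda>t. exp (d * complex_of_real t)) has_vector_derivative (d * 1) * exp (d * of_real t)) (at t within {- pi / h..pi / h})"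
          by (simp add: o_def)
        then show ?thesis by (rule has_vector_derivative_divide)
      qed
      moreover have "(d * 1) * exp (d * of_real t) / d = ?e t" using d by (simp add: d_def mult.assoc)
      ultimately show "((\<lambda>t. exp (d * of_real t) / d) has_vector_derivative ?e t) (at t within {- pi / h..pi / h})" by simp
    qed (fact cont)
    also have "\<dots> = exp (\<i> * of_real (pi * of_int k)) / d - exp (- (\<i> * of_real (pi * of_int k))) / d"
    proof -
      have "d * of_real (pi / h) = \<i> * of_real (pi * of_int k)" "d * of_real (- pi / h) = - (\<i> * of_real (pi * of_int k))"
        using h by (simp_all add: d_def)
      then show ?thesis by (simp only:)
    qed
    also have "exp (\<i> * of_real (pi * of_int k)) / d - exp (- (\<i> * of_real (pi * of_int k))) / d = 0"
    proof -
      have "exp (\<i> * of_real (pi * of_int k)) - exp (- (\<i> * of_real (pi * of_int k))) = 2 * \<i> * sin (of_real (pi * of_int k))"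
        by (simp add: sin_exp_eq)
      also have "sin (complex_of_real (pi * of_int k)) = of_real (sin (pi * of_int k))" by (rule sin_of_real)
      also have "sin (pi * real_of_int k) = 0" by (simp add: sin_integer_2pi mult.commute sin_zero_iff_int2)
      finally show ?thesis by (simp add: diff_divide_distrib[symmetric])
    qed
    finally show ?thesis unfolding eq integral_mult_right_zero using False by simp
  qed
qed

text \<open>Taylor's formula gives the lower bound \<open>x - x ^ 3 / 6\<close>. From
  \<open>pi < 3.15\<close> follow \<open>x \<le> 2.3625\<close> and
  \<open>x * x \<le> 45 / 8\<close>, and \<open>1 - 45 / 48 = 1 / 16\<close>.\<close>

lemma sin_ge_linear:
  fixes x :: real
  assumes "0 \<le> x" "x \<le> 3 * pi / 4"
  shows "x / 16 \<le> sin x"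
proof -
  have "\<bar>sin x - (\<Sum>m<3. sin_coeff m * x ^ m)\<bar> \<le> inverse (fact 3) * \<bar>x\<bar> ^ 3"
    by (rule Maclaurin_sin_bound)
  then have "\<bar>sin x - x\<bar> * 6 \<le> x * (x * x)"
    using assms by (simp add: sin_coeff_def numeral_3_eq_3 fact_numeral lessThan_Suc)
  then have s: "x - x ^ 3 / 6 \<le> sin x"
    using abs_ge_minus_self[of "sin x - x"] by (simp add: power3_eq_cube mult.assoc)
  have "x \<le> 2.3625" using assms(2) pi_less_4 pi_approx by simp
  then have "x * x \<le> 2.3625 * 2.3625" using assms(1) by (intro mult_mono) auto
  then have "x * (x * x) \<le> x * (45/8)" using assms(1) by (intro mult_left_mono) auto
  then have "x ^ 3 \<le> x * (45/8)" by (simp add: power3_eq_cube mult.assoc)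
  then show ?thesis using s by simp
qed

lemma cmod_exp_minus_1_sq: "(cmod (exp (\<i> * of_real x) - 1))\<^sup>2 = 4 * (sin (x / 2))\<^sup>2"
proof -
  have "(cmod (exp (\<i> * of_real x) - 1))\<^sup>2 = 2 - 2 * cos x"
  proof -
    have "(cmod (exp (\<i> * of_real x) - 1))\<^sup>2 = (cos x - 1)\<^sup>2 + (sin x)\<^sup>2"
      by (simp add: cmod_power2 Re_exp Im_exp)
    also have "\<dots> = 2 - 2 * cos x" using sin_cos_squared_add[of x] by (simp add: power2_diff)
    finally show ?thesis .
  qed
  also have "cos x = 1 - 2 * (sin (x / 2))\<^sup>2" using cos_double_sin[of "x / 2"] by simp
  finally show ?thesis by simp
qed

text \<open>The modulus is twice that of \<open>sin (x / 2)\<close>, and \<open>x / 2\<close> stays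
  within three quarters of \<open>pi\<close>, away from the next zero of the sine. The constant is
  the square of the 16 in \<open>sin_ge_linear\<close>.\<close>

lemma square_le_cmod_exp:
  fixes x :: real
  assumes "\<bar>x\<bar> \<le> 3 * pi / 2"
  shows "x\<^sup>2 \<le> 256 * (cmod (exp (\<i> * of_real x) - 1))\<^sup>2"
proof -
  have "\<bar>x / 2\<bar> / 16 \<le> sin \<bar>x / 2\<bar>" using assms by (intro sin_ge_linear) auto
  then have "(\<bar>x / 2\<bar> / 16)\<^sup>2 \<le> (sin \<bar>x / 2\<bar>)\<^sup>2" by (intro power_mono) auto
  moreover have "(sin \<bar>x / 2\<bar>)\<^sup>2 = (sin (x / 2))\<^sup>2" by (cases "x \<ge> 0") (auto simp: abs_if)
  ultimately show ?thesis by (simp add: cmod_exp_minus_1_sq power_divide)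
qed

section \<open>Characters on a box and Toeplitz matrices\<close>

definition character :: "real ^ 'm \<Rightarrow> real ^ 'm::finite \<Rightarrow> complex" where
  "character x \<xi> = exp (\<i> * of_real (x \<bullet> \<xi>))"

lemma cmod_character [simp]: "cmod (character x \<xi>) = 1"
  by (simp add: character_def)

lemma character_mult_cnj: "character x \<xi> * cnj (character y \<xi>) = character (x - y) \<xi>"
  by (simp add: character_def exp_cnj exp_add[symmetric] inner_diff_left algebra_simps)

lemma character_measurable [measurable]: "character x \<in> borel_measurable borel"
  unfolding character_def[abs_def] by (intro borel_measurable_continuous_onI continuous_intros)

text \<open>Density of the normalized Lebesgue measure on the cube of side
  \<open>2 * pi / h\<close>. This cube is a period cell for the characters at the points of the
  lattice of mesh \<open>h\<close>, which makes them orthonormal.\<close>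

definition box_weight :: "real \<Rightarrow> real ^ 'm::finite \<Rightarrow> real" where
  "box_weight h \<eta> = (\<Prod>i\<in>UNIV. h / (2 * pi) * indicator {- pi / h..pi / h} (\<eta> $ i))"

definition box_measure :: "real \<Rightarrow> (real ^ 'm::finite) measure" where
  "box_measure h = density lborel (\<lambda>\<eta>. ennreal (box_weight h \<eta>))"

definition lattice_point :: "real \<Rightarrow> ('m::finite \<Rightarrow> nat) \<Rightarrow> real ^ 'm" where
  "lattice_point h n = (\<chi> i. h * real (n i))"

lemma box_weight_measurable [measurable]: "box_weight h \<in> borel_measurable borel"
proof -
  have [measurable]: "(\<lambda>\<eta> :: real ^ 'a. \<eta> $ i) \<in> borel_measurable borel" for i
    by (intro borel_measurable_continuous_onI continuous_intros)
  show ?thesis unfolding box_weight_def[abs_def] by measurable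
qed

lemma box_weight_nonneg: "0 < h \<Longrightarrow> 0 \<le> box_weight h \<eta>"
  unfolding box_weight_def by (intro prod_nonneg) auto

lemma sets_box_measure [measurable_cong, simp]: "sets (box_measure h) = sets borel"
  by (simp add: box_measure_def)

lemma space_box_measure [simp]: "space (box_measure h) = UNIV"
  by (simp add: box_measure_def)

lemma box_measure_character:
  fixes a b :: "'m::finite \<Rightarrow> nat"
  assumes h: "0 < h"
  shows "integrable (box_measure h) (character (lattice_point h a - lattice_point h b))"
    and "integral\<^sup>L (box_measure h) (character (lattice_point h a - lattice_point h b)) = (if a = b then 1 else 0)"
proof -
  define k where "k = (\<lambda>i. int (a i) - int (b i))"
  define f where "f = (\<lambda>i t. complex_of_real (h / (2 * pi) * indicator {- pi / h..pi / h} t) * exp (\<i> * of_real (h * of_int (k i) * t)))"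
  note f = character_orthogonality_1d[OF h, of "k _", folded f_def]
  have eq: "box_weight h \<eta> *\<^sub>R character (lattice_point h a - lattice_point h b) \<eta> = (\<Prod>i\<in>UNIV. f i (\<eta> $ i))" for \<eta>
  proof -
    have "character (lattice_point h a - lattice_point h b) \<eta> = (\<Prod>i\<in>UNIV. exp (\<i> * of_real (h * of_int (k i) * (\<eta> $ i))))"
      by (simp add: character_def lattice_point_def inner_vec_def k_def exp_sum[symmetric] sum_distrib_left algebra_simps)
    then show ?thesis
      unfolding box_weight_def f_def scaleR_conv_of_real of_real_prod by (simp only: prod.distrib)
  qed
  have f': "f = (\<lambda>i. f i)" by simp
  have fi: "integrable lborel (f i)" for i using f(1)[of i] by (simp add: f_def)
  have fv: "(LBINT t. f i t) = (if k i = 0 then 1 else 0)" for i using f(2)[of i] by (simp add: f_def)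
  show "integrable (box_measure h) (character (lattice_point h a - lattice_point h b))"
    unfolding box_measure_def using integral_prod_lborel(1)[OF fi] box_weight_nonneg[OF h]
    by (subst integrable_density) (auto simp: eq)
  have "integral\<^sup>L (box_measure h) (character (lattice_point h a - lattice_point h b)) = (\<Prod>i\<in>UNIV. LBINT t. f i t)"
    unfolding box_measure_def using integral_prod_lborel(2)[OF fi] box_weight_nonneg[OF h]
    by (subst integral_density) (auto simp: eq)
  also have "\<dots> = (if \<forall>i. k i = 0 then 1 else 0)" by (auto simp: fv)
  also have "(\<forall>i. k i = 0) \<longleftrightarrow> a = b" by (auto simp: k_def fun_eq_iff)
  finally show "integral\<^sup>L (box_measure h) (character (lattice_point h a - lattice_point h b)) = (if a = b then 1 else 0)" .
qed

lemma finite_box_measure: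
  assumes h: "0 < h"
  shows "finite_measure (box_measure h :: (real ^ 'm::finite) measure)"
proof -
  have "integrable (box_measure h) (\<lambda>_ :: real ^ 'm. 1 :: complex)"
    using box_measure_character(1)[OF h, of "\<lambda>_. 0" "\<lambda>_. 0"] by (simp add: character_def[abs_def])
  then have "emeasure (box_measure h) (UNIV :: (real ^ 'm) set) < \<infinity>"
    by (simp add: integrable_iff_bounded)
  then show ?thesis by (intro finite_measureI) simp
qed

lemma bounded_L2_box:
  fixes f :: "real ^ 'm::finite \<Rightarrow> complex"
  assumes h: "0 < h" and [measurable]: "f \<in> borel_measurable borel" and "\<And>x. cmod (f x) \<le> C"
  shows "f \<in> L2_space (box_measure h)"
proof -
  interpret finite_measure "box_measure h :: (real ^ 'm) measure" by (rule finite_box_measure[OF h])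
  have "integrable (box_measure h) (\<lambda>x. (cmod (f x))\<^sup>2)"
    by (rule integrable_const_bound[where B = "C\<^sup>2"]) (auto intro!: power_mono assms)
  then show ?thesis by (simp add: L2_space_def)
qed

lemma box_measure_inner:
  assumes h: "0 < h"
  shows "L2_inner (box_measure h) (character (lattice_point h a)) (character (lattice_point h b)) = (if a = b then 1 else 0)"
  unfolding L2_inner_def character_mult_cnj by (rule box_measure_character(2)[OF h])

lemma character_L2: "0 < h \<Longrightarrow> character x \<in> L2_space (box_measure h)"
  by (rule bounded_L2_box[where C = 1]) auto

lemma parseval_box:
  fixes z :: "nat \<Rightarrow> 'm::finite \<Rightarrow> nat"
  assumes h: "0 < h" and z: "inj_on z {..<k}"
  shows "(L2_norm (box_measure h) (\<lambda>\<eta>. \<Sum>j<k. c j * character (lattice_point h (z j)) \<eta>))\<^sup>2 = (\<Sum>j<k. (cmod (c j))\<^sup>2)"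
proof -
  let ?B = "box_measure h :: (real ^ 'm) measure" and ?e = "\<lambda>j. character (lattice_point h (z j))"
  let ?f = "\<lambda>\<eta>. \<Sum>j<k. c j * ?e j \<eta>"
  have f: "?f \<in> L2_space ?B" by (intro L2_space_sum L2_space_cmult character_L2 h)
  have "complex_of_real ((L2_norm ?B ?f)\<^sup>2) = L2_inner ?B ?f ?f" by (rule L2_inner_self[symmetric])
  also have "\<dots> = (\<Sum>j<k. c j * L2_inner ?B (?e j) ?f)"
    using f by (subst L2_inner_sum_left) (auto intro: L2_space_cmult character_L2 h simp: L2_inner_cmult_left)
  also have "\<dots> = (\<Sum>j<k. c j * cnj (c j))"
  proof (intro sum.cong refl)
    fix j assume j: "j \<in> {..<k}"
    have "L2_inner ?B (?e j) ?f = cnj (L2_inner ?B ?f (?e j))" by (rule L2_inner_cnj)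
    also have "L2_inner ?B ?f (?e j) = (\<Sum>l<k. c l * L2_inner ?B (?e l) (?e j))"
      by (subst L2_inner_sum_left) (auto intro: L2_space_cmult character_L2 h simp: L2_inner_cmult_left)
    also have "\<dots> = (\<Sum>l<k. if l = j then c l else 0)"
      using z j by (intro sum.cong refl) (auto simp: box_measure_inner[OF h] inj_on_def)
    also have "\<dots> = c j" using j by simp
    finally show "c j * L2_inner ?B (?e j) ?f = c j * cnj (c j)" by simp
  qed
  also have "\<dots> = complex_of_real (\<Sum>j<k. (cmod (c j))\<^sup>2)"
    by (simp add: complex_norm_square del: of_real_power)
  finally show ?thesis by (simp only: of_real_eq_iff)
qed

text \<open>The matrix is a compression of multiplication by \<open>\<theta>\<close> to the span of orthonormal characters.\<close>

lemma toeplitz_contraction: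
  fixes z :: "nat \<Rightarrow> 'm::finite \<Rightarrow> nat" and \<theta> :: "real ^ 'm \<Rightarrow> complex"
  assumes h: "0 < h" and z: "inj_on z {..<k}"
    and \<theta>[measurable]: "\<theta> \<in> borel_measurable borel" and \<theta>1: "\<And>x. cmod (\<theta> x) \<le> 1"
  defines "c \<equiv> \<lambda>i j. integral\<^sup>L (box_measure h) (\<lambda>\<eta>. \<theta> \<eta> * character (lattice_point h (z i)) \<eta> * cnj (character (lattice_point h (z j)) \<eta>))"
  shows "L2_set (\<lambda>i. cmod (\<Sum>j<k. c i j * v j)) {..<k} \<le> L2_set (\<lambda>j. cmod (v j)) {..<k}"
proof -
  let ?B = "box_measure h :: (real ^ 'm) measure" and ?e = "\<lambda>j. character (lattice_point h (z j))"
  define y where "y = (\<lambda>i. \<Sum>j<k. c i j * v j)"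
  define Y where "Y = (\<lambda>\<eta>. \<Sum>i<k. cnj (y i) * ?e i \<eta>)"
  define V where "V = (\<lambda>\<eta>. \<Sum>j<k. cnj (v j) * ?e j \<eta>)"
  have \<theta>e: "(\<lambda>\<eta>. \<theta> \<eta> * ?e i \<eta>) \<in> L2_space ?B" for i
    by (rule bounded_L2_box[OF h, where C = 1]) (auto simp: norm_mult \<theta>1)
  have YL: "Y \<in> L2_space ?B" and VL: "V \<in> L2_space ?B"
    unfolding Y_def V_def by (intro L2_space_sum L2_space_cmult character_L2 h)+
  have \<theta>Y_eq: "(\<lambda>\<eta>. \<theta> \<eta> * Y \<eta>) = (\<lambda>\<eta>. \<Sum>i<k. cnj (y i) * (\<theta> \<eta> * ?e i \<eta>))"
    by (simp add: Y_def sum_distrib_left mult_ac)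
  have \<theta>Y: "(\<lambda>\<eta>. \<theta> \<eta> * Y \<eta>) \<in> L2_space ?B"
    unfolding \<theta>Y_eq by (intro L2_space_sum L2_space_cmult \<theta>e)
  have c: "c i j = L2_inner ?B (\<lambda>\<eta>. \<theta> \<eta> * ?e i \<eta>) (?e j)" for i j
    by (simp add: c_def L2_inner_def mult_ac)
  have "(\<Sum>i<k. cnj (y i) * y i) = (\<Sum>i<k. cnj (y i) * (\<Sum>j<k. c i j * v j))" by (simp add: y_def)
  also have "\<dots> = (\<Sum>i<k. cnj (y i) * L2_inner ?B (\<lambda>\<eta>. \<theta> \<eta> * ?e i \<eta>) V)"
  proof (intro sum.cong refl arg_cong[where f = "\<lambda>x. _ * x"])
    fix i
    have "L2_inner ?B (\<lambda>\<eta>. \<theta> \<eta> * ?e i \<eta>) V = cnj (L2_inner ?B V (\<lambda>\<eta>. \<theta> \<eta> * ?e i \<eta>))" by (rule L2_inner_cnj)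
    also have "L2_inner ?B V (\<lambda>\<eta>. \<theta> \<eta> * ?e i \<eta>) = (\<Sum>j<k. cnj (v j) * L2_inner ?B (?e j) (\<lambda>\<eta>. \<theta> \<eta> * ?e i \<eta>))"
      unfolding V_def using \<theta>e by (subst L2_inner_sum_left) (auto intro: L2_space_cmult character_L2 h simp: L2_inner_cmult_left)
    also have "cnj \<dots> = (\<Sum>j<k. v j * c i j)"
      by (simp add: c L2_inner_cnj[of ?B "\<lambda>\<eta>. \<theta> \<eta> * ?e i \<eta>"])
    finally show "(\<Sum>j<k. c i j * v j) = L2_inner ?B (\<lambda>\<eta>. \<theta> \<eta> * ?e i \<eta>) V" by (simp add: mult.commute)
  qed
  also have "\<dots> = L2_inner ?B (\<lambda>\<eta>. \<theta> \<eta> * Y \<eta>) V"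
    unfolding \<theta>Y_eq using VL \<theta>e by (subst L2_inner_sum_left) (auto intro: L2_space_cmult simp: L2_inner_cmult_left)
  finally have eq: "(\<Sum>i<k. cnj (y i) * y i) = L2_inner ?B (\<lambda>\<eta>. \<theta> \<eta> * Y \<eta>) V" .
  have "(\<Sum>i<k. cnj (y i) * y i) = complex_of_real (\<Sum>i<k. (cmod (y i))\<^sup>2)"
    by (simp add: complex_norm_square mult.commute del: of_real_power)
  then have "(\<Sum>i<k. (cmod (y i))\<^sup>2) = cmod (L2_inner ?B (\<lambda>\<eta>. \<theta> \<eta> * Y \<eta>) V)"
    unfolding eq[symmetric] by (simp add: sum_nonneg del: of_real_sum)
  \<comment> \<open>The arithmetic-geometric bound suffices here: half of the squared norm of
    \<open>y\<close> reappears on the right and is absorbed on the left.\<close>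
  also have "\<dots> \<le> ((L2_norm ?B (\<lambda>\<eta>. \<theta> \<eta> * Y \<eta>))\<^sup>2 + (L2_norm ?B V)\<^sup>2) / 2"
    by (rule L2_inner_AMGM(2)[OF \<theta>Y VL])
  also have "(L2_norm ?B (\<lambda>\<eta>. \<theta> \<eta> * Y \<eta>))\<^sup>2 \<le> (L2_norm ?B Y)\<^sup>2"
    unfolding L2_norm_sq
  proof (rule integral_mono)
    fix \<eta>
    have "cmod (\<theta> \<eta> * Y \<eta>) \<le> 1 * cmod (Y \<eta>)"
      unfolding norm_mult by (intro mult_right_mono \<theta>1) auto
    then show "(cmod (\<theta> \<eta> * Y \<eta>))\<^sup>2 \<le> (cmod (Y \<eta>))\<^sup>2" by (intro power_mono) auto
  qed (use \<theta>Y YL in \<open>auto intro: L2_space_integrable\<close>)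
  also have "(L2_norm ?B Y)\<^sup>2 = (\<Sum>i<k. (cmod (y i))\<^sup>2)" unfolding Y_def by (subst parseval_box[OF h z]) simp
  also have "(L2_norm ?B V)\<^sup>2 = (\<Sum>i<k. (cmod (v i))\<^sup>2)" unfolding V_def by (subst parseval_box[OF h z]) simp
  finally have "(\<Sum>i<k. (cmod (y i))\<^sup>2) \<le> (\<Sum>i<k. (cmod (v i))\<^sup>2)" by simp
  then show ?thesis unfolding L2_set_def y_def by (rule real_sqrt_le_mono)
qed

lemma card_cube: "card {n :: 'm::finite \<Rightarrow> nat. \<forall>i. n i < N} = N ^ CARD('m)"
proof -
  have "{n :: 'm \<Rightarrow> nat. \<forall>i. n i < N} = (\<Pi>\<^sub>E i\<in>UNIV. {..<N})"
    by (auto simp: PiE_UNIV_domain)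
  then show ?thesis by (simp add: card_PiE)
qed

lemma finite_cube: "finite {n :: 'm::finite \<Rightarrow> nat. \<forall>i. n i < N}"
proof -
  have "{n :: 'm \<Rightarrow> nat. \<forall>i. n i < N} = (\<Pi>\<^sub>E i\<in>UNIV. {..<N})"
    by (auto simp: PiE_UNIV_domain)
  then show ?thesis by (simp add: finite_PiE)
qed

text \<open>One side of the cube shrinks from \<open>N\<close> to \<open>N - 1\<close>. The factor
  \<open>N\<close> on the left keeps the count free of division.\<close>

lemma card_cube_shift:
  fixes l :: "'m::finite"
  shows "N * card {n :: 'm \<Rightarrow> nat. (\<forall>i. n i < N) \<and> Suc (n l) < N} = (N - 1) * N ^ CARD('m)"
proof -
  let ?T = "\<lambda>i. if i = l then N - 1 else N"
  have iff: "((\<forall>i. n i < N) \<and> Suc (n l) < N) \<longleftrightarrow> (\<forall>i. n i < ?T i)" for n :: "'m \<Rightarrow> nat"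
  proof (intro iffI conjI allI)
    fix i assume "\<forall>i. n i < ?T i"
    then have "n i < ?T i" by blast
    then show "n i < N" by (auto split: if_splits)
  next
    assume "\<forall>i. n i < ?T i"
    then have "n l < ?T l" by blast
    then show "Suc (n l) < N" by simp
  qed auto
  have "{n :: 'm \<Rightarrow> nat. (\<forall>i. n i < N) \<and> Suc (n l) < N} = (\<Pi>\<^sub>E i\<in>UNIV. {..<?T i})"
    unfolding iff PiE_UNIV_domain Pi_def by simp
  then have "card {n :: 'm \<Rightarrow> nat. (\<forall>i. n i < N) \<and> Suc (n l) < N} = (\<Prod>i\<in>UNIV. ?T i)"
    by (simp add: card_PiE)
  also have "\<dots> = ?T l * (\<Prod>i\<in>UNIV - {l}. ?T i)" by (rule prod.remove) auto
  also have "(\<Prod>i\<in>UNIV - {l}. ?T i) = (\<Prod>i\<in>UNIV - {l}. N)" by (intro prod.cong) auto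
  finally have "N * card {n :: 'm \<Rightarrow> nat. (\<forall>i. n i < N) \<and> Suc (n l) < N} = (N - 1) * (N * (\<Prod>i\<in>UNIV - {l}. N))"
    by (simp only: if_True mult.left_commute refl)
  also have "N * (\<Prod>i\<in>UNIV - {l}. N) = (\<Prod>i\<in>(UNIV :: 'm set). N)"
    by (rule prod.remove[symmetric]) auto
  finally show ?thesis by simp
qed

section \<open>Fejer kernels on the box\<close>

context
  fixes h :: real and N k :: nat and z :: "nat \<Rightarrow> 'm::finite \<Rightarrow> nat"
  assumes h: "0 < h" and N: "0 < N" and z: "bij_betw z {..<k} {n. \<forall>i. n i < N}"
begin

lemma frequency_count_eq: "k = N ^ CARD('m)"
  using bij_betw_same_card[OF z] by (simp add: card_cube)

lemma frequency_count_pos: "0 < k"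
  using N by (simp add: frequency_count_eq)

definition dirichlet :: "real ^ 'm \<Rightarrow> real ^ 'm \<Rightarrow> complex" where
  "dirichlet \<xi> \<eta> = (\<Sum>j<k. cnj (character (lattice_point h (z j)) \<xi>) * character (lattice_point h (z j)) \<eta>)"

definition fejer :: "real ^ 'm \<Rightarrow> real ^ 'm \<Rightarrow> real" where
  "fejer \<xi> \<eta> = (cmod (dirichlet \<xi> \<eta>))\<^sup>2 / real k"

lemma dirichlet_L2: "dirichlet \<xi> \<in> L2_space (box_measure h)"
  unfolding dirichlet_def[abs_def] by (intro L2_space_sum L2_space_cmult character_L2 h)

lemma dirichlet_measurable [measurable]: "dirichlet \<xi> \<in> borel_measurable borel"
  unfolding dirichlet_def[abs_def] by measurable

lemma integrable_fejer: "integrable (box_measure h) (fejer \<xi>)"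
  unfolding fejer_def[abs_def] by (intro integrable_divide L2_space_integrable dirichlet_L2)

text \<open>The function \<open>dirichlet \<xi>\<close> has \<open>k\<close> coefficients of modulus
  one, so Parseval explains the divisor \<open>k\<close> in \<open>fejer\<close>.\<close>

lemma integral_fejer: "integral\<^sup>L (box_measure h) (fejer \<xi>) = 1"
proof -
  have "integral\<^sup>L (box_measure h) (fejer \<xi>) = (L2_norm (box_measure h) (dirichlet \<xi>))\<^sup>2 / real k"
    by (simp add: fejer_def[abs_def] L2_norm_sq)
  also have "(L2_norm (box_measure h) (dirichlet \<xi>))\<^sup>2 = real k"
    unfolding dirichlet_def[abs_def] by (subst parseval_box[OF h]) (use z in \<open>auto simp: bij_betw_def\<close>)
  finally show ?thesis using frequency_count_pos by simp
qed

lemma integral_fejer_shift: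
  "integral\<^sup>L (box_measure h) (\<lambda>\<eta>. exp (\<i> * of_real (h * (\<eta> $ l - \<xi> $ l))) * of_real (fejer \<xi> \<eta>)) = of_real (1 - 1 / real N)"
proof -
  let ?B = "box_measure h :: (real ^ 'm) measure"
  define sh where "sh = (\<lambda>n :: 'm \<Rightarrow> nat. n(l := Suc (n l)))"
  define E where "E = (\<lambda>\<eta> :: real ^ 'm. exp (\<i> * of_real (h * (\<eta> $ l - \<xi> $ l))))"
  let ?e = "\<lambda>n. character (lattice_point h n)"
  \<comment> \<open>Multiplication by \<open>E\<close> moves each frequency to its neighbour in
    direction \<open>l\<close>, and the phase at \<xi> moves along.\<close>
  have sh: "E \<eta> * (cnj (?e n \<xi>) * ?e n \<eta>) = cnj (?e (sh n) \<xi>) * ?e (sh n) \<eta>" for n \<eta>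
  proof -
    have "lattice_point h (sh n) = lattice_point h n + axis l h"
      by (auto simp: lattice_point_def sh_def vec_eq_iff axis_def algebra_simps)
    then have "?e (sh n) x = exp (\<i> * of_real (h * x $ l)) * ?e n x" for x
      by (simp add: character_def inner_add_left inner_axis' exp_add[symmetric] algebra_simps)
    moreover have "E \<eta> = cnj (exp (\<i> * of_real (h * \<xi> $ l))) * exp (\<i> * of_real (h * \<eta> $ l))"
      by (simp add: E_def exp_cnj exp_add[symmetric] algebra_simps)
    ultimately show ?thesis by (simp add: mult_ac)
  qed
  define S where "S = (\<lambda>\<eta>. \<Sum>j<k. cnj (?e (sh (z j)) \<xi>) * ?e (sh (z j)) \<eta>)"
  have ES: "E \<eta> * dirichlet \<xi> \<eta> = S \<eta>" for \<eta>
    by (simp add: dirichlet_def S_def sum_distrib_left sh)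
  have "integral\<^sup>L ?B (\<lambda>\<eta>. E \<eta> * of_real (fejer \<xi> \<eta>)) = L2_inner ?B S (dirichlet \<xi>) / of_nat k"
  proof -
    have "E \<eta> * of_real (fejer \<xi> \<eta>) = S \<eta> * cnj (dirichlet \<xi> \<eta>) / of_nat k" for \<eta>
      unfolding ES[symmetric] fejer_def by (simp add: complex_norm_square del: of_real_power)
    then show ?thesis by (simp add: L2_inner_def)
  qed
  also have "L2_inner ?B S (dirichlet \<xi>) = (\<Sum>j<k. cnj (?e (sh (z j)) \<xi>) * L2_inner ?B (?e (sh (z j))) (dirichlet \<xi>))"
    unfolding S_def using dirichlet_L2
    by (subst L2_inner_sum_left) (auto intro: L2_space_cmult character_L2 h simp: L2_inner_cmult_left)
  also have "\<dots> = (\<Sum>j<k. if Suc (z j l) < N then 1 else 0)"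
  proof (intro sum.cong refl)
    fix j assume j: "j \<in> {..<k}"
    have zj: "z j i < N" for i using z j by (auto simp: bij_betw_def)
    have "L2_inner ?B (?e (sh (z j))) (dirichlet \<xi>) = cnj (L2_inner ?B (dirichlet \<xi>) (?e (sh (z j))))"
      by (rule L2_inner_cnj)
    also have "L2_inner ?B (dirichlet \<xi>) (?e (sh (z j))) = (\<Sum>i<k. cnj (?e (z i) \<xi>) * L2_inner ?B (?e (z i)) (?e (sh (z j))))"
      unfolding dirichlet_def[abs_def]
      by (subst L2_inner_sum_left) (auto intro: L2_space_cmult character_L2 h simp: L2_inner_cmult_left)
    also have "\<dots> = (\<Sum>i<k. if z i = sh (z j) then cnj (?e (sh (z j)) \<xi>) else 0)"
      by (intro sum.cong refl) (auto simp: box_measure_inner[OF h])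
    also have "\<dots> = (if Suc (z j l) < N then cnj (?e (sh (z j)) \<xi>) else 0)"
    proof (cases "Suc (z j l) < N")
      case True
      then have "sh (z j) \<in> {n. \<forall>i. n i < N}" using zj by (auto simp: sh_def)
      then have "sh (z j) \<in> z ` {..<k}" using z by (simp add: bij_betw_def)
      then obtain i0 where i0: "i0 < k" "z i0 = sh (z j)" by auto
      have "(\<Sum>i<k. if z i = sh (z j) then cnj (?e (sh (z j)) \<xi>) else 0) = (\<Sum>i<k. if i = i0 then cnj (?e (sh (z j)) \<xi>) else 0)"
        using z i0 by (intro sum.cong refl) (auto simp: bij_betw_def inj_on_def)
      then show ?thesis using True i0 by simp
    next
      case False
      have "z i \<noteq> sh (z j)" if "i < k" for i
      proof
        assume "z i = sh (z j)"
        then have "z i l = Suc (z j l)" by (simp add: sh_def)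
        moreover have "z i l < N" using z that by (auto simp: bij_betw_def)
        ultimately show False using False by simp
      qed
      then show ?thesis using False by (intro trans[OF sum.neutral]) auto
    qed
    finally show "cnj (?e (sh (z j)) \<xi>) * L2_inner ?B (?e (sh (z j))) (dirichlet \<xi>) = (if Suc (z j l) < N then 1 else 0)"
      using complex_norm_square[of "?e (sh (z j)) \<xi>"] by (simp add: mult.commute)
  qed
  also have "\<dots> = of_nat (card {j\<in>{..<k}. Suc (z j l) < N})" by (simp add: sum.If_cases Int_def)
  also have "card {j\<in>{..<k}. Suc (z j l) < N} = card {n :: 'm \<Rightarrow> nat. (\<forall>i. n i < N) \<and> Suc (n l) < N}"
  proof (rule bij_betw_same_card[of z])
    have "z ` {j\<in>{..<k}. Suc (z j l) < N} = {n \<in> z ` {..<k}. Suc (n l) < N}" by auto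
    moreover have "inj_on z {j\<in>{..<k}. Suc (z j l) < N}"
      using z by (auto simp: bij_betw_def intro: inj_on_subset)
    ultimately show "bij_betw z {j\<in>{..<k}. Suc (z j l) < N} {n. (\<forall>i. n i < N) \<and> Suc (n l) < N}"
      using z by (simp add: bij_betw_def)
  qed
  finally have *: "integral\<^sup>L ?B (\<lambda>\<eta>. E \<eta> * of_real (fejer \<xi> \<eta>))
      = of_nat (card {n :: 'm \<Rightarrow> nat. (\<forall>i. n i < N) \<and> Suc (n l) < N}) / of_nat k" .
  have "real N * real (card {n :: 'm \<Rightarrow> nat. (\<forall>i. n i < N) \<and> Suc (n l) < N}) = (real N - 1) * real k"
    using arg_cong[OF card_cube_shift[of N l], of real] N by (simp add: frequency_count_eq of_nat_diff)
  then have "real (card {n :: 'm \<Rightarrow> nat. (\<forall>i. n i < N) \<and> Suc (n l) < N}) / real k = 1 - 1 / real N"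
    using N frequency_count_pos by (simp add: field_simps)
  then have "complex_of_real (real (card {n :: 'm \<Rightarrow> nat. (\<forall>i. n i < N) \<and> Suc (n l) < N}) / real k) = of_real (1 - 1 / real N)"
    by (simp only:)
  then show ?thesis using * by (simp add: E_def)
qed

text \<open>By Parseval, \<open>1 - 1 / N\<close> is the proportion of points of the frequency cube whose neighbour in
  direction \<open>l\<close> is still in the cube, so the Fejer kernel concentrates as \<open>N\<close> grows.\<close>

lemma fejer_second_moment:
  shows "integrable (box_measure h) (\<lambda>\<eta>. (cmod (exp (\<i> * of_real (h * (\<eta> $ l - \<xi> $ l))) - 1))\<^sup>2 * fejer \<xi> \<eta>)"
    and "integral\<^sup>L (box_measure h) (\<lambda>\<eta>. (cmod (exp (\<i> * of_real (h * (\<eta> $ l - \<xi> $ l))) - 1))\<^sup>2 * fejer \<xi> \<eta>) = 2 / real N"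
proof -
  let ?B = "box_measure h :: (real ^ 'm) measure"
  define E where "E = (\<lambda>\<eta> :: real ^ 'm. exp (\<i> * of_real (h * (\<eta> $ l - \<xi> $ l))))"
  have [measurable]: "E \<in> borel_measurable borel"
    unfolding E_def by (intro borel_measurable_continuous_onI continuous_intros)
  have cE: "cmod (E \<eta>) = 1" for \<eta> by (simp add: E_def)
  have eq: "(cmod (E \<eta> - 1))\<^sup>2 * fejer \<xi> \<eta> = 2 * fejer \<xi> \<eta> - 2 * Re (E \<eta> * of_real (fejer \<xi> \<eta>))" for \<eta>
  proof -
    have "(Re (E \<eta>))\<^sup>2 + (Im (E \<eta>))\<^sup>2 = 1" using cE[of \<eta>] by (simp add: cmod_power2[symmetric])
    then have cm: "(cmod (E \<eta> - 1))\<^sup>2 = 2 - 2 * Re (E \<eta>)" by (simp add: cmod_power2 power2_diff)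
    show ?thesis unfolding cm by (simp add: algebra_simps)
  qed
  have iE: "integrable ?B (\<lambda>\<eta>. E \<eta> * of_real (fejer \<xi> \<eta>))"
    by (rule Bochner_Integration.integrable_bound[OF integrable_fejer[of \<xi>]])
       (use integrable_fejer[of \<xi>] in \<open>auto simp: norm_mult cE\<close>)
  show "integrable ?B (\<lambda>\<eta>. (cmod (exp (\<i> * of_real (h * (\<eta> $ l - \<xi> $ l))) - 1))\<^sup>2 * fejer \<xi> \<eta>)"
  proof -
    have "integrable ?B (\<lambda>\<eta>. (cmod (E \<eta> - 1))\<^sup>2 * fejer \<xi> \<eta>)"
      unfolding eq by (intro Bochner_Integration.integrable_diff integrable_mult_right integrable_Re iE integrable_fejer)
    then show ?thesis by (simp only: E_def)
  qed
  have "integral\<^sup>L ?B (\<lambda>\<eta>. (cmod (E \<eta> - 1))\<^sup>2 * fejer \<xi> \<eta>) = 2 * 1 - 2 * Re (of_real (1 - 1 / real N))"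
  proof -
    have v: "integral\<^sup>L ?B (\<lambda>\<eta>. E \<eta> * of_real (fejer \<xi> \<eta>)) = of_real (1 - 1 / real N)"
      using integral_fejer_shift[of l \<xi>] by (simp add: E_def)
    have "integral\<^sup>L ?B (\<lambda>\<eta>. Re (E \<eta> * of_real (fejer \<xi> \<eta>))) = Re (of_real (1 - 1 / real N))"
      unfolding v[symmetric] by (rule integral_Re[OF iE])
    then show ?thesis
      unfolding eq using integrable_fejer[of \<xi>] integrable_Re[OF iE] integral_fejer[of \<xi>]
      by (subst Bochner_Integration.integral_diff) simp_all
  qed
  then show "integral\<^sup>L ?B (\<lambda>\<eta>. (cmod (exp (\<i> * of_real (h * (\<eta> $ l - \<xi> $ l))) - 1))\<^sup>2 * fejer \<xi> \<eta>) = 2 / real N"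
    by (simp add: E_def)
qed

text \<open>Chebyshev's inequality for the second moment \<open>D\<close>. Outside the ball of
  radius \<delta> the function \<open>D\<close> is at least
  \<open>\<delta>\<^sup>2 * h\<^sup>2 / 256\<close>, while two values of \<theta> differ by at most
  2, whence the weight 512; the integral of \<open>D\<close> is twice the dimension over
  \<open>N\<close>, whence 1024. With \<xi> in the half box, \<open>h\<close> times a coordinate of
  \<eta> - \<xi> stays below the next period, where \<open>D\<close> would vanish again.\<close>

lemma fejer_convergence:
  fixes \<theta> :: "real ^ 'm \<Rightarrow> complex" and \<xi> :: "real ^ 'm"
  assumes \<theta>[measurable]: "\<theta> \<in> borel_measurable borel" and \<theta>1: "\<And>x. cmod (\<theta> x) \<le> 1"
    and \<xi>: "\<And>i. \<bar>\<xi> $ i\<bar> \<le> pi / (2 * h)"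
    and \<epsilon>: "0 < \<epsilon>" and \<delta>: "0 < \<delta>" and mod: "\<And>\<eta>. norm (\<eta> - \<xi>) < \<delta> \<Longrightarrow> cmod (\<theta> \<eta> - \<theta> \<xi>) \<le> \<epsilon>"
  shows "cmod (integral\<^sup>L (box_measure h) (\<lambda>\<eta>. \<theta> \<eta> * of_real (fejer \<xi> \<eta>)) - \<theta> \<xi>)
      \<le> \<epsilon> + 1024 * real CARD('m) / (\<delta>\<^sup>2 * h\<^sup>2 * real N)"
proof -
  let ?B = "box_measure h :: (real ^ 'm) measure"
  define D where "D = (\<lambda>\<eta> :: real ^ 'm. \<Sum>l\<in>UNIV. (cmod (exp (\<i> * of_real (h * (\<eta> $ l - \<xi> $ l))) - 1))\<^sup>2)"
  note fi = integrable_fejer[of \<xi>]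
  have [measurable]: "fejer \<xi> \<in> borel_measurable borel" using fi by (auto dest: borel_measurable_integrable)
  have f0: "0 \<le> fejer \<xi> \<eta>" for \<eta> by (simp add: fejer_def)
  have i1: "integrable ?B (\<lambda>\<eta>. \<theta> \<eta> * of_real (fejer \<xi> \<eta>))"
  proof (rule Bochner_Integration.integrable_bound[OF fi])
    show "AE \<eta> in ?B. norm (\<theta> \<eta> * of_real (fejer \<xi> \<eta>)) \<le> norm (fejer \<xi> \<eta>)"
      using \<theta>1 f0 by (auto simp: norm_mult mult_left_le_one_le)
  qed measurable
  have i2: "integrable ?B (\<lambda>\<eta>. \<theta> \<xi> * of_real (fejer \<xi> \<eta>))"
    using fi by (intro integrable_mult_right integrable_of_real)
  have D1: "integrable ?B (\<lambda>\<eta>. D \<eta> * fejer \<xi> \<eta>)"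
    unfolding D_def sum_distrib_right by (intro Bochner_Integration.integrable_sum fejer_second_moment)
  have D2: "integral\<^sup>L ?B (\<lambda>\<eta>. D \<eta> * fejer \<xi> \<eta>) = 2 * real CARD('m) / real N"
    unfolding D_def sum_distrib_right
    by (simp only: Bochner_Integration.integral_sum[OF fejer_second_moment(1)] fejer_second_moment(2)) simp
  have box: "AE \<eta> in ?B. \<forall>i. \<bar>\<eta> $ i\<bar> \<le> pi / h"
  proof -
    have "\<forall>i. \<bar>\<eta> $ i\<bar> \<le> pi / h" if "0 < box_weight h \<eta>" for \<eta> :: "real ^ 'm"
    proof
      fix i
      have "h / (2 * pi) * indicator {- pi / h..pi / h} (\<eta> $ i) \<noteq> 0"
proof
        assume "h / (2 * pi) * indicator {- pi / h..pi / h} (\<eta> $ i) = (0 :: real)"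
        then have "box_weight h \<eta> = 0" unfolding box_weight_def by (intro prod_zero) auto
        then show False using that by simp
      qed
      then show "\<bar>\<eta> $ i\<bar> \<le> pi / h" by (auto simp: indicator_def abs_le_iff split: if_splits)
    qed
    then show ?thesis unfolding box_measure_def by (subst AE_density) auto
  qed
  have "integral\<^sup>L ?B (\<lambda>\<eta>. \<theta> \<eta> * of_real (fejer \<xi> \<eta>)) - \<theta> \<xi>
     = integral\<^sup>L ?B (\<lambda>\<eta>. \<theta> \<eta> * of_real (fejer \<xi> \<eta>) - \<theta> \<xi> * of_real (fejer \<xi> \<eta>))"
    using i1 i2 by (simp add: integral_fejer)
  also have "cmod \<dots> \<le> integral\<^sup>L ?B (\<lambda>\<eta>. cmod (\<theta> \<eta> * of_real (fejer \<xi> \<eta>) - \<theta> \<xi> * of_real (fejer \<xi> \<eta>)))"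
    by (rule integral_norm_bound)
  also have "\<dots> \<le> integral\<^sup>L ?B (\<lambda>\<eta>. \<epsilon> * fejer \<xi> \<eta> + 512 / (\<delta>\<^sup>2 * h\<^sup>2) * (D \<eta> * fejer \<xi> \<eta>))"
  proof (rule integral_mono_AE)
    show "AE \<eta> in ?B. cmod (\<theta> \<eta> * of_real (fejer \<xi> \<eta>) - \<theta> \<xi> * of_real (fejer \<xi> \<eta>))
        \<le> \<epsilon> * fejer \<xi> \<eta> + 512 / (\<delta>\<^sup>2 * h\<^sup>2) * (D \<eta> * fejer \<xi> \<eta>)"
      using box
    proof eventually_elim
      case (elim \<eta>)
      have D0: "0 \<le> D \<eta>" unfolding D_def by (intro sum_nonneg) simp
      have c0: "0 \<le> 512 / (\<delta>\<^sup>2 * h\<^sup>2) * D \<eta>" using D0 by simp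
      have "cmod (\<theta> \<eta> - \<theta> \<xi>) \<le> \<epsilon> + 512 / (\<delta>\<^sup>2 * h\<^sup>2) * D \<eta>"
      proof (cases "norm (\<eta> - \<xi>) < \<delta>")
        case True
        then show ?thesis using mod[OF True] c0 by linarith
      next
        case False
        have "(h * (\<eta> $ l - \<xi> $ l))\<^sup>2 \<le> 256 * (cmod (exp (\<i> * of_real (h * (\<eta> $ l - \<xi> $ l))) - 1))\<^sup>2" for l
        proof (rule square_le_cmod_exp)
          have "\<bar>\<eta> $ l - \<xi> $ l\<bar> \<le> pi / h + pi / (2 * h)" using elim \<xi>[of l] by (smt (verit) abs_triangle_ineq4)
          then have "h * \<bar>\<eta> $ l - \<xi> $ l\<bar> \<le> h * (pi / h + pi / (2 * h))" using h by (intro mult_left_mono) auto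
          also have "\<dots> = 3 * pi / 2" using h by (simp add: field_simps)
          finally show "\<bar>h * (\<eta> $ l - \<xi> $ l)\<bar> \<le> 3 * pi / 2" using h by (simp add: abs_mult)
        qed
        then have "(\<Sum>l\<in>UNIV. (h * (\<eta> $ l - \<xi> $ l))\<^sup>2) \<le> 256 * D \<eta>"
          unfolding D_def sum_distrib_left by (intro sum_mono)
        also have "(\<Sum>l\<in>UNIV. (h * (\<eta> $ l - \<xi> $ l))\<^sup>2) = h\<^sup>2 * (norm (\<eta> - \<xi>))\<^sup>2"
          unfolding power2_norm_eq_inner inner_vec_def
          by (simp add: sum_distrib_left power2_eq_square mult_ac)
        finally have "h\<^sup>2 * (norm (\<eta> - \<xi>))\<^sup>2 \<le> 256 * D \<eta>" .
        moreover have "h\<^sup>2 * \<delta>\<^sup>2 \<le> h\<^sup>2 * (norm (\<eta> - \<xi>))\<^sup>2"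
          using False \<delta> by (intro mult_left_mono power_mono) auto
        ultimately have "h\<^sup>2 * \<delta>\<^sup>2 \<le> 256 * D \<eta>" by linarith
        then have "2 \<le> 512 / (\<delta>\<^sup>2 * h\<^sup>2) * D \<eta>"
          using h \<delta> by (simp add: field_simps)
        moreover have "cmod (\<theta> \<eta> - \<theta> \<xi>) \<le> 2"
          using norm_triangle_ineq4[of "\<theta> \<eta>" "\<theta> \<xi>"] \<theta>1[of \<eta>] \<theta>1[of \<xi>] by linarith
        ultimately show ?thesis using \<epsilon> by linarith
      qed
      then have "cmod (\<theta> \<eta> - \<theta> \<xi>) * fejer \<xi> \<eta> \<le> (\<epsilon> + 512 / (\<delta>\<^sup>2 * h\<^sup>2) * D \<eta>) * fejer \<xi> \<eta>"
        by (rule mult_right_mono[OF _ f0])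
      moreover have "cmod (\<theta> \<eta> * of_real (fejer \<xi> \<eta>) - \<theta> \<xi> * of_real (fejer \<xi> \<eta>)) = cmod (\<theta> \<eta> - \<theta> \<xi>) * fejer \<xi> \<eta>"
        unfolding left_diff_distrib[symmetric] norm_mult using f0 by simp
      ultimately show ?case by (simp add: distrib_right mult.assoc)
    qed
  qed (use i1 i2 fi D1 in auto)
  also have "\<dots> = \<epsilon> + 512 / (\<delta>\<^sup>2 * h\<^sup>2) * (2 * real CARD('m) / real N)"
    using fi D1 D2 by (simp add: integral_fejer)
  also have "\<dots> = \<epsilon> + 1024 * real CARD('m) / (\<delta>\<^sup>2 * h\<^sup>2 * real N)" by simp
  finally show ?thesis .
qed

lemma fejer_mean_le:
  fixes \<theta> :: "real ^ 'm \<Rightarrow> complex"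
  assumes \<theta>[measurable]: "\<theta> \<in> borel_measurable borel" and \<theta>1: "\<And>x. cmod (\<theta> x) \<le> 1"
  shows "cmod (integral\<^sup>L (box_measure h) (\<lambda>\<eta>. \<theta> \<eta> * of_real (fejer \<xi> \<eta>))) \<le> 1"
proof -
  have f0: "0 \<le> fejer \<xi> \<eta>" for \<eta> by (simp add: fejer_def)
  note fi = integrable_fejer[of \<xi>]
  have [measurable]: "fejer \<xi> \<in> borel_measurable borel" using fi by (auto dest: borel_measurable_integrable)
  have "cmod (integral\<^sup>L (box_measure h) (\<lambda>\<eta>. \<theta> \<eta> * of_real (fejer \<xi> \<eta>)))
      \<le> integral\<^sup>L (box_measure h) (\<lambda>\<eta>. cmod (\<theta> \<eta> * of_real (fejer \<xi> \<eta>)))"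
    by (rule integral_norm_bound)
  also have "\<dots> \<le> integral\<^sup>L (box_measure h) (fejer \<xi>)"
  proof (rule integral_mono[OF _ fi])
    show le: "cmod (\<theta> \<eta> * of_real (fejer \<xi> \<eta>)) \<le> fejer \<xi> \<eta>" for \<eta>
      using \<theta>1 f0 by (simp add: norm_mult mult_left_le_one_le)
    show "integrable (box_measure h) (\<lambda>\<eta>. cmod (\<theta> \<eta> * of_real (fejer \<xi> \<eta>)))"
      by (rule Bochner_Integration.integrable_bound[OF fi]) (use le f0 in auto)
  qed
  finally show ?thesis by (simp add: integral_fejer)
qed

text \<open>Expanding the square in the kernel shows the Fejer mean of \<theta> as the sum over all
  entries of its Toeplitz matrix, each multiplied by a character at a difference of lattice points.
  Integrated against \<open>q\<close>, those characters become the values of a Schur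
  multiplier.\<close>

lemma fejer_mean_bilinear:
  fixes \<theta> :: "real ^ 'm \<Rightarrow> complex"
  assumes \<theta>[measurable]: "\<theta> \<in> borel_measurable borel" and \<theta>1: "\<And>x. cmod (\<theta> x) \<le> 1"
  shows "(\<Sum>i<k. \<Sum>j<k. integral\<^sup>L (box_measure h) (\<lambda>\<eta>. \<theta> \<eta> * character (lattice_point h (z i)) \<eta> * cnj (character (lattice_point h (z j)) \<eta>))
      * character (lattice_point h (z j) - lattice_point h (z i)) \<xi>)
    = of_nat k * integral\<^sup>L (box_measure h) (\<lambda>\<eta>. \<theta> \<eta> * of_real (fejer \<xi> \<eta>))"
proof -
  interpret finite_measure "box_measure h :: (real ^ 'm) measure" by (rule finite_box_measure[OF h])
  let ?B = "box_measure h :: (real ^ 'm) measure" and ?e = "\<lambda>j. character (lattice_point h (z j))"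
  have i: "integrable ?B (\<lambda>\<eta>. \<theta> \<eta> * ?e i \<eta> * cnj (?e j \<eta>))" for i j
    by (rule integrable_const_bound[where B = 1]) (auto simp: norm_mult \<theta>1)
  have "\<theta> \<eta> * of_real (fejer \<xi> \<eta>) * of_nat k
      = (\<Sum>i<k. \<Sum>j<k. \<theta> \<eta> * ?e i \<eta> * cnj (?e j \<eta>) * character (lattice_point h (z j) - lattice_point h (z i)) \<xi>)" for \<eta>
  proof -
    have "of_real (fejer \<xi> \<eta>) * of_nat k = dirichlet \<xi> \<eta> * cnj (dirichlet \<xi> \<eta>)"
      using frequency_count_pos by (simp add: fejer_def complex_norm_square del: of_real_power)
    also have "\<dots> = (\<Sum>i<k. \<Sum>j<k. (cnj (?e i \<xi>) * ?e i \<eta>) * cnj (cnj (?e j \<xi>) * ?e j \<eta>))"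
      by (simp add: dirichlet_def sum_product)
    also have "\<dots> = (\<Sum>i<k. \<Sum>j<k. ?e i \<eta> * cnj (?e j \<eta>) * character (lattice_point h (z j) - lattice_point h (z i)) \<xi>)"
      by (simp add: character_mult_cnj[symmetric] mult_ac)
    finally show ?thesis by (simp add: mult.assoc sum_distrib_left)
  qed
  then have "integral\<^sup>L ?B (\<lambda>\<eta>. \<theta> \<eta> * of_real (fejer \<xi> \<eta>) * of_nat k)
      = integral\<^sup>L ?B (\<lambda>\<eta>. \<Sum>i<k. \<Sum>j<k. \<theta> \<eta> * ?e i \<eta> * cnj (?e j \<eta>) * character (lattice_point h (z j) - lattice_point h (z i)) \<xi>)"
    by (simp only:)
  also have "\<dots> = (\<Sum>i<k. \<Sum>j<k. integral\<^sup>L ?B (\<lambda>\<eta>. \<theta> \<eta> * ?e i \<eta> * cnj (?e j \<eta>)) * character (lattice_point h (z j) - lattice_point h (z i)) \<xi>)"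
    using i by (subst Bochner_Integration.integral_sum | simp)+
  finally show ?thesis by (simp add: mult.commute)
qed

end

text \<open>With \<theta> the conjugate phase of \<open>q\<close>, the integral of
  \<open>q * \<theta>\<close> is the total mass. For a Fejer mean in place of \<theta> the integral
  is the Schur product of \<phi> with a Toeplitz contraction, tested on the constant vector; the two
  norms \<open>sqrt k\<close> of that vector cancel the divisor \<open>k\<close>. Dominated
  convergence passes to the limit.\<close>

lemma fourier_schur_bound:
  fixes q :: "real ^ 'm::finite \<Rightarrow> complex"
  assumes q: "integrable lborel q" and cont: "\<And>\<xi>. \<xi> \<noteq> 0 \<Longrightarrow> isCont q \<xi>"
    and \<phi>: "\<And>b. \<phi> b = (LBINT \<xi>. q \<xi> * character b \<xi>)"
    and schur: "\<And>k b c v. (\<And>v. L2_set (\<lambda>i. cmod (\<Sum>j<k. c i j * v j)) {..<k} \<le> L2_set (\<lambda>j. cmod (v j)) {..<k}) \<Longrightarrow>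
      L2_set (\<lambda>i. cmod (\<Sum>j<k. c i j * \<phi> (b j - b i) * v j)) {..<k} \<le> \<kappa> * L2_set (\<lambda>j. cmod (v j)) {..<(k::nat)}"
  shows "(LBINT \<xi>. cmod (q \<xi>)) \<le> \<kappa>"
proof -
  \<comment> \<open>At the zeros of \<open>q\<close> division by zero gives the value 0. Continuity
    of \<theta> is needed only where \<open>q\<close> is nonzero, away from the origin.\<close>
  define \<theta> where "\<theta> = (\<lambda>\<xi>. cnj (q \<xi>) / of_real (cmod (q \<xi>)))"
  have qm[measurable]: "q \<in> borel_measurable borel" using q by auto
  have \<theta>m[measurable]: "\<theta> \<in> borel_measurable borel" unfolding \<theta>_def by measurable
  have \<theta>1: "cmod (\<theta> x) \<le> 1" for x by (simp add: \<theta>_def norm_divide divide_le_eq_1)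
  have q\<theta>: "q x * \<theta> x = of_real (cmod (q x))" for x
    by (cases "q x = 0") (simp_all add: \<theta>_def complex_norm_square[symmetric] power2_eq_square)
  \<comment> \<open>The mesh \<open>1 / (M + 1)\<close> makes the box exhaust the space. For the
    error in \<open>fejer_convergence\<close> to vanish, \<open>N\<close> must outgrow the inverse
    square of the mesh; the third power leaves the divisor \<open>M + 1\<close>.\<close>
  define N where "N = (\<lambda>M :: nat. Suc M ^ 3)"
  define h where "h = (\<lambda>M :: nat. 1 / real (Suc M))"
  have N0: "0 < N M" and h0: "0 < h M" for M by (simp_all add: N_def h_def)
  define k where "k = (\<lambda>M. card {n :: 'm \<Rightarrow> nat. \<forall>i. n i < N M})"
  have "\<exists>z. bij_betw z {..<k M} {n :: 'm \<Rightarrow> nat. \<forall>i. n i < N M}" for M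
    using ex_bij_betw_nat_finite[OF finite_cube[where N = "N M" and 'm = 'm]] by (simp add: k_def atLeast0LessThan)
  then obtain z where z: "\<And>M. bij_betw (z M) {..<k M} {n :: 'm \<Rightarrow> nat. \<forall>i. n i < N M}" by metis
  define F where "F = (\<lambda>M \<xi>. integral\<^sup>L (box_measure (h M)) (\<lambda>\<eta>. \<theta> \<eta> * of_real (fejer (h M) (k M) (z M) \<xi> \<eta>)))"
  define c where "c = (\<lambda>M i j. integral\<^sup>L (box_measure (h M)) (\<lambda>\<eta>. \<theta> \<eta> * character (lattice_point (h M) (z M i)) \<eta> * cnj (character (lattice_point (h M) (z M j)) \<eta>)))"
  have k0: "0 < k M" for M using frequency_count_pos[OF h0 N0 z] .
  have F_eq: "F M \<xi> = (\<Sum>i<k M. \<Sum>j<k M. c M i j * character (lattice_point (h M) (z M j) - lattice_point (h M) (z M i)) \<xi>) / of_nat (k M)" for M \<xi>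
    using fejer_mean_bilinear[OF h0[of M] N0[of M] z[of M] \<theta>m \<theta>1, where \<xi> = \<xi>] k0[of M] by (simp add: F_def c_def)
  have F_meas[measurable]: "F M \<in> borel_measurable borel" for M
    unfolding F_eq[abs_def] by measurable
  have F1: "cmod (F M \<xi>) \<le> 1" for M \<xi>
    unfolding F_def by (rule fejer_mean_le[OF h0 N0 z \<theta>m \<theta>1])
  have bound: "cmod (LBINT \<xi>. q \<xi> * F M \<xi>) \<le> \<kappa>" for M
  proof -
    let ?k = "k M" and ?b = "\<lambda>j. lattice_point (h M) (z M j)"
    have inj: "inj_on (z M) {..<?k}" using z[of M] by (simp add: bij_betw_def)
    have contr: "L2_set (\<lambda>i. cmod (\<Sum>j<?k. c M i j * v j)) {..<?k} \<le> L2_set (\<lambda>j. cmod (v j)) {..<?k}" for v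
      unfolding c_def by (rule toeplitz_contraction[OF h0 inj \<theta>m \<theta>1])
    have ci: "integrable lborel (\<lambda>\<xi>. q \<xi> * character x \<xi>)" for x
      by (rule Bochner_Integration.integrable_bound[OF q]) (auto simp: norm_mult)
    have "(LBINT \<xi>. q \<xi> * F M \<xi>) = (LBINT \<xi>. (\<Sum>i<?k. \<Sum>j<?k. c M i j * (q \<xi> * character (?b j - ?b i) \<xi>)) / of_nat ?k)"
      unfolding F_eq by (simp add: sum_distrib_left mult_ac)
    also have "\<dots> = (\<Sum>i<?k. \<Sum>j<?k. c M i j * \<phi> (?b j - ?b i)) / of_nat ?k"
      using ci by (simp add: \<phi>)
    finally have eq: "(LBINT \<xi>. q \<xi> * F M \<xi>) = (\<Sum>i<?k. \<Sum>j<?k. c M i j * \<phi> (?b j - ?b i)) / of_nat ?k" .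
    have s: "L2_set (\<lambda>i. cmod (\<Sum>j<?k. c M i j * \<phi> (?b j - ?b i))) {..<?k} \<le> \<kappa> * sqrt (real ?k)"
      using schur[OF contr, of ?b "\<lambda>_. 1"] by (simp add: L2_set_def)
    have "cmod (\<Sum>i<?k. \<Sum>j<?k. c M i j * \<phi> (?b j - ?b i)) \<le> (\<Sum>i<?k. \<bar>cmod (\<Sum>j<?k. c M i j * \<phi> (?b j - ?b i))\<bar> * \<bar>1\<bar>)"
      by (simp add: norm_sum)
    also have "\<dots> \<le> L2_set (\<lambda>i. cmod (\<Sum>j<?k. c M i j * \<phi> (?b j - ?b i))) {..<?k} * L2_set (\<lambda>_. 1) {..<?k}"
      by (rule L2_set_mult_ineq)
    also have "\<dots> \<le> \<kappa> * sqrt (real ?k) * sqrt (real ?k)"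
      using s by (intro mult_mono) (auto simp: L2_set_def intro: order_trans[OF L2_set_nonneg])
    also have "\<dots> = \<kappa> * real ?k" by simp
    finally show ?thesis using k0[of M] by (simp add: eq norm_divide divide_le_eq)
  qed
  have conv: "(\<lambda>M. q \<xi> * F M \<xi>) \<longlonglongrightarrow> q \<xi> * \<theta> \<xi>" if \<xi>: "\<xi> \<noteq> 0" for \<xi>
  proof (cases "q \<xi> = 0")
    case False
    have \<theta>c: "isCont \<theta> \<xi>" unfolding \<theta>_def using cont[OF \<xi>] False by (intro continuous_intros) auto
    have "(\<lambda>M. F M \<xi>) \<longlonglongrightarrow> \<theta> \<xi>"
    proof (rule LIMSEQ_I)
      fix r :: real assume r: "0 < r"
      then obtain \<delta> where \<delta>: "0 < \<delta>" "\<And>\<eta>. norm (\<eta> - \<xi>) < \<delta> \<Longrightarrow> cmod (\<theta> \<eta> - \<theta> \<xi>) < r / 2"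
        using \<theta>c unfolding isCont_def LIM_def continuous_at_eps_delta dist_norm
        by (metis (no_types, opaque_lifting) \<theta>c continuous_at_eps_delta dist_norm half_gt_zero)
      define K where "K = 1024 * real CARD('m) / \<delta>\<^sup>2"
      have lim: "(\<lambda>M. K / real (Suc M)) \<longlonglongrightarrow> 0"
        using tendsto_mult_right_zero[OF LIMSEQ_Suc[OF lim_1_over_n], of K] by (simp add: divide_inverse)
      have "eventually (\<lambda>M. K / real (Suc M) < r / 2) sequentially"
        using order_tendstoD(2)[OF lim, of "r / 2"] r by simp
      \<comment> \<open>From such an index on, \<xi> lies in the half box that
        \<open>fejer_convergence\<close> asks for.\<close>
      moreover have "eventually (\<lambda>M. norm \<xi> \<le> real (Suc M)) sequentially"
        by (rule eventually_sequentiallyI[of "nat \<lceil>norm \<xi>\<rceil>"]) linarith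
      ultimately have "eventually (\<lambda>M. norm (F M \<xi> - \<theta> \<xi>) < r) sequentially"
      proof eventually_elim
        case (elim M)
        have "cmod (F M \<xi> - \<theta> \<xi>) \<le> r / 2 + 1024 * real CARD('m) / (\<delta>\<^sup>2 * (h M)\<^sup>2 * real (N M))"
          unfolding F_def
        proof (rule fejer_convergence[OF h0 N0 z \<theta>m \<theta>1])
          fix i
          have "\<bar>\<xi> $ i\<bar> \<le> real (Suc M) * 1" using elim(2) component_le_norm_cart[of \<xi> i] by simp
          also have "\<dots> \<le> real (Suc M) * (pi / 2)" using pi_gt3 by (intro mult_left_mono) auto
          also have "\<dots> = pi / (2 * h M)" by (simp add: h_def)
          finally show "\<bar>\<xi> $ i\<bar> \<le> pi / (2 * h M)" .
        qed (use r \<delta> in \<open>auto intro: less_imp_le\<close>)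
        also have "1024 * real CARD('m) / (\<delta>\<^sup>2 * (h M)\<^sup>2 * real (N M)) = K / real (Suc M)"
        proof -
          have "(h M)\<^sup>2 * real (N M) = real (Suc M)"
            unfolding h_def N_def of_nat_power by (simp add: power2_eq_square power3_eq_cube del: of_nat_Suc)
          then show ?thesis by (simp add: K_def mult.assoc del: of_nat_Suc)
        qed
        finally show ?case using elim(1) by linarith
      qed
      then show "\<exists>no. \<forall>M\<ge>no. norm (F M \<xi> - \<theta> \<xi>) < r" by (simp add: eventually_sequentially)
    qed
    then show ?thesis by (intro tendsto_mult tendsto_const)
  qed simp
  have "(\<lambda>M. LBINT \<xi>. q \<xi> * F M \<xi>) \<longlonglongrightarrow> (LBINT \<xi>. q \<xi> * \<theta> \<xi>)"
  proof (rule integral_dominated_convergence)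
    show "integrable lborel (\<lambda>\<xi>. cmod (q \<xi>))" using q by simp
    show "AE \<xi> in lborel. (\<lambda>M. q \<xi> * F M \<xi>) \<longlonglongrightarrow> q \<xi> * \<theta> \<xi>"
      using AE_lborel_singleton[of "0 :: real ^ 'm"] by eventually_elim (rule conv)
    show "AE \<xi> in lborel. norm (q \<xi> * F M \<xi>) \<le> cmod (q \<xi>)" for M
      using F1 by (auto simp: norm_mult mult_left_le)
  qed measurable
  then have "(\<lambda>M. cmod (LBINT \<xi>. q \<xi> * F M \<xi>)) \<longlonglongrightarrow> cmod (LBINT \<xi>. q \<xi> * \<theta> \<xi>)" by (rule tendsto_norm)
  then have "cmod (LBINT \<xi>. q \<xi> * \<theta> \<xi>) \<le> \<kappa>"
    by (rule LIMSEQ_le_const2) (use bound in auto)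
  moreover have "(LBINT \<xi>. q \<xi> * \<theta> \<xi>) = complex_of_real (LBINT \<xi>. cmod (q \<xi>))"
    unfolding q\<theta> by (rule integral_complex_of_real)
  ultimately show ?thesis by simp
qed

section \<open>The spherical functions and their multiplier norms\<close>

lemma Gamma_nonzero_Re_pos: "0 < Re z \<Longrightarrow> Gamma z \<noteq> 0"
  by (auto simp: Gamma_eq_zero_iff elim!: nonpos_Ints_cases)

lemma sech_transform_nonzero:
  assumes "\<bar>Re \<alpha>\<bar> < p"
  shows "sech_transform p \<alpha> \<noteq> 0"
proof -
  have "Gamma ((of_real p + \<alpha>) / 2) \<noteq> 0" "Gamma ((of_real p - \<alpha>) / 2) \<noteq> 0"
    using assms by (auto intro!: Gamma_nonzero_Re_pos)
  then show ?thesis using Gamma_mult_sech_transform[OF assms] by auto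
qed

definition macdonald_mass :: "'m::finite itself \<Rightarrow> complex \<Rightarrow> complex" where
  "macdonald_mass _ s = (LBINT x :: real ^ 'm. macdonald s (norm x) * macdonald s (norm x))"

text \<open>The mass factors into sech transforms and a positive constant; the transforms are
  nonzero because the Gamma function has no zeros in the right half plane.\<close>

lemma macdonald_mass_nonzero:
  assumes "\<bar>Re s\<bar> < real CARD('m::finite) / 2"
  shows "macdonald_mass TYPE('m) s \<noteq> 0"
proof -
  have "norm_exp_integral TYPE('m) \<noteq> 0" using integral_exp_neg_norm_pos[where 'm = 'm] by (simp add: norm_exp_integral_def)
  then show ?thesis
    unfolding macdonald_mass_def using assms sech_transform_nonzero
    by (subst macdonald_moment(2)) auto
qed

text \<open>The case \<open>a = a' = 1\<close>, \<open>b = 0\<close> of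
  \<open>macdonald_fourier\<close> identifies the constant in terms of the mass. As the mass is
  nonzero, so is \<open>legendre_integral \<nu> s 1\<close>, by which the spherical function is
  normalized.\<close>

lemma macdonald_fourier_normalized:
  fixes s :: complex and a a' :: real and b :: "real ^ 'm::finite"
  defines "\<nu> \<equiv> real CARD('m) / 2"
  assumes s: "\<bar>Re s\<bar> < \<nu>"
  shows "legendre_integral \<nu> s 1 \<noteq> 0"
    and "0 < a \<Longrightarrow> 0 < a' \<Longrightarrow>
      (LBINT x. macdonald s (a * norm x) * macdonald s (a' * norm x) * character b x)
      = macdonald_mass TYPE('m) s * of_real ((a * a') powr - \<nu>)
        * (legendre_integral \<nu> s (of_real ((a\<^sup>2 + a'\<^sup>2 + (norm b)\<^sup>2) / (2 * a * a'))) / legendre_integral \<nu> s 1)"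
proof -
  have Z: "macdonald_mass TYPE('m) s = of_real ((2 * pi) powr \<nu>) * Gamma (of_real \<nu>) * legendre_integral \<nu> s 1"
    using macdonald_fourier[of s 1 1 "0 :: real ^ 'm"] s by (simp add: macdonald_mass_def \<nu>_def)
  then show L: "legendre_integral \<nu> s 1 \<noteq> 0" using macdonald_mass_nonzero[of s, where 'm = 'm] s by (auto simp: \<nu>_def)
  show "(LBINT x. macdonald s (a * norm x) * macdonald s (a' * norm x) * character b x)
      = macdonald_mass TYPE('m) s * of_real ((a * a') powr - \<nu>)
        * (legendre_integral \<nu> s (of_real ((a\<^sup>2 + a'\<^sup>2 + (norm b)\<^sup>2) / (2 * a * a'))) / legendre_integral \<nu> s 1)"
    if "0 < a" "0 < a'"
    using macdonald_fourier[of s a a' b] s that L unfolding Z character_def \<nu>_def by simp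
qed

text \<open>One minus the square of \<open>cosh r\<close> is minus the square of
  \<open>sinh r\<close>, so the prescribed values on boosts extend to a function of the entry
  \<open>g $ None $ None\<close>. That entry is bi-invariant, and the function so obtained justifies
  the choice in \<open>spherical_function\<close>.\<close>

lemma spherical_function_Gauss:
  fixes s :: complex and g :: "'m::finite lorentz_matrix"
  defines "F \<equiv> Gauss_F (of_nat CARD('m) / 4 + s / 2) (of_nat CARD('m) / 4 - s / 2) ((of_nat CARD('m) + 1) / 2)"
  assumes F: "F holomorphic_on slit_domain"
  shows "is_spherical_function s (spherical_function s :: 'm lorentz_matrix \<Rightarrow> complex)"
    and "g \<in> carrier SO0 \<Longrightarrow> spherical_function s g = F (1 - (of_real (g $ None $ None))\<^sup>2)"
proof -
  define \<phi> where "\<phi> = (\<lambda>g :: 'm lorentz_matrix. F (1 - (of_real (g $ None $ None))\<^sup>2))"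
  have "is_spherical_function s \<phi>"
    unfolding is_spherical_function_def
  proof (intro conjI ballI allI)
    show "continuous_on (carrier SO0) \<phi>"
      unfolding \<phi>_def
      by (rule continuous_on_compose2[OF holomorphic_on_imp_continuous_on[OF F]])
         (auto intro!: continuous_intros one_minus_square_slit_domain simp: carrier_SO0)
    show "\<phi> (k ** g ** k') = \<phi> g" if "k \<in> SO_subgroup" "k' \<in> SO_subgroup" for k k' g
      using SO_subgroup_mult_00[OF that] by (simp add: \<phi>_def)
    show "\<phi> (boost r) = (let m = of_nat CARD('m) in Gauss_F (m / 4 + s / 2) (m / 4 - s / 2) ((m + 1) / 2) (- (of_real (sinh r))\<^sup>2))" for r
    proof -
      have "1 - (complex_of_real (cosh r))\<^sup>2 = - (of_real (sinh r))\<^sup>2"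
        unfolding cosh_square_eq of_real_power[symmetric] by simp
      then show ?thesis by (simp add: \<phi>_def boost_00 F_def Let_def)
    qed
  qed
  moreover from this show sph: "is_spherical_function s (spherical_function s :: 'm lorentz_matrix \<Rightarrow> complex)"
    unfolding spherical_function_def by (rule someI[of "is_spherical_function s" \<phi>])
  ultimately show "spherical_function s g = F (1 - (of_real (g $ None $ None))\<^sup>2)" if "g \<in> carrier SO0"
    using is_spherical_function_unique[OF sph _ that] by (simp add: \<phi>_def)
qed

lemma spherical_function_legendre:
  fixes s :: complex and g :: "'m::finite lorentz_matrix"
  defines "\<nu> \<equiv> real CARD('m) / 2"
  assumes s: "\<bar>Re s\<bar> < \<nu>"
  shows "is_spherical_function s (spherical_function s :: 'm lorentz_matrix \<Rightarrow> complex)"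
    and "g \<in> carrier SO0 \<Longrightarrow>
      spherical_function s g = legendre_integral \<nu> s (of_real (g $ None $ None)) / legendre_integral \<nu> s 1"
proof -
  have L: "legendre_integral \<nu> s 1 \<noteq> 0" using macdonald_fourier_normalized(1)[of s, where 'm = 'm] s by (simp add: \<nu>_def)
  have eq: "of_real (\<nu> / 2) + s / 2 = of_nat CARD('m) / 4 + s / 2" "of_real (\<nu> / 2) - s / 2 = of_nat CARD('m) / 4 - s / 2"
    "complex_of_real (\<nu> + 1 / 2) = (of_nat CARD('m) + 1) / 2"
    by (simp_all add: \<nu>_def add_divide_distrib)
  note G = Gauss_F_legendre[OF s L, unfolded eq]
  show "is_spherical_function s (spherical_function s :: 'm lorentz_matrix \<Rightarrow> complex)"
    by (rule spherical_function_Gauss(1)[OF G(1)])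
  show "spherical_function s g = legendre_integral \<nu> s (of_real (g $ None $ None)) / legendre_integral \<nu> s 1"
    if "g \<in> carrier SO0"
  proof -
    have g: "1 \<le> g $ None $ None" using that by (simp add: carrier_SO0)
    note z = one_minus_square_slit_domain[OF this]
    have "csqrt ((of_real (g $ None $ None))\<^sup>2) = of_real (g $ None $ None)"
      using g by (intro csqrt_square) auto
    then show ?thesis unfolding spherical_function_Gauss(2)[OF G(1) that] G(2)[OF z] by simp
  qed
qed

text \<open>At these two values of \<open>s\<close> one upper parameter of the Gauss function is
  zero.\<close>

lemma spherical_function_trivial:
  fixes s :: complex and g :: "'m::finite lorentz_matrix"
  assumes s: "s = of_real (real CARD('m) / 2) \<or> s = - of_real (real CARD('m) / 2)"
  shows "is_spherical_function s (spherical_function s :: 'm lorentz_matrix \<Rightarrow> complex)"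
    and "g \<in> carrier SO0 \<Longrightarrow> spherical_function s g = 1"
proof -
  let ?F = "Gauss_F (of_nat CARD('m) / 4 + s / 2) (of_nat CARD('m) / 4 - s / 2) ((of_nat CARD('m) + 1) / 2)"
  have 0: "of_nat CARD('m) / 4 + s / 2 = 0 \<or> of_nat CARD('m) / 4 - s / 2 = 0" using s by auto
  have F: "?F holomorphic_on slit_domain"
    by (rule holomorphic_transform[of "\<lambda>_. 1"]) (simp_all add: Gauss_F_degenerate[OF 0])
  show "is_spherical_function s (spherical_function s :: 'm lorentz_matrix \<Rightarrow> complex)"
    by (rule spherical_function_Gauss(1)[OF F])
  show "spherical_function s g = 1" if "g \<in> carrier SO0"
  proof -
    have "1 \<le> g $ None $ None" using that by (simp add: carrier_SO0)
    note z = one_minus_square_slit_domain[OF this]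
    show ?thesis unfolding spherical_function_Gauss(2)[OF F that] by (rule Gauss_F_degenerate[OF 0 z])
  qed
qed

lemma macdonald_real_antimono:
  assumes "0 < r" "r \<le> r'"
  shows "macdonald_real \<sigma> r' \<le> macdonald_real \<sigma> r"
  unfolding macdonald_real_def
proof (rule integral_mono)
  show "exp (- r' * cosh u + \<sigma> * u) \<le> exp (- r * cosh u + \<sigma> * u)" for u
    using assms by (simp add: mult_right_mono cosh_real_nonneg)
qed (use assms integrable_exp_neg_cosh in auto)

lemma isCont_macdonald:
  assumes r: "0 < r"
  shows "isCont (macdonald s) r"
  unfolding continuous_at_sequentially
proof (intro allI impI)
  fix x assume x: "x \<longlonglongrightarrow> r"
  \<comment> \<open>Beyond this index the integrand for order \<open>Re s\<close> at
    \<open>r / 2\<close> is a common majorant.\<close>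
  obtain N where N: "\<And>n. n \<ge> N \<Longrightarrow> r / 2 < x n"
    using order_tendstoD(1)[OF x, of "r / 2"] r unfolding eventually_sequentially by auto
  have "(\<lambda>n. macdonald s (x (n + N))) \<longlonglongrightarrow> macdonald s r"
    unfolding macdonald_def
  proof (rule integral_dominated_convergence)
    show "integrable lborel (\<lambda>u. exp (- (r / 2) * cosh u + Re s * u))"
      by (rule integrable_exp_neg_cosh) (use r in simp)
    have "(\<lambda>n. x (n + N)) \<longlonglongrightarrow> r" by (rule LIMSEQ_ignore_initial_segment[OF x])
    then show "AE u in lborel. (\<lambda>n. exp (of_real (- x (n + N) * cosh u) + s * of_real u)) \<longlonglongrightarrow> exp (of_real (- r * cosh u) + s * of_real u)"
      by (intro AE_I2 tendsto_intros)
    show "AE u in lborel. norm (exp (of_real (- x (n + N) * cosh u) + s * of_real u)) \<le> exp (- (r / 2) * cosh u + Re s * u)" for n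
      using N[of "n + N"] by (auto simp: mult_right_mono cosh_real_nonneg less_imp_le intro!: AE_I2 mult_right_mono)
  qed (auto intro!: borel_measurable_continuous_onI continuous_intros)
  then show "(macdonald s \<circ> x) \<longlonglongrightarrow> macdonald s r"
    unfolding o_def by (rule LIMSEQ_offset)
qed

text \<open>Coordinates along the Gram-Schmidt family of \<open>v\<close> turn vectors in
  \<open>L2_space N\<close> into the scalar sequences that \<open>schur_multiplier\<close> expects.
  One sequence \<open>v\<close> approximates the values of both \<open>P\<close> and
  \<open>Q\<close>, so Parseval applies to every pair; weak measurability makes the coordinates
  measurable.\<close>

lemma (in haar_group) schur_multiplier_L2:
  fixes P Q :: "'a \<Rightarrow> 'c \<Rightarrow> complex" and v :: "nat \<Rightarrow> 'c \<Rightarrow> complex"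
  assumes P: "\<And>x. x \<in> carrier G \<Longrightarrow> P x \<in> L2_space N" and Q: "\<And>x. x \<in> carrier G \<Longrightarrow> Q x \<in> L2_space N"
    and Pm: "\<And>f. f \<in> L2_space N \<Longrightarrow> (\<lambda>x. L2_inner N (P x) f) \<in> borel_measurable \<mu>"
    and Qm: "\<And>f. f \<in> L2_space N \<Longrightarrow> (\<lambda>x. L2_inner N (Q x) f) \<in> borel_measurable \<mu>"
    and v: "\<And>n. v n \<in> L2_space N"
    and Pv: "\<And>x \<epsilon>. x \<in> carrier G \<Longrightarrow> 0 < \<epsilon> \<Longrightarrow> \<exists>k. (L2_norm N (\<lambda>\<xi>. P x \<xi> - v k \<xi>))\<^sup>2 < \<epsilon>"
    and Qv: "\<And>x \<epsilon>. x \<in> carrier G \<Longrightarrow> 0 < \<epsilon> \<Longrightarrow> \<exists>k. (L2_norm N (\<lambda>\<xi>. Q x \<xi> - v k \<xi>))\<^sup>2 < \<epsilon>"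
    and PA: "\<And>x. x \<in> carrier G \<Longrightarrow> (L2_norm N (P x))\<^sup>2 \<le> A" and QB: "\<And>x. x \<in> carrier G \<Longrightarrow> (L2_norm N (Q x))\<^sup>2 \<le> B"
    and "0 \<le> A" "0 \<le> B"
    and PQ: "\<And>x y. x \<in> carrier G \<Longrightarrow> y \<in> carrier G \<Longrightarrow> L2_inner N (P x) (Q y) = \<phi> (inv y \<otimes> x)"
  shows "\<exists>M. is_cb_multiplier_map G \<mu> \<phi> M" and "M0A_norm G \<mu> \<phi> \<le> sqrt (A * B)"
proof -
  let ?e = "gram_schmidt N v"
  have sq: "(\<lambda>l. (cmod (L2_inner N f (?e l)))\<^sup>2) sums (L2_norm N f)\<^sup>2"
    if f: "f \<in> L2_space N" and d: "\<And>\<epsilon>. 0 < \<epsilon> \<Longrightarrow> \<exists>k. (L2_norm N (\<lambda>\<xi>. f \<xi> - v k \<xi>))\<^sup>2 < \<epsilon>" for f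
  proof -
    have "(\<lambda>l. complex_of_real ((cmod (L2_inner N f (?e l)))\<^sup>2)) sums complex_of_real ((L2_norm N f)\<^sup>2)"
      using gram_schmidt_sums[OF v f f d d] unfolding L2_inner_self complex_norm_square[symmetric] .
    then show ?thesis by (simp only: sums_of_real_iff)
  qed
  note sP = sq[OF P Pv] and sQ = sq[OF Q Qv]
  have e: "?e l \<in> L2_space N" for l by (rule gram_schmidt_L2[OF v])
  have m: "(\<lambda>x. L2_inner N (P x) (?e l)) \<in> borel_measurable \<mu>" "(\<lambda>x. L2_inner N (Q x) (?e l)) \<in> borel_measurable \<mu>" for l
    by (rule Pm[OF e], rule Qm[OF e])
  have le: "(\<Sum>l. (cmod (L2_inner N (P x) (?e l)))\<^sup>2) \<le> A" "(\<Sum>l. (cmod (L2_inner N (Q x) (?e l)))\<^sup>2) \<le> B"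
    if "x \<in> carrier G" for x
    using sums_unique[OF sP[OF that that]] sums_unique[OF sQ[OF that that]] PA[OF that] QB[OF that] by simp_all
  have s: "(\<lambda>l. L2_inner N (P x) (?e l) * cnj (L2_inner N (Q y) (?e l))) sums \<phi> (inv y \<otimes> x)"
    if "x \<in> carrier G" "y \<in> carrier G" for x y
    using gram_schmidt_sums[OF v P[OF that(1)] Q[OF that(2)] Pv[OF that(1)] Qv[OF that(2)]] PQ[OF that] by simp
  note schur = schur_multiplier[OF m sums_summable[OF sP] sums_summable[OF sQ] le \<open>0 \<le> A\<close> \<open>0 \<le> B\<close> s]
  show "\<exists>M. is_cb_multiplier_map G \<mu> \<phi> M" by (rule schur(1))
  show "M0A_norm G \<mu> \<phi> \<le> sqrt (A * B)" by (rule schur(2))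
qed

section \<open>Waves in horospherical coordinates\<close>

definition horo_wave :: "complex \<Rightarrow> real \<Rightarrow> real ^ 'm::finite \<Rightarrow> real ^ 'm \<Rightarrow> complex" where
  "horo_wave s a b \<xi> = of_real (a powr (real CARD('m) / 2)) * macdonald s (a * norm \<xi>) * character b \<xi>"

lemma horo_wave_measurable [measurable (raw)]:
  assumes "a \<in> borel_measurable M" "b \<in> borel_measurable M" "\<xi> \<in> borel_measurable M"
  shows "(\<lambda>x. horo_wave s (a x) (b x :: real ^ 'm::finite) (\<xi> x)) \<in> borel_measurable M"
proof -
  have "(\<lambda>x. a x powr (real CARD('m) / 2)) \<in> borel_measurable M"
    by (intro powr_real_measurable borel_measurable_const assms)
  then have 1: "(\<lambda>x. complex_of_real (a x powr (real CARD('m) / 2))) \<in> borel_measurable M"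
    by measurable
  have "(\<lambda>x. a x * norm (\<xi> x)) \<in> borel_measurable M"
    using assms(1,3) by measurable
  then have 2: "(\<lambda>x. macdonald s (a x * norm (\<xi> x))) \<in> borel_measurable M"
    by (rule borel_measurable_macdonald)
  have "(\<lambda>x. \<i> * complex_of_real (b x \<bullet> \<xi> x)) \<in> borel_measurable M"
    using assms(2,3) by measurable
  then have 3: "(\<lambda>x. exp (\<i> * complex_of_real (b x \<bullet> \<xi> x))) \<in> borel_measurable M"
    by (rule measurable_compose) measurable
  show ?thesis unfolding horo_wave_def character_def by (intro borel_measurable_times 1 2 3)
qed

text \<open>A majorant uniform for heights in a compact interval, as dominated convergence in the
  parameters requires.\<close>

lemma cmod_horo_wave_le:
  assumes "0 < a0" "a0 \<le> a" "a \<le> a1" "\<xi> \<noteq> 0"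
  shows "cmod (horo_wave s a b (\<xi> :: real ^ 'm::finite)) \<le> a1 powr (real CARD('m) / 2) * macdonald_real (Re s) (a0 * norm \<xi>)"
proof -
  have "cmod (macdonald s (a * norm \<xi>)) \<le> macdonald_real (Re s) (a0 * norm \<xi>)"
    using assms by (intro order_trans[OF cmod_macdonald_le] macdonald_real_antimono) (auto intro: mult_right_mono)
  then show ?thesis
    unfolding horo_wave_def norm_mult using assms by (auto intro!: mult_mono powr_mono2)
qed

text \<open>The power of \<open>a\<close> in the wave compensates the scaling of \<xi> by
  \<open>a\<close>, so the norm is the same at every point of hyperbolic space.\<close>

lemma L2_horo_wave:
  fixes b :: "real ^ 'm::finite"
  assumes s: "\<bar>Re s\<bar> < real CARD('m) / 2" and a: "0 < a"
  shows "horo_wave s a b \<in> L2_space lborel"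
    and "(L2_norm lborel (horo_wave s a b))\<^sup>2 = (LBINT \<xi> :: real ^ 'm. (cmod (macdonald s (norm \<xi>)))\<^sup>2)"
proof -
  let ?k = "\<lambda>\<xi> :: real ^ 'm. (cmod (macdonald s (norm \<xi>)))\<^sup>2"
  have "integrable lborel (\<lambda>\<xi> :: real ^ 'm. (macdonald_real (Re s) (1 * norm \<xi>))\<^sup>2)"
    by (rule integrable_macdonald_real_sq[OF s]) simp
  then have "integrable lborel ?k"
    by (rule Bochner_Integration.integrable_bound) (auto intro!: power_mono cmod_macdonald_le)
  moreover have m: "?k \<in> borel_measurable borel" by measurable
  ultimately have i: "integrable lborel (\<lambda>\<xi>. ?k (a *\<^sub>R \<xi>))"
    using lborel_scale(1)[OF a m] by simp
  have p: "a powr real CARD('m) = a ^ CARD('m)" using a by (simp add: powr_realpow)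
  have "(a powr (real CARD('m) / 2))\<^sup>2 = a ^ CARD('m)"
    unfolding p[symmetric] power2_eq_square powr_add[symmetric] by simp
  then have eq: "(cmod (horo_wave s a b \<xi>))\<^sup>2 = a ^ CARD('m) * ?k (a *\<^sub>R \<xi>)" for \<xi>
    using a by (simp add: horo_wave_def norm_mult power_mult_distrib)
  show "horo_wave s a b \<in> L2_space lborel"
    unfolding L2_space_def using i by (auto simp: eq)
  show "(L2_norm lborel (horo_wave s a b))\<^sup>2 = (LBINT \<xi>. ?k \<xi>)"
    unfolding L2_norm_sq eq integral_mult_right_zero lborel_scale(2)[OF a m] using a by simp
qed

text \<open>Order \<open>cnj s\<close> in the second argument undoes the conjugation of the inner
  product, so two Macdonald functions of the same order \<open>s\<close> are multiplied. The powers
  of the heights cancel those in \<open>macdonald_fourier_normalized\<close>.\<close>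

lemma L2_inner_horo_wave:
  fixes b b' :: "real ^ 'm::finite"
  assumes s: "\<bar>Re s\<bar> < real CARD('m) / 2" and a: "0 < a" "0 < a'"
  shows "L2_inner lborel (horo_wave s a b) (horo_wave (cnj s) a' b')
    = macdonald_mass TYPE('m) s * (legendre_integral (real CARD('m) / 2) s
        (of_real ((a\<^sup>2 + a'\<^sup>2 + (norm (b - b'))\<^sup>2) / (2 * a * a'))) / legendre_integral (real CARD('m) / 2) s 1)"
proof -
  let ?\<nu> = "real CARD('m) / 2"
  have eq: "horo_wave s a b \<xi> * cnj (horo_wave (cnj s) a' b' \<xi>)
      = of_real ((a * a') powr ?\<nu>) * (macdonald s (a * norm \<xi>) * macdonald s (a' * norm \<xi>) * character (b - b') \<xi>)" for \<xi>
    using a by (simp add: horo_wave_def macdonald_cnj powr_mult character_mult_cnj[symmetric])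
  have "complex_of_real ((a * a') powr ?\<nu>) * of_real ((a * a') powr - ?\<nu>) = 1"
    using a by (simp add: of_real_mult[symmetric] powr_add[symmetric] del: of_real_mult)
  then have cancel: "complex_of_real ((a * a') powr ?\<nu>) * (z * of_real ((a * a') powr - ?\<nu>) * w) = z * w" for z w
    by algebra
  show ?thesis
    unfolding L2_inner_def eq integral_mult_right_zero macdonald_fourier_normalized(2)[OF s a] by (rule cancel)
qed

text \<open>Waves depend continuously on \<open>(a, b)\<close> in the square mean, by dominated
  convergence. This is what reduces the family of all waves to a countable one.\<close>

lemma horo_wave_approx:
  fixes b :: "real ^ 'm::finite" and D :: "(real \<times> (real ^ 'm)) set"
  assumes s: "\<bar>Re s\<bar> < real CARD('m) / 2" and a: "0 < a" and \<epsilon>: "0 < \<epsilon>" and D: "closure D = UNIV"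
  shows "\<exists>p\<in>D. 0 < fst p \<and> (L2_norm lborel (\<lambda>\<xi>. horo_wave s a b \<xi> - horo_wave s (fst p) (snd p) \<xi>))\<^sup>2 < \<epsilon>"
proof -
  obtain x where x: "\<And>n. x n \<in> D" "x \<longlonglongrightarrow> (a, b)"
    using D closure_sequential[of "(a, b)" D] by auto
  have xa: "(\<lambda>n. fst (x n)) \<longlonglongrightarrow> a" and xb: "(\<lambda>n. snd (x n)) \<longlonglongrightarrow> b"
    using tendsto_fst[OF x(2)] tendsto_snd[OF x(2)] by simp_all
  have "eventually (\<lambda>n. a / 2 < fst (x n) \<and> fst (x n) < 2 * a) sequentially"
    using order_tendstoD(1)[OF xa, of "a / 2"] order_tendstoD(2)[OF xa, of "2 * a"] a
    by (simp add: eventually_conj_iff)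
  then obtain N where N: "\<And>n. n \<ge> N \<Longrightarrow> a / 2 < fst (x n) \<and> fst (x n) < 2 * a"
    unfolding eventually_sequentially by auto
  define y where "y n = x (n + N)" for n
  have ya: "(\<lambda>n. fst (y n)) \<longlonglongrightarrow> a" and yb: "(\<lambda>n. snd (y n)) \<longlonglongrightarrow> b"
    unfolding y_def using LIMSEQ_ignore_initial_segment[OF xa, of N] LIMSEQ_ignore_initial_segment[OF xb, of N] by simp_all
  have y: "y n \<in> D" "a / 2 < fst (y n)" "fst (y n) < 2 * a" for n
    using x(1) N[of "n + N"] by (simp_all add: y_def)
  let ?w = "\<lambda>n \<xi>. horo_wave s (fst (y n)) (snd (y n)) \<xi>"
  define C where "C = (2 * a) powr (real CARD('m) / 2)"
  define K where "K \<xi> = C * macdonald_real (Re s) (a / 2 * norm \<xi>)" for \<xi> :: "real ^ 'm"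
  have le: "(cmod (horo_wave s a b \<xi> - ?w n \<xi>))\<^sup>2 \<le> 4 * (K \<xi>)\<^sup>2" if "\<xi> \<noteq> 0" for n \<xi>
  proof -
    have "cmod (horo_wave s a b \<xi>) \<le> K \<xi>"
      unfolding K_def C_def by (rule cmod_horo_wave_le) (use a that in auto)
    moreover have "cmod (?w n \<xi>) \<le> K \<xi>"
      unfolding K_def C_def by (rule cmod_horo_wave_le) (use a y[of n] that in auto)
    ultimately have "cmod (horo_wave s a b \<xi> - ?w n \<xi>) \<le> 2 * K \<xi>"
      using norm_triangle_ineq4[of "horo_wave s a b \<xi>" "?w n \<xi>"] by linarith
    then have "(cmod (horo_wave s a b \<xi> - ?w n \<xi>))\<^sup>2 \<le> (2 * K \<xi>)\<^sup>2" by (intro power_mono) auto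
    then show ?thesis by (simp add: power_mult_distrib)
  qed
  have "(\<lambda>n. LBINT \<xi>. (cmod (horo_wave s a b \<xi> - ?w n \<xi>))\<^sup>2) \<longlonglongrightarrow> (LBINT \<xi> :: real ^ 'm. 0)"
  proof (rule integral_dominated_convergence)
    show "integrable lborel (\<lambda>\<xi>. 4 * (K \<xi>)\<^sup>2)"
      unfolding K_def power_mult_distrib
      by (intro integrable_mult_right integrable_macdonald_real_sq s) (use a in simp)
    show "AE \<xi> in lborel. norm ((cmod (horo_wave s a b \<xi> - ?w n \<xi>))\<^sup>2) \<le> 4 * (K \<xi>)\<^sup>2" for n
      using AE_lborel_nonzero by eventually_elim (use le in auto)
    show "AE \<xi> in lborel. (\<lambda>n. (cmod (horo_wave s a b \<xi> - ?w n \<xi>))\<^sup>2) \<longlonglongrightarrow> 0"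
      using AE_lborel_nonzero
    proof eventually_elim
      fix \<xi> :: "real ^ 'm" assume \<xi>: "\<xi> \<noteq> 0"
      have "(\<lambda>n. macdonald s (fst (y n) * norm \<xi>)) \<longlonglongrightarrow> macdonald s (a * norm \<xi>)"
        using isCont_macdonald[of "a * norm \<xi>" s] a \<xi> tendsto_mult_right[OF ya, of "norm \<xi>"]
        by (intro isCont_tendsto_compose[of _ "macdonald s"]) auto
      then have "(\<lambda>n. ?w n \<xi>) \<longlonglongrightarrow> horo_wave s a b \<xi>"
        unfolding horo_wave_def character_def using a ya yb by (intro tendsto_intros) auto
      then have "(\<lambda>n. (cmod (horo_wave s a b \<xi> - ?w n \<xi>))\<^sup>2) \<longlonglongrightarrow> (cmod (horo_wave s a b \<xi> - horo_wave s a b \<xi>))\<^sup>2"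
        by (intro tendsto_intros)
      then show "(\<lambda>n. (cmod (horo_wave s a b \<xi> - ?w n \<xi>))\<^sup>2) \<longlonglongrightarrow> 0" by simp
    qed
  qed measurable
  then have "(\<lambda>n. LBINT \<xi>. (cmod (horo_wave s a b \<xi> - ?w n \<xi>))\<^sup>2) \<longlonglongrightarrow> 0" by simp
  then have "eventually (\<lambda>n. (LBINT \<xi>. (cmod (horo_wave s a b \<xi> - ?w n \<xi>))\<^sup>2) < \<epsilon>) sequentially"
    using \<epsilon> by (rule order_tendstoD(2))
  then obtain n where "(LBINT \<xi>. (cmod (horo_wave s a b \<xi> - ?w n \<xi>))\<^sup>2) < \<epsilon>"
    unfolding eventually_sequentially by auto
  moreover have "0 < fst (y n)" using y(2)[of n] a by linarith
  ultimately show ?thesis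
    unfolding L2_norm_sq using y(1)[of n] by (intro bexI[of _ "y n"]) auto
qed

text \<open>In \<open>macdonald_moment\<close>, pairing \<open>s\<close> with \<open>cnj s\<close>
  gives sech transforms at twice the real part and twice the imaginary part of \<open>s\<close>;
  pairing \<open>s\<close> with itself gives those at \<open>2 * s\<close> and 0. Each is a product
  of two Gamma values divided by \<open>G\<close>, and the constants \<open>C\<close> and
  \<open>G\<close> occur equally often above and below.\<close>

lemma spherical_norm_Gamma:
  fixes s :: complex
  defines "m \<equiv> CARD('m::finite)"
  assumes s: "\<bar>Re s\<bar> < real m / 2"
  shows "complex_of_real ((LBINT \<xi> :: real ^ 'm. (cmod (macdonald s (norm \<xi>)))\<^sup>2) / cmod (macdonald_mass TYPE('m) s)) =
    Gamma (of_nat m / 2 + of_real (Re s)) * Gamma (of_nat m / 2 - of_real (Re s)) *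
    Gamma (of_nat m / 2 + \<i> * of_real (Im s)) * Gamma (of_nat m / 2 - \<i> * of_real (Im s)) /
    (Gamma (of_nat m / 2) * Gamma (of_nat m / 2) *
     of_real (cmod (Gamma (of_nat m / 2 + s) * Gamma (of_nat m / 2 - s))))"
proof -
  define C where "C = 2 powr (1 - real m) * norm_exp_integral TYPE('m)"
  define G where "G = 2 powr (1 - real m) * Gamma (real m)"
  define S where "S \<alpha> = sech_transform (real m) (2 * \<alpha>)" for \<alpha>
  have m: "0 < real m" by (simp add: m_def)
  have C: "0 < C" using integral_exp_neg_norm_pos[where 'm = 'm] by (simp add: C_def norm_exp_integral_def)
  have G: "0 < G" using m by (simp add: G_def Gamma_real_pos)
  have Gamma: "Gamma (of_nat m / 2 + \<alpha>) * Gamma (of_nat m / 2 - \<alpha>) = of_real G * S \<alpha>"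
    if "\<bar>Re \<alpha>\<bar> < real m / 2" for \<alpha>
    using Gamma_mult_sech_transform[of "2 * \<alpha>" "real m"] that
    by (simp add: G_def S_def Gamma_complex_of_real[symmetric] add_divide_distrib diff_divide_distrib)
  have "s + cnj s = 2 * of_real (Re s)" "s - cnj s = 2 * (\<i> * of_real (Im s))"
    by (simp_all add: complex_eq_iff)
  then have I: "complex_of_real (LBINT \<xi> :: real ^ 'm. (cmod (macdonald s (norm \<xi>)))\<^sup>2) = of_real C * S (of_real (Re s)) * S (\<i> * of_real (Im s))"
    using macdonald_moment(2)[of s "cnj s", where 'm = 'm] s m
    by (simp add: C_def S_def m_def macdonald_cnj complex_norm_square[symmetric] del: of_real_power)
  have "macdonald_mass TYPE('m) s = of_real C * S s * S 0"
    using macdonald_moment(2)[of s s, where 'm = 'm] s m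
    by (simp add: macdonald_mass_def C_def S_def m_def)
  then have Z: "cmod (macdonald_mass TYPE('m) s) = C * cmod (S s) * cmod (S 0)"
    using C by (simp add: norm_mult)
  have "Gamma (of_nat m / 2) = complex_of_real (Gamma (real m / 2))"
    using Gamma_complex_of_real[of "real m / 2"] by simp
  \<comment> \<open>The square of a real number equals its modulus. The modulus of the mass brings
    absolute values to both pairs of Gamma values, while the formula keeps them around one pair
    only.\<close>
  then have G0: "Gamma (of_nat m / 2) * Gamma (of_nat m / 2) = complex_of_real (cmod (Gamma (of_nat m / 2) * Gamma (of_nat m / 2)))"
    by (simp add: norm_mult flip: of_real_mult)
  have "S \<alpha> \<noteq> 0" if "\<bar>Re \<alpha>\<bar> < real m / 2" for \<alpha>
    unfolding S_def using that by (intro sech_transform_nonzero) auto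
  then have nz: "S s \<noteq> 0" "S 0 \<noteq> 0" using s m by auto
  have "Gamma (of_nat m / 2 + of_real (Re s)) * Gamma (of_nat m / 2 - of_real (Re s)) *
    Gamma (of_nat m / 2 + \<i> * of_real (Im s)) * Gamma (of_nat m / 2 - \<i> * of_real (Im s))
    = (of_real G * S (of_real (Re s))) * (of_real G * S (\<i> * of_real (Im s)))"
    using Gamma[of "of_real (Re s)"] Gamma[of "\<i> * of_real (Im s)"] s m by (simp add: mult.assoc)
  moreover have "Gamma (of_nat m / 2) * Gamma (of_nat m / 2) = complex_of_real (G * cmod (S 0))"
  proof -
    have "Gamma (of_nat m / 2) * Gamma (of_nat m / 2) = of_real G * S 0" using Gamma[of 0] m by simp
    then have "cmod (Gamma (of_nat m / 2) * Gamma (of_nat m / 2)) = G * cmod (S 0)" using G by (simp add: norm_mult)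
    then show ?thesis using G0 by (simp only:)
  qed
  moreover have "cmod (Gamma (of_nat m / 2 + s) * Gamma (of_nat m / 2 - s)) = G * cmod (S s)"
    unfolding Gamma[OF s] using G by (simp add: norm_mult)
  ultimately show ?thesis
    unfolding of_real_divide I Z using C G nz by (simp add: field_simps)
qed

section \<open>Upper and lower bound for the multiplier norm\<close>

context
  fixes \<mu> :: "'m::finite lorentz_matrix measure" and s :: complex
  assumes haar: "left_haar_measure SO0 \<mu>" and s: "\<bar>Re s\<bar> < real CARD('m) / 2"
begin

interpretation haar_group SO0 \<mu> by (rule haar_group_SO0[OF haar])

lemma measurable_horo [measurable]:
  "horo_height \<in> borel_measurable \<mu>" "horo_point \<in> borel_measurable \<mu>"
proof -
  have h: "continuous_on (carrier SO0) (horo_height :: 'm lorentz_matrix \<Rightarrow> real)"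
    unfolding horo_height_def[abs_def] using horo_denominator_pos
    by (intro continuous_intros) (auto simp: less_le)
  then have "continuous_on (carrier SO0) (horo_point :: 'm lorentz_matrix \<Rightarrow> real ^ 'm)"
    unfolding horo_point_def[abs_def] by (intro continuous_intros)
  with h show "horo_height \<in> borel_measurable \<mu>" "horo_point \<in> borel_measurable \<mu>"
    by (auto intro: borel_measurable_haar)
qed

lemma measurable_horo_wave_inner:
  assumes "f \<in> L2_space (lborel :: (real ^ 'm) measure)"
  shows "(\<lambda>x. L2_inner lborel (horo_wave \<alpha> (horo_height x) (horo_point x)) f) \<in> borel_measurable \<mu>"
proof -
  have [measurable]: "f \<in> borel_measurable borel" using L2_space_measurable[OF assms] by simp
  have [measurable]: "(\<lambda>z. horo_wave \<alpha> (horo_height (fst z)) (horo_point (fst z)) (snd z :: real ^ 'm)) \<in> borel_measurable (\<mu> \<Otimes>\<^sub>M lborel)"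
    by (rule horo_wave_measurable) measurable
  show ?thesis
    unfolding L2_inner_def by (rule lborel.borel_measurable_lebesgue_integral) measurable
qed

text \<open>The vectors are waves of order \<open>s\<close> divided by \<open>Z\<close> and waves of
  order \<open>cnj s\<close>. Their squared norms are the constants
  \<open>I / (cmod Z)\<^sup>2\<close> and \<open>I\<close>, whose geometric mean is the
  bound.\<close>

lemma spherical_multiplier_upper:
  shows "\<exists>M. is_cb_multiplier_map SO0 \<mu> (spherical_function s) M"
    and "M0A_norm SO0 \<mu> (spherical_function s)
      \<le> (LBINT \<xi> :: real ^ 'm. (cmod (macdonald s (norm \<xi>)))\<^sup>2) / cmod (macdonald_mass TYPE('m) s)"
proof -
  define I where "I = (LBINT \<xi> :: real ^ 'm. (cmod (macdonald s (norm \<xi>)))\<^sup>2)"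
  define Z where "Z = macdonald_mass TYPE('m) s"
  have Z: "Z \<noteq> 0" using macdonald_mass_nonzero[OF s] by (simp add: Z_def)
  have s': "\<bar>Re (cnj s)\<bar> < real CARD('m) / 2" using s by simp
  have I': "(LBINT \<xi> :: real ^ 'm. (cmod (macdonald (cnj s) (norm \<xi>)))\<^sup>2) = I"
    by (simp add: I_def macdonald_cnj)
  have I0: "0 \<le> I" unfolding I_def by (rule integral_nonneg_AE) auto
  let ?W = "\<lambda>\<alpha> x :: 'm lorentz_matrix. horo_wave \<alpha> (horo_height x) (horo_point x)"
  obtain D :: "(real \<times> (real ^ 'm)) set" where "countable D" "UNIV \<subseteq> closure D"
    by (rule separable[of UNIV])
  then have D: "countable D" "closure D = UNIV" by auto
  define d where "d = from_nat_into D"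
  have d: "\<exists>n. d n = p" if "p \<in> D" for p using from_nat_into_surj[OF D(1) that] by (simp add: d_def)
  \<comment> \<open>Even indices enumerate the scaled waves of order \<open>s\<close>, odd ones the
    waves of order \<open>cnj s\<close>. The dense set also contains parameters with height at most
    zero; these yield the zero function.\<close>
  define v where "v n = (if 0 < fst (d (n div 2)) then
      (if even n then (\<lambda>\<xi>. 1 / Z * horo_wave s (fst (d (n div 2))) (snd (d (n div 2))) \<xi>)
       else horo_wave (cnj s) (fst (d (n div 2))) (snd (d (n div 2)))) else (\<lambda>_. 0))" for n
  have v: "v n \<in> L2_space lborel" for n
    unfolding v_def
    by (simp only: split: if_split) (intro conjI impI L2_space_cmult L2_horo_wave(1) s s' L2_space_zero)
  have P: "(\<lambda>\<xi>. 1 / Z * ?W s x \<xi>) \<in> L2_space lborel" if "x \<in> carrier SO0" for x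
    by (intro L2_space_cmult L2_horo_wave(1) s horo_height_pos that)
  have Q: "?W (cnj s) x \<in> L2_space lborel" if "x \<in> carrier SO0" for x
    by (intro L2_horo_wave(1) s' horo_height_pos that)
  have Pm: "(\<lambda>x. L2_inner lborel (\<lambda>\<xi>. 1 / Z * ?W s x \<xi>) f) \<in> borel_measurable \<mu>"
    if "f \<in> L2_space lborel" for f
    unfolding L2_inner_cmult_left by (intro borel_measurable_times borel_measurable_const measurable_horo_wave_inner that)
  have Pv: "\<exists>k. (L2_norm lborel (\<lambda>\<xi>. 1 / Z * ?W s x \<xi> - v k \<xi>))\<^sup>2 < \<epsilon>"
    if x: "x \<in> carrier SO0" and \<epsilon>: "0 < \<epsilon>" for x \<epsilon>
  proof -
    \<comment> \<open>The tolerance is scaled in advance, because the factor \<open>1 / Z\<close>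
      divides the squared distance by \<open>(cmod Z)\<^sup>2\<close>.\<close>
    have "0 < \<epsilon> * (cmod Z)\<^sup>2" using \<epsilon> Z by simp
    from horo_wave_approx[OF s horo_height_pos[OF x] this D(2), of "horo_point x"]
    obtain p where p: "p \<in> D" "0 < fst p"
      "(L2_norm lborel (\<lambda>\<xi>. ?W s x \<xi> - horo_wave s (fst p) (snd p) \<xi>))\<^sup>2 < \<epsilon> * (cmod Z)\<^sup>2" by auto
    obtain n where n: "d n = p" using d[OF p(1)] by blast
    have "(L2_norm lborel (\<lambda>\<xi>. 1 / Z * ?W s x \<xi> - v (2 * n) \<xi>))\<^sup>2
        = (L2_norm lborel (\<lambda>\<xi>. 1 / Z * (?W s x \<xi> - horo_wave s (fst p) (snd p) \<xi>)))\<^sup>2"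
      using p(2) n by (simp add: v_def diff_divide_distrib)
    also have "\<dots> = (L2_norm lborel (\<lambda>\<xi>. ?W s x \<xi> - horo_wave s (fst p) (snd p) \<xi>))\<^sup>2 / (cmod Z)\<^sup>2"
      unfolding L2_norm_cmult by (simp add: norm_divide power_divide)
    also have "\<dots> < \<epsilon>" using p(3) Z by (simp add: divide_less_eq)
    finally show ?thesis by blast
  qed
  have Qv: "\<exists>k. (L2_norm lborel (\<lambda>\<xi>. ?W (cnj s) x \<xi> - v k \<xi>))\<^sup>2 < \<epsilon>"
    if x: "x \<in> carrier SO0" and \<epsilon>: "0 < \<epsilon>" for x \<epsilon>
  proof -
    from horo_wave_approx[OF s' horo_height_pos[OF x] \<epsilon> D(2), of "horo_point x"]
    obtain p where p: "p \<in> D" "0 < fst p"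
      "(L2_norm lborel (\<lambda>\<xi>. ?W (cnj s) x \<xi> - horo_wave (cnj s) (fst p) (snd p) \<xi>))\<^sup>2 < \<epsilon>" by auto
    obtain n where n: "d n = p" using d[OF p(1)] by blast
    have "v (2 * n + 1) = horo_wave (cnj s) (fst p) (snd p)" using p(2) n by (simp add: v_def)
    with p(3) show ?thesis by (intro exI[of _ "2 * n + 1"]) simp
  qed
  have PA: "(L2_norm lborel (\<lambda>\<xi>. 1 / Z * ?W s x \<xi>))\<^sup>2 \<le> I / (cmod Z)\<^sup>2" if "x \<in> carrier SO0" for x
    unfolding L2_norm_cmult power_mult_distrib L2_horo_wave(2)[OF s horo_height_pos[OF that]] I_def[symmetric]
    by (simp add: norm_divide power_divide)
  have QB: "(L2_norm lborel (?W (cnj s) x))\<^sup>2 \<le> I" if "x \<in> carrier SO0" for x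
    unfolding L2_horo_wave(2)[OF s' horo_height_pos[OF that]] I' by simp
  have PQ: "L2_inner lborel (\<lambda>\<xi>. 1 / Z * ?W s x \<xi>) (?W (cnj s) y) = spherical_function s (inv\<^bsub>SO0\<^esub> y \<otimes>\<^bsub>SO0\<^esub> x)"
    if "x \<in> carrier SO0" "y \<in> carrier SO0" for x y
  proof -
    have c: "inv\<^bsub>SO0\<^esub> y \<otimes>\<^bsub>SO0\<^esub> x \<in> carrier SO0" by (intro m_closed inv_closed that)
    then show ?thesis
      unfolding spherical_function_legendre(2)[OF s c] L2_inner_cmult_left
        L2_inner_horo_wave[OF s horo_height_pos[OF that(1)] horo_height_pos[OF that(2)]] Z_def[symmetric]
      using Z minkowski_distance[OF that] by simp
  qed
  have A0: "0 \<le> I / (cmod Z)\<^sup>2" using I0 by simp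
  note schur = schur_multiplier_L2[OF P Q Pm measurable_horo_wave_inner v Pv Qv PA QB A0 I0 PQ]
  show "\<exists>M. is_cb_multiplier_map SO0 \<mu> (spherical_function s) M" by (rule schur(1))
  have "M0A_norm SO0 \<mu> (spherical_function s) \<le> sqrt (I / (cmod Z)\<^sup>2 * I)" by (rule schur(2))
  also have "\<dots> = I / cmod Z"
    using I0 Z by (intro real_sqrt_unique) (simp_all add: power2_eq_square)
  finally show "M0A_norm SO0 \<mu> (spherical_function s) \<le> I / cmod Z" .
qed

text \<open>On the horospherical group, a copy of the additive group of \<open>real ^ 'm\<close>,
  the kernel depends on differences only. The entry \<open>None\<close>, \<open>None\<close> of
  \<open>unip b\<close> is the argument of the Legendre integral at heights
  \<open>a = a' = 1\<close>, so the restricted function is the Fourier transform of \<open>q\<close>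
  and \<open>fourier_schur_bound\<close> applies.\<close>

lemma spherical_multiplier_lower:
  "(LBINT \<xi> :: real ^ 'm. (cmod (macdonald s (norm \<xi>)))\<^sup>2) / cmod (macdonald_mass TYPE('m) s)
    \<le> M0A_norm SO0 \<mu> (spherical_function s)"
proof -
  define Z where "Z = macdonald_mass TYPE('m) s"
  have Z: "Z \<noteq> 0" using macdonald_mass_nonzero[OF s] by (simp add: Z_def)
  define q where "q \<xi> = macdonald s (norm \<xi>) * macdonald s (norm \<xi>) / Z" for \<xi> :: "real ^ 'm"
  obtain M where M: "is_cb_multiplier_map SO0 \<mu> (spherical_function s) M"
    using spherical_multiplier_upper(1) by blast
  have "(LBINT \<xi>. cmod (q \<xi>)) \<le> M0A_norm SO0 \<mu> (spherical_function s)"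
  proof (rule fourier_schur_bound[where \<phi> = "\<lambda>b. spherical_function s (unip b :: 'm lorentz_matrix)"])
    show "integrable lborel q"
      unfolding q_def using s by (intro integrable_divide macdonald_moment(1)) auto
    show "isCont q \<xi>" if "\<xi> \<noteq> 0" for \<xi>
    proof -
      have "isCont (\<lambda>\<xi>. macdonald s (norm \<xi>)) \<xi>"
        using that by (intro isCont_o2[OF isCont_norm[OF continuous_ident] isCont_macdonald]) simp
      then show ?thesis unfolding q_def[abs_def] by (intro continuous_intros Z)
    qed
    show "spherical_function s (unip b :: 'm lorentz_matrix) = (LBINT \<xi>. q \<xi> * character b \<xi>)" for b
    proof -
      have "(LBINT \<xi>. q \<xi> * character b \<xi>) = (LBINT \<xi>. macdonald s (1 * norm \<xi>) * macdonald s (1 * norm \<xi>) * character b \<xi>) / Z"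
        unfolding q_def by (simp flip: integral_divide_zero)
      also have "\<dots> = spherical_function s (unip b :: 'm lorentz_matrix)"
        unfolding macdonald_fourier_normalized(2)[OF s zero_less_one zero_less_one]
          spherical_function_legendre(2)[OF s unip_SO0] Z_def[symmetric]
        using Z by (simp add: add_divide_distrib)
      finally show ?thesis by simp
    qed
    fix k :: nat and b :: "nat \<Rightarrow> real ^ 'm" and c v
    assume c: "\<And>v. L2_set (\<lambda>i. cmod (\<Sum>j<k. c i j * v j)) {..<k} \<le> L2_set (\<lambda>j. cmod (v j)) {..<k}"
    have inv: "inv\<^bsub>SO0\<^esub> (unip x) \<otimes>\<^bsub>SO0\<^esub> unip y = unip (y - x)" for x y :: "real ^ 'm"
    proof -
      have "unip (- x) \<otimes>\<^bsub>SO0\<^esub> unip x = (\<one>\<^bsub>SO0\<^esub> :: 'm lorentz_matrix)"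
        by (simp add: unip_add) (simp add: vec_eq_iff split_option_all mat_def)
      then have "inv\<^bsub>SO0\<^esub> (unip x) = (unip (- x) :: 'm lorentz_matrix)"
        by (intro inv_equality unip_SO0)
      then show ?thesis by (simp add: unip_add)
    qed
    show "L2_set (\<lambda>i. cmod (\<Sum>j<k. c i j * spherical_function s (unip (b j - b i) :: 'm lorentz_matrix) * v j)) {..<k}
        \<le> M0A_norm SO0 \<mu> (spherical_function s) * L2_set (\<lambda>j. cmod (v j)) {..<k}"
      by (rule M0A_norm_ge[OF M, of k "\<lambda>i. unip (b i)" c v, unfolded inv, OF unip_SO0 c])
  qed
  then show ?thesis
    by (simp add: q_def Z_def norm_mult norm_divide power2_eq_square)
qed

end

text \<open>A factorization through a one-dimensional Hilbert space bounds the norm from above, a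
  matrix of size one from below.\<close>

lemma (in haar_group) M0A_norm_one:
  assumes "\<And>g. g \<in> carrier G \<Longrightarrow> \<phi> g = 1"
  shows "\<exists>M. is_cb_multiplier_map G \<mu> \<phi> M" and "M0A_norm G \<mu> \<phi> = 1"
proof -
  define P :: "nat \<Rightarrow> 'a \<Rightarrow> complex" where "P l x = (if l = 0 then 1 else 0)" for l x
  have sq: "(\<lambda>l. (cmod (P l x))\<^sup>2) sums 1" for x
  proof -
    have "(cmod (P l x))\<^sup>2 = (if l = 0 then 1 else 0)" for l by (simp add: P_def)
    then show ?thesis using sums_single[of 0 "\<lambda>_. 1 :: real"] by simp
  qed
  have PQ: "(\<lambda>l. P l x * cnj (P l y)) sums \<phi> (inv y \<otimes> x)" if "x \<in> carrier G" "y \<in> carrier G" for x y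
  proof -
    have "P l x * cnj (P l y) = (if l = 0 then 1 else 0)" for l by (simp add: P_def)
    then show ?thesis using sums_single[of 0 "\<lambda>_. 1 :: complex"] assms[of "inv y \<otimes> x"] that by simp
  qed
  have m: "P l \<in> borel_measurable \<mu>" for l by (simp add: P_def[abs_def])
  note schur = schur_multiplier[OF m m sums_summable[OF sq] sums_summable[OF sq] _ _ zero_le_one zero_le_one PQ]
  show ex: "\<exists>M. is_cb_multiplier_map G \<mu> \<phi> M" by (rule schur(1)) (simp_all add: sums_unique[OF sq, symmetric])
  have "M0A_norm G \<mu> \<phi> \<le> sqrt (1 * 1)" by (rule schur(2)) (simp_all add: sums_unique[OF sq, symmetric])
  moreover obtain M where M: "is_cb_multiplier_map G \<mu> \<phi> M" using ex by blast
  have "1 \<le> M0A_norm G \<mu> \<phi>"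
    using M0A_norm_ge[OF M, of "Suc 0" "\<lambda>_. \<one>" "\<lambda>_ _. 1" "\<lambda>_. 1"] assms by (simp add: L2_set_def)
  ultimately show "M0A_norm G \<mu> \<phi> = 1" by simp
qed

theorem theorem0p2:
  fixes n m :: nat
    and \<mu> :: "'m::finite lorentz_matrix measure"
  assumes n: "n = CARD('m option)" and m: "m = n - 1"
    and haar: "left_haar_measure SO0 \<mu>"
  shows "(\<forall>s. \<bar>Re s\<bar> < real m / 2 \<longrightarrow>
            spherical_function s \<in> M0A SO0 \<mu> \<and>
            complex_of_real (M0A_norm SO0 \<mu> (spherical_function s)) =
              Gamma (of_nat m / 2 + of_real (Re s)) * Gamma (of_nat m / 2 - of_real (Re s)) *
              Gamma (of_nat m / 2 + \<i> * of_real (Im s)) * Gamma (of_nat m / 2 - \<i> * of_real (Im s)) /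
              (Gamma (of_nat m / 2) * Gamma (of_nat m / 2) *
               of_real (cmod (Gamma (of_nat m / 2 + s) * Gamma (of_nat m / 2 - s))))) \<and>
         (\<forall>s\<in>{complex_of_real (real m / 2), - complex_of_real (real m / 2)}.
            spherical_function s \<in> M0A SO0 \<mu> \<and>
            M0A_norm SO0 \<mu> (spherical_function s) = 1)"
proof -
  have mm: "m = CARD('m)" using n m by (simp add: card_option)
  interpret haar_group SO0 \<mu> by (rule haar_group_SO0[OF haar])
  show ?thesis
  proof (intro conjI allI ballI impI)
    fix s :: complex assume s: "\<bar>Re s\<bar> < real m / 2"
    note s' = s[unfolded mm]
    show "spherical_function s \<in> M0A SO0 \<mu>"
      unfolding M0A_def using spherical_multiplier_upper(1)[OF haar s'] spherical_function_legendre(1)[OF s']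
      by (simp add: is_spherical_function_def)
    have "M0A_norm SO0 \<mu> (spherical_function s)
        = (LBINT \<xi> :: real ^ 'm. (cmod (macdonald s (norm \<xi>)))\<^sup>2) / cmod (macdonald_mass TYPE('m) s)"
      by (intro antisym spherical_multiplier_upper(2)[OF haar s'] spherical_multiplier_lower[OF haar s'])
    then show "complex_of_real (M0A_norm SO0 \<mu> (spherical_function s)) =
              Gamma (of_nat m / 2 + of_real (Re s)) * Gamma (of_nat m / 2 - of_real (Re s)) *
              Gamma (of_nat m / 2 + \<i> * of_real (Im s)) * Gamma (of_nat m / 2 - \<i> * of_real (Im s)) /
              (Gamma (of_nat m / 2) * Gamma (of_nat m / 2) *
               of_real (cmod (Gamma (of_nat m / 2 + s) * Gamma (of_nat m / 2 - s))))"
      using spherical_norm_Gamma[OF s'] unfolding mm by (simp only:)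
  next
    fix s assume "s \<in> {complex_of_real (real m / 2), - complex_of_real (real m / 2)}"
    then have s: "s = of_real (real CARD('m) / 2) \<or> s = - of_real (real CARD('m) / 2)" by (simp add: mm)
    note triv = M0A_norm_one[OF spherical_function_trivial(2)[OF s]]
    show "spherical_function s \<in> M0A SO0 \<mu>"
      unfolding M0A_def using triv(1) spherical_function_trivial(1)[OF s]
      by (simp add: is_spherical_function_def)
    show "M0A_norm SO0 \<mu> (spherical_function s) = 1" by (rule triv(2))
  qed
qed

end
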